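(* The KSGNS construction provides a semi-functor (i.e. an assignment on objects and morphisms preserving composition, with no requirement concerning identities) \[ \mathrm{KSGNS}\colon \mathsf{Quesadilla}\to\mathsf{Enchilada} \] such that: (i) $\mathrm{KSGNS}(A)=A$ for every $C^*$-algebra $A$; and (ii) for a strict positive correspondence $(\rho,{}_AX_B)$, $\mathrm{KSGNS}(\rho,{}_AX_B)$ is the isomorphism class of the correspondence $(\pi_\rho,{}_A(A\otimes_\rho X)_B)$. In particular, if $\rho$ is a nondegenerate $*$-homomorphism, then $\mathrm{KSGNS}(\rho,{}_AX_B)=(\rho,{}_AX_B)$. Moreover, if $U\colon\mathsf{Enchilada}\to\mathsf{Quesadilla}$ is the forgetful semi-functor given by considering nondegenerate $*$-homomorphisms as strict completely positive maps, then \[ \mathrm{KSGNS}\circ U=\mathrm{Id}_{\mathsf{Enchilada}}\quad\text{and}\quad U\circ\mathrm{KSGNS}\ \text{is idempotent}. \]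
   Context: $C^*$-algebras are separable and $C^*$-modules countably generated. For a right $C^*$-module $X_B$ (inner product $\langle\cdot\mid\cdot\rangle_B$), $\mathrm{End}_B(X)$ denotes the adjointable operators. An $A$--$B$-correspondence $(\phi,{}_AX_B)$ is a right $C^*$-module $X_B$ with a $*$-homomorphism $\phi\colon A\to\mathrm{End}_B(X)$; it is nondegenerate if $\overline{\phi(A)X}=X$. A completely positive map $\rho\colon A\to\mathrm{End}_B(X)$ is strict if $(\rho(a_i))_i$ is strictly Cauchy (i.e. $(\rho(a_i)x)_i$ and $(\rho(a_i)^*x)_i$ are norm Cauchy for all $x\in X$) for some approximate unit $(a_i)_i$ of $A$; it is nondegenerate if moreover $\rho(a_i)\to\mathrm{Id}_X$ strictly. A strict positive $A$--$B$-correspondence $(\rho,{}_AX_B)$ is a right $C^*$-module $X_B$ with a strict completely positive map $\rho\colon A\to\mathrm{End}_B(X)$. Two positive $A$--$B$-correspondences $(\rho,X)$, $(\sigma,Y)$ are isomorphic if there is an adjointable unitary $V\colon X\to Y$ with $V\rho(a)V^*=\sigma(a)$ for all $a\in A$. KSGNS: for a strict positive correspondence $(\rho,{}_AX_B)$, $A\otimes_\rho X$ is the completion of the algebraic tensor product $A\odot X$ (modulo null vectors) for $\langle a_1\otimes x_1\mid a_2\otimes x_2\rangle=\langle x_1\mid\rho(a_1^*a_2)x_2\rangle_B$, with the obvious right $B$-action and left action $\pi_\rho(a')(a\otimes x)=a'a\otimes x$; it is a nondegenerate $A$--$B$-correspondence. $\mathsf{Enchilada}$: objects are $C^*$-algebras;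 morphisms $A\to B$ are isomorphism classes of nondegenerate $A$--$B$-correspondences; composition is the class of the balanced (internal) tensor product. $\mathsf{Quesadilla}$: objects are $C^*$-algebras; morphisms $A\to B$ are isomorphism classes of strict positive $A$--$B$-correspondences; the composite of $(\rho,{}_AX_B)\colon A\to B$ and $(\sigma,{}_BY_C)\colon B\to C$ is the class of $(\rho\otimes\mathrm{Id}_{B\otimes_\sigma Y},\ X\otimes_B(B\otimes_\sigma Y))$, where $(\rho\otimes\mathrm{Id})(a)(x\otimes\eta)=\rho(a)x\otimes\eta$. It is a semi-category (a category possibly without identities). *)

theory Defs
  imports
    "HOL-Analysis.Abstract_Metric_Spaces"
    "HOL-Library.Equipollence"
    "HOL-Library.FuncSet"
    "HOL-Algebra.Module"
    "HOL-Decision_Procs.Algebra_Aux"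
begin

section \<open>C*-algebras\<close>

text \<open>Structures are carrier-based, on top of the module record of HOL-Algebra.  As usual there, the
  field \<open>one\<close> is present but meaningless for a C*-algebra (which need not be unital), and the fields
  \<open>mult\<close> and \<open>one\<close> are meaningless for a C*-module.\<close>

abbreviation complex_ring :: "complex ring" where
  "complex_ring \<equiv> cring_class_ops"

record 'a cstar = "(complex, 'a) module" +
  star :: "'a \<Rightarrow> 'a"
  nrm :: "'a \<Rightarrow> real"

text \<open>Distances are set to 0 off the carrier because \<open>Metric_space\<close> asks for symmetry and
  nonnegativity on the whole type.\<close>

definition cdist :: "'a cstar \<Rightarrow> 'a \<Rightarrow> 'a \<Rightarrow> real" where
  "cdist A a b =
     (if a \<in> carrier A \<and> b \<in> carrier A then nrm A (a \<ominus>\<^bsub>A\<^esub> b) else 0)"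

locale cstar_algebra = module complex_ring A for A :: "'a cstar" +
  assumes mult_closed: "\<lbrakk>a \<in> carrier A; b \<in> carrier A\<rbrakk> \<Longrightarrow> a \<otimes>\<^bsub>A\<^esub> b \<in> carrier A"
    and mult_assoc: "\<lbrakk>a \<in> carrier A; b \<in> carrier A; c \<in> carrier A\<rbrakk>
      \<Longrightarrow> (a \<otimes>\<^bsub>A\<^esub> b) \<otimes>\<^bsub>A\<^esub> c = a \<otimes>\<^bsub>A\<^esub> (b \<otimes>\<^bsub>A\<^esub> c)"
    and distr_left: "\<lbrakk>a \<in> carrier A; b \<in> carrier A; c \<in> carrier A\<rbrakk>
      \<Longrightarrow> (a \<oplus>\<^bsub>A\<^esub> b) \<otimes>\<^bsub>A\<^esub> c = a \<otimes>\<^bsub>A\<^esub> c \<oplus>\<^bsub>A\<^esub> b \<otimes>\<^bsub>A\<^esub> c"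
    and distr_right: "\<lbrakk>a \<in> carrier A; b \<in> carrier A; c \<in> carrier A\<rbrakk>
      \<Longrightarrow> c \<otimes>\<^bsub>A\<^esub> (a \<oplus>\<^bsub>A\<^esub> b) = c \<otimes>\<^bsub>A\<^esub> a \<oplus>\<^bsub>A\<^esub> c \<otimes>\<^bsub>A\<^esub> b"
    and smult_mult_left: "\<lbrakk>a \<in> carrier A; b \<in> carrier A\<rbrakk>
      \<Longrightarrow> (z \<odot>\<^bsub>A\<^esub> a) \<otimes>\<^bsub>A\<^esub> b = z \<odot>\<^bsub>A\<^esub> (a \<otimes>\<^bsub>A\<^esub> b)"
    and smult_mult_right: "\<lbrakk>a \<in> carrier A; b \<in> carrier A\<rbrakk>
      \<Longrightarrow> a \<otimes>\<^bsub>A\<^esub> (z \<odot>\<^bsub>A\<^esub> b) = z \<odot>\<^bsub>A\<^esub> (a \<otimes>\<^bsub>A\<^esub> b)"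
    and star_closed: "a \<in> carrier A \<Longrightarrow> star A a \<in> carrier A"
    and star_star: "a \<in> carrier A \<Longrightarrow> star A (star A a) = a"
    and star_add: "\<lbrakk>a \<in> carrier A; b \<in> carrier A\<rbrakk>
      \<Longrightarrow> star A (a \<oplus>\<^bsub>A\<^esub> b) = star A a \<oplus>\<^bsub>A\<^esub> star A b"
    and star_smult: "a \<in> carrier A \<Longrightarrow> star A (z \<odot>\<^bsub>A\<^esub> a) = cnj z \<odot>\<^bsub>A\<^esub> star A a"
    and star_mult: "\<lbrakk>a \<in> carrier A; b \<in> carrier A\<rbrakk>
      \<Longrightarrow> star A (a \<otimes>\<^bsub>A\<^esub> b) = star A b \<otimes>\<^bsub>A\<^esub> star A a"
    and nrm_nonneg: "a \<in> carrier A \<Longrightarrow> 0 \<le> nrm A a"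
    and nrm_eq_zero_iff: "a \<in> carrier A \<Longrightarrow> nrm A a = 0 \<longleftrightarrow> a = \<zero>\<^bsub>A\<^esub>"
    and nrm_add: "\<lbrakk>a \<in> carrier A; b \<in> carrier A\<rbrakk> \<Longrightarrow> nrm A (a \<oplus>\<^bsub>A\<^esub> b) \<le> nrm A a + nrm A b"
    and nrm_smult: "a \<in> carrier A \<Longrightarrow> nrm A (z \<odot>\<^bsub>A\<^esub> a) = cmod z * nrm A a"
    and nrm_mult: "\<lbrakk>a \<in> carrier A; b \<in> carrier A\<rbrakk> \<Longrightarrow> nrm A (a \<otimes>\<^bsub>A\<^esub> b) \<le> nrm A a * nrm A b"
    and cstar_identity: "a \<in> carrier A \<Longrightarrow> nrm A (star A a \<otimes>\<^bsub>A\<^esub> a) = (nrm A a)\<^sup>2"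
    and complete: "Metric_space.mcomplete (carrier A) (cdist A)"

definition separable_cstar :: "'a cstar \<Rightarrow> bool" where
  "separable_cstar A \<longleftrightarrow> cstar_algebra A \<and>
     separable_space (Metric_space.mtopology (carrier A) (cdist A))"

text \<open>\<open>mat_pos n A M\<close>: the matrix \<open>M\<close> with index set \<open>{..<n}\<close> is a positive element of the C*-algebra
  \<open>M\<^sub>n(A)\<close>, i.e. \<open>M = N* N\<close> for some \<open>N\<close> in \<open>M\<^sub>n(A)\<close>.\<close>

definition mat_pos :: "nat \<Rightarrow> 'a cstar \<Rightarrow> (nat \<Rightarrow> nat \<Rightarrow> 'a) \<Rightarrow> bool" where
  "mat_pos n A M \<longleftrightarrow> (\<exists>N. (\<forall>i<n. \<forall>j<n. N i j \<in> carrier A) \<and>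
     (\<forall>i<n. \<forall>j<n. M i j = (\<Oplus>\<^bsub>A\<^esub>k\<in>{..<n}. star A (N k i) \<otimes>\<^bsub>A\<^esub> N k j)))"

definition cpos :: "'a cstar \<Rightarrow> 'a \<Rightarrow> bool" where
  "cpos A a \<longleftrightarrow> (\<exists>b\<in>carrier A. a = star A b \<otimes>\<^bsub>A\<^esub> b)"

definition lin_map :: "'a cstar \<Rightarrow> 'b cstar \<Rightarrow> ('a \<Rightarrow> 'b) \<Rightarrow> bool" where
  "lin_map A D \<rho> \<longleftrightarrow> \<rho> \<in> carrier A \<rightarrow> carrier D \<and>
     (\<forall>a\<in>carrier A. \<forall>b\<in>carrier A. \<rho> (a \<oplus>\<^bsub>A\<^esub> b) = \<rho> a \<oplus>\<^bsub>D\<^esub> \<rho> b) \<and>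
     (\<forall>z. \<forall>a\<in>carrier A. \<rho> (z \<odot>\<^bsub>A\<^esub> a) = z \<odot>\<^bsub>D\<^esub> \<rho> a)"

definition star_hom :: "'a cstar \<Rightarrow> 'b cstar \<Rightarrow> ('a \<Rightarrow> 'b) \<Rightarrow> bool" where
  "star_hom A D \<phi> \<longleftrightarrow> lin_map A D \<phi> \<and>
     (\<forall>a\<in>carrier A. \<forall>b\<in>carrier A. \<phi> (a \<otimes>\<^bsub>A\<^esub> b) = \<phi> a \<otimes>\<^bsub>D\<^esub> \<phi> b) \<and>
     (\<forall>a\<in>carrier A. \<phi> (star A a) = star D (\<phi> a))"

definition cp_map :: "'a cstar \<Rightarrow> 'b cstar \<Rightarrow> ('a \<Rightarrow> 'b) \<Rightarrow> bool" where
  "cp_map A D \<rho> \<longleftrightarrow> lin_map A D \<rho> \<and>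
     (\<forall>n M. mat_pos n A M \<longrightarrow> mat_pos n D (\<lambda>i j. \<rho> (M i j)))"

text \<open>A net is represented by the filter generated by the images of its tails; every proper filter
  arises from a net, and convergence and the Cauchy property depend only on this filter.
  Approximate units consist of positive contractions; monotonicity is not required.\<close>

definition approx_unit :: "'a cstar \<Rightarrow> 'a filter \<Rightarrow> bool" where
  "approx_unit A F \<longleftrightarrow> F \<noteq> bot \<and>
     eventually (\<lambda>e. e \<in> carrier A \<and> cpos A e \<and> nrm A e \<le> 1) F \<and>
     (\<forall>a\<in>carrier A. ((\<lambda>e. cdist A (e \<otimes>\<^bsub>A\<^esub> a) a) \<longlongrightarrow> 0) F \<and>
                    ((\<lambda>e. cdist A (a \<otimes>\<^bsub>A\<^esub> e) a) \<longlongrightarrow> 0) F)"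


section \<open>Right C*-modules and adjointable operators\<close>

record ('b, 'x) hmod = "(complex, 'x) module" +
  ract :: "'x \<Rightarrow> 'b \<Rightarrow> 'x"
  inner :: "'x \<Rightarrow> 'x \<Rightarrow> 'b"

definition hnorm :: "'b cstar \<Rightarrow> ('b, 'x) hmod \<Rightarrow> 'x \<Rightarrow> real" where
  "hnorm B X x = sqrt (nrm B (inner X x x))"

text \<open>The difference is written as \<open>x + (-1)y\<close> so that the (semi-)distance also makes sense on the
  lists of \<open>alg_tensor\<close> below, which have no additive inverses.\<close>

definition hdist :: "'b cstar \<Rightarrow> ('b, 'x) hmod \<Rightarrow> 'x \<Rightarrow> 'x \<Rightarrow> real" where
  "hdist B X x y =
     (if x \<in> carrier X \<and> y \<in> carrier X then hnorm B X (x \<oplus>\<^bsub>X\<^esub> ((-1) \<odot>\<^bsub>X\<^esub> y)) else 0)"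

locale hilbert_module = B: cstar_algebra B + X: module complex_ring X
  for B :: "'b cstar" and X :: "('b, 'x) hmod" +
  assumes ract_closed: "\<lbrakk>x \<in> carrier X; b \<in> carrier B\<rbrakk> \<Longrightarrow> ract X x b \<in> carrier X"
    and ract_add_left: "\<lbrakk>x \<in> carrier X; y \<in> carrier X; b \<in> carrier B\<rbrakk>
      \<Longrightarrow> ract X (x \<oplus>\<^bsub>X\<^esub> y) b = ract X x b \<oplus>\<^bsub>X\<^esub> ract X y b"
    and ract_add_right: "\<lbrakk>x \<in> carrier X; b \<in> carrier B; c \<in> carrier B\<rbrakk>
      \<Longrightarrow> ract X x (b \<oplus>\<^bsub>B\<^esub> c) = ract X x b \<oplus>\<^bsub>X\<^esub> ract X x c"
    and ract_mult: "\<lbrakk>x \<in> carrier X; b \<in> carrier B; c \<in> carrier B\<rbrakk>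
      \<Longrightarrow> ract X x (b \<otimes>\<^bsub>B\<^esub> c) = ract X (ract X x b) c"
    and ract_smult_left: "\<lbrakk>x \<in> carrier X; b \<in> carrier B\<rbrakk>
      \<Longrightarrow> ract X (z \<odot>\<^bsub>X\<^esub> x) b = z \<odot>\<^bsub>X\<^esub> ract X x b"
    and ract_smult_right: "\<lbrakk>x \<in> carrier X; b \<in> carrier B\<rbrakk>
      \<Longrightarrow> ract X x (z \<odot>\<^bsub>B\<^esub> b) = z \<odot>\<^bsub>X\<^esub> ract X x b"
    and inner_closed: "\<lbrakk>x \<in> carrier X; y \<in> carrier X\<rbrakk> \<Longrightarrow> inner X x y \<in> carrier B"
    and inner_add: "\<lbrakk>x \<in> carrier X; y \<in> carrier X; w \<in> carrier X\<rbrakk>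
      \<Longrightarrow> inner X x (y \<oplus>\<^bsub>X\<^esub> w) = inner X x y \<oplus>\<^bsub>B\<^esub> inner X x w"
    and inner_smult: "\<lbrakk>x \<in> carrier X; y \<in> carrier X\<rbrakk>
      \<Longrightarrow> inner X x (z \<odot>\<^bsub>X\<^esub> y) = z \<odot>\<^bsub>B\<^esub> inner X x y"
    and inner_ract: "\<lbrakk>x \<in> carrier X; y \<in> carrier X; b \<in> carrier B\<rbrakk>
      \<Longrightarrow> inner X x (ract X y b) = inner X x y \<otimes>\<^bsub>B\<^esub> b"
    and inner_star: "\<lbrakk>x \<in> carrier X; y \<in> carrier X\<rbrakk> \<Longrightarrow> star B (inner X x y) = inner X y x"
    and inner_pos: "x \<in> carrier X \<Longrightarrow> cpos B (inner X x x)"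
    and inner_definite: "\<lbrakk>x \<in> carrier X; inner X x x = \<zero>\<^bsub>B\<^esub>\<rbrakk> \<Longrightarrow> x = \<zero>\<^bsub>X\<^esub>"
    and complete: "Metric_space.mcomplete (carrier X) (hdist B X)"

inductive_set lin_span :: "('b, 'x) hmod \<Rightarrow> 'x set \<Rightarrow> 'x set"
  for X :: "('b, 'x) hmod" and S :: "'x set"
  where
    zero: "\<zero>\<^bsub>X\<^esub> \<in> lin_span X S"
  | gen: "x \<in> S \<Longrightarrow> x \<in> lin_span X S"
  | add: "\<lbrakk>x \<in> lin_span X S; y \<in> lin_span X S\<rbrakk> \<Longrightarrow> x \<oplus>\<^bsub>X\<^esub> y \<in> lin_span X S"
  | smult: "x \<in> lin_span X S \<Longrightarrow> z \<odot>\<^bsub>X\<^esub> x \<in> lin_span X S"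

definition closed_span :: "'b cstar \<Rightarrow> ('b, 'x) hmod \<Rightarrow> 'x set \<Rightarrow> 'x set" where
  "closed_span B X S =
     Metric_space.mtopology (carrier X) (hdist B X) closure_of (lin_span X S)"

definition countably_generated :: "'b cstar \<Rightarrow> ('b, 'x) hmod \<Rightarrow> bool" where
  "countably_generated B X \<longleftrightarrow> (\<exists>S. countable S \<and> S \<subseteq> carrier X \<and>
     closed_span B X {ract X x b | x b. x \<in> S \<and> b \<in> carrier B} = carrier X)"

definition cstar_module :: "'b cstar \<Rightarrow> ('b, 'x) hmod \<Rightarrow> bool" where
  "cstar_module B X \<longleftrightarrow> separable_cstar B \<and> hilbert_module B X \<and> countably_generated B X"

definition is_adjoint ::
    "('b, 'x) hmod \<Rightarrow> ('b, 'y) hmod \<Rightarrow> ('x \<Rightarrow> 'y) \<Rightarrow> ('y \<Rightarrow> 'x) \<Rightarrow> bool" where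
  "is_adjoint X Y T S \<longleftrightarrow> T \<in> carrier X \<rightarrow> carrier Y \<and> S \<in> carrier Y \<rightarrow> carrier X \<and>
     (\<forall>x\<in>carrier X. \<forall>y\<in>carrier Y. inner Y (T x) y = inner X x (S y))"

text \<open>Operators are extensional functions on the carrier, so that equality in the record is equality
  of operators.\<close>

definition End :: "'b cstar \<Rightarrow> ('b, 'x) hmod \<Rightarrow> ('x \<Rightarrow> 'x) cstar" where
  "End B X = \<lparr>
     carrier = {T \<in> extensional (carrier X). \<exists>S. is_adjoint X X T S},
     mult = (\<lambda>S T. compose (carrier X) S T),
     one = (\<lambda>x\<in>carrier X. x),
     zero = (\<lambda>x\<in>carrier X. \<zero>\<^bsub>X\<^esub>),
     add = (\<lambda>S T. \<lambda>x\<in>carrier X. S x \<oplus>\<^bsub>X\<^esub> T x),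
     smult = (\<lambda>z T. \<lambda>x\<in>carrier X. z \<odot>\<^bsub>X\<^esub> T x),
     star = (\<lambda>T. THE S. S \<in> extensional (carrier X) \<and> is_adjoint X X T S),
     nrm = (\<lambda>T. SUP x\<in>{x \<in> carrier X. hnorm B X x \<le> 1}. hnorm B X (T x))\<rparr>"


section \<open>Strict positive correspondences and correspondences\<close>

type_synonym ('a, 'b, 'x) corr = "('a \<Rightarrow> 'x \<Rightarrow> 'x) \<times> ('b, 'x) hmod"

definition norm_cauchy :: "'b cstar \<Rightarrow> ('b, 'x) hmod \<Rightarrow> 'a filter \<Rightarrow> ('a \<Rightarrow> 'x) \<Rightarrow> bool" where
  "norm_cauchy B X F f \<longleftrightarrow>
     (\<forall>\<epsilon>>0. \<exists>G. eventually (\<lambda>e. e \<in> G) F \<and> (\<forall>d\<in>G. \<forall>e\<in>G. hdist B X (f d) (f e) < \<epsilon>))"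

definition strict_map :: "'a cstar \<Rightarrow> 'b cstar \<Rightarrow> ('a, 'b, 'x) corr \<Rightarrow> bool" where
  "strict_map A B = (\<lambda>(\<rho>, X). \<exists>F. approx_unit A F \<and>
     (\<forall>x\<in>carrier X. norm_cauchy B X F (\<lambda>e. \<rho> e x) \<and>
                    norm_cauchy B X F (\<lambda>e. star (End B X) (\<rho> e) x)))"

definition strict_pos_corr :: "'a cstar \<Rightarrow> 'b cstar \<Rightarrow> ('a, 'b, 'x) corr \<Rightarrow> bool" where
  "strict_pos_corr A B = (\<lambda>(\<rho>, X). separable_cstar A \<and> cstar_module B X \<and>
     cp_map A (End B X) \<rho> \<and> strict_map A B (\<rho>, X))"

definition correspondence :: "'a cstar \<Rightarrow> 'b cstar \<Rightarrow> ('a, 'b, 'x) corr \<Rightarrow> bool" where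
  "correspondence A B = (\<lambda>(\<phi>, X). separable_cstar A \<and> cstar_module B X \<and>
     star_hom A (End B X) \<phi>)"

definition nondeg_corr :: "'a cstar \<Rightarrow> 'b cstar \<Rightarrow> ('a, 'b, 'x) corr \<Rightarrow> bool" where
  "nondeg_corr A B = (\<lambda>(\<phi>, X). correspondence A B (\<phi>, X) \<and>
     closed_span B X {\<phi> a x | a x. a \<in> carrier A \<and> x \<in> carrier X} = carrier X)"

text \<open>Isomorphism via an adjointable unitary \<open>V\<close> with adjoint (= inverse) \<open>W\<close>.  The underlying element
  types may differ.\<close>

definition corr_iso ::
    "'a cstar \<Rightarrow> ('a, 'b, 'x) corr \<Rightarrow> ('a, 'b, 'y) corr \<Rightarrow> bool" where
  "corr_iso A = (\<lambda>(\<rho>, X) (\<sigma>, Y). \<exists>V W. is_adjoint X Y V W \<and>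
     (\<forall>x\<in>carrier X. W (V x) = x) \<and> (\<forall>y\<in>carrier Y. V (W y) = y) \<and>
     (\<forall>a\<in>carrier A. \<forall>y\<in>carrier Y. V (\<rho> a (W y)) = \<sigma> a y))"


section \<open>Tensor products\<close>

text \<open>The completion of a semi-inner-product module modulo its null vectors: Cauchy sequences modulo
  null sequences.  The operations are computed on representatives.\<close>

definition hcauchy :: "'b cstar \<Rightarrow> ('b, 'p) hmod \<Rightarrow> (nat \<Rightarrow> 'p) set" where
  "hcauchy B P = {s. range s \<subseteq> carrier P \<and>
     (\<forall>\<epsilon>>0. \<exists>N. \<forall>m\<ge>N. \<forall>n\<ge>N. hdist B P (s m) (s n) < \<epsilon>)}"

definition null_rel :: "'b cstar \<Rightarrow> ('b, 'p) hmod \<Rightarrow> ((nat \<Rightarrow> 'p) \<times> (nat \<Rightarrow> 'p)) set" where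
  "null_rel B P = {(s, t). s \<in> hcauchy B P \<and> t \<in> hcauchy B P \<and>
     (\<lambda>n. hdist B P (s n) (t n)) \<longlonglongrightarrow> 0}"

definition completion :: "'b cstar \<Rightarrow> ('b, 'p) hmod \<Rightarrow> ('b, (nat \<Rightarrow> 'p) set) hmod" where
  "completion B P = \<lparr>
     carrier = hcauchy B P // null_rel B P,
     mult = undefined,
     one = undefined,
     zero = null_rel B P `` {\<lambda>n. \<zero>\<^bsub>P\<^esub>},
     add = (\<lambda>S T. \<Union>s\<in>S. \<Union>t\<in>T. null_rel B P `` {\<lambda>n. s n \<oplus>\<^bsub>P\<^esub> t n}),
     smult = (\<lambda>z S. \<Union>s\<in>S. null_rel B P `` {\<lambda>n. z \<odot>\<^bsub>P\<^esub> s n}),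
     ract = (\<lambda>S b. \<Union>s\<in>S. null_rel B P `` {\<lambda>n. ract P (s n) b}),
     inner = (\<lambda>S T. THE c. c \<in> carrier B \<and>
        (\<exists>s\<in>S. \<exists>t\<in>T. (\<lambda>n. cdist B (inner P (s n) (t n)) c) \<longlonglongrightarrow> 0))\<rparr>"

definition extend_op :: "'b cstar \<Rightarrow> ('b, 'p) hmod \<Rightarrow> ('p \<Rightarrow> 'p) \<Rightarrow>
    (nat \<Rightarrow> 'p) set \<Rightarrow> (nat \<Rightarrow> 'p) set" where
  "extend_op B P T =
     (\<lambda>S\<in>carrier (completion B P). \<Union>s\<in>S. null_rel B P `` {\<lambda>n. T (s n)})"

text \<open>The algebraic tensor product of \<open>X\<^sub>B\<close> with \<open>(\<sigma>, Y\<^sub>C)\<close>, for the form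
  \<open>\<langle>x \<otimes> y | x' \<otimes> y'\<rangle> = \<langle>y | \<sigma>(\<langle>x | x'\<rangle>) y'\<rangle>\<close>.  The tensor \<open>\<Sum>\<^sub>i x\<^sub>i \<otimes> y\<^sub>i\<close> is represented by the list
  of the pairs \<open>(x\<^sub>i, y\<^sub>i)\<close>.  Two lists denoting the same tensor (and likewise
  \<open>xb \<otimes> y\<close> and \<open>x \<otimes> \<sigma>(b)y\<close> when \<open>\<sigma>\<close> is multiplicative) differ by a null vector,
  so they become equal once \<open>completion\<close> divides out the null vectors.\<close>

definition alg_tensor :: "('b, 'x) hmod \<Rightarrow> 'c cstar \<Rightarrow> ('b, 'c, 'y) corr \<Rightarrow>
    ('c, ('x \<times> 'y) list) hmod" where
  "alg_tensor X C = (\<lambda>(\<sigma>, Y). \<lparr>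
     carrier = lists (carrier X \<times> carrier Y),
     mult = undefined,
     one = undefined,
     zero = [],
     add = (@),
     smult = (\<lambda>z. map (\<lambda>(x, y). (z \<odot>\<^bsub>X\<^esub> x, y))),
     ract = (\<lambda>s c. map (\<lambda>(x, y). (x, ract Y y c)) s),
     inner = (\<lambda>s t. \<Oplus>\<^bsub>C\<^esub>i\<in>{..<length s}. \<Oplus>\<^bsub>C\<^esub>j\<in>{..<length t}.
        inner Y (snd (s ! i)) (\<sigma> (inner X (fst (s ! i)) (fst (t ! j))) (snd (t ! j))))\<rparr>)"

text \<open>\<open>(\<rho> \<otimes> Id, X \<otimes> Y)\<close> for \<open>(\<rho>, X\<^sub>B)\<close> and \<open>(\<sigma>, Y\<^sub>C)\<close>.  For \<open>\<sigma>\<close> a *-homomorphism, \<open>X \<otimes> Y\<close> is the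
  internal tensor product \<open>X \<otimes>\<^sub>B Y\<close>.\<close>

definition tensor_corr :: "'c cstar \<Rightarrow> ('a, 'b, 'x) corr \<Rightarrow> ('b, 'c, 'y) corr \<Rightarrow>
    ('a, 'c, (nat \<Rightarrow> ('x \<times> 'y) list) set) corr" where
  "tensor_corr C = (\<lambda>(\<rho>, X) (\<sigma>, Y).
     (\<lambda>a. extend_op C (alg_tensor X C (\<sigma>, Y)) (map (\<lambda>(x, y). (\<rho> a x, y))),
      completion C (alg_tensor X C (\<sigma>, Y))))"

text \<open>\<open>A\<close> acting on itself, with \<open>\<langle>a\<^sub>1 | a\<^sub>2\<rangle> = a\<^sub>1* a\<^sub>2\<close>.\<close>

definition self_corr :: "'a cstar \<Rightarrow> ('a, 'a, 'a) corr" where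
  "self_corr A = (\<lambda>a'. \<lambda>a\<in>carrier A. a' \<otimes>\<^bsub>A\<^esub> a,
     \<lparr>carrier = carrier A, mult = undefined, one = undefined, zero = \<zero>\<^bsub>A\<^esub>, add = (\<oplus>\<^bsub>A\<^esub>),
      smult = (\<odot>\<^bsub>A\<^esub>), ract = (\<otimes>\<^bsub>A\<^esub>), inner = (\<lambda>a b. star A a \<otimes>\<^bsub>A\<^esub> b)\<rparr>)"

text \<open>\<open>(\<pi>\<^sub>\<rho>, A \<otimes>\<^sub>\<rho> X)\<close>: the form of \<open>alg_tensor\<close> becomes
  \<open>\<langle>a\<^sub>1 \<otimes> x\<^sub>1 | a\<^sub>2 \<otimes> x\<^sub>2\<rangle> = \<langle>x\<^sub>1 | \<rho>(a\<^sub>1* a\<^sub>2) x\<^sub>2\<rangle>\<close>, and the left action is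
  \<open>\<pi>\<^sub>\<rho>(a')(a \<otimes> x) = a'a \<otimes> x\<close>.\<close>

definition ksgns :: "'a cstar \<Rightarrow> 'b cstar \<Rightarrow> ('a, 'b, 'x) corr \<Rightarrow>
    ('a, 'b, (nat \<Rightarrow> ('a \<times> 'x) list) set) corr" where
  "ksgns A B Z = tensor_corr B (self_corr A) Z"


section \<open>Semi-categories and semi-functors\<close>

text \<open>\<open>Comp C a b c f g\<close> is the composite of \<open>f : a \<rightarrow> b\<close> followed by \<open>g : b \<rightarrow> c\<close>.\<close>

record ('o, 'm) semicat =
  Ob :: "'o set"
  Hom :: "'o \<Rightarrow> 'o \<Rightarrow> 'm set"
  Comp :: "'o \<Rightarrow> 'o \<Rightarrow> 'o \<Rightarrow> 'm \<Rightarrow> 'm \<Rightarrow> 'm"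

locale semicategory =
  fixes C :: "('o, 'm) semicat"
  assumes comp_closed: "\<lbrakk>a \<in> Ob C; b \<in> Ob C; c \<in> Ob C; f \<in> Hom C a b; g \<in> Hom C b c\<rbrakk>
      \<Longrightarrow> Comp C a b c f g \<in> Hom C a c"
    and comp_assoc: "\<lbrakk>a \<in> Ob C; b \<in> Ob C; c \<in> Ob C; d \<in> Ob C;
      f \<in> Hom C a b; g \<in> Hom C b c; h \<in> Hom C c d\<rbrakk>
      \<Longrightarrow> Comp C a c d (Comp C a b c f g) h = Comp C a b d f (Comp C b c d g h)"

record ('o1, 'm1, 'o2, 'm2) sfun =
  obj :: "'o1 \<Rightarrow> 'o2"
  mor :: "'o1 \<Rightarrow> 'o1 \<Rightarrow> 'm1 \<Rightarrow> 'm2"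

locale semifunctor = C: semicategory C + D: semicategory D
  for C :: "('o1, 'm1) semicat" and D :: "('o2, 'm2) semicat" +
  fixes F :: "('o1, 'm1, 'o2, 'm2) sfun"
  assumes obj_closed: "a \<in> Ob C \<Longrightarrow> obj F a \<in> Ob D"
    and mor_closed: "\<lbrakk>a \<in> Ob C; b \<in> Ob C; f \<in> Hom C a b\<rbrakk>
      \<Longrightarrow> mor F a b f \<in> Hom D (obj F a) (obj F b)"
    and mor_comp: "\<lbrakk>a \<in> Ob C; b \<in> Ob C; c \<in> Ob C; f \<in> Hom C a b; g \<in> Hom C b c\<rbrakk>
      \<Longrightarrow> mor F a c (Comp C a b c f g) =
        Comp D (obj F a) (obj F b) (obj F c) (mor F a b f) (mor F b c g)"

definition sf_id :: "('o, 'm, 'o, 'm) sfun" where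
  "sf_id = \<lparr>obj = (\<lambda>a. a), mor = (\<lambda>a b f. f)\<rparr>"

definition sf_comp :: "('o2, 'm2, 'o3, 'm3) sfun \<Rightarrow> ('o1, 'm1, 'o2, 'm2) sfun \<Rightarrow>
    ('o1, 'm1, 'o3, 'm3) sfun" where
  "sf_comp G F = \<lparr>obj = (\<lambda>a. obj G (obj F a)),
     mor = (\<lambda>a b f. mor G (obj F a) (obj F b) (mor F a b f))\<rparr>"

text \<open>Equality of semi-functors with source \<open>C\<close>: agreement on the objects and morphisms of \<open>C\<close>.\<close>

definition sf_eq :: "('o1, 'm1) semicat \<Rightarrow> ('o1, 'm1, 'o2, 'm2) sfun \<Rightarrow>
    ('o1, 'm1, 'o2, 'm2) sfun \<Rightarrow> bool" where
  "sf_eq C F G \<longleftrightarrow> (\<forall>a\<in>Ob C. obj F a = obj G a) \<and>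
     (\<forall>a\<in>Ob C. \<forall>b\<in>Ob C. \<forall>f\<in>Hom C a b. mor F a b f = mor G a b f)"


section \<open>The semi-categories Enchilada and Quesadilla\<close>

text \<open>Objects are the separable C*-algebras with carrier in \<open>'a\<close>, and the modules have carrier in \<open>'x\<close>.
  The correspondence \<open>Z\<close> whose isomorphism class is formed may live on another type (such as that of
  \<open>tensor_corr\<close>); its class is the set of all isomorphic correspondences on \<open>'x\<close>.\<close>

definition ench_class :: "'a cstar \<Rightarrow> 'b cstar \<Rightarrow> ('a, 'b, 'z) corr \<Rightarrow> ('a, 'b, 'x) corr set" where
  "ench_class A B Z = {W. nondeg_corr A B W \<and> corr_iso A Z W}"

definition ques_class :: "'a cstar \<Rightarrow> 'b cstar \<Rightarrow> ('a, 'b, 'z) corr \<Rightarrow> ('a, 'b, 'x) corr set" where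
  "ques_class A B Z = {W. strict_pos_corr A B W \<and> corr_iso A Z W}"

definition Enchilada :: "('a cstar, ('a, 'a, 'x) corr set) semicat" where
  "Enchilada = \<lparr>
     Ob = {A. separable_cstar A},
     Hom = (\<lambda>A B. {ench_class A B Z | Z :: ('a, 'a, 'x) corr. nondeg_corr A B Z}),
     Comp = (\<lambda>A B C f g. \<Union>Z\<in>f. \<Union>W\<in>g. ench_class A C (tensor_corr C Z W))\<rparr>"

definition Quesadilla :: "('a cstar, ('a, 'a, 'x) corr set) semicat" where
  "Quesadilla = \<lparr>
     Ob = {A. separable_cstar A},
     Hom = (\<lambda>A B. {ques_class A B Z | Z :: ('a, 'a, 'x) corr. strict_pos_corr A B Z}),
     Comp = (\<lambda>A B C f g. \<Union>Z\<in>f. \<Union>W\<in>g. ques_class A C (tensor_corr C Z (ksgns B C W)))\<rparr>"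

definition forget ::
    "('a cstar, ('a, 'a, 'x) corr set, 'a cstar, ('a, 'a, 'x) corr set) sfun" where
  "forget = \<lparr>obj = (\<lambda>A. A), mor = (\<lambda>A B f. \<Union>Z\<in>f. ques_class A B Z)\<rparr>"

end

theory Submission
  imports Defs "HOL-Analysis.Analysis" "HOL-Computational_Algebra.Formal_Power_Series"
begin

text \<open>
  Composition in both semi-categories and the KSGNS construction are instances of one operation, the tensor
  product \<open>X \<otimes> Y\<close> of modules along a completely positive map into the operators on \<open>Y\<close>: the KSGNS
  correspondence of \<open>(\<rho>, X)\<close> is \<open>A \<otimes> X\<close>.  Functoriality is therefore associativity,
  \<open>A \<otimes> (X \<otimes> (B \<otimes> Y)) \<cong> (A \<otimes> X) \<otimes> (B \<otimes> Y)\<close> (\<open>ksgns_tensor\<close>, from \<open>tensor_assoc\<close>), and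
  \<open>KSGNS \<circ> U = Id\<close> is the isomorphism \<open>a \<otimes> x \<mapsto> \<phi>(a)x\<close> from \<open>A \<otimes> X\<close> to \<open>X\<close> that exists for a nondegenerate
  homomorphism \<open>\<phi>\<close> (\<open>ksgns_nondeg_iso\<close>).  Since a KSGNS correspondence is nondegenerate, the latter also
  shows that \<open>U \<circ> KSGNS\<close> is idempotent.  Each isomorphism comes from \<open>gram_unitary\<close>: two C*-modules are
  unitarily equivalent as soon as they have total families with equal inner products.  The families are the
  simple tensors, and equality of their inner products is a short computation.

  The work is in showing that the tensor products are correspondences.  The form on lists of pairs has to be
  positive; this holds for \<open>X = A\<close> by complete positivity (\<open>tensor_self\<close>) and for *-homomorphisms by a
  Cholesky argument (\<open>tensor_hom\<close>), which together cover all tensor products that occur.  An operator \<open>R\<close> on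
  \<open>X\<close> has to extend to \<open>R \<otimes> Id\<close>; a bound that does not depend on the list follows from
  the growth of the powers of \<open>R*R\<close> on each single list (\<open>formal_adjoint_bound\<close>).  Strictness and nondegeneracy are
  conditions on a closed subspace and are checked on simple tensors; for strictness this needs a uniform
  bound on \<open>\<rho>\<close> (\<open>rho_bounded_on_positive\<close>).

  All this rests on the order structure of C*-algebras, in the first place on the positivity of \<open>b*b\<close> and on
  the fact that positive elements form a closed cone.  These facts are derived without spectral theory.  An
  element is called positive if it is self-adjoint and satisfies \<open>\<Parallel>t - h\<Parallel> \<le> t\<close> for some \<open>t\<close>; the binomial series
  gives square roots; and estimates for norms of powers replace arguments about the spectrum.  The proof
  takes place in a type class of unital C*-algebras, where power series are available, and reaches
  algebras given by a carrier set through unitizations and the choice of an algebra \<open>worst_cstar\<close> that is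
  a counterexample if there is one.

  Finally, the classes consist of modules on a fixed type, whereas tensor products live on types of their
  own.  A countably generated module over a separable algebra has at most the cardinality of the continuum,
  so each of them has an isomorphic copy on the fixed type (\<open>corr_copy\<close>), and an isomorphism class is
  determined by any of its representatives.
\<close>

section \<open>Positive elements of a unital C*-algebra\<close>

text \<open>A complex algebra is encoded as a real one with a central element \<open>im\<close> that acts as the imaginary unit.\<close>

class unital_cstar = real_normed_algebra_1 + banach +
  fixes adj :: "'a \<Rightarrow> 'a" and im :: "'a"
  assumes adj_adj [simp]: "adj (adj x) = x"
    and adj_add: "adj (x + y) = adj x + adj y"
    and adj_scaleR: "adj (r *\<^sub>R x) = r *\<^sub>R adj x"
    and adj_mult: "adj (x * y) = adj y * adj x"
    and im_commute: "im * x = x * im"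
    and im_im: "im * im = - 1"
    and adj_im: "adj im = - im"
    and norm_adj_mult: "norm (adj x * x) = norm x ^ 2"

lemma adj_zero [simp]: "adj (0::'a::unital_cstar) = 0"
  using adj_scaleR[of 0 "0::'a"] by simp

lemma adj_one [simp]: "adj (1::'a::unital_cstar) = 1"
  using adj_mult[of "adj (1::'a)" 1] by simp

lemma adj_minus: "adj (- x) = - adj (x::'a::unital_cstar)"
  using adj_scaleR[of "-1" x] by simp

lemma adj_diff: "adj (x - y) = adj x - adj (y::'a::unital_cstar)"
  using adj_add[of x "- y"] by (simp add: adj_minus)

lemma adj_of_real [simp]: "adj (of_real t :: 'a::unital_cstar) = of_real t"
  by (simp add: of_real_def adj_scaleR)

lemma adj_power: "adj (x ^ n) = adj (x::'a::unital_cstar) ^ n"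
  by (induct n) (simp_all add: adj_mult power_commutes)

lemmas adj_simps = adj_add adj_diff adj_minus adj_mult adj_scaleR adj_im adj_power

lemma norm_adj [simp]: "norm (adj x) = norm (x::'a::unital_cstar)"
proof -
  have le: "norm y \<le> norm (adj y)" for y :: 'a
    using norm_adj_mult[of y] norm_mult_ineq[of "adj y" y]
    by (cases "norm y = 0") (auto simp: power2_eq_square)
  show ?thesis using le[of x] le[of "adj x"] by simp
qed

lemma norm_mult_adj: "norm (x * adj x) = norm (x::'a::unital_cstar) ^ 2"
  using norm_adj_mult[of "adj x"] by simp

lemma bounded_linear_adj: "bounded_linear (adj :: 'a::unital_cstar \<Rightarrow> 'a)"
  by (rule bounded_linear_intro[of _ 1]) (simp_all add: adj_add adj_scaleR)

lemma norm_im [simp]: "norm (im :: 'a::unital_cstar) = 1"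
proof -
  have "norm (im :: 'a) ^ 2 = 1"
    using norm_adj_mult[of "im::'a"] by (simp add: adj_im im_im)
  then show ?thesis by (simp add: power2_eq_1_iff) (metis norm_ge_zero not_one_le_zero neg_0_le_iff_le zero_neq_neg_one order_antisym zero_le_one)
qed

lemma norm_power_selfadjoint:
  fixes x :: "'a::unital_cstar"
  assumes "adj x = x"
  shows "norm (x ^ (2 ^ k)) = norm x ^ (2 ^ k)"
proof (induct k)
  case (Suc k)
  have "norm (x ^ 2 ^ Suc k) = norm (adj (x ^ 2 ^ k) * x ^ 2 ^ k)"
    by (simp add: adj_power assms power_add mult_2)
  also have "\<dots> = (norm x ^ 2 ^ k) ^ 2" by (simp only: norm_adj_mult Suc)
  also have "\<dots> = norm x ^ 2 ^ Suc k" by (simp add: power_mult[symmetric] mult.commute)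
  finally show ?case .
qed simp

text \<open>The spectral radius of a self-adjoint element is its norm, so a bound on its powers that is
  exponential up to a linear factor already bounds the norm.  This is the substitute for the spectral radius
  formula in the two lemmas on positivity below.\<close>

lemma norm_le_of_power_growth:
  fixes x :: "'a::unital_cstar"
  assumes sa: "adj x = x" and t: "t > 0"
    and growth: "\<And>m. norm (x ^ m) \<le> (1 + c * real m) * t ^ m"
  shows "norm x \<le> t"
proof (rule ccontr)
  assume "\<not> norm x \<le> t"
  define q where "q = t / norm x"
  have n0: "norm x > 0" using \<open>\<not> norm x \<le> t\<close> t by linarith
  then have q: "0 < q" "q < 1"
    using \<open>\<not> norm x \<le> t\<close> t unfolding q_def by (auto simp: field_simps)
  have "(\<lambda>m. 1 * q ^ m + c * (real m * q ^ m)) \<longlonglongrightarrow> 1 * 0 + c * 0"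
    using q by (intro tendsto_intros LIMSEQ_power_zero powser_times_n_limit_0) auto
  then have "eventually (\<lambda>m. 1 * q ^ m + c * (real m * q ^ m) < 1) sequentially"
    by (intro order_tendstoD) auto
  then obtain M where M: "\<And>m. m \<ge> M \<Longrightarrow> 1 * q ^ m + c * (real m * q ^ m) < 1"
    by (auto simp: eventually_sequentially)
  define m :: nat where "m = 2 ^ M"
  have "m \<ge> M" unfolding m_def by (simp add: less_imp_le)
  have "norm x ^ m \<le> (1 + c * real m) * t ^ m"
    using growth[of m] norm_power_selfadjoint[OF sa, of M] by (simp add: m_def)
  then have "1 \<le> (1 + c * real m) * (t ^ m / norm x ^ m)"
    using n0 by (simp add: field_simps)
  then have "1 \<le> (1 + c * real m) * q ^ m" by (simp add: q_def power_divide)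
  with M[OF \<open>m \<ge> M\<close>] show False by (simp add: algebra_simps)
qed

subsection \<open>The square root by the binomial series\<close>

text \<open>The Taylor coefficients of \<open>\<surd>(1 - y)\<close> at \<open>0\<close>.  They sum up to at most \<open>1\<close> in absolute value, with the constant term left out,
  so the series converges on the closed unit ball.\<close>

definition sqrt_coeff :: "nat \<Rightarrow> real" where
  "sqrt_coeff n = (-1) ^ n * ((1/2) gchoose n)"

lemma sqrt_coeff_0 [simp]: "sqrt_coeff 0 = 1"
  by (simp add: sqrt_coeff_def)

lemma sqrt_coeff_nonpos: "n > 0 \<Longrightarrow> sqrt_coeff n \<le> 0"
proof -
  assume "n > 0"
  then obtain m where m: "n = Suc m" by (cases n) auto
  have "sqrt_coeff n = real n - 3/2 gchoose n"
    unfolding sqrt_coeff_def gbinomial_negated_upper[of "1/2" n] by (simp flip: mult.assoc power_add)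
  also have "\<dots> = (\<Prod>i<m. real n - 3/2 - real i) * (-1/2) / fact n"
    by (simp add: gbinomial_prod_rev m atLeast0LessThan)
  also have "\<dots> \<le> 0"
    by (intro divide_nonpos_pos mult_nonneg_nonpos prod_nonneg) (auto simp: m)
  finally show ?thesis .
qed

lemma sqrt_coeff_partial_sum: "(\<Sum>k\<le>n. sqrt_coeff k) \<ge> 0"
proof -
  have "(\<Sum>k\<le>n. sqrt_coeff k) = (-1) ^ n * (1/2 - 1 gchoose n)"
    unfolding sqrt_coeff_def using gbinomial_sum_lower_neg[of "1/2::real" n] by (simp add: mult.commute)
  also have "\<dots> = (real n - 1/2 gchoose n)"
    unfolding gbinomial_negated_upper[of "1/2 - 1" n] by (simp flip: mult.assoc power_add)
  also have "\<dots> \<ge> 0"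
    unfolding gbinomial_prod_rev by (intro divide_nonneg_pos prod_nonneg) auto
  finally show ?thesis .
qed

lemma sqrt_coeff_abs_partial: "(\<Sum>k<n. \<bar>sqrt_coeff (Suc k)\<bar>) \<le> 1"
proof -
  have "(\<Sum>k<n. \<bar>sqrt_coeff (Suc k)\<bar>) = - (\<Sum>k<n. sqrt_coeff (Suc k))"
    using sqrt_coeff_nonpos by (simp add: sum_negf[symmetric])
  also have "\<dots> = 1 - (\<Sum>k\<le>n. sqrt_coeff k)"
    by (subst sum.atMost_shift) simp
  finally show ?thesis using sqrt_coeff_partial_sum[of n] by simp
qed

lemma summable_sqrt_coeff: "summable (\<lambda>n. \<bar>sqrt_coeff (Suc n)\<bar>)"
  by (rule bounded_imp_summable[where B=1])
     (use sqrt_coeff_abs_partial[of "Suc n" for n] in \<open>auto simp: lessThan_Suc_atMost\<close>)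

lemma sqrt_coeff_convolution:
  "(\<Sum>i\<le>n. sqrt_coeff i * sqrt_coeff (n - i)) = (if n = 0 then 1 else if n = 1 then -1 else 0)"
proof -
  have "(\<Sum>i\<le>n. sqrt_coeff i * sqrt_coeff (n - i))
      = (\<Sum>i\<le>n. (-1) ^ n * (((1/2) gchoose i) * ((1/2) gchoose (n - i))))"
  proof (rule sum.cong, simp)
    fix i assume "i \<in> {..n}"
    then have "(-1::real) ^ n = (-1) ^ i * (-1) ^ (n - i)" by (simp flip: power_add)
    then show "sqrt_coeff i * sqrt_coeff (n - i)
        = (-1) ^ n * (((1/2) gchoose i) * ((1/2) gchoose (n - i)))"
      by (simp add: sqrt_coeff_def)
  qed
  also have "\<dots> = (-1) ^ n * ((1/2 + 1/2 :: real) gchoose n)"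
    by (simp only: sum_distrib_left[symmetric] gbinomial_Vandermonde[symmetric] atLeast0AtMost)
  also have "\<dots> = (-1) ^ n * of_nat (1 choose n)"
    by (simp add: binomial_gbinomial)
  also have "\<dots> = (if n = 0 then 1 else if n = 1 then -1 else 0)"
    by auto
  finally show ?thesis .
qed

definition sqrt_series :: "'a \<Rightarrow> 'a::unital_cstar" where
  "sqrt_series y = (\<Sum>n. sqrt_coeff n *\<^sub>R y ^ n)"

context
  fixes y :: "'a::unital_cstar"
  assumes y: "norm y \<le> 1"
begin

lemma sqrt_series_norm_term: "norm (sqrt_coeff n *\<^sub>R y ^ n) \<le> \<bar>sqrt_coeff n\<bar>"
proof -
  have "norm (y ^ n) \<le> 1" using norm_power_ineq[of y n] power_le_one[OF norm_ge_zero y, of n] by linarith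
  then show ?thesis by (simp add: mult_left_le)
qed

lemma sqrt_series_norm_summable: "summable (\<lambda>n. norm (sqrt_coeff n *\<^sub>R y ^ n))"
proof (rule summable_comparison_test')
  show "summable (\<lambda>n. \<bar>sqrt_coeff n\<bar>)" using summable_sqrt_coeff by (subst summable_Suc_iff[symmetric])
  show "\<And>n. n \<ge> 0 \<Longrightarrow> norm (norm (sqrt_coeff n *\<^sub>R y ^ n)) \<le> \<bar>sqrt_coeff n\<bar>"
    using sqrt_series_norm_term by simp
qed

lemmas sqrt_series_summable = summable_norm_cancel[OF sqrt_series_norm_summable]

lemma sqrt_series_square: "sqrt_series y * sqrt_series y = 1 - y"
proof -
  let ?g = "\<lambda>n. (if n = 0 then 1 else if n = 1 then -1 else 0) *\<^sub>R y ^ n"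
  have "(\<lambda>k. \<Sum>i\<le>k. (sqrt_coeff i *\<^sub>R y ^ i) * (sqrt_coeff (k - i) *\<^sub>R y ^ (k - i)))
      sums (sqrt_series y * sqrt_series y)"
    unfolding sqrt_series_def by (intro Cauchy_product_sums sqrt_series_norm_summable)
  moreover have "(\<Sum>i\<le>k. (sqrt_coeff i *\<^sub>R y ^ i) * (sqrt_coeff (k - i) *\<^sub>R y ^ (k - i))) = ?g k" for k
  proof -
    have "(\<Sum>i\<le>k. (sqrt_coeff i *\<^sub>R y ^ i) * (sqrt_coeff (k - i) *\<^sub>R y ^ (k - i)))
        = (\<Sum>i\<le>k. (sqrt_coeff i * sqrt_coeff (k - i)) *\<^sub>R y ^ k)"
      by (rule sum.cong) (auto simp flip: power_add)
    then show ?thesis by (simp only: scaleR_sum_left[symmetric] sqrt_coeff_convolution)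
  qed
  ultimately have "?g sums (sqrt_series y * sqrt_series y)" by simp
  moreover have "?g sums (\<Sum>n\<in>{0,1}. ?g n)" by (rule sums_finite) auto
  ultimately have "sqrt_series y * sqrt_series y = (\<Sum>n\<in>{0,1}. ?g n)" by (rule sums_unique2)
  then show ?thesis by simp
qed

lemma sqrt_series_adj: "adj y = y \<Longrightarrow> adj (sqrt_series y) = sqrt_series y"
  unfolding sqrt_series_def
  by (subst bounded_linear.suminf[OF bounded_linear_adj sqrt_series_summable])
     (simp add: adj_scaleR adj_power)

lemma sqrt_series_commute:
  assumes "z * y = y * z"
  shows "z * sqrt_series y = sqrt_series y * z"
proof -
  have "z * (sqrt_coeff n *\<^sub>R y ^ n) = (sqrt_coeff n *\<^sub>R y ^ n) * z" for n
    using power_commuting_commutes[of y z n] assms by simp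
  then show ?thesis
    unfolding sqrt_series_def suminf_mult[OF sqrt_series_summable, symmetric]
      suminf_mult2[OF sqrt_series_summable] by (simp only:)
qed

lemma norm_one_minus_sqrt_series: "norm (1 - sqrt_series y) \<le> 1"
proof -
  have s: "summable (\<lambda>n. norm (sqrt_coeff (Suc n) *\<^sub>R y ^ Suc n))"
    using sqrt_series_norm_summable by (subst (asm) summable_Suc_iff[symmetric])
  have "norm (1 - sqrt_series y) = norm (\<Sum>n. sqrt_coeff (Suc n) *\<^sub>R y ^ Suc n)"
    using suminf_split_head[OF sqrt_series_summable]
    by (simp add: sqrt_series_def norm_minus_commute)
  also have "\<dots> \<le> (\<Sum>n. norm (sqrt_coeff (Suc n) *\<^sub>R y ^ Suc n))"
    by (rule summable_norm[OF s])
  also have "\<dots> \<le> (\<Sum>n. \<bar>sqrt_coeff (Suc n)\<bar>)"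
    by (rule suminf_le[OF sqrt_series_norm_term s summable_sqrt_coeff])
  also have "\<dots> \<le> 1"
    by (rule suminf_le_const[OF summable_sqrt_coeff sqrt_coeff_abs_partial])
  finally show ?thesis .
qed

end

subsection \<open>The cone of positive elements\<close>

text \<open>For a self-adjoint \<open>h\<close>, the inequality says that the spectrum of \<open>h\<close> lies in \<open>[0, 2t]\<close>.  In this form
  sums of positive elements are positive by the triangle inequality.\<close>

definition pos :: "'a::unital_cstar \<Rightarrow> bool" where
  "pos h \<longleftrightarrow> adj h = h \<and> (\<exists>t\<ge>0. norm (of_real t - h) \<le> t)"

lemma pos_adj: "pos h \<Longrightarrow> adj h = h"
  by (simp add: pos_def)

lemma posI: "adj h = h \<Longrightarrow> norm (of_real t - h) \<le> t \<Longrightarrow> pos h"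
  unfolding pos_def using norm_ge_zero order_trans by blast

lemma pos_witness:
  assumes "pos h" obtains t where "t > 0" "norm (of_real t - h) \<le> t"
proof -
  obtain t where t: "t \<ge> 0" "norm (of_real t - h) \<le> t" using assms by (auto simp: pos_def)
  have "norm (of_real (t + 1) - h) \<le> norm (of_real t - h) + norm (1 :: 'a)"
    using norm_triangle_ineq[of "of_real t - h" 1] by (simp add: algebra_simps)
  then show ?thesis using t that[of "t + 1"] by simp
qed

lemma pos_zero [simp]: "pos (0::'a::unital_cstar)"
  by (auto simp: pos_def intro: exI[of _ 0])

lemma pos_add: assumes "pos h" "pos k" shows "pos (h + k)"
proof -
  obtain s t where "norm (of_real s - h) \<le> s" "norm (of_real t - k) \<le> t"
    using assms by (auto simp: pos_def)
  then have "norm (of_real (s + t) - (h + k)) \<le> s + t"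
    using norm_triangle_ineq[of "of_real s - h" "of_real t - k"] by (simp add: algebra_simps)
  then show ?thesis using assms by (intro posI[of _ "s + t"]) (auto simp: adj_add pos_adj)
qed

lemma pos_scaleR: assumes "pos h" "r \<ge> 0" shows "pos (r *\<^sub>R h)"
proof -
  obtain t where "norm (of_real t - h) \<le> t" using assms by (auto simp: pos_def)
  then have "norm (of_real (r * t) - r *\<^sub>R h) \<le> r * t"
    using assms(2) by (simp add: of_real_def scaleR_diff_right[symmetric] scaleR_scaleR[symmetric] mult_left_mono
        del: scaleR_scaleR)
  then show ?thesis using assms by (intro posI[of _ "r * t"]) (auto simp: adj_scaleR pos_adj)
qed

text \<open>The square root is \<open>\<surd>t \<surd>(1 - y)\<close> with \<open>y = 1 - h/t\<close>, a limit of polynomials in \<open>h\<close>; it commutes with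
  whatever commutes with \<open>h\<close>.\<close>

lemma pos_sqrt:
  assumes "pos h"
  obtains k where "pos k" "k * k = h" "\<And>z. z * h = h * z \<Longrightarrow> z * k = k * z"
proof -
  obtain t where t: "t > 0" "norm (of_real t - h) \<le> t" using pos_witness[OF assms] .
  define y where "y = 1 - (1/t) *\<^sub>R h"
  have "norm y = norm ((1/t) *\<^sub>R (of_real t - h))"
    using t by (simp add: y_def scaleR_diff_right of_real_def)
  also have "\<dots> = norm (of_real t - h) / t" using t by (simp only: norm_scaleR) simp
  also have "\<dots> \<le> 1" using t by simp
  finally have y: "norm y \<le> 1" .
  define k where "k = sqrt t *\<^sub>R sqrt_series y"
  have ya: "adj y = y" using assms by (simp add: y_def adj_diff adj_scaleR pos_adj)
  have "k * k = t *\<^sub>R (1 - y)" using t by (simp add: k_def sqrt_series_square[OF y])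
  also have "\<dots> = h" using t by (simp add: y_def)
  finally have kk: "k * k = h" .
  have "norm (of_real (sqrt t) - k) = sqrt t * norm (1 - sqrt_series y)"
    using t by (simp add: k_def of_real_def scaleR_diff_right[symmetric])
  also have "\<dots> \<le> sqrt t" using norm_one_minus_sqrt_series[OF y] t by (simp add: mult_left_le)
  finally have "pos k"
    using sqrt_series_adj[OF y ya] by (intro posI) (auto simp: k_def adj_scaleR)
  moreover have "z * k = k * z" if "z * h = h * z" for z
  proof -
    have "z * y = y * z" using that by (simp add: y_def algebra_simps)
    then show ?thesis using sqrt_series_commute[OF y] by (simp add: k_def)
  qed
  ultimately show ?thesis using that kk by blast
qed

text \<open>\<open>k + ic\<close> is unitary.\<close>

lemma norm_le_one_of_circle:
  fixes k c :: "'a::unital_cstar"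
  assumes sa: "adj k = k" "adj c = c" and com: "k * c = c * k" and one: "k * k + c * c = 1"
  shows "norm c \<le> 1"
proof -
  define u where "u = k + im * c"
  have adju: "adj u = k - im * c" using sa by (simp add: u_def adj_simps im_commute)
  have "adj u * u = k * k + k * (im * c) - (im * c) * k - (im * c) * (im * c)"
    unfolding adju by (simp add: u_def algebra_simps)
  also have "k * (im * c) = im * (k * c)" by (metis im_commute mult.assoc)
  also have "(im * c) * k = im * (k * c)" by (simp add: com mult.assoc)
  also have "(im * c) * (im * c) = (im * im) * (c * c)" by (metis im_commute mult.assoc)
  also have "k * k + im * (k * c) - im * (k * c) - (im * im) * (c * c) = 1"
    using one by (simp add: im_im)
  finally have "norm u = 1" using norm_adj_mult[of u] norm_ge_zero[of u] by (simp add: power2_eq_1_iff)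
  moreover have "u - adj u = 2 *\<^sub>R (im * c)" by (simp only: adju) (simp add: u_def scaleR_2)
  then have "norm (2 *\<^sub>R (im * c)) \<le> norm u + norm (adj u)"
    using norm_triangle_ineq4[of u "adj u"] by simp
  ultimately have *: "norm (im * c) \<le> 1" by simp
  have "im * (im * c) = - c" by (simp only: mult.assoc[symmetric] im_im) simp
  then have "norm c \<le> norm (im :: 'a) * norm (im * c)" using norm_mult_ineq[of im "im * c"] by simp
  then show ?thesis using * by simp
qed

text \<open>With \<open>c = \<surd>(1 - k\<^sup>2)\<close> one has \<open>k\<^sup>2 + c\<^sup>2 = 1\<close>, so \<open>c\<close> is a contraction as well.\<close>

lemma norm_one_minus_square:
  fixes k :: "'a::unital_cstar"
  assumes "adj k = k" "norm k \<le> 1"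
  shows "norm (1 - k * k) \<le> 1"
proof -
  have "norm (k * k) \<le> 1" using norm_mult_ineq[of k k] assms(2) mult_le_one[of "norm k" "norm k"] by simp
  note y = this
  define c where "c = sqrt_series (k * k)"
  have c: "adj c = c" "k * c = c * k" "c * c = 1 - k * k"
    using sqrt_series_adj[OF y] sqrt_series_commute[OF y, of k] sqrt_series_square[OF y] assms
    by (auto simp: c_def adj_mult mult.assoc)
  then have "norm c \<le> 1" using norm_le_one_of_circle[of k c] assms by simp
  then have "norm (c * c) \<le> 1" using norm_mult_ineq[of c c] mult_le_one[of "norm c" "norm c"] by simp
  then show ?thesis by (simp add: c)
qed

lemma norm_minus_square:
  fixes k :: "'a::unital_cstar"
  assumes "adj k = k" "norm (k * k) \<le> t"
  shows "norm (of_real t - k * k) \<le> t"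
proof (cases "t = 0")
  case False
  then have t: "t > 0" using assms(2) norm_ge_zero[of "k * k"] by linarith
  define k' where "k' = (1 / sqrt t) *\<^sub>R k"
  have "norm (k * k) = norm k ^ 2" using norm_adj_mult[of k] assms by simp
  then have "norm k \<le> sqrt t" using assms(2) by (simp add: real_le_rsqrt)
  then have "norm k' \<le> 1" using t by (simp add: k'_def field_simps)
  then have "norm (1 - k' * k') \<le> 1" using assms by (intro norm_one_minus_square) (auto simp: k'_def adj_scaleR)
  moreover have "of_real t - k * k = t *\<^sub>R (1 - k' * k')"
    using t by (simp add: k'_def scaleR_diff_right of_real_def)
  ultimately show ?thesis using t by (simp add: mult_left_le)
qed (use assms in simp)

lemma pos_square: "adj k = k \<Longrightarrow> pos (k * k)"
  by (rule posI[of _ "norm (k * k)"]) (simp_all add: adj_mult norm_minus_square)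

lemma pos_norm_minus:
  assumes "pos h" "norm h \<le> t" shows "norm (of_real t - h) \<le> t"
proof -
  obtain k where "pos k" "k * k = h" using pos_sqrt[OF assms(1)] by blast
  then show ?thesis using norm_minus_square[of k t] assms(2) by (simp add: pos_adj)
qed

text \<open>The witness \<open>t\<close> in the definition of positivity can be any upper bound of the norm, hence can be chosen
  uniformly for a convergent sequence.\<close>

lemma pos_closed:
  assumes lim: "f \<longlonglongrightarrow> h" and p: "\<And>n. pos (f n)"
  shows "pos (h :: 'a::unital_cstar)"
proof -
  obtain K where K: "\<And>n. norm (f n) \<le> K"
    using convergent_imp_Bseq[OF convergentI[OF lim]] by (auto simp: Bseq_def)
  have "(\<lambda>n. norm (of_real K - f n)) \<longlonglongrightarrow> norm (of_real K - h)" by (intro tendsto_intros lim)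
  then have "norm (of_real K - h) \<le> K"
    by (rule LIMSEQ_le_const2) (use pos_norm_minus[OF p K] in auto)
  moreover have "(\<lambda>n. adj (f n)) \<longlonglongrightarrow> adj h"
    using bounded_linear.tendsto[OF bounded_linear_adj lim] .
  then have "adj h = h" using lim p by (simp add: pos_adj LIMSEQ_unique)
  ultimately show ?thesis by (intro posI)
qed

lemma pos_mult:
  assumes "pos h" "pos k" "h * k = k * h" shows "pos (h * k)"
proof -
  obtain a where a: "pos a" "a * a = h" "\<And>z. z * h = h * z \<Longrightarrow> z * a = a * z" using pos_sqrt[OF assms(1)] by blast
  obtain b where b: "pos b" "b * b = k" "\<And>z. z * k = k * z \<Longrightarrow> z * b = b * z" using pos_sqrt[OF assms(2)] by blast
  have ak: "a * k = k * a" using a(3)[of k] assms(3) by simp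
  have ab: "a * b = b * a" using b(3)[OF ak] .
  have "h * k = a * (a * b) * b" by (simp add: a(2)[symmetric] b(2)[symmetric] mult.assoc)
  also have "\<dots> = (a * b) * (a * b)" by (metis ab mult.assoc)
  finally show ?thesis using pos_square[of "a * b"] a(1) b(1) by (simp add: adj_mult pos_adj ab)
qed

lemma pos_of_real: "t \<ge> 0 \<Longrightarrow> pos (of_real t :: 'a::unital_cstar)"
  by (intro posI[of _ t]) auto

lemma norm_le_of_pos:
  assumes "pos h" "pos (of_real t - h)" "t \<ge> 0"
  shows "norm (h::'a::unital_cstar) \<le> t"
proof -
  have strict: "norm h \<le> s" if s: "s > 0" and sh: "pos (of_real s - h)" for s
  proof -
    obtain a where a: "pos a" "a * a = h" using pos_sqrt[OF assms(1)] by metis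
    obtain b where b: "pos b" "b * b = of_real s - h"
      "\<And>z. z * (of_real s - h) = (of_real s - h) * z \<Longrightarrow> z * b = b * z" using pos_sqrt[OF sh] by blast
    have "a * h = h * a" by (simp add: a(2)[symmetric] mult.assoc)
    then have "a * (of_real s - h) = (of_real s - h) * a" by (simp add: algebra_simps of_real_def)
    then have ab: "a * b = b * a" using b(3) by blast
    define a' b' where "a' = (1 / sqrt s) *\<^sub>R a" and "b' = (1 / sqrt s) *\<^sub>R b"
    have "b' * b' + a' * a' = (1/s) *\<^sub>R (b * b + a * a)"
      using s by (simp add: a'_def b'_def scaleR_add_right)
    also have "\<dots> = 1" using s by (simp add: a(2) b(2) of_real_def)
    finally have one: "b' * b' + a' * a' = 1" .
    have "adj a' = a'" "adj b' = b'" "b' * a' = a' * b'"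
      using a(1) b(1) ab by (simp_all add: a'_def b'_def adj_scaleR pos_adj)
    then have "norm a' \<le> 1" using one norm_le_one_of_circle by blast
    then have "norm a \<le> sqrt s" using s by (simp add: a'_def field_simps)
    then have "norm a ^ 2 \<le> s" using power_mono[of "norm a" "sqrt s" 2] s by simp
    then show ?thesis using norm_adj_mult[of a] a by (simp add: pos_adj)
  qed
  show ?thesis
  proof (rule field_le_epsilon)
    fix \<epsilon> :: real assume "\<epsilon> > 0"
    then have "pos (of_real (t + \<epsilon>) - h)"
      using pos_add[OF assms(2) pos_of_real[of \<epsilon>]] by (simp add: algebra_simps)
    then show "norm h \<le> t + \<epsilon>" using strict[of "t + \<epsilon>"] assms(3) \<open>\<epsilon> > 0\<close> by simp
  qed
qed

lemma norm_mono:
  assumes "pos h" "pos (k - h)" shows "norm h \<le> norm (k::'a::unital_cstar)"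
proof -
  have "pos k" using pos_add[OF assms] by simp
  then have "norm (of_real (norm k) - k) \<le> norm k" by (intro pos_norm_minus) auto
  then have "pos (of_real (norm k) - k)"
    using \<open>pos k\<close> by (intro posI[of _ "norm k"]) (auto simp: adj_diff pos_adj)
  from pos_add[OF this assms(2)] have "pos (of_real (norm k) - h)" by simp
  then show ?thesis using assms(1) by (intro norm_le_of_pos) auto
qed

lemma pos_of_real_minus:
  assumes "pos h" "norm h \<le> t" shows "pos (of_real t - h)"
proof -
  have "norm (of_real t - (of_real t - h)) \<le> t" using assms(2) by simp
  then show ?thesis using assms(1) by (intro posI[of _ t]) (auto simp: adj_diff pos_adj)
qed

lemma pos_antisym: "pos h \<Longrightarrow> pos (- h) \<Longrightarrow> h = 0"
  using norm_mono[of h 0] by simp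

subsection \<open>Elements of the form b*b are positive\<close>

text \<open>Since \<open>qp = 0\<close>, one has \<open>q (t - q)\<^sup>m = q (t - (p + q))\<^sup>m\<close>.  Hence the powers of \<open>t - q\<close> grow at most like
  \<open>t\<^sup>m\<close> times a linear factor.\<close>

lemma pos_of_orthogonal_sum:
  fixes p q :: "'a::unital_cstar"
  assumes sa: "adj q = q" and z: "q * p = 0" and s: "pos (p + q)"
  shows "pos q"
proof -
  obtain t where t: "t > 0" "norm (of_real t - (p + q)) \<le> t" using pos_witness[OF s] .
  define w where "w = of_real t - q"
  define v where "v = of_real t - (p + q)"
  have qw: "q * w = w * q" by (simp add: w_def algebra_simps of_real_def)
  have qv: "q * v = w * q" using z by (simp add: w_def v_def algebra_simps of_real_def)
  have eq: "q * w ^ m = q * v ^ m" for m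
  proof (induct m)
    case (Suc m)
    have "q * w ^ Suc m = w * (q * w ^ m)" by (simp add: qw mult.assoc[symmetric])
    also have "\<dots> = q * v ^ Suc m" by (simp add: Suc qv mult.assoc[symmetric])
    finally show ?case .
  qed simp
  have "norm (w ^ m) \<le> (1 + (norm q / t) * real m) * t ^ m" for m
  proof (induct m)
    case (Suc m)
    have "w ^ Suc m = t *\<^sub>R w ^ m - q * w ^ m" by (simp add: w_def algebra_simps of_real_def)
    then have "norm (w ^ Suc m) \<le> t * norm (w ^ m) + norm (q * v ^ m)"
      using norm_triangle_ineq4[of "t *\<^sub>R w ^ m" "q * w ^ m"] t by (simp add: eq)
    also have "norm (q * v ^ m) \<le> norm q * t ^ m"
      using norm_mult_ineq[of q "v ^ m"] norm_power_ineq[of v m] power_mono[OF t(2) norm_ge_zero, of m]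
      unfolding v_def[symmetric]
      by (meson mult_left_mono norm_ge_zero order_trans)
    also have "t * norm (w ^ m) \<le> t * ((1 + (norm q / t) * real m) * t ^ m)"
      using Suc t by (intro mult_left_mono) auto
    finally show ?case using t by (simp add: field_simps)
  qed simp
  moreover have "adj w = w" using sa by (simp add: w_def adj_diff)
  ultimately have "norm w \<le> t" using norm_le_of_power_growth[of w t "norm q / t"] t(1) by blast
  then show ?thesis using sa by (intro posI[of q t]) (auto simp: w_def)
qed

text \<open>Here \<open>m\<close> is the absolute value \<open>\<surd>(h\<^sup>2)\<close>, and \<open>(m + h)(m - h) = 0\<close> makes the two factors orthogonal.\<close>

lemma selfadjoint_decomposition:
  fixes h :: "'a::unital_cstar"
  assumes "adj h = h"
  obtains m where "pos (m + h)" "pos (m - h)" "m * m = h * h" "m * h = h * m" "adj m = m"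
proof -
  obtain m where m: "pos m" "m * m = h * h" "\<And>z. z * (h * h) = (h * h) * z \<Longrightarrow> z * m = m * z"
    using pos_sqrt[OF pos_square[OF assms]] by blast
  have mh: "m * h = h * m" using m(3)[of h] by (simp add: mult.assoc)
  have a: "adj m = m" using m(1) by (rule pos_adj)
  have "(m - h) + (m + h) = 2 *\<^sub>R m" by (simp add: scaleR_2)
  then have s: "pos ((m + h) + (m - h))" "pos ((m - h) + (m + h))"
    using pos_scaleR[OF m(1), of 2] by (simp_all add: add.commute)
  have "(m - h) * (m + h) = 0" "(m + h) * (m - h) = 0" using m(2) mh by (simp_all add: algebra_simps)
  then have "pos (m - h)" "pos (m + h)"
    using pos_of_orthogonal_sum[OF _ _ s(1)] pos_of_orthogonal_sum[OF _ _ s(2)] a assms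
    by (auto simp: adj_simps)
  then show ?thesis using that m mh a by blast
qed

text \<open>The powers of \<open>t + dd*\<close> are controlled by those of \<open>t + d*d\<close>, since
  \<open>d* (t + dd*)\<^sup>m = (t + d*d)\<^sup>m d*\<close>.\<close>

lemma pos_minus_mult_adj:
  fixes d :: "'a::unital_cstar"
  assumes "pos (- (adj d * d))" shows "pos (- (d * adj d))"
proof -
  obtain t where t: "t > 0" "norm (of_real t - - (adj d * d)) \<le> t" using pos_witness[OF assms] .
  define v where "v = of_real t + adj d * d"
  define w where "w = of_real t + d * adj d"
  have v: "norm v \<le> t" using t by (simp add: v_def)
  have dw: "adj d * w = v * adj d" by (simp add: w_def v_def algebra_simps of_real_def)
  have eq: "adj d * w ^ m = v ^ m * adj d" for m
  proof (induct m)
    case (Suc m)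
    have "adj d * w ^ Suc m = v * (adj d * w ^ m)" by (simp add: dw mult.assoc[symmetric])
    then show ?case by (simp add: Suc mult.assoc)
  qed simp
  have "norm (w ^ m) \<le> (1 + (norm d ^ 2 / t) * real m) * t ^ m" for m
  proof (induct m)
    case (Suc m)
    have "w ^ Suc m = t *\<^sub>R w ^ m + d * (v ^ m * adj d)"
      by (simp add: w_def algebra_simps of_real_def eq[symmetric, unfolded w_def of_real_def])
    then have "norm (w ^ Suc m) \<le> t * norm (w ^ m) + norm (d * (v ^ m * adj d))"
      using norm_triangle_ineq[of "t *\<^sub>R w ^ m" "d * (v ^ m * adj d)"] t by simp
    also have "norm (d * (v ^ m * adj d)) \<le> norm d * (norm (v ^ m) * norm d)"
      using norm_mult_ineq[of d "v ^ m * adj d"]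
        mult_left_mono[OF norm_mult_ineq[of "v ^ m" "adj d"] norm_ge_zero[of d]]
      unfolding norm_adj by linarith
    also have "\<dots> \<le> norm d * (t ^ m * norm d)"
      using norm_power_ineq[of v m] power_mono[OF v norm_ge_zero, of m]
      by (intro mult_left_mono mult_right_mono) auto
    also have "t * norm (w ^ m) \<le> t * ((1 + (norm d ^ 2 / t) * real m) * t ^ m)"
      using Suc t by (intro mult_left_mono) auto
    finally show ?case using t by (simp add: field_simps power2_eq_square)
  qed simp
  moreover have "adj w = w" by (simp add: w_def adj_add adj_mult)
  ultimately have "norm w \<le> t" using norm_le_of_power_growth[of w t "norm d ^ 2 / t"] t(1) by blast
  then show ?thesis by (intro posI[of _ t]) (auto simp: w_def adj_simps)
qed

text \<open>If \<open>-d*d\<close> is positive, then so is \<open>-dd*\<close>.  But \<open>d*d + dd*\<close> is twice the sum of the squares of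
  the real and the imaginary part of \<open>d\<close>, so \<open>d*d\<close> is positive together with its negative.\<close>

lemma zero_of_pos_minus:
  fixes d :: "'a::unital_cstar"
  assumes "pos (- (adj d * d))" shows "d = 0"
proof -
  \<comment> \<open>up to sign twice the real and the imaginary part of \<open>d\<close>\<close>
  define u v where "u = d + adj d" and "v = im * (d - adj d)"
  have "pos (u * u + v * v)"
    by (intro pos_add pos_square) (auto simp: u_def v_def adj_simps im_commute algebra_simps)
  also have "v * v = (im * im) * ((d - adj d) * (d - adj d))"
    unfolding v_def by (metis im_commute mult.assoc)
  also have "u * u + \<dots> = 2 *\<^sub>R (adj d * d + d * adj d)"
    by (simp add: u_def im_im algebra_simps scaleR_2)
  finally have "pos (2 *\<^sub>R (adj d * d + d * adj d))" .
  from pos_scaleR[OF this, of "1/2"] have "pos (adj d * d + d * adj d)" by simp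
  from pos_add[OF this pos_minus_mult_adj[OF assms]] have "pos (adj d * d)" by simp
  then have "adj d * d = 0" using assms pos_antisym by blast
  then show ?thesis using norm_adj_mult[of d] by simp
qed

text \<open>The argument of Kelley and Vaught: let \<open>q\<close> be twice the negative part of \<open>h = b*b\<close>.  Then \<open>d = bq\<close> satisfies
  \<open>d*d = qhq = -q\<^sup>3/2\<close>, which forces \<open>d = 0\<close> and \<open>q = 0\<close>.\<close>

theorem pos_adj_mult: "pos (adj b * (b::'a::unital_cstar))"
proof -
  define h where "h = adj b * b"
  have ah: "adj h = h" by (simp add: h_def adj_mult)
  obtain m where m: "pos (m + h)" "pos (m - h)" "m * m = h * h" "m * h = h * m" "adj m = m"
    using selfadjoint_decomposition[OF ah] .
  \<comment> \<open>twice the negative part of \<open>h\<close>\<close>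
  define q where "q = m - h"
  have aq: "adj q = q" using m(2) by (simp add: q_def pos_adj)
  have hq: "2 *\<^sub>R (h * q) = - (q * q)" using m by (simp add: q_def algebra_simps scaleR_2)
  define d where "d = b * q"
  have "2 *\<^sub>R (adj d * d) = q * (2 *\<^sub>R (h * q))" by (simp add: d_def adj_mult aq h_def mult.assoc)
  also have "\<dots> = - (q * q * q)" by (simp add: hq mult.assoc)
  finally have eq: "- (2 *\<^sub>R (adj d * d)) = q * q * q" by simp
  have "pos (q * q * q)"
    using m(2) by (intro pos_mult pos_square aq) (auto simp: q_def[symmetric] mult.assoc)
  then have "pos ((1/2) *\<^sub>R (- (2 *\<^sub>R (adj d * d))))" unfolding eq by (intro pos_scaleR) auto
  then have "d = 0" by (intro zero_of_pos_minus) simp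
  then have "q * q * q = 0" using eq by simp
  then have "norm (q ^ (2 ^ 2)) = 0" by (simp add: power_numeral_reduce mult.assoc)
  then have "q = 0" using norm_power_selfadjoint[OF aq, of 2] by simp
  then have "m + h = 2 *\<^sub>R h" by (simp add: q_def scaleR_2)
  then have "pos (2 *\<^sub>R h)" using m(1) by simp
  from pos_scaleR[OF this, of "1/2"] show ?thesis by (simp add: h_def)
qed

lemma pos_conjugate: "pos h \<Longrightarrow> pos (adj x * h * x)"
proof -
  assume "pos h"
  then obtain k where "pos k" "k * k = h" using pos_sqrt by metis
  then show ?thesis using pos_adj_mult[of "k * x"] by (auto simp: adj_mult pos_adj mult.assoc)
qed

subsection \<open>Consequences of positivity\<close>

text \<open>The algebraic core of the Cauchy-Schwarz inequality in Hilbert modules, with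
  \<open>a = \<langle>x, y\<rangle>\<close>, \<open>c = \<langle>x, x\<rangle>\<close> and \<open>d = \<langle>y, y\<rangle>\<close>.\<close>

lemma cauchy_schwarz_core:
  fixes a c d :: "'a::unital_cstar"
  assumes t: "t > 0" and c: "pos c" "norm c \<le> t"
    and p: "pos (adj a * c * a - 2 *\<^sub>R t *\<^sub>R (adj a * a) + (t * t) *\<^sub>R d)"
  shows "pos (t *\<^sub>R d - adj a * a)"
proof -
  have "pos (adj a * (of_real t - c) * a)" by (intro pos_conjugate pos_of_real_minus c)
  also have "adj a * (of_real t - c) * a = t *\<^sub>R (adj a * a) - adj a * c * a"
    by (simp add: algebra_simps of_real_def)
  finally have "pos ((adj a * c * a - 2 *\<^sub>R t *\<^sub>R (adj a * a) + (t * t) *\<^sub>R d)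
      + (t *\<^sub>R (adj a * a) - adj a * c * a))" by (rule pos_add[OF p])
  also have "(adj a * c * a - 2 *\<^sub>R t *\<^sub>R (adj a * a) + (t * t) *\<^sub>R d)
      + (t *\<^sub>R (adj a * a) - adj a * c * a) = (t * t) *\<^sub>R d - t *\<^sub>R (adj a * a)"
    by (simp only: scaleR_2) simp
  finally have "pos ((t * t) *\<^sub>R d - t *\<^sub>R (adj a * a))" .
  from pos_scaleR[OF this, of "1/t"] show ?thesis
    using t by (simp add: scaleR_diff_right)
qed

text \<open>After rescaling, \<open>h + \<epsilon>\<close> is \<open>1 - y\<close> with \<open>\<Parallel>y\<Parallel> < 1\<close>, and the inverse is a geometric series.\<close>

lemma inverse_of_pos_plus:
  assumes "pos h" "\<epsilon> > 0"
  obtains r where "r * (h + of_real \<epsilon>) = 1" "adj r = r" "\<And>z. z * h = h * z \<Longrightarrow> z * r = r * z"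
proof -
  obtain t where t: "t > 0" "norm (of_real t - h) \<le> t" using pos_witness[OF assms(1)] .
  define y where "y = (1 / (t + \<epsilon>)) *\<^sub>R (of_real t - h)"
  have "norm y \<le> t / (t + \<epsilon>)" using t assms by (simp add: y_def divide_right_mono)
  then have y: "norm y < 1" using t assms by (smt (verit) divide_less_eq_1_pos)
  have ay: "adj y = y" using assms by (simp add: y_def adj_simps pos_adj)
  note s = complete_algebra_summable_geometric[OF y]
  define g where "g = (\<Sum>n. y ^ n)"
  have "g = 1 + (\<Sum>n. y ^ Suc n)"
    unfolding g_def using suminf_split_head[OF s] by simp
  also have "(\<Sum>n. y ^ Suc n) = g * y"
    unfolding g_def by (simp add: suminf_mult2[OF s] power_commutes)
  finally have gy: "g - g * y = 1" by (metis add_diff_cancel_right')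
  have ag: "adj g = g" unfolding g_def
    by (subst bounded_linear.suminf[OF bounded_linear_adj s]) (simp add: adj_power ay)
  have cg: "z * g = g * z" if "z * h = h * z" for z
  proof -
    have "z * y = y * z" using that by (simp add: y_def algebra_simps of_real_def)
    then have "z * y ^ n = y ^ n * z" for n using power_commuting_commutes[of y z n] by simp
    then show ?thesis unfolding g_def
      by (simp add: suminf_mult[OF s, symmetric] suminf_mult2[OF s])
  qed
  define r where "r = (1 / (t + \<epsilon>)) *\<^sub>R g"
  have "h + of_real \<epsilon> = (t + \<epsilon>) *\<^sub>R (1 - y)"
    using t assms by (simp add: y_def scaleR_diff_right of_real_def) (simp add: scaleR_add_left)
  then have "r * (h + of_real \<epsilon>) = g * (1 - y)" using t assms by (simp add: r_def)
  then have "r * (h + of_real \<epsilon>) = 1" using gy by (simp add: algebra_simps)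
  moreover have "adj r = r" by (simp add: r_def adj_scaleR ag)
  moreover have "z * r = r * z" if "z * h = h * z" for z using cg[OF that] by (simp add: r_def)
  ultimately show ?thesis using that by blast
qed

text \<open>With \<open>r = (b\<^sup>2 + s\<^sup>2)\<^sup>-\<^sup>1\<close>, the element \<open>e = b\<^sup>2r\<close> is a local unit for \<open>b\<close>, and \<open>f = br\<close> is an approximate
  inverse of \<open>b\<close>.\<close>

lemma local_unit:
  fixes b :: "'a::unital_cstar"
  assumes b: "pos b" and s: "s > 0"
  obtains f r g where "f = b * r" "adj f = f" "b * f = f * b" "pos (b * f)" "norm (b * f) \<le> 1"
    "adj g = g" "g * g = f - f * b * f"
    "norm ((1 - b * f) * b * (1 - b * f)) \<le> s"
proof -
  have ab: "adj b = b" using b by (rule pos_adj)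
  have s2: "s ^ 2 > 0" using s by simp
  obtain r where r: "r * (b * b + of_real (s ^ 2)) = 1" "adj r = r"
    and rc: "\<And>z. z * (b * b) = (b * b) * z \<Longrightarrow> z * r = r * z"
    using inverse_of_pos_plus[OF pos_square[OF ab] s2] by blast
  have br: "b * r = r * b" using rc[of b] by (simp add: mult.assoc)
  have com: "b * (r * x) = r * (b * x)" for x using br by (metis mult.assoc)
  have r1: "r * (b * b) = 1 - s ^ 2 *\<^sub>R r"
    using r(1) by (simp add: algebra_simps of_real_def)
  have posr: "pos r"
  proof -
    have "r = r * (r * (b * b + of_real (s ^ 2)))" using r(1) by simp
    also have "\<dots> = (r * b) * (r * b) + s ^ 2 *\<^sub>R (r * r)"
      by (simp add: algebra_simps of_real_def com)
    also have "pos \<dots>"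
      using r ab br by (intro pos_add pos_scaleR pos_square) (auto simp: adj_mult)
    finally show ?thesis .
  qed
  define f where "f = b * r"
  have bf: "b * f = 1 - s ^ 2 *\<^sub>R r" using r1 by (simp add: f_def com br)
  have posf: "pos f" unfolding f_def by (intro pos_mult b posr br)
  have af: "adj f = f" using posf by (rule pos_adj)
  have fb: "b * f = f * b" by (simp add: f_def com br mult.assoc)
  have pe: "pos (b * f)" by (intro pos_mult b posf fb)
  have "pos (of_real 1 - b * f)" using pos_scaleR[OF posr, of "s ^ 2"] by (simp add: bf)
  then have ne: "norm (b * f) \<le> 1" by (intro norm_le_of_pos pe) auto
  have "f - f * b * f = s ^ 2 *\<^sub>R (b * (r * r))"
    using bf by (simp add: mult.assoc) (simp add: f_def algebra_simps)
  also have "pos \<dots>"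
    using posr br com by (intro pos_scaleR pos_mult b) (auto simp: mult.assoc)
  finally obtain g where g: "pos g" "g * g = f - f * b * f" using pos_sqrt by metis
  have "norm ((1 - b * f) * b * (1 - b * f)) \<le> s"
  proof -
    have e: "(1 - b * f) * b * (1 - b * f) = s ^ 4 *\<^sub>R (b * (r * r))"
      by (simp add: bf com mult.assoc power4_eq_xxxx power2_eq_square)
    have p1: "pos (s ^ 4 *\<^sub>R (b * (r * r)))"
      using posr br com by (intro pos_scaleR pos_mult b) (auto simp: mult.assoc)
    \<comment> \<open>\<open>s\<^sup>4 b r\<^sup>2 \<le> s/2\<close> is the inequality \<open>2s\<^sup>3 b \<le> (b\<^sup>2 + s\<^sup>2)\<^sup>2\<close>, whose difference is a sum of squares\<close>
    define w where "w = b * b + of_real (s ^ 2)"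
    have rw: "r * w = 1" and wr: "w * r = 1" using r(1) br com by (auto simp: w_def algebra_simps of_real_def)
    have "pos ((b * b) * (b * b) + s ^ 2 *\<^sub>R (b * b) + s ^ 2 *\<^sub>R ((b - of_real s) * (b - of_real s)))"
      using ab by (intro pos_add pos_scaleR pos_square) (auto simp: adj_mult adj_diff)
    also have "(b * b) * (b * b) + s ^ 2 *\<^sub>R (b * b) + s ^ 2 *\<^sub>R ((b - of_real s) * (b - of_real s))
        = w * w - (2 * s ^ 3) *\<^sub>R b"
      by (simp add: w_def algebra_simps of_real_def power2_eq_square power3_eq_cube scaleR_2)
        (simp add: scaleR_add_left[symmetric])
    finally have "pos (adj r * (w * w - (2 * s ^ 3) *\<^sub>R b) * r)" by (rule pos_conjugate)
    also have "adj r * (w * w - (2 * s ^ 3) *\<^sub>R b) * r = (r * w) * (w * r) - (2 * s ^ 3) *\<^sub>R (b * (r * r))"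
      by (simp add: r(2) algebra_simps com br)
    finally have "pos (1 - (2 * s ^ 3) *\<^sub>R (b * (r * r)))" by (simp add: rw wr)
    from pos_scaleR[OF this, of "s/2"] have "pos (of_real (s/2) - s ^ 4 *\<^sub>R (b * (r * r)))"
      using s by (simp add: scaleR_diff_right of_real_def power4_eq_xxxx power3_eq_cube mult.assoc)
    from norm_le_of_pos[OF p1 this] show ?thesis using s unfolding e by simp
  qed
  then show ?thesis using that[of f r g] f_def af fb pe ne pos_adj[OF g(1)] g(2) by blast
qed

text \<open>The sum exists by completeness, and it dominates each of its terms because the remaining sums stay in the
  closed cone.\<close>

lemma weighted_sum_upper_bound:
  fixes a :: "nat \<Rightarrow> 'a::unital_cstar"
  assumes p: "\<And>n. pos (a n)" and n: "\<And>n. norm (a n) \<le> 1"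
  shows "summable (\<lambda>n. (1/2) ^ n *\<^sub>R a n)" "pos (\<Sum>n. (1/2) ^ n *\<^sub>R a n)"
    "pos ((\<Sum>n. (1/2) ^ n *\<^sub>R a n) - (1/2) ^ k *\<^sub>R a k)"
proof -
  have "summable (\<lambda>n. norm ((1/2) ^ n *\<^sub>R a n))"
    by (rule summable_comparison_test'[of "\<lambda>n. (1/2) ^ n"]) (use n in \<open>auto simp: mult_left_le\<close>)
  then show s: "summable (\<lambda>n. (1/2) ^ n *\<^sub>R a n)" by (rule summable_norm_cancel)
  have sum: "pos (\<Sum>n\<in>A. (1/2) ^ n *\<^sub>R a n)" if "finite A" for A
    using that by (induct A) (auto intro!: pos_add pos_scaleR p)
  show "pos (\<Sum>n. (1/2) ^ n *\<^sub>R a n)"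
    using summable_LIMSEQ[OF s] by (rule pos_closed) (simp add: sum)
  have "(\<lambda>N. (\<Sum>n<N + Suc k. (1/2) ^ n *\<^sub>R a n) - (1/2) ^ k *\<^sub>R a k)
      \<longlonglongrightarrow> (\<Sum>n. (1/2) ^ n *\<^sub>R a n) - (1/2) ^ k *\<^sub>R a k"
    by (intro tendsto_intros LIMSEQ_ignore_initial_segment summable_LIMSEQ[OF s])
  moreover have "pos ((\<Sum>n<N + Suc k. (1/2) ^ n *\<^sub>R a n) - (1/2) ^ k *\<^sub>R a k)" for N
    using sum[of "{..<N + Suc k} - {k}"] by (simp add: sum_diff1)
  ultimately show "pos ((\<Sum>n. (1/2) ^ n *\<^sub>R a n) - (1/2) ^ k *\<^sub>R a k)" by (rule pos_closed)
qed

hide_const (open) Multiset.mult Polynomial.smult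

section \<open>From typed to carrier-based C*-algebras\<close>

locale cmodule = module complex_ring M for M :: "(complex, 'a, 'm) module_scheme" (structure)
begin

lemma csmult_closed [simp, intro]: "x \<in> carrier M \<Longrightarrow> z \<odot> x \<in> carrier M"
  by (rule smult_closed) (simp_all add: carrier_class)

lemma csmult_l_distr: "x \<in> carrier M \<Longrightarrow> (z + w) \<odot> x = z \<odot> x \<oplus> w \<odot> x"
  using smult_l_distr[of z w x] by (simp add: carrier_class plus_class)

lemma csmult_r_distr: "x \<in> carrier M \<Longrightarrow> y \<in> carrier M \<Longrightarrow> z \<odot> (x \<oplus> y) = z \<odot> x \<oplus> z \<odot> y"
  using smult_r_distr[of z x y] by (simp add: carrier_class)

lemma csmult_assoc: "x \<in> carrier M \<Longrightarrow> z \<odot> (w \<odot> x) = (z * w) \<odot> x"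
  using smult_assoc1[of z w x] by (simp add: carrier_class times_class)

lemma csmult_one [simp]: "x \<in> carrier M \<Longrightarrow> 1 \<odot> x = x"
  using smult_one[of x] by (simp add: one_class)

lemma csmult_0 [simp]: "x \<in> carrier M \<Longrightarrow> 0 \<odot> x = \<zero>"
  using smult_l_null[of x] by (simp add: zero_class)

lemma csmult_zero [simp]: "z \<odot> \<zero> = \<zero>"
  using smult_r_null[of z] by (simp add: carrier_class)

lemma csmult_m1: "x \<in> carrier M \<Longrightarrow> (-1) \<odot> x = \<ominus> x"
  using smult_l_minus[of "1" x] by (simp add: carrier_class uminus_class)

lemma minus_csmult: "x \<in> carrier M \<Longrightarrow> y \<in> carrier M \<Longrightarrow> x \<ominus> y = x \<oplus> (-1) \<odot> y"
  by (simp add: a_minus_def csmult_m1)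

lemma add_m1_self [simp]: "x \<in> carrier M \<Longrightarrow> x \<oplus> (-1) \<odot> x = \<zero>"
  by (simp add: csmult_m1 r_neg)

lemma add_m1_eq_zero: "x \<in> carrier M \<Longrightarrow> y \<in> carrier M \<Longrightarrow> x \<oplus> (-1) \<odot> y = \<zero> \<longleftrightarrow> x = y"
  by (metis add_m1_self csmult_closed csmult_m1 add.inv_closed minus_equality minus_minus)

end

lemma cmoduleI: "module complex_ring M \<Longrightarrow> cmodule M"
  by (simp add: cmodule_def)

context cstar_algebra
begin

sublocale cm: cmodule A
  by (rule cmoduleI) (rule module_axioms)

lemma star_zero [simp]: "star A \<zero>\<^bsub>A\<^esub> = \<zero>\<^bsub>A\<^esub>"
  using star_smult[of "\<zero>\<^bsub>A\<^esub>" 0] by (simp add: star_closed)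

lemma mult_zero_left [simp]: "a \<in> carrier A \<Longrightarrow> \<zero>\<^bsub>A\<^esub> \<otimes>\<^bsub>A\<^esub> a = \<zero>\<^bsub>A\<^esub>"
  using smult_mult_left[of "\<zero>\<^bsub>A\<^esub>" a 0] by (simp add: mult_closed)

lemma mult_zero_right [simp]: "a \<in> carrier A \<Longrightarrow> a \<otimes>\<^bsub>A\<^esub> \<zero>\<^bsub>A\<^esub> = \<zero>\<^bsub>A\<^esub>"
  using smult_mult_right[of a "\<zero>\<^bsub>A\<^esub>" 0] by (simp add: mult_closed)

lemma nrm_zero [simp]: "nrm A \<zero>\<^bsub>A\<^esub> = 0"
  using nrm_eq_zero_iff[of "\<zero>\<^bsub>A\<^esub>"] by simp

lemma cdist_eq: "a \<in> carrier A \<Longrightarrow> b \<in> carrier A \<Longrightarrow> cdist A a b = nrm A (a \<oplus>\<^bsub>A\<^esub> (-1) \<odot>\<^bsub>A\<^esub> b)"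
  by (simp add: cdist_def cm.minus_csmult)

lemma metric: "Metric_space (carrier A) (cdist A)"
proof
  show "0 \<le> cdist A a b" for a b
    by (simp add: cdist_def nrm_nonneg)
  show "cdist A a b = cdist A b a" for a b
  proof (cases "a \<in> carrier A \<and> b \<in> carrier A")
    case True
    then have "b \<oplus>\<^bsub>A\<^esub> (-1) \<odot>\<^bsub>A\<^esub> a = (-1) \<odot>\<^bsub>A\<^esub> (a \<oplus>\<^bsub>A\<^esub> (-1) \<odot>\<^bsub>A\<^esub> b)"
      by (simp add: cm.csmult_r_distr cm.csmult_assoc a_comm)
    then show ?thesis using True by (simp add: cdist_eq nrm_smult)
  qed (auto simp: cdist_def)
  show "cdist A a b = 0 \<longleftrightarrow> a = b" if "a \<in> carrier A" "b \<in> carrier A" for a b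
    using that by (simp add: cdist_eq nrm_eq_zero_iff cm.add_m1_eq_zero)
  show "cdist A a c \<le> cdist A a b + cdist A b c"
    if "a \<in> carrier A" "b \<in> carrier A" "c \<in> carrier A" for a b c
  proof -
    have "a \<oplus>\<^bsub>A\<^esub> (-1) \<odot>\<^bsub>A\<^esub> c = (a \<oplus>\<^bsub>A\<^esub> (-1) \<odot>\<^bsub>A\<^esub> b) \<oplus>\<^bsub>A\<^esub> (b \<oplus>\<^bsub>A\<^esub> (-1) \<odot>\<^bsub>A\<^esub> c)"
      using that by (simp add: cm.csmult_m1 a_assoc r_neg1)
    then show ?thesis using that by (simp add: cdist_eq nrm_add)
  qed
qed

end

text \<open>The facts about positive elements that the theory of C*-modules below rests on.\<close>

definition order_facts :: "'a cstar \<Rightarrow> bool" where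
  "order_facts A \<longleftrightarrow>
    (\<forall>a b. cpos A a \<and> cpos A b \<longrightarrow> cpos A (a \<oplus>\<^bsub>A\<^esub> b)) \<and>
    (\<forall>f a. (\<forall>n::nat. cpos A (f n)) \<and> a \<in> carrier A \<and> (\<lambda>n. cdist A (f n) a) \<longlonglongrightarrow> 0 \<longrightarrow> cpos A a) \<and>
    (\<forall>a c. cpos A a \<and> cpos A c \<longrightarrow> nrm A a \<le> nrm A (a \<oplus>\<^bsub>A\<^esub> c)) \<and>
    (\<forall>a\<in>carrier A. \<forall>c\<in>carrier A. \<forall>d\<in>carrier A. \<forall>t>0. cpos A c \<and> nrm A c \<le> t \<and>
      cpos A (star A a \<otimes>\<^bsub>A\<^esub> c \<otimes>\<^bsub>A\<^esub> a \<oplus>\<^bsub>A\<^esub> complex_of_real (- 2 * t) \<odot>\<^bsub>A\<^esub> (star A a \<otimes>\<^bsub>A\<^esub> a)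
        \<oplus>\<^bsub>A\<^esub> complex_of_real (t * t) \<odot>\<^bsub>A\<^esub> d) \<longrightarrow>
      cpos A (complex_of_real t \<odot>\<^bsub>A\<^esub> d \<oplus>\<^bsub>A\<^esub> (-1) \<odot>\<^bsub>A\<^esub> (star A a \<otimes>\<^bsub>A\<^esub> a))) \<and>
    (\<forall>b s. cpos A b \<and> s > 0 \<longrightarrow> (\<exists>f\<in>carrier A. \<exists>g\<in>carrier A. star A f = f \<and> star A g = g \<and>
      b \<otimes>\<^bsub>A\<^esub> f = f \<otimes>\<^bsub>A\<^esub> b \<and> cpos A (b \<otimes>\<^bsub>A\<^esub> f) \<and> nrm A (b \<otimes>\<^bsub>A\<^esub> f) \<le> 1 \<and>
      f = f \<otimes>\<^bsub>A\<^esub> b \<otimes>\<^bsub>A\<^esub> f \<oplus>\<^bsub>A\<^esub> g \<otimes>\<^bsub>A\<^esub> g \<and>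
      (\<forall>a\<in>carrier A. \<forall>c. cpos A c \<and> b = a \<otimes>\<^bsub>A\<^esub> star A a \<oplus>\<^bsub>A\<^esub> c \<longrightarrow>
        (cdist A (b \<otimes>\<^bsub>A\<^esub> f \<otimes>\<^bsub>A\<^esub> a) a)\<^sup>2 \<le> s))) \<and>
    (\<forall>a::nat \<Rightarrow> 'a. (\<forall>n. cpos A (a n) \<and> nrm A (a n) \<le> 1) \<longrightarrow>
      (\<exists>s. cpos A s \<and> (\<forall>n. \<exists>c. cpos A c \<and> s = complex_of_real ((1/2) ^ n) \<odot>\<^bsub>A\<^esub> a n \<oplus>\<^bsub>A\<^esub> c))) \<and>
    (\<forall>a\<in>carrier A. \<exists>p q r s. cpos A p \<and> cpos A q \<and> cpos A r \<and> cpos A s \<and>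
      a = p \<oplus>\<^bsub>A\<^esub> (-1) \<odot>\<^bsub>A\<^esub> q \<oplus>\<^bsub>A\<^esub> \<i> \<odot>\<^bsub>A\<^esub> r \<oplus>\<^bsub>A\<^esub> (-\<i>) \<odot>\<^bsub>A\<^esub> s)"

text \<open>The default value in the choice below has to be a C*-algebra on an arbitrary type.\<close>

definition trivial_cstar :: "'a cstar" where
  "trivial_cstar = \<lparr>carrier = {undefined}, mult = \<lambda>_ _. undefined, one = undefined, zero = undefined,
     add = \<lambda>_ _. undefined, smult = \<lambda>_ _. undefined, star = \<lambda>_. undefined, nrm = \<lambda>_. 0\<rparr>"

lemma trivial_cstar: "cstar_algebra trivial_cstar"
proof -
  have m: "module complex_ring (trivial_cstar :: 'a cstar)"
    by (rule moduleI)
      (auto intro!: abelian_groupI cring_class simp: trivial_cstar_def)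
  have "\<forall>a b. a \<ominus>\<^bsub>trivial_cstar\<^esub> b = (undefined :: 'a)"
    by (simp add: a_minus_def trivial_cstar_def)
  then have ms: "Metric_space (carrier (trivial_cstar :: 'a cstar)) (cdist trivial_cstar)"
    by unfold_locales (auto simp: cdist_def trivial_cstar_def)
  have "Metric_space.mcomplete (carrier (trivial_cstar :: 'a cstar)) (cdist trivial_cstar)"
    unfolding Metric_space.mcomplete_def[OF ms]
  proof (intro allI impI)
    fix \<sigma> :: "nat \<Rightarrow> 'a" assume "Metric_space.MCauchy (carrier trivial_cstar) (cdist trivial_cstar) \<sigma>"
    then have r: "range \<sigma> \<subseteq> carrier trivial_cstar" by (simp add: Metric_space.MCauchy_def[OF ms])
    then have "\<sigma> n = undefined" for n by (auto simp: trivial_cstar_def)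
    then show "\<exists>x. limitin (Metric_space.mtopology (carrier trivial_cstar) (cdist trivial_cstar)) \<sigma> x sequentially"
      unfolding Metric_space.limit_metric_sequentially[OF ms] using r Metric_space.mdist_zero[OF ms]
      by (intro exI[of _ undefined]) (auto simp: trivial_cstar_def)
  qed
  then show ?thesis
    by (intro cstar_algebra.intro m cstar_algebra_axioms.intro) (simp_all add: trivial_cstar_def)
qed

text \<open>An algebra that violates one of these facts, if there is any.  All that is known about it is that it
  is a C*-algebra, so what is proved about it holds for every C*-algebra on its type.  Its carrier
  defines a type, which makes the type classes of normed algebras available.\<close>

definition worst_cstar :: "'a cstar" where
  "worst_cstar = (if \<exists>A::'a cstar. cstar_algebra A \<and> \<not> order_facts A
     then SOME A. cstar_algebra A \<and> \<not> order_facts A else trivial_cstar)"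

lemma worst_cstar: "cstar_algebra (worst_cstar :: 'a cstar)"
proof (cases "\<exists>A::'a cstar. cstar_algebra A \<and> \<not> order_facts A")
  case True
  then show ?thesis using someI_ex[OF True] by (simp add: worst_cstar_def)
qed (auto simp: worst_cstar_def trivial_cstar)

text \<open>If the chosen algebra satisfies the facts, there was no counterexample to choose.\<close>

lemma order_facts_of_worst:
  assumes "order_facts (worst_cstar :: 'a cstar)" "cstar_algebra (A :: 'a cstar)"
  shows "order_facts A"
proof (rule ccontr)
  assume "\<not> order_facts A"
  then have ex: "\<exists>A::'a cstar. cstar_algebra A \<and> \<not> order_facts A" using assms(2) by blast
  then have "\<not> order_facts (worst_cstar :: 'a cstar)"
    using someI_ex[OF ex] by (simp add: worst_cstar_def)
  with assms(1) show False by simp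
qed

interpretation W: cstar_algebra worst_cstar by (rule worst_cstar)

typedef 'a elt = "carrier (worst_cstar :: 'a cstar)"
  by (rule exI[of _ "\<zero>\<^bsub>worst_cstar\<^esub>"]) simp

setup_lifting type_definition_elt

instantiation elt :: (type) real_normed_vector
begin

lift_definition zero_elt :: "'a elt" is "\<zero>\<^bsub>worst_cstar\<^esub>" by simp
lift_definition plus_elt :: "'a elt \<Rightarrow> 'a elt \<Rightarrow> 'a elt" is "(\<oplus>\<^bsub>worst_cstar\<^esub>)" by simp
lift_definition uminus_elt :: "'a elt \<Rightarrow> 'a elt" is "\<lambda>x. (-1) \<odot>\<^bsub>worst_cstar\<^esub> x" by simp
lift_definition minus_elt :: "'a elt \<Rightarrow> 'a elt \<Rightarrow> 'a elt" is
  "\<lambda>x y. x \<oplus>\<^bsub>worst_cstar\<^esub> (-1) \<odot>\<^bsub>worst_cstar\<^esub> y" by simp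
lift_definition scaleR_elt :: "real \<Rightarrow> 'a elt \<Rightarrow> 'a elt" is
  "\<lambda>r x. complex_of_real r \<odot>\<^bsub>worst_cstar\<^esub> x" by simp
lift_definition norm_elt :: "'a elt \<Rightarrow> real" is "nrm worst_cstar" .

definition dist_elt :: "'a elt \<Rightarrow> 'a elt \<Rightarrow> real" where "dist_elt x y = norm (x - y)"
definition sgn_elt :: "'a elt \<Rightarrow> 'a elt" where "sgn_elt x = scaleR (inverse (norm x)) x"
definition uniformity_elt :: "('a elt \<times> 'a elt) filter" where
  "uniformity_elt = (INF e\<in>{0<..}. principal {(x, y). dist x y < e})"
definition open_elt :: "'a elt set \<Rightarrow> bool" where
  "open_elt U \<longleftrightarrow> (\<forall>x\<in>U. eventually (\<lambda>(x', y). x' = x \<longrightarrow> y \<in> U) uniformity)"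

instance
proof
  fix x y z :: "'a elt" and r s :: real
  show "x + y + z = x + (y + z)" by transfer (rule W.a_assoc)
  show "x + y = y + x" by transfer (rule W.a_comm)
  show "0 + x = x" by transfer simp
  show "- x + x = 0" by transfer (simp add: W.cm.csmult_m1 W.l_neg)
  show "x - y = x + - y" by transfer simp
  show "r *\<^sub>R (x + y) = r *\<^sub>R x + r *\<^sub>R y" by transfer (simp add: W.cm.csmult_r_distr)
  show "(r + s) *\<^sub>R x = r *\<^sub>R x + s *\<^sub>R x" by transfer (simp add: W.cm.csmult_l_distr)
  show "r *\<^sub>R s *\<^sub>R x = (r * s) *\<^sub>R x" by transfer (simp add: W.cm.csmult_assoc)
  show "1 *\<^sub>R x = x" by transfer simp
  show "norm x = 0 \<longleftrightarrow> x = 0" by transfer (rule W.nrm_eq_zero_iff)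
  show "norm (x + y) \<le> norm x + norm y" by transfer (rule W.nrm_add)
  show "norm (r *\<^sub>R x) = \<bar>r\<bar> * norm x" by transfer (simp add: W.nrm_smult)
qed (simp_all add: dist_elt_def sgn_elt_def uniformity_elt_def open_elt_def)

end

instantiation elt :: (type) real_normed_algebra
begin

lift_definition times_elt :: "'a elt \<Rightarrow> 'a elt \<Rightarrow> 'a elt" is "(\<otimes>\<^bsub>worst_cstar\<^esub>)"
  by (rule W.mult_closed)

instance
proof
  fix x y z :: "'a elt" and r :: real
  show "x * y * z = x * (y * z)" by transfer (rule W.mult_assoc)
  show "(x + y) * z = x * z + y * z" by transfer (rule W.distr_left)
  show "x * (y + z) = x * y + x * z" by transfer (rule W.distr_right)
  show "r *\<^sub>R x * y = r *\<^sub>R (x * y)" by transfer (rule W.smult_mult_left)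
  show "x * r *\<^sub>R y = r *\<^sub>R (x * y)" by transfer (rule W.smult_mult_right)
  show "norm (x * y) \<le> norm x * norm y" by transfer (rule W.nrm_mult)
qed

end

lift_definition cscale :: "complex \<Rightarrow> 'a elt \<Rightarrow> 'a elt" is "(\<odot>\<^bsub>worst_cstar\<^esub>)" by simp
lift_definition estar :: "'a elt \<Rightarrow> 'a elt" is "star worst_cstar" by (rule W.star_closed)

lemma cscale_simps:
  "cscale z (x + y) = cscale z x + cscale z y" "cscale (z + w) x = cscale z x + cscale w x"
  "cscale z (cscale w x) = cscale (z * w) x" "cscale z x * y = cscale z (x * y)"
  "x * cscale z y = cscale z (x * y)" "cscale 1 x = x" "cscale z 0 = 0" "cscale 0 x = 0"
  "norm (cscale z x) = cmod z * norm x"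
  "cscale z (r *\<^sub>R x) = r *\<^sub>R cscale z x" "cscale (of_real r) x = r *\<^sub>R x"
  by (transfer; simp add: W.cm.csmult_r_distr W.cm.csmult_l_distr W.cm.csmult_assoc W.smult_mult_left
      W.smult_mult_right W.nrm_smult mult.commute)+

lemma cscale_minus: "cscale (- z) x = - cscale z x"
  using cscale_simps(2)[of z "- z" x] by (simp add: cscale_simps eq_neg_iff_add_eq_0 add.commute)

lemma cscale_diff: "cscale z (x - y) = cscale z x - cscale z y" "cscale (z - w) x = cscale z x - cscale w x"
  using cscale_simps(1)[of z "x - y" y] cscale_simps(2)[of "z - w" w x] by (simp_all add: eq_diff_eq)

lemma cscale_scaleR: "cscale (r *\<^sub>R z) x = r *\<^sub>R cscale z x"
  by (simp add: scaleR_conv_of_real cscale_simps flip: cscale_simps(11))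

lemma estar_simps:
  "estar (estar x) = x" "estar (x + y) = estar x + estar y" "estar (cscale z x) = cscale (cnj z) (estar x)"
  "estar (x * y) = estar y * estar x" "estar (r *\<^sub>R x) = r *\<^sub>R estar x"
  by (transfer; simp add: W.star_star W.star_add W.star_smult W.star_mult)+

lemma norm_estar_mult: "norm (estar x * x) = (norm x)\<^sup>2"
  by transfer (rule W.cstar_identity)

lemma norm_estar: "norm (estar x) = norm x"
proof -
  have "norm y \<le> norm (estar y)" for y :: "'a elt"
    using norm_estar_mult[of y] norm_mult_ineq[of "estar y" y]
    by (cases "norm y = 0") (auto simp: power2_eq_square)
  from this[of x] this[of "estar x"] show ?thesis by (simp add: estar_simps)
qed

instance elt :: (type) banach
proof
  fix X :: "nat \<Rightarrow> 'a elt" assume "Cauchy X"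
  have d: "dist x y = cdist worst_cstar (Rep_elt x) (Rep_elt y)" for x y :: "'a elt"
    using Rep_elt[of x] Rep_elt[of y] by (simp add: dist_elt_def norm_elt.rep_eq minus_elt.rep_eq W.cdist_eq)
  have "Metric_space.MCauchy (carrier worst_cstar) (cdist worst_cstar) (\<lambda>n. Rep_elt (X n))"
    unfolding Metric_space.MCauchy_def[OF W.metric]
    using \<open>Cauchy X\<close> Rep_elt by (auto simp: Cauchy_def d)
  then obtain x where "limitin (Metric_space.mtopology (carrier worst_cstar) (cdist worst_cstar))
      (\<lambda>n. Rep_elt (X n)) x sequentially"
    using W.complete unfolding Metric_space.mcomplete_def[OF W.metric] by blast
  then have x: "x \<in> carrier worst_cstar"
    "\<forall>\<epsilon>>0. \<exists>N. \<forall>n\<ge>N. cdist worst_cstar (Rep_elt (X n)) x < \<epsilon>"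
    unfolding Metric_space.limit_metric_sequentially[OF W.metric] by meson+
  then have "X \<longlonglongrightarrow> Abs_elt x"
    unfolding lim_sequentially d by (simp add: Abs_elt_inverse)
  then show "convergent X" by (rule convergentI)
qed

text \<open>The unitization.  The norm is the larger one of two C*-seminorms, the operator norm on the algebra
  and the absolute value of the scalar part; the latter makes it definite also if there was a unit
  before.\<close>

datatype 'a unitized = Unitized (scal: complex) (elem: "'a elt")

lemma unitized_eqI: "scal x = scal y \<Longrightarrow> elem x = elem y \<Longrightarrow> x = y"
  by (rule unitized.expand) simp

definition lmult :: "'a unitized \<Rightarrow> 'a elt \<Rightarrow> 'a elt" where
  "lmult x y = cscale (scal x) y + elem x * y"

lemma bounded_linear_lmult: "bounded_linear (lmult x)"
proof (rule bounded_linear_intro)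
  fix y :: "'a elt"
  have "norm (lmult x y) \<le> cmod (scal x) * norm y + norm (elem x) * norm y"
    unfolding lmult_def by (rule norm_triangle_mono) (simp_all add: cscale_simps norm_mult_ineq)
  then show "norm (lmult x y) \<le> norm y * (cmod (scal x) + norm (elem x))" by (simp add: algebra_simps)
qed (simp_all add: lmult_def cscale_simps algebra_simps)

instantiation unitized :: (type) real_normed_algebra_1
begin

definition zero_unitized :: "'a unitized" where "zero_unitized = Unitized 0 0"
definition one_unitized :: "'a unitized" where "one_unitized = Unitized 1 0"
definition plus_unitized :: "'a unitized \<Rightarrow> 'a unitized \<Rightarrow> 'a unitized" where
  "plus_unitized x y = Unitized (scal x + scal y) (elem x + elem y)"
definition uminus_unitized :: "'a unitized \<Rightarrow> 'a unitized" where
  "uminus_unitized x = Unitized (- scal x) (- elem x)"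
definition minus_unitized :: "'a unitized \<Rightarrow> 'a unitized \<Rightarrow> 'a unitized" where
  "minus_unitized x y = Unitized (scal x - scal y) (elem x - elem y)"
definition scaleR_unitized :: "real \<Rightarrow> 'a unitized \<Rightarrow> 'a unitized" where
  "scaleR_unitized r x = Unitized (r *\<^sub>R scal x) (r *\<^sub>R elem x)"
definition times_unitized :: "'a unitized \<Rightarrow> 'a unitized \<Rightarrow> 'a unitized" where
  "times_unitized x y = Unitized (scal x * scal y)
     (cscale (scal x) (elem y) + cscale (scal y) (elem x) + elem x * elem y)"
definition norm_unitized :: "'a unitized \<Rightarrow> real" where
  "norm_unitized x = max (cmod (scal x)) (onorm (lmult x))"
definition dist_unitized :: "'a unitized \<Rightarrow> 'a unitized \<Rightarrow> real" where "dist_unitized x y = norm (x - y)"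
definition sgn_unitized :: "'a unitized \<Rightarrow> 'a unitized" where "sgn_unitized x = scaleR (inverse (norm x)) x"
definition uniformity_unitized :: "('a unitized \<times> 'a unitized) filter" where
  "uniformity_unitized = (INF e\<in>{0<..}. principal {(x, y). dist x y < e})"
definition open_unitized :: "'a unitized set \<Rightarrow> bool" where
  "open_unitized U \<longleftrightarrow> (\<forall>x\<in>U. eventually (\<lambda>(x', y). x' = x \<longrightarrow> y \<in> U) uniformity)"

lemmas unitized_simps = zero_unitized_def one_unitized_def plus_unitized_def uminus_unitized_def
  minus_unitized_def scaleR_unitized_def times_unitized_def

lemma lmult_simps:
  "lmult (x + y) v = lmult x v + lmult y v" "lmult (r *\<^sub>R x) v = r *\<^sub>R lmult x v"
  "lmult (x * y) v = lmult x (lmult y v)" "lmult 1 v = v"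
  by (simp_all add: lmult_def unitized_simps cscale_simps cscale_scaleR algebra_simps)

lemma lmult_le: "norm (lmult x v) \<le> onorm (lmult x) * norm v"
  by (rule onorm[OF bounded_linear_lmult])

lemma onorm_lmult_leI: "0 \<le> b \<Longrightarrow> (\<And>v. norm (lmult x v) \<le> b * norm v) \<Longrightarrow> onorm (lmult x) \<le> b"
  by (rule onorm_bound)

lemma onorm_lmult_nonneg: "0 \<le> onorm (lmult x)"
  by (rule onorm_pos_le[OF bounded_linear_lmult])

instance
proof
  fix x y z :: "'a unitized" and r s :: real
  show "x + y + z = x + (y + z)" "x + y = y + x" "0 + x = x" "- x + x = 0" "x - y = x + - y"
    "r *\<^sub>R (x + y) = r *\<^sub>R x + r *\<^sub>R y" "(r + s) *\<^sub>R x = r *\<^sub>R x + s *\<^sub>R x"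
    "r *\<^sub>R s *\<^sub>R x = (r * s) *\<^sub>R x" "1 *\<^sub>R x = x" "(0::'a unitized) \<noteq> 1"
    by (simp_all add: unitized_simps algebra_simps)
  show "x * y * z = x * (y * z)" "(x + y) * z = x * z + y * z" "x * (y + z) = x * y + x * z"
    "1 * x = x" "x * 1 = x" "r *\<^sub>R x * y = r *\<^sub>R (x * y)" "x * r *\<^sub>R y = r *\<^sub>R (x * y)"
    by (simp_all add: unitized_simps cscale_simps cscale_scaleR algebra_simps)
  show "norm x = 0 \<longleftrightarrow> x = 0"
  proof
    assume "norm x = 0"
    then have *: "cmod (scal x) \<le> 0" "onorm (lmult x) \<le> 0"
      unfolding norm_unitized_def by (metis max.cobounded1, metis max.cobounded2)
    then have 0: "scal x = 0" and "onorm (lmult x) = 0"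
      using onorm_lmult_nonneg[of x] by auto
    then have "norm (lmult x (estar (elem x))) \<le> 0" using lmult_le[of x "estar (elem x)"] by simp
    then have "norm (estar (elem x)) ^ 2 = 0"
      using norm_estar_mult[of "estar (elem x)"] using 0 by (simp add: lmult_def cscale_simps estar_simps)
    then show "x = 0" using 0 by (intro unitized_eqI) (simp_all add: norm_estar zero_unitized_def)
  next
    assume "x = 0"
    then have "lmult x = (\<lambda>_. 0)" by (auto simp: lmult_def zero_unitized_def cscale_simps)
    then show "norm x = 0" using \<open>x = 0\<close> by (simp add: norm_unitized_def onorm_zero zero_unitized_def)
  qed
  show "norm (x + y) \<le> norm x + norm y"
  proof -
    have "onorm (lmult (x + y)) \<le> onorm (lmult x) + onorm (lmult y)"
      using onorm_triangle[OF bounded_linear_lmult bounded_linear_lmult, of x y]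
      by (simp add: lmult_simps[abs_def])
    moreover have "cmod (scal (x + y)) \<le> cmod (scal x) + cmod (scal y)"
      by (simp add: plus_unitized_def norm_triangle_ineq)
    ultimately show ?thesis unfolding norm_unitized_def by linarith
  qed
  show "norm (r *\<^sub>R x) = \<bar>r\<bar> * norm x"
    using onorm_scaleR[OF bounded_linear_lmult, of r x]
    by (simp add: norm_unitized_def lmult_simps[abs_def] max_mult_distrib_left)
      (simp add: scaleR_unitized_def)
  show "norm (x * y) \<le> norm x * norm y"
  proof -
    have "onorm (lmult (x * y)) \<le> onorm (lmult x) * onorm (lmult y)"
      using onorm_compose[OF bounded_linear_lmult bounded_linear_lmult, of x y]
      by (simp add: lmult_simps[abs_def] o_def)
    also have "\<dots> \<le> norm x * norm y"
      by (intro mult_mono) (auto simp: norm_unitized_def onorm_lmult_nonneg le_max_iff_disj)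
    finally have "onorm (lmult (x * y)) \<le> norm x * norm y" .
    moreover have "cmod (scal (x * y)) \<le> norm x * norm y"
      by (simp add: times_unitized_def norm_mult norm_unitized_def mult_mono le_max_iff_disj)
    ultimately show ?thesis by (simp add: norm_unitized_def[of "x * y"])
  qed
  show "norm (1::'a unitized) = 1"
  proof -
    have "onorm (lmult (1::'a unitized)) \<le> 1" by (rule onorm_lmult_leI) (simp_all add: lmult_simps)
    then show ?thesis by (simp add: norm_unitized_def one_unitized_def)
  qed
qed (simp_all add: dist_unitized_def sgn_unitized_def uniformity_unitized_def open_unitized_def)

end

lemma scal_simps [simp]:
  "scal (x + y) = scal x + scal y" "scal (x - y) = scal x - scal y" "scal (x * y) = scal x * scal y"
  "scal (- x) = - scal x" "scal 0 = 0" "scal 1 = 1" "scal (r *\<^sub>R x) = r *\<^sub>R scal x"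
  by (simp_all add: unitized_simps)

lemma norm_unitized_bounds: "cmod (scal x) \<le> norm x" "onorm (lmult x) \<le> norm x"
  by (simp_all add: norm_unitized_def)

lemma norm_elem_le: "norm (Unitized 0 a) = norm (a :: 'a elt)"
proof (rule antisym)
  have "onorm (lmult (Unitized 0 a)) \<le> norm a"
    by (rule onorm_lmult_leI) (simp_all add: lmult_def cscale_simps norm_mult_ineq)
  then show "norm (Unitized 0 a) \<le> norm a" by (simp add: norm_unitized_def)
  have "norm (a * estar a) \<le> onorm (lmult (Unitized 0 a)) * norm a"
    using lmult_le[of "Unitized 0 a" "estar a"] by (simp add: lmult_def cscale_simps norm_estar)
  also have "\<dots> \<le> norm (Unitized 0 a) * norm a"
    by (intro mult_right_mono norm_unitized_bounds) simp
  finally have "norm a ^ 2 \<le> norm (Unitized 0 a) * norm a"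
    using norm_estar_mult[of "estar a"] by (simp add: estar_simps norm_estar)
  then show "norm a \<le> norm (Unitized 0 a)"
    by (cases "norm a = 0") (auto simp: power2_eq_square)
qed

instance unitized :: (type) banach
proof
  fix X :: "nat \<Rightarrow> 'a unitized" assume C: "Cauchy X"
  have bl: "bounded_linear (scal :: 'a unitized \<Rightarrow> complex)"
    by (rule bounded_linear_intro[of _ 1]) (simp_all add: norm_unitized_bounds)
  have e: "Unitized 0 (elem x) = x - Unitized (scal x) 0" for x :: "'a unitized"
    by (simp add: minus_unitized_def)
  have nz: "norm (Unitized z 0 :: 'a unitized) \<le> cmod z" for z
  proof -
    have "onorm (lmult (Unitized z 0 :: 'a unitized)) \<le> cmod z"
      by (rule onorm_lmult_leI) (simp_all add: lmult_def cscale_simps)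
    then show ?thesis by (simp add: norm_unitized_def)
  qed
  have "norm (elem x) \<le> norm x * 2" for x :: "'a unitized"
    using norm_triangle_ineq4[of x "Unitized (scal x) 0"] nz[of "scal x"] norm_unitized_bounds(1)[of x]
    unfolding e[symmetric] norm_elem_le by linarith
  then have bl2: "bounded_linear (elem :: 'a unitized \<Rightarrow> 'a elt)"
    by (intro bounded_linear_intro[of _ 2]) (simp_all add: unitized_simps)
  have "convergent (\<lambda>n. scal (X n))" "convergent (\<lambda>n. elem (X n))"
    using bounded_linear.Cauchy[OF bl C] bounded_linear.Cauchy[OF bl2 C]
    by (auto simp: Cauchy_convergent_iff)
  then obtain z a where z: "(\<lambda>n. scal (X n)) \<longlonglongrightarrow> z" and a: "(\<lambda>n. elem (X n)) \<longlonglongrightarrow> a"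
    by (auto simp: convergent_def)
  have "(\<lambda>n. norm (X n - Unitized z a)) \<longlonglongrightarrow> 0"
  proof (rule Lim_null_comparison)
    show "eventually (\<lambda>n. norm (norm (X n - Unitized z a))
        \<le> cmod (scal (X n) - z) + norm (elem (X n) - a)) sequentially"
    proof (rule always_eventually, rule allI)
      fix n
      have "X n - Unitized z a = Unitized (scal (X n) - z) 0 + Unitized 0 (elem (X n) - a)"
        by (simp add: unitized_simps)
      then show "norm (norm (X n - Unitized z a)) \<le> cmod (scal (X n) - z) + norm (elem (X n) - a)"
        using norm_triangle_ineq[of "Unitized (scal (X n) - z) 0" "Unitized 0 (elem (X n) - a)"]
          nz[of "scal (X n) - z"] by (simp add: norm_elem_le)
    qed
    have "(\<lambda>n. cmod (scal (X n) - z) + norm (elem (X n) - a)) \<longlonglongrightarrow> cmod (z - z) + norm (a - a)"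
      by (intro tendsto_intros z a)
    then show "(\<lambda>n. cmod (scal (X n) - z) + norm (elem (X n) - a)) \<longlonglongrightarrow> 0" by simp
  qed
  then have "X \<longlonglongrightarrow> Unitized z a" using LIM_zero_iff tendsto_norm_zero_iff by blast
  then show "convergent X" by (rule convergentI)
qed

instantiation unitized :: (type) unital_cstar
begin

definition adj_unitized :: "'a unitized \<Rightarrow> 'a unitized" where
  "adj_unitized x = Unitized (cnj (scal x)) (estar (elem x))"
definition im_unitized :: "'a unitized" where "im_unitized = Unitized \<i> 0"

instance
proof
  fix x y :: "'a unitized" and r :: real
  show "adj (adj x) = x" "adj (x + y) = adj x + adj y" "adj (r *\<^sub>R x) = r *\<^sub>R adj x"
    "adj (x * y) = adj y * adj x"
    by (simp_all add: adj_unitized_def unitized_simps estar_simps algebra_simps)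
  have e0: "estar 0 = (0 :: 'a elt)" using estar_simps(5)[of 0 0] by simp
  show "im * x = x * im" "(im :: 'a unitized) * im = - 1" "adj (im :: 'a unitized) = - im"
    by (simp_all add: adj_unitized_def im_unitized_def unitized_simps cscale_simps e0)
  have le: "(onorm (lmult x))\<^sup>2 \<le> onorm (lmult (adj x * x))" for x :: "'a unitized"
  proof -
    have "norm (lmult x v) \<le> sqrt (onorm (lmult (adj x * x))) * norm v" for v
    proof -
      have "estar (lmult x v) * lmult x v = estar v * lmult (adj x * x) v"
        by (simp add: lmult_simps) (simp add: lmult_def adj_unitized_def estar_simps cscale_simps algebra_simps)
      then have "norm (lmult x v) ^ 2 = norm (estar v * lmult (adj x * x) v)"
        using norm_estar_mult[of "lmult x v"] by simp
      also have "\<dots> \<le> norm (estar v) * norm (lmult (adj x * x) v)" by (rule norm_mult_ineq)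
      also have "\<dots> \<le> norm v * (onorm (lmult (adj x * x)) * norm v)"
        unfolding norm_estar by (intro mult_left_mono lmult_le) simp
      also have "\<dots> = (sqrt (onorm (lmult (adj x * x))) * norm v) ^ 2"
        by (simp add: power_mult_distrib onorm_lmult_nonneg power2_eq_square)
      finally show ?thesis by (rule power2_le_imp_le) (simp add: onorm_lmult_nonneg)
    qed
    then have "onorm (lmult x) \<le> sqrt (onorm (lmult (adj x * x)))"
      by (intro onorm_lmult_leI) (simp_all add: onorm_lmult_nonneg)
    then show ?thesis
      using power_mono[OF _ onorm_lmult_nonneg, of x "sqrt (onorm (lmult (adj x * x)))" 2]
      by (simp add: onorm_lmult_nonneg)
  qed
  have mult: "onorm (lmult (adj x * x)) \<le> onorm (lmult (adj x)) * onorm (lmult x)" for x :: "'a unitized"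
    using onorm_compose[OF bounded_linear_lmult bounded_linear_lmult, of "adj x" x]
    by (simp add: lmult_simps[abs_def] o_def)
  have inv: "adj (adj z) = z" for z :: "'a unitized" by (simp add: adj_unitized_def estar_simps)
  have le2: "onorm (lmult x) \<le> onorm (lmult (adj x))" for x :: "'a unitized"
    using order_trans[OF le mult, of x] onorm_lmult_nonneg[of x] onorm_lmult_nonneg[of "adj x"]
    by (cases "onorm (lmult x) = 0") (auto simp: power2_eq_square)
  have "onorm (lmult (adj x)) = onorm (lmult x)" using le2[of x] le2[of "adj x"] by (simp add: inv)
  then have "onorm (lmult (adj x * x)) = (onorm (lmult x))\<^sup>2"
    using le[of x] mult[of x] by (simp add: power2_eq_square)
  moreover have "max (a\<^sup>2) (b\<^sup>2) = (max a b)\<^sup>2" if "0 \<le> a" "0 \<le> b" for a b :: real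
    using that power_mono[of a b 2] power_mono[of b a 2] by (auto simp: max_def)
  moreover have "cmod (scal (adj x * x)) = (cmod (scal x))\<^sup>2"
    by (simp add: adj_unitized_def norm_mult power2_eq_square)
  ultimately show "norm (adj x * x) = norm x ^ 2"
    unfolding norm_unitized_def using norm_ge_zero[of "scal x"] onorm_lmult_nonneg[of x] by presburger
qed

end

subsection \<open>Transfer to arbitrary C*-algebras\<close>

definition emb :: "'a elt \<Rightarrow> 'a unitized" where "emb a = Unitized 0 a"

lemma emb_simps:
  "emb (x + y) = emb x + emb y" "emb (x - y) = emb x - emb y" "emb (x * y) = emb x * emb y"
  "emb (- x) = - emb x" "emb (r *\<^sub>R x) = r *\<^sub>R emb x" "emb (estar x) = adj (emb x)" "norm (emb x) = norm x"
  "scal (emb x) = 0" "emb x = emb y \<longleftrightarrow> x = y"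
  by (simp_all add: emb_def unitized_simps adj_unitized_def cscale_simps norm_elem_le)

lemma emb_elem: "scal x = 0 \<Longrightarrow> emb (elem x) = x"
  by (cases x) (simp add: emb_def)

definition epos :: "'a elt \<Rightarrow> bool" where "epos a \<longleftrightarrow> pos (emb a)"

text \<open>The square root of an element without scalar part has no scalar part either, so positivity in the
  unitization coincides with positivity in the algebra.\<close>

lemma epos_iff: "epos a \<longleftrightarrow> (\<exists>b. a = estar b * b)"
proof
  assume "epos a"
  then obtain k where k: "pos k" "k * k = emb a" unfolding epos_def using pos_sqrt by metis
  have "scal k * scal k = 0" using arg_cong[OF k(2), of scal] by (simp add: emb_simps)
  then have k0: "emb (elem k) = k" by (simp add: emb_elem)
  have "adj k = k" using k(1) by (rule pos_adj)
  then have "emb a = emb (estar (elem k) * elem k)" by (simp add: emb_simps k0 k(2))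
  then show "\<exists>b. a = estar b * b" by (auto simp: emb_simps(9))
qed (auto simp: epos_def emb_simps pos_adj_mult)

lemma epos_closed:
  assumes "f \<longlonglongrightarrow> a" "\<And>n. epos (f n)" shows "epos a"
proof -
  have "(\<lambda>n. norm (emb (f n) - emb a)) \<longlonglongrightarrow> 0"
    using assms(1) by (simp add: emb_simps(7) LIM_zero_iff tendsto_norm_zero_iff flip: emb_simps(2))
  then have "(\<lambda>n. emb (f n)) \<longlonglongrightarrow> emb a" using LIM_zero_iff tendsto_norm_zero_iff by blast
  then show ?thesis using assms(2) unfolding epos_def by (rule pos_closed)
qed

text \<open>The bound on \<open>bfa - a\<close> follows from \<open>aa* \<le> b\<close> by conjugation with \<open>1 - bf\<close>.  The elements \<open>f\<close> and \<open>g\<close>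
  have no scalar part, so they lie in the algebra itself.\<close>

lemma epos_local_unit:
  assumes "epos b" "s > 0"
  shows "\<exists>f g. estar f = f \<and> estar g = g \<and> b * f = f * b \<and> epos (b * f) \<and> norm (b * f) \<le> 1 \<and>
    f = f * b * f + g * g \<and>
    (\<forall>a c. epos c \<and> b = a * estar a + c \<longrightarrow> (dist (b * f * a) a)\<^sup>2 \<le> s)"
proof -
  obtain f r g where f: "f = emb b * r" "adj f = f" "emb b * f = f * emb b" "pos (emb b * f)"
    "norm (emb b * f) \<le> 1" "adj g = g" "g * g = f - f * emb b * f"
    "norm ((1 - emb b * f) * emb b * (1 - emb b * f)) \<le> s"
    using local_unit[of "emb b" s] assms unfolding epos_def by metis
  have "scal f = 0" by (simp add: f(1) emb_simps)
  moreover have "scal g * scal g = 0" using arg_cong[OF f(7), of scal] \<open>scal f = 0\<close> by (simp add: emb_simps)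
  ultimately obtain f' g' where eq: "f = emb f'" "g = emb g'" by (metis emb_elem mult_eq_0_iff)
  have small: "(dist (b * f' * a) a)\<^sup>2 \<le> s" if c: "epos c" and b: "b = a * estar a + c" for a c
  proof -
    let ?u = "1 - emb b * f"
    have au: "adj ?u = ?u" using f(4) by (simp add: adj_diff pos_adj)
    have "?u * emb b * ?u = (?u * emb a) * adj (?u * emb a) + adj ?u * emb c * ?u"
      by (simp only: adj_mult au) (simp add: b emb_simps algebra_simps)
    moreover have "pos (adj ?u * emb c * ?u)" using c by (intro pos_conjugate) (simp add: epos_def)
    moreover have "pos ((?u * emb a) * adj (?u * emb a))" using pos_adj_mult[of "adj (?u * emb a)"] by simp
    ultimately have "norm ((?u * emb a) * adj (?u * emb a)) \<le> s"
      using norm_mono[of "(?u * emb a) * adj (?u * emb a)" "?u * emb b * ?u"] f(8) by simp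
    then have "norm (?u * emb a) ^ 2 \<le> s" by (simp only: norm_mult_adj)
    moreover have "?u * emb a = - emb (b * f' * a - a)" by (simp add: emb_simps eq algebra_simps)
    ultimately show ?thesis by (simp only: norm_minus_cancel emb_simps(7) dist_norm)
  qed
  have "emb f' = emb (f' * b * f' + g' * g')" using f(7) by (simp add: emb_simps eq)
  then have "f' = f' * b * f' + g' * g'" by (simp only: emb_simps(9))
  moreover have "estar f' = f'" "estar g' = g'" "b * f' = f' * b"
    using f(2,6,3) by (simp_all only: eq emb_simps(9) flip: emb_simps(3,6))
  ultimately show ?thesis using f(4,5) small
    by (intro exI[of _ f'] exI[of _ g']) (auto simp: eq epos_def simp flip: emb_simps(3,7))
qed

lemma epos_decomposition:
  "\<exists>p q r s. epos p \<and> epos q \<and> epos r \<and> epos s \<and>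
    a = p + cscale (-1) q + cscale \<i> r + cscale (- \<i>) s"
proof -
  have sa: "\<exists>p q. epos p \<and> epos q \<and> h = p - q" if h: "estar h = h" for h :: "'a elt"
  proof -
    have "adj (emb h) = emb h" using h by (simp flip: emb_simps(6))
    then obtain m where m: "pos (m + emb h)" "pos (m - emb h)" "m * m = emb h * emb h"
      using selfadjoint_decomposition by metis
    have "scal m * scal m = 0" using arg_cong[OF m(3), of scal] by (simp add: emb_simps)
    then have "m = emb (elem m)" by (simp add: emb_elem)
    with m(1,2) have "epos (elem m + h)" "epos (elem m - h)" unfolding epos_def emb_simps by metis+
    then have "epos ((1/2) *\<^sub>R (elem m + h))" "epos ((1/2) *\<^sub>R (elem m - h))"
      unfolding epos_def emb_simps(5) by (auto intro: pos_scaleR)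
    moreover have "h = (1/2) *\<^sub>R (elem m + h) - (1/2) *\<^sub>R (elem m - h)"
      by (simp add: algebra_simps flip: scaleR_add_left)
    ultimately show ?thesis by blast
  qed
  define h k where "h = (1/2) *\<^sub>R (a + estar a)" and "k = cscale (- \<i>/2) (a - estar a)"
  have ms: "estar (x - y) = estar x - estar y" for x y :: "'a elt"
    using estar_simps(2)[of "x - y" y] by (simp add: eq_diff_eq)
  have "estar h = h" by (simp add: h_def estar_simps add.commute)
  moreover have "estar k = k"
  proof -
    have "estar k = cscale (\<i>/2) (- (a - estar a))" by (simp add: k_def estar_simps ms)
    also have "\<dots> = k" using cscale_minus[of "\<i>/2" "a - estar a"] by (simp add: k_def cscale_diff)
    finally show ?thesis .
  qed
  ultimately obtain p q r s where e: "epos p" "epos q" "epos r" "epos s" "h = p - q" "k = r - s"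
    using sa by metis
  have "a = h + cscale \<i> k"
    using cscale_simps(11)[of "1/2" "a - estar a"]
    by (simp add: h_def k_def cscale_simps algebra_simps flip: scaleR_add_left)
  then have "a = p + cscale (-1) q + cscale \<i> r + cscale (- \<i>) s"
    by (simp add: e cscale_minus cscale_diff cscale_simps algebra_simps)
  then show ?thesis using e by blast
qed

lemma cpos_worst_iff: "cpos worst_cstar a \<longleftrightarrow> (\<exists>a'. a = Rep_elt a' \<and> epos a')"
proof
  assume "cpos worst_cstar a"
  then obtain b where b: "b \<in> carrier worst_cstar" "a = star worst_cstar b \<otimes>\<^bsub>worst_cstar\<^esub> b"
    by (auto simp: cpos_def)
  then have "a = Rep_elt (estar (Abs_elt b) * Abs_elt b)"
    by (simp add: times_elt.rep_eq estar.rep_eq Abs_elt_inverse)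
  then show "\<exists>a'. a = Rep_elt a' \<and> epos a'" by (auto simp: epos_iff)
next
  assume "\<exists>a'. a = Rep_elt a' \<and> epos a'"
  then obtain b where "a = Rep_elt (estar b * b)" by (auto simp: epos_iff)
  then show "cpos worst_cstar a"
    unfolding cpos_def by (intro bexI[of _ "Rep_elt b"]) (simp_all add: times_elt.rep_eq estar.rep_eq Rep_elt)
qed

lemma cpos_worst_Rep: "cpos worst_cstar (Rep_elt a) \<longleftrightarrow> epos a"
  by (auto simp: cpos_worst_iff Rep_elt_inject)

lemma cdist_worst: "cdist worst_cstar (Rep_elt x) (Rep_elt y) = dist x y"
  using Rep_elt[of x] Rep_elt[of y] by (simp add: dist_elt_def norm_elt.rep_eq minus_elt.rep_eq W.cdist_eq)

lemmas fold_worst = plus_elt.rep_eq[symmetric] times_elt.rep_eq[symmetric] cscale.rep_eq[symmetric]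
  estar.rep_eq[symmetric] norm_elt.rep_eq[symmetric] cdist_worst cpos_worst_Rep Rep_elt_inject Rep_elt

lemma worst_carrierE: "a \<in> carrier worst_cstar \<Longrightarrow> (\<And>a'. a = Rep_elt a' \<Longrightarrow> P) \<Longrightarrow> P"
  by (rule Rep_elt_cases) auto

lemma epos_add: "epos a \<Longrightarrow> epos b \<Longrightarrow> epos (a + b)"
  by (simp add: epos_def emb_simps pos_add)

lemma epos_cauchy_schwarz:
  assumes "t > 0" "epos c" "norm c \<le> t"
    "epos (estar a * c * a + cscale (complex_of_real (- 2 * t)) (estar a * a) + cscale (complex_of_real (t * t)) d)"
  shows "epos (cscale (complex_of_real t) d + cscale (-1) (estar a * a))"
proof -
  have "cscale (-1) x = - x" for x :: "'a elt" using cscale_minus[of 1 x] by (simp add: cscale_simps)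
  moreover have "pos (t *\<^sub>R emb d - adj (emb a) * emb a)"
    using assms by (intro cauchy_schwarz_core[of t "emb c"])
      (simp_all only: epos_def cscale_simps(11) emb_simps scaleR_scaleR scaleR_minus_left diff_conv_add_uminus mult_minus_left)
  ultimately show ?thesis by (simp add: epos_def cscale_simps emb_simps)
qed

lemma epos_weighted_sum:
  fixes a :: "nat \<Rightarrow> 'a elt"
  assumes "\<And>n. epos (a n) \<and> norm (a n) \<le> 1"
  shows "\<exists>s. epos s \<and> (\<forall>n. \<exists>c. epos c \<and> s = cscale (complex_of_real ((1/2) ^ n)) (a n) + c)"
proof -
  have a: "pos (emb (a n))" "norm (emb (a n)) \<le> 1" for n using assms by (auto simp: epos_def emb_simps)
  note w = weighted_sum_upper_bound[of "\<lambda>n. emb (a n)", OF a]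
  define s where "s = (\<Sum>n. (1/2) ^ n *\<^sub>R emb (a n))"
  have bl: "bounded_linear (scal :: 'a unitized \<Rightarrow> complex)"
    by (rule bounded_linear_intro[of _ 1]) (simp_all add: norm_unitized_bounds)
  have "scal s = (\<Sum>n. scal ((1/2) ^ n *\<^sub>R emb (a n)))"
    unfolding s_def by (rule bounded_linear.suminf[OF bl w(1)])
  then have s: "emb (elem s) = s" by (intro emb_elem) (simp add: emb_simps)
  have "epos (elem s)" using w(2) unfolding epos_def s by (simp only: s_def)
  moreover have "epos (elem s - (1/2) ^ n *\<^sub>R a n)" for n
    using w(3)[of n] unfolding epos_def emb_simps s by (simp only: s_def)
  moreover have "elem s = cscale (complex_of_real ((1/2) ^ n)) (a n) + (elem s - (1/2) ^ n *\<^sub>R a n)" for n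
    unfolding cscale_simps(11) by simp
  ultimately show ?thesis by blast
qed

lemma order_facts_worst: "order_facts (worst_cstar :: 'a cstar)"
  unfolding order_facts_def
proof (intro conjI)
  let ?W = "worst_cstar :: 'a cstar"
  show "\<forall>a b. cpos ?W a \<and> cpos ?W b \<longrightarrow> cpos ?W (a \<oplus>\<^bsub>?W\<^esub> b)"
    unfolding cpos_worst_iff by (metis epos_add plus_elt.rep_eq)
  show "\<forall>f a. (\<forall>n::nat. cpos ?W (f n)) \<and> a \<in> carrier ?W \<and> (\<lambda>n. cdist ?W (f n) a) \<longlonglongrightarrow> 0 \<longrightarrow> cpos ?W a"
  proof (intro allI impI, elim conjE)
    fix f :: "nat \<Rightarrow> 'a" and a
    assume f: "\<forall>n. cpos ?W (f n)" and a: "a \<in> carrier ?W" and lim: "(\<lambda>n. cdist ?W (f n) a) \<longlonglongrightarrow> 0"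
    obtain a' where a': "a = Rep_elt a'" using a by (rule worst_carrierE)
    obtain f' where f': "\<And>n. f n = Rep_elt (f' n)" "\<And>n. epos (f' n)"
      using f unfolding cpos_worst_iff by metis
    have "(\<lambda>n. dist (f' n) a') \<longlonglongrightarrow> 0" using lim by (simp add: f' a' cdist_worst)
    then have "f' \<longlonglongrightarrow> a'" by (subst tendsto_dist_iff)
    then show "cpos ?W a" using epos_closed f' by (auto simp: a' cpos_worst_Rep)
  qed
  show "\<forall>a c. cpos ?W a \<and> cpos ?W c \<longrightarrow> nrm ?W a \<le> nrm ?W (a \<oplus>\<^bsub>?W\<^esub> c)"
  proof (intro allI impI)
    fix a c assume "cpos ?W a \<and> cpos ?W c"
    then obtain a' c' where e: "a = Rep_elt a'" "c = Rep_elt c'" "epos a'" "epos c'"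
      unfolding cpos_worst_iff by blast
    have "norm (emb a') \<le> norm (emb (a' + c'))"
      by (rule norm_mono) (use e(3,4) in \<open>simp_all add: epos_def emb_simps(1)\<close>)
    then show "nrm ?W a \<le> nrm ?W (a \<oplus>\<^bsub>?W\<^esub> c)" unfolding e(1,2) fold_worst emb_simps(7) .
  qed
  show "\<forall>a\<in>carrier ?W. \<forall>c\<in>carrier ?W. \<forall>d\<in>carrier ?W. \<forall>t>0. cpos ?W c \<and> nrm ?W c \<le> t \<and>
      cpos ?W (star ?W a \<otimes>\<^bsub>?W\<^esub> c \<otimes>\<^bsub>?W\<^esub> a \<oplus>\<^bsub>?W\<^esub> complex_of_real (- 2 * t) \<odot>\<^bsub>?W\<^esub> (star ?W a \<otimes>\<^bsub>?W\<^esub> a)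
        \<oplus>\<^bsub>?W\<^esub> complex_of_real (t * t) \<odot>\<^bsub>?W\<^esub> d) \<longrightarrow>
      cpos ?W (complex_of_real t \<odot>\<^bsub>?W\<^esub> d \<oplus>\<^bsub>?W\<^esub> (-1) \<odot>\<^bsub>?W\<^esub> (star ?W a \<otimes>\<^bsub>?W\<^esub> a))"
    by (intro ballI allI impI, elim worst_carrierE conjE, hypsubst, unfold fold_worst)
      (rule epos_cauchy_schwarz)
  show "\<forall>b s. cpos ?W b \<and> s > 0 \<longrightarrow> (\<exists>f\<in>carrier ?W. \<exists>g\<in>carrier ?W. star ?W f = f \<and> star ?W g = g \<and>
      b \<otimes>\<^bsub>?W\<^esub> f = f \<otimes>\<^bsub>?W\<^esub> b \<and> cpos ?W (b \<otimes>\<^bsub>?W\<^esub> f) \<and> nrm ?W (b \<otimes>\<^bsub>?W\<^esub> f) \<le> 1 \<and>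
      f = f \<otimes>\<^bsub>?W\<^esub> b \<otimes>\<^bsub>?W\<^esub> f \<oplus>\<^bsub>?W\<^esub> g \<otimes>\<^bsub>?W\<^esub> g \<and>
      (\<forall>a\<in>carrier ?W. \<forall>c. cpos ?W c \<and> b = a \<otimes>\<^bsub>?W\<^esub> star ?W a \<oplus>\<^bsub>?W\<^esub> c \<longrightarrow>
        (cdist ?W (b \<otimes>\<^bsub>?W\<^esub> f \<otimes>\<^bsub>?W\<^esub> a) a)\<^sup>2 \<le> s))"
  proof (intro allI impI, elim conjE)
    fix b and s :: real assume "cpos ?W b" and s: "s > 0"
    then obtain b' where b: "b = Rep_elt b'" "epos b'" by (auto simp: cpos_worst_iff)
    obtain f g where fg: "estar f = f" "estar g = g" "b' * f = f * b'" "epos (b' * f)" "norm (b' * f) \<le> 1"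
      "f = f * b' * f + g * g"
      "\<And>a c. epos c \<Longrightarrow> b' = a * estar a + c \<Longrightarrow> (dist (b' * f * a) a)\<^sup>2 \<le> s"
      using epos_local_unit[OF b(2) s] by metis
    show "\<exists>f\<in>carrier ?W. \<exists>g\<in>carrier ?W. star ?W f = f \<and> star ?W g = g \<and>
      b \<otimes>\<^bsub>?W\<^esub> f = f \<otimes>\<^bsub>?W\<^esub> b \<and> cpos ?W (b \<otimes>\<^bsub>?W\<^esub> f) \<and> nrm ?W (b \<otimes>\<^bsub>?W\<^esub> f) \<le> 1 \<and>
      f = f \<otimes>\<^bsub>?W\<^esub> b \<otimes>\<^bsub>?W\<^esub> f \<oplus>\<^bsub>?W\<^esub> g \<otimes>\<^bsub>?W\<^esub> g \<and>
      (\<forall>a\<in>carrier ?W. \<forall>c. cpos ?W c \<and> b = a \<otimes>\<^bsub>?W\<^esub> star ?W a \<oplus>\<^bsub>?W\<^esub> c \<longrightarrow>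
        (cdist ?W (b \<otimes>\<^bsub>?W\<^esub> f \<otimes>\<^bsub>?W\<^esub> a) a)\<^sup>2 \<le> s)"
    proof (rule bexI[of _ "Rep_elt f"], rule bexI[of _ "Rep_elt g"], intro conjI ballI allI impI)
      fix a c assume "a \<in> carrier ?W"
        and *: "cpos ?W c \<and> b = a \<otimes>\<^bsub>?W\<^esub> star ?W a \<oplus>\<^bsub>?W\<^esub> c"
      then obtain a' where a: "a = Rep_elt a'" by (auto elim: worst_carrierE)
      obtain c' where c: "c = Rep_elt c'" "epos c'" using * by (auto simp: cpos_worst_iff)
      have "b' = a' * estar a' + c'" using * unfolding a c b fold_worst by blast
      from fg(7)[OF c(2) this] show "(cdist ?W (b \<otimes>\<^bsub>?W\<^esub> Rep_elt f \<otimes>\<^bsub>?W\<^esub> a) a)\<^sup>2 \<le> s"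
        unfolding a b fold_worst .
    qed (unfold b fold_worst, (rule fg(1-6) Rep_elt TrueI)+)
  qed
  show "\<forall>a::nat \<Rightarrow> 'a. (\<forall>n. cpos ?W (a n) \<and> nrm ?W (a n) \<le> 1) \<longrightarrow>
      (\<exists>s. cpos ?W s \<and> (\<forall>n. \<exists>c. cpos ?W c \<and> s = complex_of_real ((1/2) ^ n) \<odot>\<^bsub>?W\<^esub> a n \<oplus>\<^bsub>?W\<^esub> c))"
  proof (intro allI impI)
    fix a :: "nat \<Rightarrow> 'a" assume a: "\<forall>n. cpos ?W (a n) \<and> nrm ?W (a n) \<le> 1"
    obtain a' where a': "\<And>n. a n = Rep_elt (a' n)" "\<And>n. epos (a' n)"
      using a unfolding cpos_worst_iff by metis
    have "epos (a' n) \<and> norm (a' n) \<le> 1" for n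
    proof -
      have "nrm ?W (Rep_elt (a' n)) \<le> 1" using a a'(1)[of n] by metis
      then show ?thesis using a'(2)[of n] unfolding fold_worst by (rule conjI[rotated])
    qed
    from epos_weighted_sum[of a', OF this] obtain s where s: "epos s \<and>
      (\<forall>n. \<exists>c. epos c \<and> s = cscale (complex_of_real ((1/2) ^ n)) (a' n) + c)" ..
    have "\<exists>c. cpos ?W c \<and> Rep_elt s = complex_of_real ((1/2) ^ n) \<odot>\<^bsub>?W\<^esub> a n \<oplus>\<^bsub>?W\<^esub> c" for n
    proof -
      obtain c where c: "epos c \<and> s = cscale (complex_of_real ((1/2) ^ n)) (a' n) + c"
        using conjunct2[OF s, rule_format, of n] ..
      then show ?thesis
        by (intro exI[of _ "Rep_elt c"]) (simp only: a' fold_worst)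
    qed
    then show "\<exists>s. cpos ?W s \<and> (\<forall>n. \<exists>c. cpos ?W c \<and> s = complex_of_real ((1/2) ^ n) \<odot>\<^bsub>?W\<^esub> a n \<oplus>\<^bsub>?W\<^esub> c)"
      using conjunct1[OF s] cpos_worst_Rep by blast
  qed
  show "\<forall>a\<in>carrier ?W. \<exists>p q r s. cpos ?W p \<and> cpos ?W q \<and> cpos ?W r \<and> cpos ?W s \<and>
      a = p \<oplus>\<^bsub>?W\<^esub> (-1) \<odot>\<^bsub>?W\<^esub> q \<oplus>\<^bsub>?W\<^esub> \<i> \<odot>\<^bsub>?W\<^esub> r \<oplus>\<^bsub>?W\<^esub> (-\<i>) \<odot>\<^bsub>?W\<^esub> s"
  proof
    fix a assume "a \<in> carrier ?W"
    then obtain a' where a: "a = Rep_elt a'" by (rule worst_carrierE)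
    obtain p q r s where "epos p" "epos q" "epos r" "epos s"
      "a' = p + cscale (-1) q + cscale \<i> r + cscale (- \<i>) s" using epos_decomposition by blast
    then show "\<exists>p q r s. cpos ?W p \<and> cpos ?W q \<and> cpos ?W r \<and> cpos ?W s \<and>
        a = p \<oplus>\<^bsub>?W\<^esub> (-1) \<odot>\<^bsub>?W\<^esub> q \<oplus>\<^bsub>?W\<^esub> \<i> \<odot>\<^bsub>?W\<^esub> r \<oplus>\<^bsub>?W\<^esub> (-\<i>) \<odot>\<^bsub>?W\<^esub> s"
      by (rule_tac x = "Rep_elt p" in exI, rule_tac x = "Rep_elt q" in exI,
          rule_tac x = "Rep_elt r" in exI, rule_tac x = "Rep_elt s" in exI)
        (simp only: a fold_worst)
  qed
qed

theorem order_facts: "cstar_algebra A \<Longrightarrow> order_facts A"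
  by (rule order_facts_of_worst[OF order_facts_worst])

section \<open>Order and limits in C*-algebras\<close>

lemma null_cmp:
  fixes f g :: "nat \<Rightarrow> real"
  assumes "g \<longlonglongrightarrow> c" "\<And>n. f n \<le> g n" "\<And>n. 0 \<le> f n" "c = 0" shows "f \<longlonglongrightarrow> 0"
  by (rule Lim_null_comparison[of _ g]) (use assms in auto)

context cstar_algebra
begin

declare mult_closed [simp, intro] star_closed [simp, intro]

lemma cpos_carrier: "cpos A a \<Longrightarrow> a \<in> carrier A"
  by (auto simp: cpos_def)

lemma cpos_star: "cpos A a \<Longrightarrow> star A a = a"
  by (auto simp: cpos_def star_mult star_star)

lemma cpos_star_mult: "a \<in> carrier A \<Longrightarrow> cpos A (star A a \<otimes>\<^bsub>A\<^esub> a)"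
  by (auto simp: cpos_def)

lemma cpos_mult_star: "a \<in> carrier A \<Longrightarrow> cpos A (a \<otimes>\<^bsub>A\<^esub> star A a)"
  using cpos_star_mult[of "star A a"] by (simp add: star_star)

lemma cpos_zero [simp]: "cpos A \<zero>\<^bsub>A\<^esub>"
  using cpos_star_mult[of "\<zero>\<^bsub>A\<^esub>"] by simp

lemma cpos_scale:
  assumes "cpos A a" "r \<ge> 0" shows "cpos A (complex_of_real r \<odot>\<^bsub>A\<^esub> a)"
proof -
  obtain b where b: "b \<in> carrier A" "a = star A b \<otimes>\<^bsub>A\<^esub> b" using assms(1) by (auto simp: cpos_def)
  have "complex_of_real r \<odot>\<^bsub>A\<^esub> a
      = star A (complex_of_real (sqrt r) \<odot>\<^bsub>A\<^esub> b) \<otimes>\<^bsub>A\<^esub> (complex_of_real (sqrt r) \<odot>\<^bsub>A\<^esub> b)"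
    using b assms(2) by (simp add: star_smult smult_mult_left smult_mult_right cm.csmult_assoc flip: of_real_mult)
  then show ?thesis using b by (simp add: cpos_star_mult)
qed

lemma nrm_star: "a \<in> carrier A \<Longrightarrow> nrm A (star A a) = nrm A a"
proof -
  have le: "nrm A b \<le> nrm A (star A b)" if b: "b \<in> carrier A" for b
  proof (cases "nrm A b = 0")
    case False
    then have "nrm A b > 0" using nrm_nonneg[OF b] by simp
    have "(nrm A b)\<^sup>2 \<le> nrm A (star A b) * nrm A b"
      using nrm_mult[OF star_closed[OF b] b] cstar_identity[OF b] by linarith
    then have "nrm A b * nrm A b \<le> nrm A (star A b) * nrm A b" unfolding monoid_mult_class.power2_eq_square .
    then show ?thesis using \<open>nrm A b > 0\<close> by (rule mult_right_le_imp_le)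
  qed (use b in \<open>simp add: nrm_nonneg\<close>)
  assume "a \<in> carrier A"
  then show ?thesis using le[of a] le[of "star A a"] by (simp add: star_star)
qed

lemmas order_facts_here = order_facts[OF cstar_algebra_axioms, unfolded order_facts_def]

lemma cpos_add: "cpos A a \<Longrightarrow> cpos A b \<Longrightarrow> cpos A (a \<oplus>\<^bsub>A\<^esub> b)"
  using order_facts_here[THEN conjunct1] by blast

lemma cpos_limit:
  "(\<And>n::nat. cpos A (f n)) \<Longrightarrow> a \<in> carrier A \<Longrightarrow> (\<lambda>n. cdist A (f n) a) \<longlonglongrightarrow> 0 \<Longrightarrow> cpos A a"
  using order_facts_here[THEN conjunct2, THEN conjunct1] by blast

lemma cpos_nrm_mono: "cpos A a \<Longrightarrow> cpos A c \<Longrightarrow> nrm A a \<le> nrm A (a \<oplus>\<^bsub>A\<^esub> c)"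
  using order_facts_here[THEN conjunct2, THEN conjunct2, THEN conjunct1] by blast

lemma cpos_cauchy_schwarz:
  "a \<in> carrier A \<Longrightarrow> c \<in> carrier A \<Longrightarrow> d \<in> carrier A \<Longrightarrow> t > 0 \<Longrightarrow> cpos A c \<Longrightarrow> nrm A c \<le> t \<Longrightarrow>
    cpos A (star A a \<otimes>\<^bsub>A\<^esub> c \<otimes>\<^bsub>A\<^esub> a \<oplus>\<^bsub>A\<^esub> complex_of_real (- 2 * t) \<odot>\<^bsub>A\<^esub> (star A a \<otimes>\<^bsub>A\<^esub> a)
      \<oplus>\<^bsub>A\<^esub> complex_of_real (t * t) \<odot>\<^bsub>A\<^esub> d) \<Longrightarrow>
    cpos A (complex_of_real t \<odot>\<^bsub>A\<^esub> d \<oplus>\<^bsub>A\<^esub> (-1) \<odot>\<^bsub>A\<^esub> (star A a \<otimes>\<^bsub>A\<^esub> a))"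
  using order_facts_here[THEN conjunct2, THEN conjunct2, THEN conjunct2, THEN conjunct1] by blast

lemma cpos_local_unit:
  assumes "cpos A b" "s > 0"
  obtains f g where "f \<in> carrier A" "g \<in> carrier A" "star A f = f" "star A g = g"
    "b \<otimes>\<^bsub>A\<^esub> f = f \<otimes>\<^bsub>A\<^esub> b" "cpos A (b \<otimes>\<^bsub>A\<^esub> f)" "nrm A (b \<otimes>\<^bsub>A\<^esub> f) \<le> 1"
    "f = f \<otimes>\<^bsub>A\<^esub> b \<otimes>\<^bsub>A\<^esub> f \<oplus>\<^bsub>A\<^esub> g \<otimes>\<^bsub>A\<^esub> g"
    "\<And>a c. a \<in> carrier A \<Longrightarrow> cpos A c \<Longrightarrow> b = a \<otimes>\<^bsub>A\<^esub> star A a \<oplus>\<^bsub>A\<^esub> c \<Longrightarrow>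
      (cdist A (b \<otimes>\<^bsub>A\<^esub> f \<otimes>\<^bsub>A\<^esub> a) a)\<^sup>2 \<le> s"
proof -
  from order_facts_here[THEN conjunct2, THEN conjunct2, THEN conjunct2, THEN conjunct2, THEN conjunct1,
      THEN spec, THEN spec, THEN mp, OF conjI[OF assms]]
  show thesis by (elim bexE conjE) (rule that; blast)
qed

lemma cpos_weighted_sum:
  fixes a :: "nat \<Rightarrow> 'a"
  assumes "\<And>n. cpos A (a n)" "\<And>n. nrm A (a n) \<le> 1"
  obtains s where "cpos A s" "\<And>n. \<exists>c. cpos A c \<and> s = complex_of_real ((1/2) ^ n) \<odot>\<^bsub>A\<^esub> a n \<oplus>\<^bsub>A\<^esub> c"
  using order_facts_here[THEN conjunct2, THEN conjunct2, THEN conjunct2, THEN conjunct2, THEN conjunct2, THEN conjunct1] assms by meson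

lemma cpos_decomposition:
  assumes "a \<in> carrier A"
  obtains p q r s where "cpos A p" "cpos A q" "cpos A r" "cpos A s"
    "a = p \<oplus>\<^bsub>A\<^esub> (-1) \<odot>\<^bsub>A\<^esub> q \<oplus>\<^bsub>A\<^esub> \<i> \<odot>\<^bsub>A\<^esub> r \<oplus>\<^bsub>A\<^esub> (-\<i>) \<odot>\<^bsub>A\<^esub> s"
  using order_facts_here[THEN conjunct2, THEN conjunct2, THEN conjunct2, THEN conjunct2, THEN conjunct2, THEN conjunct2] assms by meson

lemma cdist_nonneg [simp]: "0 \<le> cdist A a b"
  by (rule Metric_space.nonneg[OF metric])

lemma cdist_commute: "cdist A a b = cdist A b a"
  by (rule Metric_space.commute[OF metric])

lemma cdist_zero_iff: "a \<in> carrier A \<Longrightarrow> b \<in> carrier A \<Longrightarrow> cdist A a b = 0 \<longleftrightarrow> a = b"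
  by (rule Metric_space.zero[OF metric])

lemma cdist_self [simp]: "cdist A a a = 0"
  by (cases "a \<in> carrier A") (simp add: cdist_zero_iff, simp add: cdist_def)

lemma cdist_triangle:
  "a \<in> carrier A \<Longrightarrow> b \<in> carrier A \<Longrightarrow> c \<in> carrier A \<Longrightarrow> cdist A a c \<le> cdist A a b + cdist A b c"
  by (rule Metric_space.triangle[OF metric])

lemma cdist_add:
  assumes "a \<in> carrier A" "b \<in> carrier A" "c \<in> carrier A" "d \<in> carrier A"
  shows "cdist A (a \<oplus>\<^bsub>A\<^esub> b) (c \<oplus>\<^bsub>A\<^esub> d) \<le> cdist A a c + cdist A b d"
proof -
  have "(a \<oplus>\<^bsub>A\<^esub> b) \<oplus>\<^bsub>A\<^esub> (-1) \<odot>\<^bsub>A\<^esub> (c \<oplus>\<^bsub>A\<^esub> d) = (a \<oplus>\<^bsub>A\<^esub> (-1) \<odot>\<^bsub>A\<^esub> c) \<oplus>\<^bsub>A\<^esub> (b \<oplus>\<^bsub>A\<^esub> (-1) \<odot>\<^bsub>A\<^esub> d)"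
    using assms by (simp add: cm.csmult_r_distr a_ac)
  then show ?thesis using assms by (simp add: cdist_eq nrm_add)
qed

lemma cdist_smult:
  assumes "a \<in> carrier A" "b \<in> carrier A"
  shows "cdist A (z \<odot>\<^bsub>A\<^esub> a) (z \<odot>\<^bsub>A\<^esub> b) = cmod z * cdist A a b"
proof -
  have "(z \<odot>\<^bsub>A\<^esub> a) \<oplus>\<^bsub>A\<^esub> (-1) \<odot>\<^bsub>A\<^esub> (z \<odot>\<^bsub>A\<^esub> b) = z \<odot>\<^bsub>A\<^esub> (a \<oplus>\<^bsub>A\<^esub> (-1) \<odot>\<^bsub>A\<^esub> b)"
    using assms by (simp add: cm.csmult_r_distr cm.csmult_assoc)
  then show ?thesis using assms by (simp add: cdist_eq nrm_smult)
qed

lemma cdist_mult_right: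
  assumes "a \<in> carrier A" "b \<in> carrier A" "c \<in> carrier A"
  shows "cdist A (a \<otimes>\<^bsub>A\<^esub> c) (b \<otimes>\<^bsub>A\<^esub> c) \<le> cdist A a b * nrm A c"
proof -
  have "a \<otimes>\<^bsub>A\<^esub> c \<oplus>\<^bsub>A\<^esub> (-1) \<odot>\<^bsub>A\<^esub> (b \<otimes>\<^bsub>A\<^esub> c) = (a \<oplus>\<^bsub>A\<^esub> (-1) \<odot>\<^bsub>A\<^esub> b) \<otimes>\<^bsub>A\<^esub> c"
    using assms by (simp add: distr_left smult_mult_left)
  then show ?thesis using assms by (simp add: cdist_eq nrm_mult)
qed

lemma cdist_mult_left:
  assumes "a \<in> carrier A" "b \<in> carrier A" "c \<in> carrier A"
  shows "cdist A (c \<otimes>\<^bsub>A\<^esub> a) (c \<otimes>\<^bsub>A\<^esub> b) \<le> nrm A c * cdist A a b"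
proof -
  have "c \<otimes>\<^bsub>A\<^esub> a \<oplus>\<^bsub>A\<^esub> (-1) \<odot>\<^bsub>A\<^esub> (c \<otimes>\<^bsub>A\<^esub> b) = c \<otimes>\<^bsub>A\<^esub> (a \<oplus>\<^bsub>A\<^esub> (-1) \<odot>\<^bsub>A\<^esub> b)"
    using assms by (simp add: distr_right smult_mult_right)
  then show ?thesis using assms by (simp add: cdist_eq nrm_mult)
qed

lemma cdist_star:
  assumes "a \<in> carrier A" "b \<in> carrier A" shows "cdist A (star A a) (star A b) = cdist A a b"
proof -
  have "star A a \<oplus>\<^bsub>A\<^esub> (-1) \<odot>\<^bsub>A\<^esub> star A b = star A (a \<oplus>\<^bsub>A\<^esub> (-1) \<odot>\<^bsub>A\<^esub> b)"
    using assms by (simp add: star_add star_smult)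
  then show ?thesis using assms by (simp add: cdist_eq nrm_star)
qed

lemma nrm_cdist: "a \<in> carrier A \<Longrightarrow> nrm A a = cdist A a \<zero>\<^bsub>A\<^esub>"
  by (simp add: cdist_eq)

lemma nrm_cdist_le: "a \<in> carrier A \<Longrightarrow> b \<in> carrier A \<Longrightarrow> \<bar>nrm A a - nrm A b\<bar> \<le> cdist A a b"
  using cdist_triangle[of a b "\<zero>\<^bsub>A\<^esub>"] cdist_triangle[of b a "\<zero>\<^bsub>A\<^esub>"] cdist_commute[of a b]
  by (simp add: nrm_cdist abs_le_iff)

definition tends :: "(nat \<Rightarrow> 'a) \<Rightarrow> 'a \<Rightarrow> bool" where
  "tends f a \<longleftrightarrow> (\<forall>n. f n \<in> carrier A) \<and> a \<in> carrier A \<and> (\<lambda>n. cdist A (f n) a) \<longlonglongrightarrow> 0"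

lemma tends_carrier: "tends f a \<Longrightarrow> f n \<in> carrier A" "tends f a \<Longrightarrow> a \<in> carrier A"
  by (auto simp: tends_def)

lemma tends_cmp:
  assumes f: "tends f a" and g: "\<And>n. g n \<in> carrier A" "b \<in> carrier A"
    and le: "\<And>n. cdist A (g n) b \<le> K * cdist A (f n) a"
  shows "tends g b"
proof -
  have "(\<lambda>n. K * cdist A (f n) a) \<longlonglongrightarrow> K * 0" using f unfolding tends_def by (intro tendsto_intros) auto
  then have "(\<lambda>n. cdist A (g n) b) \<longlonglongrightarrow> 0"
    by - (erule null_cmp, auto simp: le)
  then show ?thesis using g by (simp add: tends_def)
qed

lemma tends_const: "a \<in> carrier A \<Longrightarrow> tends (\<lambda>_. a) a"
  by (simp add: tends_def)

lemma tends_add: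
  assumes f: "tends f a" and g: "tends g b"
  shows "tends (\<lambda>n. f n \<oplus>\<^bsub>A\<^esub> g n) (a \<oplus>\<^bsub>A\<^esub> b)"
proof -
  have "(\<lambda>n. cdist A (f n) a + cdist A (g n) b) \<longlonglongrightarrow> 0 + 0"
    using f g unfolding tends_def by (intro tendsto_intros) auto
  then have "(\<lambda>n. cdist A (f n \<oplus>\<^bsub>A\<^esub> g n) (a \<oplus>\<^bsub>A\<^esub> b)) \<longlonglongrightarrow> 0"
    using tends_carrier[OF f] tends_carrier[OF g]
    by - (erule null_cmp, auto simp: cdist_add)
  then show ?thesis using tends_carrier[OF f] tends_carrier[OF g] by (simp add: tends_def)
qed

lemma tends_smult: "tends f a \<Longrightarrow> tends (\<lambda>n. z \<odot>\<^bsub>A\<^esub> f n) (z \<odot>\<^bsub>A\<^esub> a)"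
  by (rule tends_cmp[of f a _ _ "cmod z"]) (auto dest: tends_carrier simp: cdist_smult tends_carrier)

lemma tends_mult_right: "tends f a \<Longrightarrow> c \<in> carrier A \<Longrightarrow> tends (\<lambda>n. f n \<otimes>\<^bsub>A\<^esub> c) (a \<otimes>\<^bsub>A\<^esub> c)"
  by (rule tends_cmp[of f a _ _ "nrm A c"])
    (auto dest: tends_carrier intro: order_trans[OF cdist_mult_right] simp: tends_carrier mult.commute)

lemma tends_star: "tends f a \<Longrightarrow> tends (\<lambda>n. star A (f n)) (star A a)"
  by (rule tends_cmp[of f a _ _ 1]) (auto dest: tends_carrier simp: cdist_star tends_carrier)

lemma tends_unique:
  assumes "tends f a" "tends f b" shows "a = b"
proof -
  have "(\<lambda>n. cdist A (f n) a + cdist A (f n) b) \<longlonglongrightarrow> 0 + 0"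
    using assms unfolding tends_def by (intro tendsto_intros) auto
  moreover have "cdist A a b \<le> cdist A (f n) a + cdist A (f n) b" for n
    using cdist_triangle[of a "f n" b] tends_carrier[OF assms(1)] tends_carrier[OF assms(2)]
    by (simp add: cdist_commute)
  ultimately have "cdist A a b \<le> 0 + 0" by (intro LIMSEQ_le_const) auto
  then show ?thesis using cdist_zero_iff tends_carrier[OF assms(1)] tends_carrier[OF assms(2)]
    using cdist_nonneg[of a b] by auto
qed

lemma tends_nrm: assumes "tends f a" shows "(\<lambda>n. nrm A (f n)) \<longlonglongrightarrow> nrm A a"
proof -
  have "(\<lambda>n. nrm A (f n) - nrm A a) \<longlonglongrightarrow> 0"
  proof (rule Lim_null_comparison)
    show "(\<lambda>n. cdist A (f n) a) \<longlonglongrightarrow> 0" using assms by (simp add: tends_def)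
    show "\<forall>\<^sub>F n in sequentially. norm (nrm A (f n) - nrm A a) \<le> cdist A (f n) a"
      using tends_carrier[OF assms] by (simp add: nrm_cdist_le)
  qed
  then show ?thesis by (simp add: LIM_zero_iff)
qed

lemma tends_cpos: "tends f a \<Longrightarrow> (\<And>n. cpos A (f n)) \<Longrightarrow> cpos A a"
  using cpos_limit[of f a] by (auto simp: tends_def)

lemma tends_zero_close:
  assumes "tends f a" "\<And>n. g n \<in> carrier A" "(\<lambda>n. cdist A (f n) (g n)) \<longlonglongrightarrow> 0"
  shows "tends g a"
proof -
  have "(\<lambda>n. cdist A (f n) (g n) + cdist A (f n) a) \<longlonglongrightarrow> 0 + 0"
    using assms unfolding tends_def by (intro tendsto_intros) auto
  then have "(\<lambda>n. cdist A (g n) a) \<longlonglongrightarrow> 0"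
    using cdist_triangle[of "g n" "f n" a for n] assms(2) tends_carrier[OF assms(1)]
    by - (erule null_cmp, auto simp: cdist_commute)
  then show ?thesis using assms(2) tends_carrier[OF assms(1)] by (simp add: tends_def)
qed

lemma cauchy_tends:
  assumes "\<And>n. f n \<in> carrier A" "\<And>\<epsilon>. \<epsilon> > 0 \<Longrightarrow> \<exists>N. \<forall>m\<ge>N. \<forall>n\<ge>N. cdist A (f m) (f n) < \<epsilon>"
  shows "\<exists>a. tends f a"
proof -
  have "Metric_space.MCauchy (carrier A) (cdist A) f"
    unfolding Metric_space.MCauchy_def[OF metric] using assms by blast
  then obtain a where "limitin (Metric_space.mtopology (carrier A) (cdist A)) f a sequentially"
    using complete unfolding Metric_space.mcomplete_def[OF metric] by blast
  then have "tends f a"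
    unfolding Metric_space.limit_metric_sequentially[OF metric] tends_def lim_sequentially
    using assms(1) by auto
  then show ?thesis by blast
qed

end

section \<open>Semi-inner product modules\<close>

text \<open>The setting common to C*-modules and to the lists that represent tensors.  There is no additive
  group: all that is used of the linear operations is how the form depends on them.\<close>

locale form_module = cstar_algebra B for B :: "'b cstar" and P :: "('b, 'p) hmod" +
  assumes zero_closed [simp, intro]: "\<zero>\<^bsub>P\<^esub> \<in> carrier P"
    and add_closed [simp, intro]: "x \<in> carrier P \<Longrightarrow> y \<in> carrier P \<Longrightarrow> x \<oplus>\<^bsub>P\<^esub> y \<in> carrier P"
    and smult_closed [simp, intro]: "x \<in> carrier P \<Longrightarrow> z \<odot>\<^bsub>P\<^esub> x \<in> carrier P"
    and ract_closed [simp, intro]: "x \<in> carrier P \<Longrightarrow> b \<in> carrier B \<Longrightarrow> ract P x b \<in> carrier P"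
    and inner_closed [simp, intro]: "x \<in> carrier P \<Longrightarrow> y \<in> carrier P \<Longrightarrow> inner P x y \<in> carrier B"
    and inner_zero [simp]: "x \<in> carrier P \<Longrightarrow> inner P x \<zero>\<^bsub>P\<^esub> = \<zero>\<^bsub>B\<^esub>"
    and inner_add: "\<lbrakk>x \<in> carrier P; y \<in> carrier P; w \<in> carrier P\<rbrakk>
      \<Longrightarrow> inner P x (y \<oplus>\<^bsub>P\<^esub> w) = inner P x y \<oplus>\<^bsub>B\<^esub> inner P x w"
    and inner_smult: "\<lbrakk>x \<in> carrier P; y \<in> carrier P\<rbrakk> \<Longrightarrow> inner P x (z \<odot>\<^bsub>P\<^esub> y) = z \<odot>\<^bsub>B\<^esub> inner P x y"
    and inner_ract: "\<lbrakk>x \<in> carrier P; y \<in> carrier P; b \<in> carrier B\<rbrakk>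
      \<Longrightarrow> inner P x (ract P y b) = inner P x y \<otimes>\<^bsub>B\<^esub> b"
    and inner_star: "\<lbrakk>x \<in> carrier P; y \<in> carrier P\<rbrakk> \<Longrightarrow> star B (inner P x y) = inner P y x"
begin

lemma inner_zero_left [simp]: "x \<in> carrier P \<Longrightarrow> inner P \<zero>\<^bsub>P\<^esub> x = \<zero>\<^bsub>B\<^esub>"
  using inner_star[of x "\<zero>\<^bsub>P\<^esub>"] by simp

lemma inner_add_left: "\<lbrakk>x \<in> carrier P; y \<in> carrier P; w \<in> carrier P\<rbrakk>
      \<Longrightarrow> inner P (x \<oplus>\<^bsub>P\<^esub> y) w = inner P x w \<oplus>\<^bsub>B\<^esub> inner P y w"
  using inner_star[of w "x \<oplus>\<^bsub>P\<^esub> y"] by (simp add: inner_add star_add inner_star)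

lemma inner_smult_left: "\<lbrakk>x \<in> carrier P; y \<in> carrier P\<rbrakk> \<Longrightarrow> inner P (z \<odot>\<^bsub>P\<^esub> x) y = cnj z \<odot>\<^bsub>B\<^esub> inner P x y"
  using inner_star[of y "z \<odot>\<^bsub>P\<^esub> x"] by (simp add: inner_smult star_smult inner_star)

lemma inner_ract_left: "\<lbrakk>x \<in> carrier P; y \<in> carrier P; b \<in> carrier B\<rbrakk>
      \<Longrightarrow> inner P (ract P x b) y = star B b \<otimes>\<^bsub>B\<^esub> inner P x y"
  using inner_star[of y "ract P x b"] by (simp add: inner_ract star_mult inner_star)

lemmas inner_simps = inner_add inner_smult inner_ract inner_add_left inner_smult_left inner_ract_left

text \<open>Equality up to a null vector, expressed without reference to differences.\<close>

definition eqv :: "'p \<Rightarrow> 'p \<Rightarrow> bool" where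
  "eqv x y \<longleftrightarrow> x \<in> carrier P \<and> y \<in> carrier P \<and> (\<forall>w\<in>carrier P. inner P w x = inner P w y)"

lemma eqv_left: "eqv x y \<Longrightarrow> w \<in> carrier P \<Longrightarrow> inner P x w = inner P y w"
  unfolding eqv_def by (metis inner_star)

end

locale semi_module = form_module B P for B :: "'b cstar" and P :: "('b, 'p) hmod" +
  assumes inner_pos: "x \<in> carrier P \<Longrightarrow> cpos B (inner P x x)"
begin

abbreviation hn :: "'p \<Rightarrow> real" where "hn \<equiv> hnorm B P"

lemma hnorm_sq: "x \<in> carrier P \<Longrightarrow> (hn x)\<^sup>2 = nrm B (inner P x x)"
  by (simp add: hnorm_def nrm_nonneg)

lemma hnorm_nonneg [simp]: "x \<in> carrier P \<Longrightarrow> 0 \<le> hn x"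
  by (simp add: hnorm_def nrm_nonneg)

lemma hnorm_leI: "x \<in> carrier P \<Longrightarrow> 0 \<le> r \<Longrightarrow> nrm B (inner P x x) \<le> r\<^sup>2 \<Longrightarrow> hn x \<le> r"
  unfolding hnorm_def by (rule real_le_lsqrt) (auto simp: nrm_nonneg)

text \<open>Positivity of the inner square of \<open>xa - ty\<close>, where \<open>a = \<langle>x, y\<rangle>\<close>.\<close>

lemma cauchy_schwarz_order:
  assumes x: "x \<in> carrier P" and y: "y \<in> carrier P" and t: "t > 0" "nrm B (inner P x x) \<le> t"
  shows "cpos B (complex_of_real t \<odot>\<^bsub>B\<^esub> inner P y y \<oplus>\<^bsub>B\<^esub> (-1) \<odot>\<^bsub>B\<^esub> (inner P y x \<otimes>\<^bsub>B\<^esub> inner P x y))"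
proof -
  define a c d where "a = inner P x y" and "c = inner P x x" and "d = inner P y y"
  have cl: "a \<in> carrier B" "c \<in> carrier B" "d \<in> carrier B" using x y by (auto simp: a_def c_def d_def)
  have yx: "inner P y x = star B a" using inner_star[OF x y] by (simp add: a_def)
  define w where "w = ract P x a \<oplus>\<^bsub>P\<^esub> complex_of_real (- t) \<odot>\<^bsub>P\<^esub> y"
  have w: "w \<in> carrier P" using x y cl by (simp add: w_def)
  have wx: "inner P w x = star B a \<otimes>\<^bsub>B\<^esub> c \<oplus>\<^bsub>B\<^esub> complex_of_real (- t) \<odot>\<^bsub>B\<^esub> star B a"
    using x y cl by (simp add: w_def inner_simps yx c_def[symmetric])
  have wy: "inner P w y = star B a \<otimes>\<^bsub>B\<^esub> a \<oplus>\<^bsub>B\<^esub> complex_of_real (- t) \<odot>\<^bsub>B\<^esub> d"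
    using x y cl by (simp add: w_def inner_simps a_def[symmetric] d_def[symmetric])
  have "inner P w w = inner P w x \<otimes>\<^bsub>B\<^esub> a \<oplus>\<^bsub>B\<^esub> complex_of_real (- t) \<odot>\<^bsub>B\<^esub> inner P w y"
    using x y cl w by (subst (2) w_def) (simp add: inner_simps)
  also have "\<dots> = star B a \<otimes>\<^bsub>B\<^esub> c \<otimes>\<^bsub>B\<^esub> a \<oplus>\<^bsub>B\<^esub> complex_of_real (- 2 * t) \<odot>\<^bsub>B\<^esub> (star B a \<otimes>\<^bsub>B\<^esub> a)
      \<oplus>\<^bsub>B\<^esub> complex_of_real (t * t) \<odot>\<^bsub>B\<^esub> d"
  proof -
    have "complex_of_real (- 2 * t) \<odot>\<^bsub>B\<^esub> (star B a \<otimes>\<^bsub>B\<^esub> a)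
        = complex_of_real (- t) \<odot>\<^bsub>B\<^esub> (star B a \<otimes>\<^bsub>B\<^esub> a) \<oplus>\<^bsub>B\<^esub> complex_of_real (- t) \<odot>\<^bsub>B\<^esub> (star B a \<otimes>\<^bsub>B\<^esub> a)"
      using cl by (subst cm.csmult_l_distr[symmetric]) auto
    then show ?thesis using cl
      by (simp add: wx wy distr_left smult_mult_left cm.csmult_r_distr cm.csmult_assoc a_assoc)
  qed
  finally have "cpos B \<dots>" using inner_pos[OF w] by simp
  then show ?thesis
    using cpos_cauchy_schwarz[of a c d t] cl t inner_pos[OF x] by (simp add: yx a_def c_def d_def)
qed

lemma cauchy_schwarz:
  assumes x: "x \<in> carrier P" and y: "y \<in> carrier P"
  shows "nrm B (inner P x y) \<le> hn x * hn y"
proof -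
  let ?a = "inner P x y" let ?d = "inner P y y"
  have key: "(nrm B ?a)\<^sup>2 \<le> t * nrm B ?d" if t: "t > nrm B (inner P x x)" for t
  proof -
    have t0: "t > 0" using t nrm_nonneg[of "inner P x x"] x by (meson inner_closed le_less_trans)
    let ?p = "complex_of_real t \<odot>\<^bsub>B\<^esub> ?d \<oplus>\<^bsub>B\<^esub> (-1) \<odot>\<^bsub>B\<^esub> (inner P y x \<otimes>\<^bsub>B\<^esub> inner P x y)"
    have "cpos B ?p" using cauchy_schwarz_order[OF x y t0] t by simp
    moreover have sq: "inner P y x \<otimes>\<^bsub>B\<^esub> inner P x y = star B ?a \<otimes>\<^bsub>B\<^esub> ?a" using x y by (simp add: inner_star)
    moreover have "(star B ?a \<otimes>\<^bsub>B\<^esub> ?a) \<oplus>\<^bsub>B\<^esub> ?p = complex_of_real t \<odot>\<^bsub>B\<^esub> ?d"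
      using x y cm.add_m1_self[of "star B ?a \<otimes>\<^bsub>B\<^esub> ?a"] unfolding sq by (simp add: a_lcomm)
    ultimately have "nrm B (star B ?a \<otimes>\<^bsub>B\<^esub> ?a) \<le> nrm B (complex_of_real t \<odot>\<^bsub>B\<^esub> ?d)"
      using cpos_nrm_mono[of "star B ?a \<otimes>\<^bsub>B\<^esub> ?a" ?p] x y by (simp add: cpos_star_mult)
    then show ?thesis using x y t0 by (simp add: cstar_identity nrm_smult)
  qed
  have "(nrm B ?a)\<^sup>2 \<le> nrm B (inner P x x) * nrm B ?d"
  proof (cases "nrm B ?d = 0")
    case True
    then show ?thesis using key[of "nrm B (inner P x x) + 1"] by simp
  next
    case False
    then have d: "nrm B ?d > 0" using nrm_nonneg[of ?d] y by simp
    have "(nrm B ?a)\<^sup>2 / nrm B ?d \<le> nrm B (inner P x x)"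
    proof (rule dense_ge)
      fix t assume "nrm B (inner P x x) < t"
      from key[OF this] show "(nrm B ?a)\<^sup>2 / nrm B ?d \<le> t" using d by (simp add: pos_divide_le_eq)
    qed
    then show ?thesis using d by (simp add: pos_divide_le_eq)
  qed
  then have "(nrm B ?a)\<^sup>2 \<le> (hn x * hn y)\<^sup>2" using x y by (simp add: power_mult_distrib hnorm_sq)
  then show ?thesis by (rule power2_le_imp_le) (simp add: x y)
qed

lemma hnorm_triangle:
  assumes "x \<in> carrier P" "y \<in> carrier P" shows "hn (x \<oplus>\<^bsub>P\<^esub> y) \<le> hn x + hn y"
proof (rule hnorm_leI)
  have "inner P (x \<oplus>\<^bsub>P\<^esub> y) (x \<oplus>\<^bsub>P\<^esub> y) = (inner P x x \<oplus>\<^bsub>B\<^esub> inner P y x) \<oplus>\<^bsub>B\<^esub> (inner P x y \<oplus>\<^bsub>B\<^esub> inner P y y)"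
    using assms by (simp add: inner_simps)
  also have "nrm B \<dots> \<le> (nrm B (inner P x x) + nrm B (inner P y x)) + (nrm B (inner P x y) + nrm B (inner P y y))"
    using assms by (intro order_trans[OF nrm_add] add_mono nrm_add) auto
  also have "\<dots> \<le> ((hn x)\<^sup>2 + hn y * hn x) + (hn x * hn y + (hn y)\<^sup>2)"
    using assms by (intro add_mono cauchy_schwarz) (auto simp: hnorm_sq)
  finally show "nrm B (inner P (x \<oplus>\<^bsub>P\<^esub> y) (x \<oplus>\<^bsub>P\<^esub> y)) \<le> (hn x + hn y)\<^sup>2"
    by (simp add: power2_sum)
qed (use assms in auto)

lemma hnorm_smult: "x \<in> carrier P \<Longrightarrow> hn (z \<odot>\<^bsub>P\<^esub> x) = cmod z * hn x"
  by (simp add: hnorm_def inner_simps nrm_smult real_sqrt_mult cm.csmult_assoc norm_mult)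

lemma hnorm_ract: assumes "x \<in> carrier P" "b \<in> carrier B" shows "hn (ract P x b) \<le> hn x * nrm B b"
proof (rule hnorm_leI)
  have "nrm B (star B b \<otimes>\<^bsub>B\<^esub> (inner P x x \<otimes>\<^bsub>B\<^esub> b)) \<le> nrm B (star B b) * (nrm B (inner P x x) * nrm B b)"
    using assms by (intro order_trans[OF nrm_mult] mult_left_mono nrm_mult) (auto simp: nrm_nonneg)
  also have "\<dots> = (hn x * nrm B b)\<^sup>2"
    unfolding nrm_star[OF assms(2)] power_mult_distrib hnorm_sq[OF assms(1)] by (simp add: monoid_mult_class.power2_eq_square)
  finally show "nrm B (inner P (ract P x b) (ract P x b)) \<le> (hn x * nrm B b)\<^sup>2"
    using assms by (simp add: inner_simps mult_assoc)
qed (use assms in \<open>auto simp: nrm_nonneg\<close>)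

lemma hnorm_zero [simp]: "hn \<zero>\<^bsub>P\<^esub> = 0"
  by (simp add: hnorm_def)

lemma hnorm_cong: assumes "eqv x y" shows "hn x = hn y"
proof -
  have c: "x \<in> carrier P" "y \<in> carrier P" using assms by (auto simp: eqv_def)
  have "inner P x x = inner P x y" using assms c by (auto simp: eqv_def)
  also have "\<dots> = inner P y y" using eqv_left[OF assms c(2)] .
  finally show ?thesis by (simp add: hnorm_def)
qed

abbreviation hd' :: "'p \<Rightarrow> 'p \<Rightarrow> real" where "hd' \<equiv> hdist B P"

lemma hdist_eq: "x \<in> carrier P \<Longrightarrow> y \<in> carrier P \<Longrightarrow> hd' x y = hn (x \<oplus>\<^bsub>P\<^esub> (-1) \<odot>\<^bsub>P\<^esub> y)"
  by (simp add: hdist_def)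

lemma hdist_nonneg [simp]: "0 \<le> hd' x y"
  by (simp add: hdist_def)

lemma inner_minus:
  "w \<in> carrier P \<Longrightarrow> x \<in> carrier P \<Longrightarrow> y \<in> carrier P \<Longrightarrow>
    inner P w (x \<oplus>\<^bsub>P\<^esub> (-1) \<odot>\<^bsub>P\<^esub> y) = inner P w x \<oplus>\<^bsub>B\<^esub> (-1) \<odot>\<^bsub>B\<^esub> inner P w y"
  by (simp add: inner_simps)

lemma hdist_zero_iff: assumes "x \<in> carrier P" "y \<in> carrier P" shows "hd' x y = 0 \<longleftrightarrow> eqv x y"
proof
  let ?d = "x \<oplus>\<^bsub>P\<^esub> (-1) \<odot>\<^bsub>P\<^esub> y"
  assume 0: "hd' x y = 0"
  show "eqv x y" unfolding eqv_def
  proof (intro conjI ballI assms)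
    fix w assume w: "w \<in> carrier P"
    have "nrm B (inner P w ?d) \<le> 0" using cauchy_schwarz[OF w, of ?d] 0 assms by (simp add: hdist_eq)
    then have "inner P w ?d = \<zero>\<^bsub>B\<^esub>" using w assms nrm_nonneg[of "inner P w ?d"] by (simp add: nrm_eq_zero_iff)
    then show "inner P w x = inner P w y" using w assms by (simp add: inner_minus cm.add_m1_eq_zero)
  qed
next
  assume e: "eqv x y"
  have "inner P w (x \<oplus>\<^bsub>P\<^esub> (-1) \<odot>\<^bsub>P\<^esub> y) = inner P w \<zero>\<^bsub>P\<^esub>" if "w \<in> carrier P" for w
    using that assms e by (simp add: inner_minus eqv_def)
  then have "eqv (x \<oplus>\<^bsub>P\<^esub> (-1) \<odot>\<^bsub>P\<^esub> y) \<zero>\<^bsub>P\<^esub>" using assms by (simp add: eqv_def)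
  from hnorm_cong[OF this] show "hd' x y = 0" using assms by (simp add: hdist_eq)
qed

lemma hdist_self [simp]: "hd' x x = 0"
  by (cases "x \<in> carrier P") (simp add: hdist_zero_iff eqv_def, simp add: hdist_def)

lemma hdist_commute: "hd' x y = hd' y x"
proof (cases "x \<in> carrier P \<and> y \<in> carrier P")
  case True
  have "eqv (x \<oplus>\<^bsub>P\<^esub> (-1) \<odot>\<^bsub>P\<^esub> y) ((-1) \<odot>\<^bsub>P\<^esub> (y \<oplus>\<^bsub>P\<^esub> (-1) \<odot>\<^bsub>P\<^esub> x))"
    using True by (auto simp: eqv_def inner_simps cm.csmult_r_distr cm.csmult_assoc a_comm)
  from hnorm_cong[OF this] show ?thesis using True by (simp add: hdist_eq hnorm_smult)
qed (auto simp: hdist_def)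

lemma add_m1_telescope:
  "a \<in> carrier B \<Longrightarrow> b \<in> carrier B \<Longrightarrow> c \<in> carrier B \<Longrightarrow>
    (a \<oplus>\<^bsub>B\<^esub> (-1) \<odot>\<^bsub>B\<^esub> b) \<oplus>\<^bsub>B\<^esub> (b \<oplus>\<^bsub>B\<^esub> (-1) \<odot>\<^bsub>B\<^esub> c) = a \<oplus>\<^bsub>B\<^esub> (-1) \<odot>\<^bsub>B\<^esub> c"
  by (simp add: cm.csmult_m1 a_assoc r_neg1)

lemma hdist_triangle:
  assumes "x \<in> carrier P" "y \<in> carrier P" "w \<in> carrier P"
  shows "hd' x w \<le> hd' x y + hd' y w"
proof -
  have "eqv (x \<oplus>\<^bsub>P\<^esub> (-1) \<odot>\<^bsub>P\<^esub> w) ((x \<oplus>\<^bsub>P\<^esub> (-1) \<odot>\<^bsub>P\<^esub> y) \<oplus>\<^bsub>P\<^esub> (y \<oplus>\<^bsub>P\<^esub> (-1) \<odot>\<^bsub>P\<^esub> w))"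
    using assms by (auto simp: eqv_def inner_simps add_m1_telescope)
  from hnorm_cong[OF this] show ?thesis
    using assms hnorm_triangle[of "x \<oplus>\<^bsub>P\<^esub> (-1) \<odot>\<^bsub>P\<^esub> y" "y \<oplus>\<^bsub>P\<^esub> (-1) \<odot>\<^bsub>P\<^esub> w"] by (simp add: hdist_eq)
qed

lemma hnorm_hdist: "x \<in> carrier P \<Longrightarrow> hn x = hd' x \<zero>\<^bsub>P\<^esub>"
proof -
  assume x: "x \<in> carrier P"
  have "eqv x (x \<oplus>\<^bsub>P\<^esub> (-1) \<odot>\<^bsub>P\<^esub> \<zero>\<^bsub>P\<^esub>)" using x by (auto simp: eqv_def inner_simps)
  from hnorm_cong[OF this] show ?thesis using x by (simp add: hdist_eq)
qed

lemma hnorm_hdist_le: "x \<in> carrier P \<Longrightarrow> y \<in> carrier P \<Longrightarrow> \<bar>hn x - hn y\<bar> \<le> hd' x y"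
  using hdist_triangle[of x y "\<zero>\<^bsub>P\<^esub>"] hdist_triangle[of y x "\<zero>\<^bsub>P\<^esub>"] hdist_commute[of x y]
  by (simp add: hnorm_hdist abs_le_iff)

lemma hdist_add:
  assumes "x \<in> carrier P" "y \<in> carrier P" "u \<in> carrier P" "v \<in> carrier P"
  shows "hd' (x \<oplus>\<^bsub>P\<^esub> y) (u \<oplus>\<^bsub>P\<^esub> v) \<le> hd' x u + hd' y v"
proof -
  have "eqv ((x \<oplus>\<^bsub>P\<^esub> y) \<oplus>\<^bsub>P\<^esub> (-1) \<odot>\<^bsub>P\<^esub> (u \<oplus>\<^bsub>P\<^esub> v)) ((x \<oplus>\<^bsub>P\<^esub> (-1) \<odot>\<^bsub>P\<^esub> u) \<oplus>\<^bsub>P\<^esub> (y \<oplus>\<^bsub>P\<^esub> (-1) \<odot>\<^bsub>P\<^esub> v))"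
    using assms by (auto simp: eqv_def inner_simps cm.csmult_r_distr a_ac)
  from hnorm_cong[OF this] show ?thesis
    using assms hnorm_triangle[of "x \<oplus>\<^bsub>P\<^esub> (-1) \<odot>\<^bsub>P\<^esub> u" "y \<oplus>\<^bsub>P\<^esub> (-1) \<odot>\<^bsub>P\<^esub> v"] by (simp add: hdist_eq)
qed

lemma hdist_smult:
  assumes "x \<in> carrier P" "y \<in> carrier P"
  shows "hd' (z \<odot>\<^bsub>P\<^esub> x) (z \<odot>\<^bsub>P\<^esub> y) = cmod z * hd' x y"
proof -
  have "eqv ((z \<odot>\<^bsub>P\<^esub> x) \<oplus>\<^bsub>P\<^esub> (-1) \<odot>\<^bsub>P\<^esub> (z \<odot>\<^bsub>P\<^esub> y)) (z \<odot>\<^bsub>P\<^esub> (x \<oplus>\<^bsub>P\<^esub> (-1) \<odot>\<^bsub>P\<^esub> y))"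
    using assms by (auto simp: eqv_def inner_simps cm.csmult_r_distr cm.csmult_assoc mult.commute)
  from hnorm_cong[OF this] show ?thesis using assms by (simp add: hdist_eq hnorm_smult)
qed

lemma hdist_ract:
  assumes "x \<in> carrier P" "y \<in> carrier P" "b \<in> carrier B"
  shows "hd' (ract P x b) (ract P y b) \<le> hd' x y * nrm B b"
proof -
  have "eqv (ract P x b \<oplus>\<^bsub>P\<^esub> (-1) \<odot>\<^bsub>P\<^esub> ract P y b) (ract P (x \<oplus>\<^bsub>P\<^esub> (-1) \<odot>\<^bsub>P\<^esub> y) b)"
    using assms by (auto simp: eqv_def inner_simps distr_left smult_mult_left)
  from hnorm_cong[OF this] show ?thesis
    using assms hnorm_ract[of "x \<oplus>\<^bsub>P\<^esub> (-1) \<odot>\<^bsub>P\<^esub> y" b] by (simp add: hdist_eq)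
qed

lemma cdist_inner:
  assumes "x \<in> carrier P" "y \<in> carrier P" "u \<in> carrier P" "v \<in> carrier P"
  shows "cdist B (inner P x y) (inner P u v) \<le> hn x * hd' y v + hd' x u * hn v"
proof -
  have "inner P x y \<oplus>\<^bsub>B\<^esub> (-1) \<odot>\<^bsub>B\<^esub> inner P u v
      = inner P x (y \<oplus>\<^bsub>P\<^esub> (-1) \<odot>\<^bsub>P\<^esub> v) \<oplus>\<^bsub>B\<^esub> inner P (x \<oplus>\<^bsub>P\<^esub> (-1) \<odot>\<^bsub>P\<^esub> u) v"
    using assms by (simp add: inner_simps add_m1_telescope)
  then have "cdist B (inner P x y) (inner P u v)
      \<le> nrm B (inner P x (y \<oplus>\<^bsub>P\<^esub> (-1) \<odot>\<^bsub>P\<^esub> v)) + nrm B (inner P (x \<oplus>\<^bsub>P\<^esub> (-1) \<odot>\<^bsub>P\<^esub> u) v)"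
    using assms by (simp add: cdist_eq nrm_add)
  also have "\<dots> \<le> hn x * hd' y v + hd' x u * hn v"
    using assms cauchy_schwarz[of x "y \<oplus>\<^bsub>P\<^esub> (-1) \<odot>\<^bsub>P\<^esub> v"] cauchy_schwarz[of "x \<oplus>\<^bsub>P\<^esub> (-1) \<odot>\<^bsub>P\<^esub> u" v]
    by (simp add: hdist_eq)
  finally show ?thesis .
qed

lemma metric_of_definite:
  assumes "\<And>x y. x \<in> carrier P \<Longrightarrow> y \<in> carrier P \<Longrightarrow> hd' x y = 0 \<Longrightarrow> x = y"
  shows "Metric_space (carrier P) hd'"
  by unfold_locales (use assms hdist_triangle hdist_commute in auto)

end

hide_const (open) Complete_Measure.completion

section \<open>The completion of a semi-inner product module\<close>

context semi_module
begin

lemma hcauchy_carrier: "s \<in> hcauchy B P \<Longrightarrow> s n \<in> carrier P"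
  by (auto simp: hcauchy_def)

lemma hcauchyI: "(\<And>n. s n \<in> carrier P) \<Longrightarrow> (\<And>\<epsilon>. \<epsilon> > 0 \<Longrightarrow> \<exists>N. \<forall>m\<ge>N. \<forall>n\<ge>N. hd' (s m) (s n) < \<epsilon>)
    \<Longrightarrow> s \<in> hcauchy B P"
  by (auto simp: hcauchy_def)

lemma hcauchyD: "s \<in> hcauchy B P \<Longrightarrow> \<epsilon> > 0 \<Longrightarrow> \<exists>N. \<forall>m\<ge>N. \<forall>n\<ge>N. hd' (s m) (s n) < \<epsilon>"
  by (auto simp: hcauchy_def)

lemma hcauchy_const: "p \<in> carrier P \<Longrightarrow> (\<lambda>_. p) \<in> hcauchy B P"
  by (rule hcauchyI) auto

lemma hcauchy_cmp:
  assumes s: "s \<in> hcauchy B P" and t: "\<And>n. t n \<in> carrier P"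
    and le: "\<And>m n. hd' (t m) (t n) \<le> K * hd' (s m) (s n)"
  shows "t \<in> hcauchy B P"
proof (rule hcauchyI[OF t])
  fix \<epsilon> :: real assume "\<epsilon> > 0"
  then obtain N where N: "\<forall>m\<ge>N. \<forall>n\<ge>N. hd' (s m) (s n) < \<epsilon> / (\<bar>K\<bar> + 1)"
    using hcauchyD[OF s, of "\<epsilon> / (\<bar>K\<bar> + 1)"] by (auto simp: field_simps)
  show "\<exists>N. \<forall>m\<ge>N. \<forall>n\<ge>N. hd' (t m) (t n) < \<epsilon>"
  proof (intro exI allI impI)
    fix m n assume "N \<le> m" "N \<le> n"
    then have lt: "hd' (s m) (s n) < \<epsilon> / (\<bar>K\<bar> + 1)" using N by blast
    have "hd' (t m) (t n) \<le> (\<bar>K\<bar> + 1) * hd' (s m) (s n)"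
      by (rule order_trans[OF le]) (intro mult_right_mono, auto)
    also have "\<dots> < \<epsilon>" using lt by (simp add: field_simps)
    finally show "hd' (t m) (t n) < \<epsilon>" .
  qed
qed

lemma hcauchy_add:
  assumes s: "s \<in> hcauchy B P" and t: "t \<in> hcauchy B P"
  shows "(\<lambda>n. s n \<oplus>\<^bsub>P\<^esub> t n) \<in> hcauchy B P"
proof (rule hcauchyI)
  show "s n \<oplus>\<^bsub>P\<^esub> t n \<in> carrier P" for n using assms by (simp add: hcauchy_carrier)
  fix \<epsilon> :: real assume e: "\<epsilon> > 0"
  obtain N M where NM: "\<forall>m\<ge>N. \<forall>n\<ge>N. hd' (s m) (s n) < \<epsilon>/2" "\<forall>m\<ge>M. \<forall>n\<ge>M. hd' (t m) (t n) < \<epsilon>/2"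
    using hcauchyD[OF s, of "\<epsilon>/2"] hcauchyD[OF t, of "\<epsilon>/2"] e by auto
  show "\<exists>N. \<forall>m\<ge>N. \<forall>n\<ge>N. hd' (s m \<oplus>\<^bsub>P\<^esub> t m) (s n \<oplus>\<^bsub>P\<^esub> t n) < \<epsilon>"
  proof (intro exI[of _ "max N M"] allI impI)
    fix m n assume "max N M \<le> m" "max N M \<le> n"
    then have "hd' (s m) (s n) < \<epsilon>/2" "hd' (t m) (t n) < \<epsilon>/2" using NM by auto
    then show "hd' (s m \<oplus>\<^bsub>P\<^esub> t m) (s n \<oplus>\<^bsub>P\<^esub> t n) < \<epsilon>"
      using hdist_add[of "s m" "t m" "s n" "t n"] assms by (simp add: hcauchy_carrier)
  qed
qed

lemma hcauchy_smult: "s \<in> hcauchy B P \<Longrightarrow> (\<lambda>n. z \<odot>\<^bsub>P\<^esub> s n) \<in> hcauchy B P"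
  by (rule hcauchy_cmp[of s _ "cmod z"]) (auto simp: hcauchy_carrier hdist_smult)

lemma hcauchy_ract: "s \<in> hcauchy B P \<Longrightarrow> b \<in> carrier B \<Longrightarrow> (\<lambda>n. ract P (s n) b) \<in> hcauchy B P"
  by (rule hcauchy_cmp[of s _ "nrm B b"])
    (auto simp: hcauchy_carrier mult.commute intro: order_trans[OF hdist_ract])

lemma hcauchy_bounded:
  assumes "s \<in> hcauchy B P" shows "\<exists>K. \<forall>n. hn (s n) \<le> K"
proof -
  obtain N where N: "\<forall>m\<ge>N. \<forall>n\<ge>N. hd' (s m) (s n) < 1" using hcauchyD[OF assms, of 1] by auto
  have "hn (s n) \<le> Max ((\<lambda>n. hn (s n)) ` {..N}) + 1" for n
  proof (cases "n \<le> N")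
    case True
    then have "hn (s n) \<le> Max ((\<lambda>n. hn (s n)) ` {..N})" by (intro Max_ge) auto
    then show ?thesis by simp
  next
    case False
    then have "hd' (s n) (s N) < 1" using N by auto
    moreover have "hn (s N) \<le> Max ((\<lambda>n. hn (s n)) ` {..N})" by (intro Max_ge) auto
    moreover have "hn (s n) - hn (s N) \<le> hd' (s n) (s N)"
      using hnorm_hdist_le[of "s n" "s N"] assms by (simp add: hcauchy_carrier abs_le_iff)
    ultimately show ?thesis by linarith
  qed
  then show ?thesis by blast
qed

lemma null_relD: "(s, t) \<in> null_rel B P \<Longrightarrow> s \<in> hcauchy B P \<and> t \<in> hcauchy B P \<and> (\<lambda>n. hd' (s n) (t n)) \<longlonglongrightarrow> 0"
  by (auto simp: null_rel_def)

lemma null_relI_cmp: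
  assumes "(s, t) \<in> null_rel B P" "u \<in> hcauchy B P" "v \<in> hcauchy B P"
    "\<And>n. hd' (u n) (v n) \<le> K * hd' (s n) (t n)"
  shows "(u, v) \<in> null_rel B P"
proof -
  have "(\<lambda>n. K * hd' (s n) (t n)) \<longlonglongrightarrow> K * 0" using null_relD[OF assms(1)] by (intro tendsto_intros) auto
  then have "(\<lambda>n. hd' (u n) (v n)) \<longlonglongrightarrow> 0"
    by - (erule null_cmp, auto simp: assms(4))
  then show ?thesis using assms by (simp add: null_rel_def)
qed

lemma equiv_null_rel: "equiv (hcauchy B P) (null_rel B P)"
proof (rule equivI)
  show "null_rel B P \<subseteq> hcauchy B P \<times> hcauchy B P" by (auto simp: null_rel_def)
  show "refl_on (hcauchy B P) (null_rel B P)" by (auto simp: refl_on_def null_rel_def)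
  show "sym (null_rel B P)" by (auto simp: sym_def null_rel_def hdist_commute)
  show "trans (null_rel B P)"
  proof (rule transI)
    fix s t u assume st: "(s, t) \<in> null_rel B P" and tu: "(t, u) \<in> null_rel B P"
    have "(\<lambda>n. hd' (s n) (t n) + hd' (t n) (u n)) \<longlonglongrightarrow> 0 + 0"
      using null_relD[OF st] null_relD[OF tu] by (intro tendsto_intros) auto
    then have "(\<lambda>n. hd' (s n) (u n)) \<longlonglongrightarrow> 0"
      using null_relD[OF st] null_relD[OF tu] hdist_triangle
      by - (erule null_cmp, auto simp: hcauchy_carrier)
    then show "(s, u) \<in> null_rel B P" using null_relD[OF st] null_relD[OF tu] by (simp add: null_rel_def)
  qed
qed

abbreviation cls :: "(nat \<Rightarrow> 'p) \<Rightarrow> (nat \<Rightarrow> 'p) set" where "cls s \<equiv> null_rel B P `` {s}"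
abbreviation Q where "Q \<equiv> completion B P"

lemma cls_in [simp, intro]: "s \<in> hcauchy B P \<Longrightarrow> cls s \<in> carrier Q"
  by (simp add: Defs.completion_def quotientI)

lemma completionE:
  assumes "S \<in> carrier Q" obtains s where "s \<in> hcauchy B P" "S = cls s"
  using assms by (auto simp: Defs.completion_def elim: quotientE)

lemma cls_eq_iff:
  "s \<in> hcauchy B P \<Longrightarrow> t \<in> hcauchy B P \<Longrightarrow> cls s = cls t \<longleftrightarrow> (\<lambda>n. hd' (s n) (t n)) \<longlonglongrightarrow> 0"
  by (subst eq_equiv_class_iff[OF equiv_null_rel]) (simp_all add: null_rel_def)

lemma cls_eqI:
  assumes "s \<in> hcauchy B P" "t \<in> hcauchy B P" "\<And>n. eqv (s n) (t n)" shows "cls s = cls t"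
proof -
  have "hd' (s n) (t n) = 0" for n using assms by (simp add: hdist_zero_iff hcauchy_carrier)
  then show ?thesis by (simp add: cls_eq_iff assms(1,2))
qed

lemma cls_eqI_null: "(s, t) \<in> null_rel B P \<Longrightarrow> cls s = cls t"
  by (rule equiv_class_eq[OF equiv_null_rel])

lemma add_cls:
  assumes "s \<in> hcauchy B P" "t \<in> hcauchy B P"
  shows "cls s \<oplus>\<^bsub>Q\<^esub> cls t = cls (\<lambda>n. s n \<oplus>\<^bsub>P\<^esub> t n)"
proof -
  have "congruent2 (null_rel B P) (null_rel B P) (\<lambda>s t. cls (\<lambda>n. s n \<oplus>\<^bsub>P\<^esub> t n))"
  proof (rule congruent2I')
    fix s s' t t' assume s: "(s, s') \<in> null_rel B P" and t: "(t, t') \<in> null_rel B P"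
    have "(\<lambda>n. hd' (s n) (s' n) + hd' (t n) (t' n)) \<longlonglongrightarrow> 0 + 0"
      using null_relD[OF s] null_relD[OF t] by (intro tendsto_intros) auto
    then have "(\<lambda>n. hd' (s n \<oplus>\<^bsub>P\<^esub> t n) (s' n \<oplus>\<^bsub>P\<^esub> t' n)) \<longlonglongrightarrow> 0"
      using null_relD[OF s] null_relD[OF t]
      by - (erule null_cmp, auto simp: hcauchy_carrier hdist_add)
    then show "cls (\<lambda>n. s n \<oplus>\<^bsub>P\<^esub> t n) = cls (\<lambda>n. s' n \<oplus>\<^bsub>P\<^esub> t' n)"
      using null_relD[OF s] null_relD[OF t] by (simp add: cls_eq_iff hcauchy_add)
  qed
  from UN_equiv_class2[OF equiv_null_rel equiv_null_rel this assms]
  show ?thesis by (simp add: Defs.completion_def)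
qed

lemma smult_cls:
  assumes "s \<in> hcauchy B P" shows "z \<odot>\<^bsub>Q\<^esub> cls s = cls (\<lambda>n. z \<odot>\<^bsub>P\<^esub> s n)"
proof -
  have "congruent (null_rel B P) (\<lambda>s. cls (\<lambda>n. z \<odot>\<^bsub>P\<^esub> s n))"
    by (rule congruentI, rule cls_eqI_null, rule null_relI_cmp[where K="cmod z"], assumption)
      (auto dest!: null_relD simp: hcauchy_smult hdist_smult hcauchy_carrier)
  from UN_equiv_class[OF equiv_null_rel this assms] show ?thesis by (simp add: Defs.completion_def)
qed

lemma ract_cls:
  assumes "s \<in> hcauchy B P" "b \<in> carrier B" shows "ract Q (cls s) b = cls (\<lambda>n. ract P (s n) b)"
proof -
  have "congruent (null_rel B P) (\<lambda>s. cls (\<lambda>n. ract P (s n) b))"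
    by (rule congruentI, rule cls_eqI_null, rule null_relI_cmp[where K="nrm B b"], assumption)
      (use assms(2) in \<open>auto dest!: null_relD simp: hcauchy_ract hcauchy_carrier mult.commute
        intro: order_trans[OF hdist_ract]\<close>)
  from UN_equiv_class[OF equiv_null_rel this assms(1)] show ?thesis by (simp add: Defs.completion_def)
qed

lemma zero_cls: "\<zero>\<^bsub>Q\<^esub> = cls (\<lambda>_. \<zero>\<^bsub>P\<^esub>)"
  by (simp add: Defs.completion_def)

lemma inner_tends_ex:
  assumes s: "s \<in> hcauchy B P" and t: "t \<in> hcauchy B P"
  shows "\<exists>c. tends (\<lambda>n. inner P (s n) (t n)) c"
proof (rule cauchy_tends)
  show "inner P (s n) (t n) \<in> carrier B" for n using assms by (simp add: hcauchy_carrier)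
  fix \<epsilon> :: real assume e: "\<epsilon> > 0"
  obtain K L where KL: "\<And>n. hn (s n) \<le> K" "\<And>n. hn (t n) \<le> L"
    using hcauchy_bounded[OF s] hcauchy_bounded[OF t] by metis
  have "0 \<le> K" "0 \<le> L"
    using order_trans[OF hnorm_nonneg KL(1)[of 0]] order_trans[OF hnorm_nonneg KL(2)[of 0]] assms
    by (auto simp: hcauchy_carrier)
  define d where "d = \<epsilon> / (K + L + 1)"
  have d: "d > 0" "(K + L) * d < \<epsilon>" using e \<open>0 \<le> K\<close> \<open>0 \<le> L\<close> by (auto simp: d_def field_simps)
  obtain N M where NM: "\<forall>m\<ge>N. \<forall>n\<ge>N. hd' (s m) (s n) < d" "\<forall>m\<ge>M. \<forall>n\<ge>M. hd' (t m) (t n) < d"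
    using hcauchyD[OF s d(1)] hcauchyD[OF t d(1)] by auto
  show "\<exists>N. \<forall>m\<ge>N. \<forall>n\<ge>N. cdist B (inner P (s m) (t m)) (inner P (s n) (t n)) < \<epsilon>"
  proof (intro exI[of _ "max N M"] allI impI)
    fix m n assume "max N M \<le> m" "max N M \<le> n"
    then have lt: "hd' (s m) (s n) \<le> d" "hd' (t m) (t n) \<le> d" using NM by (auto simp: less_imp_le)
    have "cdist B (inner P (s m) (t m)) (inner P (s n) (t n))
        \<le> hn (s m) * hd' (t m) (t n) + hd' (s m) (s n) * hn (t n)"
      using assms by (simp add: cdist_inner hcauchy_carrier)
    also have "\<dots> \<le> K * d + d * L"
      using lt KL \<open>0 \<le> K\<close> \<open>0 \<le> L\<close> assms d by (intro add_mono mult_mono) (auto simp: hcauchy_carrier)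
    also have "\<dots> < \<epsilon>" using d by (simp add: algebra_simps)
    finally show "cdist B (inner P (s m) (t m)) (inner P (s n) (t n)) < \<epsilon>" .
  qed
qed

lemma inner_close:
  assumes s: "(s, s') \<in> null_rel B P" and t: "(t, t') \<in> null_rel B P"
  shows "(\<lambda>n. cdist B (inner P (s n) (t n)) (inner P (s' n) (t' n))) \<longlonglongrightarrow> 0"
proof -
  note h = null_relD[OF s] null_relD[OF t]
  obtain K L where KL: "\<And>n. hn (s n) \<le> K" "\<And>n. hn (t' n) \<le> L"
    using hcauchy_bounded[of s] hcauchy_bounded[of t'] h by metis
  have "(\<lambda>n. K * hd' (t n) (t' n) + hd' (s n) (s' n) * L) \<longlonglongrightarrow> K * 0 + 0 * L"
    using h by (intro tendsto_intros) auto
  moreover have "cdist B (inner P (s n) (t n)) (inner P (s' n) (t' n))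
      \<le> K * hd' (t n) (t' n) + hd' (s n) (s' n) * L" for n
    using h KL by (intro order_trans[OF cdist_inner] add_mono mult_right_mono mult_left_mono)
      (auto simp: hcauchy_carrier)
  ultimately show ?thesis by - (erule null_cmp, auto)
qed

text \<open>The inner product of classes is defined as a limit of inner products of representatives; the limit exists
  by the Cauchy-Schwarz inequality and is the same for all representatives.\<close>

lemma inner_cls:
  assumes s: "s \<in> hcauchy B P" and t: "t \<in> hcauchy B P"
  shows "tends (\<lambda>n. inner P (s n) (t n)) (inner Q (cls s) (cls t))"
proof -
  obtain c where c: "tends (\<lambda>n. inner P (s n) (t n)) c" using inner_tends_ex[OF assms] by blast
  have "inner Q (cls s) (cls t) = c"
    unfolding Defs.completion_def hmod.simps
  proof (rule the_equality)
    show "c \<in> carrier B \<and> (\<exists>s\<in>cls s. \<exists>t\<in>cls t. (\<lambda>n. cdist B (inner P (s n) (t n)) c) \<longlonglongrightarrow> 0)"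
      using c equiv_class_self[OF equiv_null_rel s] equiv_class_self[OF equiv_null_rel t]
      by (auto simp: tends_def simp del: Image_singleton_iff)
    fix d assume d: "d \<in> carrier B \<and> (\<exists>s\<in>cls s. \<exists>t\<in>cls t. (\<lambda>n. cdist B (inner P (s n) (t n)) d) \<longlonglongrightarrow> 0)"
    then obtain s' t' where st: "(s, s') \<in> null_rel B P" "(t, t') \<in> null_rel B P"
      "(\<lambda>n. cdist B (inner P (s' n) (t' n)) d) \<longlonglongrightarrow> 0" by auto
    have "tends (\<lambda>n. inner P (s' n) (t' n)) d"
      using st d null_relD[OF st(1)] null_relD[OF st(2)] by (auto simp: tends_def hcauchy_carrier)
    moreover have "tends (\<lambda>n. inner P (s' n) (t' n)) c"
      using null_relD[OF st(1)] null_relD[OF st(2)]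
      by (intro tends_zero_close[OF c _ inner_close[OF st(1,2)]]) (auto simp: hcauchy_carrier)
    ultimately show "d = c" by (rule tends_unique)
  qed
  then show ?thesis using c by simp
qed

lemma inner_clsI:
  "s \<in> hcauchy B P \<Longrightarrow> t \<in> hcauchy B P \<Longrightarrow> tends (\<lambda>n. inner P (s n) (t n)) c \<Longrightarrow> inner Q (cls s) (cls t) = c"
  using tends_unique inner_cls by blast

lemma semi_module_completion: "semi_module B Q"
proof (intro semi_module.intro form_module.intro form_module_axioms.intro semi_module_axioms.intro)
  show "cstar_algebra B" by (rule cstar_algebra_axioms)
  note hc = hcauchy_add hcauchy_smult hcauchy_ract hcauchy_const[OF zero_closed] hcauchy_carrier
  note ops = add_cls smult_cls ract_cls zero_cls
  show "\<zero>\<^bsub>Q\<^esub> \<in> carrier Q" by (simp add: zero_cls hc)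
  fix x y w z b
  show "x \<in> carrier Q \<Longrightarrow> y \<in> carrier Q \<Longrightarrow> x \<oplus>\<^bsub>Q\<^esub> y \<in> carrier Q"
    by (auto elim!: completionE simp: ops hc)
  show "x \<in> carrier Q \<Longrightarrow> z \<odot>\<^bsub>Q\<^esub> x \<in> carrier Q" by (auto elim!: completionE simp: ops hc)
  show "x \<in> carrier Q \<Longrightarrow> b \<in> carrier B \<Longrightarrow> ract Q x b \<in> carrier Q" by (auto elim!: completionE simp: ops hc)
  show "x \<in> carrier Q \<Longrightarrow> y \<in> carrier Q \<Longrightarrow> inner Q x y \<in> carrier B"
    using inner_cls tends_carrier(2) by (auto elim!: completionE)
  show "x \<in> carrier Q \<Longrightarrow> inner Q x \<zero>\<^bsub>Q\<^esub> = \<zero>\<^bsub>B\<^esub>"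
    by (elim completionE) (simp add: zero_cls, rule inner_clsI, auto simp: hc intro!: tends_const)
  show "x \<in> carrier Q \<Longrightarrow> y \<in> carrier Q \<Longrightarrow> w \<in> carrier Q
      \<Longrightarrow> inner Q x (y \<oplus>\<^bsub>Q\<^esub> w) = inner Q x y \<oplus>\<^bsub>B\<^esub> inner Q x w"
  proof (elim completionE)
    fix s t u assume "s \<in> hcauchy B P" "x = cls s" "t \<in> hcauchy B P" "y = cls t" "u \<in> hcauchy B P" "w = cls u"
    then show ?thesis
      using tends_add[OF inner_cls inner_cls, of s t s u] by (auto simp: ops hc inner_add intro!: inner_clsI)
  qed
  show "x \<in> carrier Q \<Longrightarrow> y \<in> carrier Q \<Longrightarrow> inner Q x (z \<odot>\<^bsub>Q\<^esub> y) = z \<odot>\<^bsub>B\<^esub> inner Q x y"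
  proof (elim completionE)
    fix s t assume "s \<in> hcauchy B P" "x = cls s" "t \<in> hcauchy B P" "y = cls t"
    then show ?thesis
      using tends_smult[OF inner_cls, of s t z] by (auto simp: ops hc inner_smult intro!: inner_clsI)
  qed
  show "x \<in> carrier Q \<Longrightarrow> y \<in> carrier Q \<Longrightarrow> b \<in> carrier B \<Longrightarrow> inner Q x (ract Q y b) = inner Q x y \<otimes>\<^bsub>B\<^esub> b"
  proof (elim completionE)
    fix s t assume "s \<in> hcauchy B P" "x = cls s" "t \<in> hcauchy B P" "y = cls t" and b: "b \<in> carrier B"
    then show ?thesis
      using tends_mult_right[OF inner_cls b, of s t] by (auto simp: ops hc inner_ract intro!: inner_clsI)
  qed
  show "x \<in> carrier Q \<Longrightarrow> y \<in> carrier Q \<Longrightarrow> star B (inner Q x y) = inner Q y x"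
  proof (elim completionE)
    fix s t assume "s \<in> hcauchy B P" "x = cls s" "t \<in> hcauchy B P" "y = cls t"
    then show ?thesis
      using tends_star[OF inner_cls, of s t] by (auto simp: hc inner_star intro!: inner_clsI[symmetric])
  qed
  show "x \<in> carrier Q \<Longrightarrow> cpos B (inner Q x x)"
  proof (elim completionE)
    fix s assume "s \<in> hcauchy B P" "x = cls s"
    then show ?thesis using tends_cpos[OF inner_cls, of s s] by (auto simp: hc inner_pos)
  qed
qed

lemma hnorm_cls: assumes "s \<in> hcauchy B P" shows "(\<lambda>n. hn (s n)) \<longlonglongrightarrow> hnorm B Q (cls s)"
  unfolding hnorm_def by (intro tendsto_real_sqrt tends_nrm inner_cls assms)

lemma hdist_cls:
  assumes "s \<in> hcauchy B P" "t \<in> hcauchy B P"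
  shows "(\<lambda>n. hd' (s n) (t n)) \<longlonglongrightarrow> hdist B Q (cls s) (cls t)"
proof -
  have h: "(\<lambda>n. s n \<oplus>\<^bsub>P\<^esub> (-1) \<odot>\<^bsub>P\<^esub> t n) \<in> hcauchy B P" using assms by (simp add: hcauchy_add hcauchy_smult)
  have "cls s \<oplus>\<^bsub>Q\<^esub> (-1) \<odot>\<^bsub>Q\<^esub> cls t = cls (\<lambda>n. s n \<oplus>\<^bsub>P\<^esub> (-1) \<odot>\<^bsub>P\<^esub> t n)"
    using assms by (simp add: add_cls smult_cls hcauchy_smult)
  then show ?thesis using hnorm_cls[OF h] assms by (simp add: hdist_eq hcauchy_carrier hdist_def)
qed

lemma metric_completion: "Metric_space (carrier Q) (hdist B Q)"
proof (rule semi_module.metric_of_definite[OF semi_module_completion])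
  fix x y assume "x \<in> carrier Q" "y \<in> carrier Q" and 0: "hdist B Q x y = 0"
  then obtain s t where "s \<in> hcauchy B P" "x = cls s" "t \<in> hcauchy B P" "y = cls t" by (metis completionE)
  then show "x = y" using hdist_cls[of s t] 0 by (simp add: cls_eq_iff)
qed

definition emb_c :: "'p \<Rightarrow> (nat \<Rightarrow> 'p) set" where "emb_c p = cls (\<lambda>_. p)"

lemma emb_c_in [simp, intro]: "p \<in> carrier P \<Longrightarrow> emb_c p \<in> carrier Q"
  by (simp add: emb_c_def hcauchy_const)

lemma emb_c_simps:
  "p \<in> carrier P \<Longrightarrow> q \<in> carrier P \<Longrightarrow> emb_c (p \<oplus>\<^bsub>P\<^esub> q) = emb_c p \<oplus>\<^bsub>Q\<^esub> emb_c q"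
  "p \<in> carrier P \<Longrightarrow> emb_c (z \<odot>\<^bsub>P\<^esub> p) = z \<odot>\<^bsub>Q\<^esub> emb_c p"
  "p \<in> carrier P \<Longrightarrow> b \<in> carrier B \<Longrightarrow> emb_c (ract P p b) = ract Q (emb_c p) b"
  "emb_c \<zero>\<^bsub>P\<^esub> = \<zero>\<^bsub>Q\<^esub>"
  by (simp_all add: emb_c_def add_cls smult_cls ract_cls zero_cls hcauchy_const)

lemma inner_emb_c: "p \<in> carrier P \<Longrightarrow> q \<in> carrier P \<Longrightarrow> inner Q (emb_c p) (emb_c q) = inner P p q"
  unfolding emb_c_def by (rule inner_clsI) (auto simp: hcauchy_const tends_const)

lemma hdist_emb_c:
  assumes "p \<in> carrier P" "q \<in> carrier P" shows "hdist B Q (emb_c p) (emb_c q) = hd' p q"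
  using hdist_cls[of "\<lambda>_. p" "\<lambda>_. q"] assms by (simp add: emb_c_def hcauchy_const LIMSEQ_const_iff)

lemma cls_limit:
  assumes s: "s \<in> hcauchy B P" shows "(\<lambda>n. hdist B Q (emb_c (s n)) (cls s)) \<longlonglongrightarrow> 0"
proof (rule LIMSEQ_I)
  interpret Q: semi_module B Q by (rule semi_module_completion)
  fix \<epsilon> :: real assume "\<epsilon> > 0"
  then obtain N where N: "\<forall>m\<ge>N. \<forall>n\<ge>N. hd' (s m) (s n) < \<epsilon>/2" using hcauchyD[OF s, of "\<epsilon>/2"] by auto
  have "hdist B Q (emb_c (s n)) (cls s) \<le> \<epsilon>/2" if "n \<ge> N" for n
    unfolding emb_c_def
    by (rule LIMSEQ_le_const2[OF hdist_cls])
      (use s N that in \<open>auto simp: hcauchy_const hcauchy_carrier intro!: exI[of _ N] less_imp_le\<close>)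
  then show "\<exists>N. \<forall>n\<ge>N. norm (hdist B Q (emb_c (s n)) (cls s) - 0) < \<epsilon>"
    using \<open>\<epsilon> > 0\<close> by (intro exI[of _ N]) fastforce
qed

lemma emb_c_dense:
  assumes "S \<in> carrier Q" "\<epsilon> > 0" shows "\<exists>p\<in>carrier P. hdist B Q (emb_c p) S < \<epsilon>"
proof -
  interpret Q: semi_module B Q by (rule semi_module_completion)
  obtain s where s: "s \<in> hcauchy B P" "S = cls s" using assms(1) by (rule completionE)
  obtain n where "norm (hdist B Q (emb_c (s n)) (cls s) - 0) < \<epsilon>"
    using LIMSEQ_D[OF cls_limit[OF s(1)] assms(2)] by blast
  then show ?thesis using s by (auto simp: hcauchy_carrier)
qed

lemma mcomplete_completion: "Metric_space.mcomplete (carrier Q) (hdist B Q)"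
  unfolding Metric_space.mcomplete_def[OF metric_completion]
proof (intro allI impI)
  interpret Q: semi_module B Q by (rule semi_module_completion)
  fix \<sigma> assume "Metric_space.MCauchy (carrier Q) (hdist B Q) \<sigma>"
  then have r: "\<sigma> n \<in> carrier Q" and C: "\<And>\<epsilon>. \<epsilon> > 0 \<Longrightarrow> \<exists>N. \<forall>m\<ge>N. \<forall>n\<ge>N. hdist B Q (\<sigma> m) (\<sigma> n) < \<epsilon>" for n
    unfolding Metric_space.MCauchy_def[OF metric_completion] by auto
  have "\<exists>p\<in>carrier P. hdist B Q (emb_c p) (\<sigma> n) < 1 / real (Suc n)" for n using emb_c_dense[OF r] by simp
  then obtain p where p: "\<And>n. p n \<in> carrier P" "\<And>n. hdist B Q (emb_c (p n)) (\<sigma> n) < 1 / real (Suc n)"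
    by metis
  have small: "\<exists>N. \<forall>n\<ge>N. 1 / real (Suc n) < \<epsilon>" if "\<epsilon> > 0" for \<epsilon> :: real
    using LIMSEQ_D[OF LIMSEQ_inverse_real_of_nat that] by (simp add: inverse_eq_divide)
  have ph: "p \<in> hcauchy B P"
  proof (rule hcauchyI)
    fix \<epsilon> :: real assume e: "\<epsilon> > 0"
    obtain N M where NM: "\<forall>m\<ge>N. \<forall>n\<ge>N. hdist B Q (\<sigma> m) (\<sigma> n) < \<epsilon>/3" "\<forall>n\<ge>M. 1 / real (Suc n) < \<epsilon>/3"
      using C[of "\<epsilon>/3"] small[of "\<epsilon>/3"] e by auto
    show "\<exists>N. \<forall>m\<ge>N. \<forall>n\<ge>N. hd' (p m) (p n) < \<epsilon>"
    proof (intro exI[of _ "max N M"] allI impI)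
      fix m n assume mn: "max N M \<le> m" "max N M \<le> n"
      have "hd' (p m) (p n) \<le> hdist B Q (emb_c (p m)) (\<sigma> m) + (hdist B Q (\<sigma> m) (\<sigma> n) + hdist B Q (\<sigma> n) (emb_c (p n)))"
        using Q.hdist_triangle[of "emb_c (p m)" "\<sigma> m" "emb_c (p n)"]
          Q.hdist_triangle[of "\<sigma> m" "\<sigma> n" "emb_c (p n)"] by (simp add: p r hdist_emb_c)
      moreover have "hdist B Q (emb_c (p m)) (\<sigma> m) < \<epsilon>/3" "hdist B Q (\<sigma> n) (emb_c (p n)) < \<epsilon>/3"
        "hdist B Q (\<sigma> m) (\<sigma> n) < \<epsilon>/3"
        using p(2)[of m] p(2)[of n] NM mn by (auto simp: Q.hdist_commute[of "\<sigma> n"] intro: less_trans)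
      ultimately show "hd' (p m) (p n) < \<epsilon>" by linarith
    qed
  qed (rule p)
  have "(\<lambda>n. 1 / real (Suc n) + hdist B Q (emb_c (p n)) (cls p)) \<longlonglongrightarrow> 0 + 0"
    using LIMSEQ_inverse_real_of_nat cls_limit[OF ph] by (intro tendsto_intros) (simp_all add: inverse_eq_divide)
  moreover have "hdist B Q (\<sigma> n) (cls p) \<le> 1 / real (Suc n) + hdist B Q (emb_c (p n)) (cls p)" for n
    using Q.hdist_triangle[of "\<sigma> n" "emb_c (p n)" "cls p"] p(2)[of n] ph p(1) r
    by (simp add: Q.hdist_commute[of "\<sigma> n"])
  ultimately have "(\<lambda>n. hdist B Q (\<sigma> n) (cls p)) \<longlonglongrightarrow> 0"
    by - (erule null_cmp, auto)
  then show "\<exists>x. limitin (Metric_space.mtopology (carrier Q) (hdist B Q)) \<sigma> x sequentially"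
    unfolding Metric_space.limit_metric_sequentially[OF metric_completion]
    using ph r by (intro exI[of _ "cls p"]) (auto simp: lim_sequentially)
qed

theorem hilbert_module_completion: "hilbert_module B Q"
proof -
  interpret Q: semi_module B Q by (rule semi_module_completion)
  note hc = hcauchy_add hcauchy_smult hcauchy_ract hcauchy_const[OF zero_closed] hcauchy_carrier
  note ops = add_cls smult_cls ract_cls zero_cls
  note balg = cm.csmult_l_distr cm.csmult_r_distr cm.csmult_assoc a_ac distr_left distr_right
    smult_mult_left smult_mult_right mult_assoc
  have ab: "abelian_group Q"
  proof (rule abelian_groupI)
    fix x assume "x \<in> carrier Q"
    then obtain s where s: "s \<in> hcauchy B P" "x = cls s" by (rule completionE)
    show "\<zero>\<^bsub>Q\<^esub> \<oplus>\<^bsub>Q\<^esub> x = x"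
      using s by (simp add: ops hc ) (rule cls_eqI, auto simp: eqv_def inner_simps hc)
    show "\<exists>y\<in>carrier Q. y \<oplus>\<^bsub>Q\<^esub> x = \<zero>\<^bsub>Q\<^esub>"
    proof (rule bexI[of _ "(-1) \<odot>\<^bsub>Q\<^esub> x"])
      show "(-1) \<odot>\<^bsub>Q\<^esub> x \<oplus>\<^bsub>Q\<^esub> x = \<zero>\<^bsub>Q\<^esub>"
        using s by (simp add: ops hc) (rule cls_eqI, auto simp: eqv_def inner_simps hc a_comm)
      show "(-1) \<odot>\<^bsub>Q\<^esub> x \<in> carrier Q" using \<open>x \<in> carrier Q\<close> by simp
    qed
  next
    fix x y assume "x \<in> carrier Q" "y \<in> carrier Q"
    then obtain s t where s: "s \<in> hcauchy B P" "x = cls s" "t \<in> hcauchy B P" "y = cls t" by (metis completionE)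
    show "x \<oplus>\<^bsub>Q\<^esub> y = y \<oplus>\<^bsub>Q\<^esub> x"
      using s by (simp add: ops hc ) (rule cls_eqI, auto simp: eqv_def inner_simps hc a_ac)
    fix z assume "z \<in> carrier Q"
    then obtain u where u: "u \<in> hcauchy B P" "z = cls u" by (rule completionE)
    show "(x \<oplus>\<^bsub>Q\<^esub> y) \<oplus>\<^bsub>Q\<^esub> z = x \<oplus>\<^bsub>Q\<^esub> (y \<oplus>\<^bsub>Q\<^esub> z)"
      using s u by (simp add: ops hc ) (rule cls_eqI, auto simp: eqv_def inner_simps hc a_ac)
  qed auto
  have md: "module complex_ring Q"
  proof (rule moduleI[OF cring_class ab])
    fix z w :: complex and x y
    assume x: "x \<in> carrier Q"
    then obtain s where s: "s \<in> hcauchy B P" "x = cls s" by (rule completionE)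
    show "z \<odot>\<^bsub>Q\<^esub> x \<in> carrier Q" using x by simp
    show "(z \<oplus>\<^bsub>complex_ring\<^esub> w) \<odot>\<^bsub>Q\<^esub> x = z \<odot>\<^bsub>Q\<^esub> x \<oplus>\<^bsub>Q\<^esub> w \<odot>\<^bsub>Q\<^esub> x"
      using s by (simp add: ops hc plus_class) (rule cls_eqI, auto simp: eqv_def inner_simps hc balg)
    show "(z \<otimes>\<^bsub>complex_ring\<^esub> w) \<odot>\<^bsub>Q\<^esub> x = z \<odot>\<^bsub>Q\<^esub> (w \<odot>\<^bsub>Q\<^esub> x)"
      using s by (simp add: ops hc times_class) (rule cls_eqI, auto simp: eqv_def inner_simps hc balg)
    show "\<one>\<^bsub>complex_ring\<^esub> \<odot>\<^bsub>Q\<^esub> x = x"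
      using s by (simp add: ops hc one_class) (rule cls_eqI, auto simp: eqv_def inner_simps hc balg)
    assume y: "y \<in> carrier Q"
    then obtain t where t: "t \<in> hcauchy B P" "y = cls t" by (rule completionE)
    show "z \<odot>\<^bsub>Q\<^esub> (x \<oplus>\<^bsub>Q\<^esub> y) = z \<odot>\<^bsub>Q\<^esub> x \<oplus>\<^bsub>Q\<^esub> z \<odot>\<^bsub>Q\<^esub> y"
      using s t by (simp add: ops hc ) (rule cls_eqI, auto simp: eqv_def inner_simps hc balg)
  qed
  show ?thesis
  proof (intro hilbert_module.intro hilbert_module_axioms.intro cstar_algebra_axioms md mcomplete_completion
      Q.ract_closed Q.inner_closed Q.inner_add Q.inner_smult Q.inner_ract Q.inner_star Q.inner_pos)
    fix x y b c z assume x: "x \<in> carrier Q"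
    then obtain s where s: "s \<in> hcauchy B P" "x = cls s" by (rule completionE)
    { assume "inner Q x x = \<zero>\<^bsub>B\<^esub>"
      then have "hdist B Q x \<zero>\<^bsub>Q\<^esub> = 0" using x by (simp flip: Q.hnorm_hdist) (simp add: hnorm_def)
      then show "x = \<zero>\<^bsub>Q\<^esub>" using Metric_space.zero[OF metric_completion x Q.zero_closed] by simp }
    assume b: "b \<in> carrier B"
    show "ract Q x (z \<odot>\<^bsub>B\<^esub> b) = z \<odot>\<^bsub>Q\<^esub> ract Q x b" for z
      using s b by (simp add: ops hc) (rule cls_eqI, auto simp: eqv_def inner_simps hc balg)
    show "ract Q (z \<odot>\<^bsub>Q\<^esub> x) b = z \<odot>\<^bsub>Q\<^esub> ract Q x b"
      using s b by (simp add: ops hc ) (rule cls_eqI, auto simp: eqv_def inner_simps hc balg)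
    { assume y: "y \<in> carrier Q"
      then obtain t where t: "t \<in> hcauchy B P" "y = cls t" by (rule completionE)
      show "ract Q (x \<oplus>\<^bsub>Q\<^esub> y) b = ract Q x b \<oplus>\<^bsub>Q\<^esub> ract Q y b"
        using s t b by (simp add: ops hc ) (rule cls_eqI, auto simp: eqv_def inner_simps hc balg) }
    assume c: "c \<in> carrier B"
    show "ract Q x (b \<oplus>\<^bsub>B\<^esub> c) = ract Q x b \<oplus>\<^bsub>Q\<^esub> ract Q x c"
      using s b c by (simp add: ops hc) (rule cls_eqI, auto simp: eqv_def inner_simps hc balg)
    show "ract Q x (b \<otimes>\<^bsub>B\<^esub> c) = ract Q (ract Q x b) c"
      using s b c by (simp add: ops hc) (rule cls_eqI, auto simp: eqv_def inner_simps hc balg)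
  qed auto
qed

end

section \<open>C*-modules and their operators\<close>

context hilbert_module
begin

sublocale semi_module B X
proof (intro semi_module.intro form_module.intro form_module_axioms.intro semi_module_axioms.intro)
  show "cstar_algebra B" by (rule B.cstar_algebra_axioms)
  interpret cX: cmodule X by (rule cmoduleI) (rule X.module_axioms)
  fix x y w z b
  show "\<zero>\<^bsub>X\<^esub> \<in> carrier X" by simp
  show "x \<in> carrier X \<Longrightarrow> y \<in> carrier X \<Longrightarrow> x \<oplus>\<^bsub>X\<^esub> y \<in> carrier X" by simp
  show "x \<in> carrier X \<Longrightarrow> z \<odot>\<^bsub>X\<^esub> x \<in> carrier X" by simp
  show "x \<in> carrier X \<Longrightarrow> inner X x \<zero>\<^bsub>X\<^esub> = \<zero>\<^bsub>B\<^esub>"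
    using inner_smult[of x "\<zero>\<^bsub>X\<^esub>" 0] by (simp add: inner_closed)
qed (fact ract_closed inner_closed inner_add inner_smult inner_ract inner_star inner_pos)+

sublocale cX: cmodule X
  by (rule cmoduleI) (rule X.module_axioms)

lemma inner_eqI:
  assumes "x \<in> carrier X" "y \<in> carrier X" "\<And>w. w \<in> carrier X \<Longrightarrow> inner X w x = inner X w y" shows "x = y"
proof -
  let ?d = "x \<oplus>\<^bsub>X\<^esub> (-1) \<odot>\<^bsub>X\<^esub> y"
  have "inner X ?d ?d = \<zero>\<^bsub>B\<^esub>" using assms by (simp add: inner_minus)
  then have "?d = \<zero>\<^bsub>X\<^esub>" using assms by (intro inner_definite) auto
  then show ?thesis using assms by (simp add: cX.add_m1_eq_zero)
qed

lemma inner_eqI_left: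
  assumes "x \<in> carrier X" "y \<in> carrier X" "\<And>w. w \<in> carrier X \<Longrightarrow> inner X x w = inner X y w" shows "x = y"
  using assms by (intro inner_eqI) (simp_all flip: inner_star[of x] inner_star[of y])

lemma eqv_eq: "eqv x y \<Longrightarrow> x = y"
  by (rule inner_eqI) (auto simp: eqv_def)

lemma metric: "Metric_space (carrier X) (hdist B X)"
  by (rule metric_of_definite) (simp add: hdist_zero_iff eqv_eq)

lemma hdist_zeroD: "x \<in> carrier X \<Longrightarrow> y \<in> carrier X \<Longrightarrow> hdist B X x y = 0 \<Longrightarrow> x = y"
  by (simp add: hdist_zero_iff eqv_eq)

lemma hcauchy_limit:
  assumes "s \<in> hcauchy B X" shows "\<exists>x\<in>carrier X. (\<lambda>n. hdist B X (s n) x) \<longlonglongrightarrow> 0"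
proof -
  have "Metric_space.MCauchy (carrier X) (hdist B X) s"
    unfolding Metric_space.MCauchy_def[OF metric] using assms by (auto simp: hcauchy_def)
  then obtain a where "limitin (Metric_space.mtopology (carrier X) (hdist B X)) s a sequentially"
    using complete unfolding Metric_space.mcomplete_def[OF metric] by blast
  then have "a \<in> carrier X" "(\<lambda>n. hdist B X (s n) a) \<longlonglongrightarrow> 0"
    unfolding Metric_space.limit_metric_sequentially[OF metric] lim_sequentially by (simp_all, meson)
  then show ?thesis by blast
qed

lemma hcauchy_of_limit:
  assumes c: "\<And>n. s n \<in> carrier X" "x \<in> carrier X" and lim: "(\<lambda>n. hdist B X (s n) x) \<longlonglongrightarrow> 0"
  shows "s \<in> hcauchy B X"
proof (rule hcauchyI[OF c(1)])
  fix \<epsilon> :: real assume "\<epsilon> > 0"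
  then obtain N where N: "\<And>n. n \<ge> N \<Longrightarrow> hdist B X (s n) x < \<epsilon>/2"
    using LIMSEQ_D[OF lim, of "\<epsilon>/2"] by auto
  show "\<exists>N. \<forall>m\<ge>N. \<forall>n\<ge>N. hdist B X (s m) (s n) < \<epsilon>"
  proof (intro exI[of _ N] allI impI)
    fix m n assume "N \<le> m" "N \<le> n"
    then show "hdist B X (s m) (s n) < \<epsilon>"
      using N[of m] N[of n] hdist_triangle[of "s m" x "s n"] c by (simp add: hdist_commute)
  qed
qed

lemma tends_inner:
  assumes "\<And>n. s n \<in> carrier X" "x \<in> carrier X" "(\<lambda>n. hdist B X (s n) x) \<longlonglongrightarrow> 0" "w \<in> carrier X"
  shows "B.tends (\<lambda>n. inner X (s n) w) (inner X x w)"
proof -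
  have "(\<lambda>n. hdist B X (s n) x * hnorm B X w) \<longlonglongrightarrow> 0 * hnorm B X w"
    using assms by (intro tendsto_intros)
  moreover have "cdist B (inner X (s n) w) (inner X x w) \<le> hdist B X (s n) x * hnorm B X w" for n
    using cdist_inner[of "s n" w x w] assms by simp
  ultimately have "(\<lambda>n. cdist B (inner X (s n) w) (inner X x w)) \<longlonglongrightarrow> 0" by - (erule null_cmp, auto)
  then show ?thesis using assms by (simp add: B.tends_def)
qed

subsection \<open>Closed spans\<close>

text \<open>Membership in a closed span is used through the least closed subspace principle
  \<open>closed_span_least\<close>.\<close>

definition closed_subspace :: "'x set \<Rightarrow> bool" where
  "closed_subspace C \<longleftrightarrow> C \<subseteq> carrier X \<and> \<zero>\<^bsub>X\<^esub> \<in> C \<and> (\<forall>x\<in>C. \<forall>y\<in>C. x \<oplus>\<^bsub>X\<^esub> y \<in> C) \<and>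
     (\<forall>z. \<forall>x\<in>C. z \<odot>\<^bsub>X\<^esub> x \<in> C) \<and> (\<forall>x\<in>carrier X. (\<forall>\<epsilon>>0. \<exists>y\<in>C. hdist B X y x < \<epsilon>) \<longrightarrow> x \<in> C)"

lemma lin_span_carrier:
  assumes S: "S \<subseteq> carrier X" and x: "x \<in> lin_span X S" shows "x \<in> carrier X"
  using x by induct (use S in auto)

lemma closed_span_iff:
  assumes "S \<subseteq> carrier X"
  shows "x \<in> closed_span B X S \<longleftrightarrow> x \<in> carrier X \<and> (\<forall>\<epsilon>>0. \<exists>s\<in>lin_span X S. hdist B X s x < \<epsilon>)"
  unfolding closed_span_def Metric_space.metric_closure_of[OF metric]
  using lin_span_carrier[OF assms] by (auto simp: Metric_space.in_mball[OF metric] hdist_commute)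

lemma closed_span_carrier: "S \<subseteq> carrier X \<Longrightarrow> closed_span B X S \<subseteq> carrier X"
  by (auto simp: closed_span_iff)

lemma closed_span_gen: "S \<subseteq> carrier X \<Longrightarrow> x \<in> S \<Longrightarrow> x \<in> closed_span B X S"
  unfolding closed_span_iff using hdist_self[of x] lin_span.gen[of x S X] by (metis subsetD)

lemma closed_span_least:
  assumes S: "S \<subseteq> C" and C: "closed_subspace C" shows "closed_span B X S \<subseteq> C"
proof
  fix x assume x: "x \<in> closed_span B X S"
  have SX: "S \<subseteq> carrier X" using S C by (auto simp: closed_subspace_def)
  have "s \<in> C" if "s \<in> lin_span X S" for s
    using that by induct (use S C in \<open>auto simp: closed_subspace_def\<close>)
  then show "x \<in> C" using x C unfolding closed_span_iff[OF SX] closed_subspace_def by metis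
qed

lemma closed_subspace_closed_span:
  assumes S: "S \<subseteq> carrier X" shows "closed_subspace (closed_span B X S)"
  unfolding closed_subspace_def
proof (intro conjI ballI allI impI)
  note sc = lin_span_carrier[OF S]
  note csI = closed_span_iff[OF S, THEN iffD2, OF conjI]
  show "closed_span B X S \<subseteq> carrier X" using S by (rule closed_span_carrier)
  show "\<zero>\<^bsub>X\<^esub> \<in> closed_span B X S"
    by (rule csI) (auto intro!: bexI[of _ "\<zero>\<^bsub>X\<^esub>"] lin_span.zero)
  fix x assume x: "x \<in> closed_span B X S"
  have xc: "x \<in> carrier X" using x closed_span_carrier[OF S] by blast
  show "z \<odot>\<^bsub>X\<^esub> x \<in> closed_span B X S" for z
  proof -
    have "\<exists>s\<in>lin_span X S. hdist B X s (z \<odot>\<^bsub>X\<^esub> x) < \<epsilon>" if e: "\<epsilon> > 0" for \<epsilon>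
    proof -
      have "\<epsilon> / (cmod z + 1) > 0" using e by (simp add: add_nonneg_pos)
      then obtain s where s: "s \<in> lin_span X S" "hdist B X s x < \<epsilon> / (cmod z + 1)"
        using x[unfolded closed_span_iff[OF S]] by blast
      have "hdist B X (z \<odot>\<^bsub>X\<^esub> s) (z \<odot>\<^bsub>X\<^esub> x) = cmod z * hdist B X s x"
        using s xc sc by (simp add: hdist_smult)
      also have "\<dots> \<le> (cmod z + 1) * hdist B X s x" by (intro mult_right_mono) auto
      also have "\<dots> < \<epsilon>" using s(2) by (simp add: pos_less_divide_eq add_nonneg_pos mult.commute)
      finally show ?thesis by (rule bexI[OF _ lin_span.smult[OF s(1)]])
    qed
    then show ?thesis using xc by (intro csI) auto
  qed
  show "x \<oplus>\<^bsub>X\<^esub> y \<in> closed_span B X S" if y: "y \<in> closed_span B X S" for y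
  proof -
    have yc: "y \<in> carrier X" using y closed_span_carrier[OF S] by blast
    have "\<exists>s\<in>lin_span X S. hdist B X s (x \<oplus>\<^bsub>X\<^esub> y) < \<epsilon>" if "\<epsilon> > 0" for \<epsilon>
    proof -
      have e: "\<epsilon>/2 > 0" using that by simp
      obtain s where s: "s \<in> lin_span X S" "hdist B X s x < \<epsilon>/2"
        using x[unfolded closed_span_iff[OF S]] e by blast
      obtain t where t: "t \<in> lin_span X S" "hdist B X t y < \<epsilon>/2"
        using y[unfolded closed_span_iff[OF S]] e by blast
      have "hdist B X (s \<oplus>\<^bsub>X\<^esub> t) (x \<oplus>\<^bsub>X\<^esub> y) < \<epsilon>"
        using hdist_add[of s t x y] s t xc yc sc by simp
      then show ?thesis by (rule bexI[OF _ lin_span.add[OF s(1) t(1)]])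
    qed
    then show ?thesis using xc yc by (intro csI) auto
  qed
next
  fix x assume x: "x \<in> carrier X" and *: "\<forall>\<epsilon>>0. \<exists>y\<in>closed_span B X S. hdist B X y x < \<epsilon>"
  have "\<exists>s\<in>lin_span X S. hdist B X s x < \<epsilon>" if "\<epsilon> > 0" for \<epsilon>
  proof -
    obtain y where y: "y \<in> closed_span B X S" "hdist B X y x < \<epsilon>/2" using * \<open>\<epsilon> > 0\<close> half_gt_zero by blast
    then obtain s where s: "s \<in> lin_span X S" "hdist B X s y < \<epsilon>/2"
      using y(1)[unfolded closed_span_iff[OF S]] half_gt_zero[OF \<open>\<epsilon> > 0\<close>] by blast
    then show ?thesis using hdist_triangle[of s y x] y x lin_span_carrier[OF S] closed_span_iff[OF S]
      by (intro bexI[of _ s]) auto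
  qed
  then show "x \<in> closed_span B X S" using x closed_span_iff[OF S] by blast
qed

definition total :: "'x set \<Rightarrow> bool" where
  "total S \<longleftrightarrow> S \<subseteq> carrier X \<and> closed_span B X S = carrier X"

text \<open>The standard way to prove a closed linear condition for all vectors.\<close>

lemma total_induct: "total S \<Longrightarrow> closed_subspace C \<Longrightarrow> S \<subseteq> C \<Longrightarrow> x \<in> carrier X \<Longrightarrow> x \<in> C"
  using closed_span_least[of S C] by (auto simp: total_def)

lemma totalI:
  assumes "S \<subseteq> carrier X" "\<And>C. closed_subspace C \<Longrightarrow> S \<subseteq> C \<Longrightarrow> carrier X \<subseteq> C" shows "total S"
  using assms closed_span_carrier[OF assms(1)] closed_subspace_closed_span[OF assms(1)] closed_span_gen[OF assms(1)]
  by (auto simp: total_def)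

text \<open>A subspace given by a condition that is continuous in \<open>x\<close>.\<close>

lemma closed_subspaceI:
  assumes "C \<subseteq> carrier X" "\<zero>\<^bsub>X\<^esub> \<in> C" "\<And>x y. x \<in> C \<Longrightarrow> y \<in> C \<Longrightarrow> x \<oplus>\<^bsub>X\<^esub> y \<in> C" "\<And>z x. x \<in> C \<Longrightarrow> z \<odot>\<^bsub>X\<^esub> x \<in> C"
    and lim: "\<And>s x. (\<And>n::nat. s n \<in> C) \<Longrightarrow> x \<in> carrier X \<Longrightarrow> (\<lambda>n. hdist B X (s n) x) \<longlonglongrightarrow> 0 \<Longrightarrow> x \<in> C"
  shows "closed_subspace C"
proof -
  have "x \<in> C" if x: "x \<in> carrier X" and *: "\<forall>\<epsilon>>0. \<exists>y\<in>C. hdist B X y x < \<epsilon>" for x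
  proof -
    have "\<exists>y\<in>C. hdist B X y x < inverse (real (Suc n))" for n using * by simp
    then obtain s where s: "\<And>n. s n \<in> C" "\<And>n. hdist B X (s n) x < inverse (real (Suc n))" by metis
    have "(\<lambda>n. hdist B X (s n) x) \<longlonglongrightarrow> 0"
      using LIMSEQ_inverse_real_of_nat s(2) by - (erule null_cmp, auto intro: less_imp_le)
    then show ?thesis using lim s(1) x by blast
  qed
  with assms(1-4) show ?thesis unfolding closed_subspace_def by blast
qed

lemma closed_subspace_inner_eq:
  assumes "y \<in> carrier X" "y' \<in> carrier X"
  shows "closed_subspace {w \<in> carrier X. inner X w y = inner X w y'}"
proof (rule closed_subspaceI)
  fix s x assume s: "\<And>n::nat. s n \<in> {w \<in> carrier X. inner X w y = inner X w y'}"
    and x: "x \<in> carrier X" "(\<lambda>n. hdist B X (s n) x) \<longlonglongrightarrow> 0"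
  have sc: "s n \<in> carrier X" for n using s by blast
  have "B.tends (\<lambda>n. inner X (s n) y) (inner X x y)" "B.tends (\<lambda>n. inner X (s n) y') (inner X x y')"
    by (rule tends_inner[OF sc x assms(1)], rule tends_inner[OF sc x assms(2)])
  then show "x \<in> {w \<in> carrier X. inner X w y = inner X w y'}" using B.tends_unique s x by simp
qed (use assms in \<open>auto simp: inner_simps\<close>)

lemma total_eqI:
  assumes "total S" "y \<in> carrier X" "y' \<in> carrier X" "\<And>s. s \<in> S \<Longrightarrow> inner X s y = inner X s y'"
  shows "y = y'"
proof (rule inner_eqI)
  have "S \<subseteq> carrier X" using assms(1) by (simp add: total_def)
  then have "S \<subseteq> {w \<in> carrier X. inner X w y = inner X w y'}" using assms(4) by auto
  from total_induct[OF assms(1) closed_subspace_inner_eq[OF assms(2,3)] this]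
  show "inner X w y = inner X w y'" if "w \<in> carrier X" for w using that by blast
qed (use assms in auto)

lemma lin_span_seq:
  assumes "total S" "x \<in> carrier X"
  obtains s where "\<And>n::nat. s n \<in> lin_span X S" "(\<lambda>n. hdist B X (s n) x) \<longlonglongrightarrow> 0"
proof -
  have SX: "S \<subseteq> carrier X" using assms by (simp add: total_def)
  have "\<exists>y\<in>lin_span X S. hdist B X y x < inverse (real (Suc n))" for n
    using assms closed_span_iff[OF SX, of x] by (auto simp: total_def)
  then obtain s where s: "\<And>n. s n \<in> lin_span X S" "\<And>n. hdist B X (s n) x < inverse (real (Suc n))" by metis
  have "(\<lambda>n. hdist B X (s n) x) \<longlonglongrightarrow> 0"
    using LIMSEQ_inverse_real_of_nat s(2) by - (erule null_cmp, auto intro: less_imp_le)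
  then show ?thesis using that s(1) by blast
qed

end

subsection \<open>Unitaries from Gram matrices\<close>

text \<open>If two total families have the same inner products, then the closure of the linear relation that
  pairs their members is the graph of a unitary.  Instead of extending a map from the span, the relation
  is defined by its inner products with the families; it is closed from the start.\<close>

lemma gram_extension:
  fixes X :: "('b, 'x) hmod" and Y :: "('b, 'y) hmod" and f :: "'i \<Rightarrow> 'x" and g :: "'i \<Rightarrow> 'y"
  assumes "hilbert_module B X" "hilbert_module B Y"
    and tf: "hilbert_module.total B X (f ` I)" and tg: "hilbert_module.total B Y (g ` I)"
    and gram: "\<And>i j. i \<in> I \<Longrightarrow> j \<in> I \<Longrightarrow> inner X (f i) (f j) = inner Y (g i) (g j)"
  defines "rel \<equiv> \<lambda>x y. x \<in> carrier X \<and> y \<in> carrier Y \<and> (\<forall>i\<in>I. inner X (f i) x = inner Y (g i) y)"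
  assumes x: "x \<in> carrier X"
  shows "\<exists>y. rel x y \<and> (\<forall>x' y'. rel x' y' \<longrightarrow> inner X x x' = inner Y y y')"
proof -
  interpret X: hilbert_module B X by fact
  interpret Y: hilbert_module B Y by fact
  have fX: "f i \<in> carrier X" and gY: "g i \<in> carrier Y" if "i \<in> I" for i
    using tf tg that by (auto simp: X.total_def Y.total_def)
  \<comment> \<open>pairs in the relation whose inner products with all other pairs agree, not only those with the families\<close>
  define good where "good x y \<longleftrightarrow> rel x y \<and> (\<forall>x' y'. rel x' y' \<longrightarrow> inner X x x' = inner Y y y')" for x y
  have relD: "x \<in> carrier X" "y \<in> carrier Y" "i \<in> I \<Longrightarrow> inner X (f i) x = inner Y (g i) y" if "rel x y" for x y i
    using that by (auto simp: rel_def)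
  have goodD: "rel x y" "rel x' y' \<Longrightarrow> inner X x x' = inner Y y y'" if "good x y" for x y x' y'
    using that by (auto simp: good_def)
  have goodI: "good x y" if "x \<in> carrier X" "y \<in> carrier Y" "\<And>i. i \<in> I \<Longrightarrow> inner X (f i) x = inner Y (g i) y"
    "\<And>x' y'. rel x' y' \<Longrightarrow> inner X x x' = inner Y y y'" for x y
    using that unfolding good_def rel_def by blast
  have good_add: "good (x \<oplus>\<^bsub>X\<^esub> x') (y \<oplus>\<^bsub>Y\<^esub> y')" if g: "good x y" "good x' y'" for x x' y y'
  proof (rule goodI)
    note r = relD[OF goodD(1)[OF g(1)]] relD[OF goodD(1)[OF g(2)]]
    show "x \<oplus>\<^bsub>X\<^esub> x' \<in> carrier X" "y \<oplus>\<^bsub>Y\<^esub> y' \<in> carrier Y" using r by auto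
    show "inner X (f i) (x \<oplus>\<^bsub>X\<^esub> x') = inner Y (g i) (y \<oplus>\<^bsub>Y\<^esub> y')" if "i \<in> I" for i
      using r that by (simp add: X.inner_simps Y.inner_simps fX gY)
    show "inner X (x \<oplus>\<^bsub>X\<^esub> x') u = inner Y (y \<oplus>\<^bsub>Y\<^esub> y') v" if "rel u v" for u v
      using r relD(1,2)[OF that] goodD(2)[OF g(1) that] goodD(2)[OF g(2) that]
      by (simp add: X.inner_simps Y.inner_simps)
  qed
  have good_smult: "good (z \<odot>\<^bsub>X\<^esub> x) (z \<odot>\<^bsub>Y\<^esub> y)" if g: "good x y" for x y z
  proof (rule goodI)
    note r = relD[OF goodD(1)[OF g]]
    show "z \<odot>\<^bsub>X\<^esub> x \<in> carrier X" "z \<odot>\<^bsub>Y\<^esub> y \<in> carrier Y" using r by auto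
    show "inner X (f i) (z \<odot>\<^bsub>X\<^esub> x) = inner Y (g i) (z \<odot>\<^bsub>Y\<^esub> y)" if "i \<in> I" for i
      using r that by (simp add: X.inner_simps Y.inner_simps fX gY)
    show "inner X (z \<odot>\<^bsub>X\<^esub> x) u = inner Y (z \<odot>\<^bsub>Y\<^esub> y) v" if "rel u v" for u v
      using r relD(1,2)[OF that] goodD(2)[OF g that] by (simp add: X.inner_simps Y.inner_simps)
  qed
  have span: "\<exists>y. good s y" if "s \<in> lin_span X (f ` I)" for s
    using that
  proof induct
    case zero
    have "good \<zero>\<^bsub>X\<^esub> \<zero>\<^bsub>Y\<^esub>" by (auto simp: good_def rel_def fX gY)
    then show ?case by blast
  next
    case (gen s)
    then obtain i where i: "i \<in> I" "s = f i" by auto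
    have "good (f i) (g i)" using i by (auto simp: good_def rel_def fX gY gram)
    then show ?case using i by blast
  next
    case (add s t) then show ?case using good_add by blast
  next
    case (smult s z) then show ?case using good_smult by blast
  qed
  obtain s where s: "\<And>n::nat. s n \<in> lin_span X (f ` I)" "(\<lambda>n. hdist B X (s n) x) \<longlonglongrightarrow> 0"
    using X.lin_span_seq[OF tf x] by blast
  have "\<forall>n. \<exists>y. good (s n) y" using span[OF s(1)] by blast
  then obtain t where t: "\<And>n. good (s n) (t n)" by metis
  have sc: "s n \<in> carrier X" and tc: "t n \<in> carrier Y" for n using relD goodD(1)[OF t] by blast+
  have hn: "hnorm B X u = hnorm B Y v" if "good u v" for u v
    using goodD[OF that] by (simp add: hnorm_def)
  have "hdist B Y (t m) (t n) = hdist B X (s m) (s n)" for m n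
    using hn[OF good_add[OF t[of m] good_smult[OF t[of n], of "-1"]]] sc tc by (simp add: X.hdist_eq Y.hdist_eq)
  then have "t \<in> hcauchy B Y"
    using X.hcauchy_of_limit[OF sc x s(2)] tc by (auto simp: hcauchy_def)
  then obtain y where y: "y \<in> carrier Y" "(\<lambda>n. hdist B Y (t n) y) \<longlonglongrightarrow> 0" using Y.hcauchy_limit by blast
  have gen: "inner X x x' = inner Y y y'" if r: "rel x' y'" for x' y'
  proof -
    note c = relD(1,2)[OF r]
    have "X.B.tends (\<lambda>n. inner X (s n) x') (inner X x x')" by (rule X.tends_inner) (use sc x s c in auto)
    moreover have "X.B.tends (\<lambda>n. inner Y (t n) y') (inner Y y y')" by (rule Y.tends_inner) (use tc y c in auto)
    moreover have "inner X (s n) x' = inner Y (t n) y'" for n using goodD(2)[OF t r] .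
    ultimately show ?thesis using X.B.tends_unique by simp
  qed
  have "inner X (f i) x = inner Y (g i) y" if "i \<in> I" for i
  proof -
    have "rel (f i) (g i)" using that by (auto simp: rel_def fX gY gram)
    from gen[OF this] show ?thesis
      using that x y by (metis X.inner_star Y.inner_star fX gY)
  qed
  then have "rel x y" using x y by (auto simp: rel_def)
  then show ?thesis using gen by blast
qed

lemma gram_unitary:
  fixes X :: "('b, 'x) hmod" and Y :: "('b, 'y) hmod" and f :: "'i \<Rightarrow> 'x" and g :: "'i \<Rightarrow> 'y"
  assumes hX: "hilbert_module B X" and hY: "hilbert_module B Y"
    and tf: "hilbert_module.total B X (f ` I)" and tg: "hilbert_module.total B Y (g ` I)"
    and gram: "\<And>i j. i \<in> I \<Longrightarrow> j \<in> I \<Longrightarrow> inner X (f i) (f j) = inner Y (g i) (g j)"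
    and rho: "\<And>a. a \<in> carrier A \<Longrightarrow> \<exists>S. is_adjoint X X (\<rho> a) S"
    and sig: "\<And>a. a \<in> carrier A \<Longrightarrow> \<exists>S. is_adjoint Y Y (\<sigma> a) S"
    and act: "\<And>a i j. a \<in> carrier A \<Longrightarrow> i \<in> I \<Longrightarrow> j \<in> I \<Longrightarrow>
      inner X (f i) (\<rho> a (f j)) = inner Y (g i) (\<sigma> a (g j))"
  shows "corr_iso A (\<rho>, X) (\<sigma>, Y)"
proof -
  interpret X: hilbert_module B X by fact
  interpret Y: hilbert_module B Y by fact
  have fX: "f i \<in> carrier X" and gY: "g i \<in> carrier Y" if "i \<in> I" for i
    using tf tg that by (auto simp: X.total_def Y.total_def)
  define rel where "rel = (\<lambda>x y. x \<in> carrier X \<and> y \<in> carrier Y \<and> (\<forall>i\<in>I. inner X (f i) x = inner Y (g i) y))"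
  have unique_right: "y = y'" if "rel x y" "rel x y'" for x y y'
    using that by (intro Y.total_eqI[OF tg]) (auto simp: rel_def)
  have unique_left: "x = x'" if "rel x y" "rel x' y" for x x' y
    using that by (intro X.total_eqI[OF tf]) (auto simp: rel_def)
  have relD: "x \<in> carrier X" "y \<in> carrier Y" if "rel x y" for x y
    using that by (auto simp: rel_def)
  note ext = gram_extension[OF hX hY tf tg gram]
  have ex: "\<exists>y. rel x y" if "x \<in> carrier X" for x
    using ext[OF _ _ that] unfolding rel_def by blast
  have iso: "inner X x x' = inner Y y y'" if "rel x y" "rel x' y'" for x y x' y'
  proof -
    have "x \<in> carrier X" using relD that by blast
    then obtain v where v: "rel x v" "\<And>x' y'. rel x' y' \<Longrightarrow> inner X x x' = inner Y v y'"
      using ext[of x] unfolding rel_def by blast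
    then show ?thesis using that unique_right by blast
  qed
  have ex': "\<exists>x. rel x y" if "y \<in> carrier Y" for y
    using gram_extension[OF hY hX tg tf gram[symmetric] that] unfolding rel_def by metis
  define V where "V x = (THE y. rel x y)" for x
  define W where "W y = (THE x. rel x y)" for y
  have V: "rel x (V x)" if "x \<in> carrier X" for x
    unfolding V_def by (rule theI') (use ex[OF that] unique_right in blast)
  have W: "rel (W y) y" if "y \<in> carrier Y" for y
    unfolding W_def by (rule theI') (use ex'[OF that] unique_left in blast)
  show ?thesis unfolding corr_iso_def prod.case
  proof (intro exI[of _ V] exI[of _ W] conjI ballI)
    show "is_adjoint X Y V W"
      unfolding is_adjoint_def using relD(2)[OF V] relD(1)[OF W] iso[OF V W] by auto
    show "W (V x) = x" if "x \<in> carrier X" for x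
      using V[OF that] W unique_left relD by blast
    show "V (W y) = y" if "y \<in> carrier Y" for y
      using W[OF that] V unique_right relD by blast
    fix a y assume a: "a \<in> carrier A" and y: "y \<in> carrier Y"
    obtain R where R: "is_adjoint X X (\<rho> a) R" using rho[OF a] ..
    obtain S where S: "is_adjoint Y Y (\<sigma> a) S" using sig[OF a] ..
    have x: "W y \<in> carrier X" using W[OF y] relD by blast
    have "rel (\<rho> a (W y)) (\<sigma> a y)"
      unfolding rel_def
    proof (intro conjI ballI)
      show "\<rho> a (W y) \<in> carrier X" "\<sigma> a y \<in> carrier Y" using R S x y by (auto simp: is_adjoint_def)
      fix i assume i: "i \<in> I"
      have Rc: "R (f i) \<in> carrier X" and Sc: "S (g i) \<in> carrier Y"
        using R S fX[OF i] gY[OF i] by (auto simp: is_adjoint_def)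
      have "inner X (f j) (R (f i)) = inner Y (g j) (S (g i))" if j: "j \<in> I" for j
      proof -
        have "inner X (f j) (R (f i)) = inner X (\<rho> a (f j)) (f i)"
          using R fX i j by (simp add: is_adjoint_def)
        also have "\<dots> = star B (inner X (f i) (\<rho> a (f j)))"
          using R fX i j by (subst X.inner_star) (auto simp: is_adjoint_def)
        also have "\<dots> = star B (inner Y (g i) (\<sigma> a (g j)))" using act a i j by simp
        also have "\<dots> = inner Y (\<sigma> a (g j)) (g i)"
          using S gY i j by (subst Y.inner_star) (auto simp: is_adjoint_def)
        also have "\<dots> = inner Y (g j) (S (g i))" using S gY i j by (simp add: is_adjoint_def)
        finally show ?thesis .
      qed
      then have "rel (R (f i)) (S (g i))" using Rc Sc by (auto simp: rel_def)
      from iso[OF W[OF y] this] have "inner X (W y) (R (f i)) = inner Y y (S (g i))" .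
      then have "inner X (\<rho> a (W y)) (f i) = inner Y (\<sigma> a y) (g i)"
        using R S x y fX[OF i] gY[OF i] by (simp add: is_adjoint_def)
      then have "star B (inner X (\<rho> a (W y)) (f i)) = star B (inner Y (\<sigma> a y) (g i))" by simp
      then show "inner X (f i) (\<rho> a (W y)) = inner Y (g i) (\<sigma> a y)"
        using \<open>\<rho> a (W y) \<in> carrier X\<close> \<open>\<sigma> a y \<in> carrier Y\<close> fX[OF i] gY[OF i]
        by (simp add: X.inner_star Y.inner_star)
    qed
    then show "V (\<rho> a (W y)) = \<sigma> a y" using V unique_right relD by blast
  qed
qed

subsection \<open>Adjointable operators\<close>

lemma is_adjoint_sym:
  assumes "hilbert_module B X" "hilbert_module B Y" "is_adjoint X Y T S" shows "is_adjoint Y X S T"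
proof -
  interpret X: hilbert_module B X by fact
  interpret Y: hilbert_module B Y by fact
  show ?thesis unfolding is_adjoint_def
  proof (intro conjI ballI)
    show "S \<in> carrier Y \<rightarrow> carrier X" "T \<in> carrier X \<rightarrow> carrier Y" using assms(3) by (auto simp: is_adjoint_def)
    fix y x assume "y \<in> carrier Y" "x \<in> carrier X"
    then have "star B (inner Y (T x) y) = star B (inner X x (S y))" "T x \<in> carrier Y" "S y \<in> carrier X"
      using assms(3) by (auto simp: is_adjoint_def)
    then show "inner X (S y) x = inner Y y (T x)" using \<open>y \<in> carrier Y\<close> \<open>x \<in> carrier X\<close>
      by (simp add: X.inner_star Y.inner_star)
  qed
qed

context hilbert_module
begin

lemma is_adjointD:
  assumes "is_adjoint X X T S"
  shows "x \<in> carrier X \<Longrightarrow> T x \<in> carrier X" "x \<in> carrier X \<Longrightarrow> S x \<in> carrier X"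
    "x \<in> carrier X \<Longrightarrow> y \<in> carrier X \<Longrightarrow> inner X (T x) y = inner X x (S y)"
    "x \<in> carrier X \<Longrightarrow> y \<in> carrier X \<Longrightarrow> inner X x (T y) = inner X (S x) y"
  using assms is_adjoint_sym[OF hilbert_module_axioms hilbert_module_axioms assms]
  by (auto simp: is_adjoint_def)

lemma is_adjoint_self_sym: "is_adjoint X X T S \<Longrightarrow> is_adjoint X X S T"
  by (rule is_adjoint_sym[OF hilbert_module_axioms hilbert_module_axioms])

lemma adjointable_add:
  assumes "is_adjoint X X T S" "x \<in> carrier X" "y \<in> carrier X" shows "T (x \<oplus>\<^bsub>X\<^esub> y) = T x \<oplus>\<^bsub>X\<^esub> T y"
  by (rule inner_eqI) (use assms in \<open>auto simp: is_adjointD[OF assms(1)] inner_simps\<close>)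

lemma adjointable_smult:
  assumes "is_adjoint X X T S" "x \<in> carrier X" shows "T (z \<odot>\<^bsub>X\<^esub> x) = z \<odot>\<^bsub>X\<^esub> T x"
  by (rule inner_eqI) (use assms in \<open>auto simp: is_adjointD[OF assms(1)] inner_simps\<close>)

lemma adjointable_ract:
  assumes "is_adjoint X X T S" "x \<in> carrier X" "b \<in> carrier B" shows "T (ract X x b) = ract X (T x) b"
  by (rule inner_eqI) (use assms in \<open>auto simp: is_adjointD[OF assms(1)] inner_simps\<close>)

lemma adjointable_zero: assumes "is_adjoint X X T S" shows "T \<zero>\<^bsub>X\<^esub> = \<zero>\<^bsub>X\<^esub>"
  using adjointable_smult[OF assms, of "\<zero>\<^bsub>X\<^esub>" 0] is_adjointD[OF assms] by simp

lemma adjoint_unique: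
  assumes "is_adjoint X X T S" "is_adjoint X X T S'" "x \<in> carrier X" shows "S x = S' x"
  by (rule inner_eqI) (use assms in \<open>auto simp: is_adjointD[OF assms(1)] is_adjointD[OF assms(2)]
      simp flip: is_adjointD(3)[OF assms(1)] is_adjointD(3)[OF assms(2)]\<close>)

lemma hdist_adjointable:
  assumes "is_adjoint X X T S" "x \<in> carrier X" "y \<in> carrier X"
  shows "hdist B X (T x) (T y) = hnorm B X (T (x \<oplus>\<^bsub>X\<^esub> (-1) \<odot>\<^bsub>X\<^esub> y))"
  using assms
  by (simp add: is_adjointD[OF assms(1)] hdist_eq adjointable_add[OF assms(1)] adjointable_smult[OF assms(1)])

text \<open>The sets where \<open>T\<close> is bounded by \<open>n\<close> are closed because \<open>\<langle>x, S(Tx)\<rangle> = \<langle>Tx, Tx\<rangle>\<close>, and they cover the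
  module, so one of them contains a ball.\<close>

lemma adjointable_bounded:
  assumes T: "is_adjoint X X T S"
  shows "\<exists>K\<ge>0. \<forall>x\<in>carrier X. hnorm B X (T x) \<le> K * hnorm B X x"
proof -
  interpret M: Metric_space "carrier X" "hdist B X" by (rule metric)
  note Tc = is_adjointD[OF T]
  define E where "E n = {x \<in> carrier X. hn (T x) \<le> real n}" for n :: nat
  have closed: "closedin M.mtopology (E n)" for n
    unfolding M.closedin_metric
  proof (intro conjI allI impI)
    fix x assume "x \<in> carrier X - E n"
    then have x: "x \<in> carrier X" and big: "hn (T x) > real n" by (auto simp: E_def)
    define v where "v = S (T x)"
    have v: "v \<in> carrier X" using x Tc by (simp add: v_def)
    \<comment> \<open>within this radius the norm of \<open>\<langle>u, v\<rangle>\<close> stays larger than \<open>n \<Parallel>Tx\<Parallel>\<close>; the summand \<open>1\<close> avoids a vanishing denominator\<close>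
    define r where "r = hn (T x) * (hn (T x) - real n) / (hn v + 1)"
    have h0: "hn (T x) > 0" using big by linarith
    have r: "r > 0" using big h0 v hnorm_nonneg[of v] unfolding r_def
      by (intro divide_pos_pos mult_pos_pos) linarith+
    moreover have "disjnt (E n) (M.mball x r)"
    proof (rule ccontr)
      assume "\<not> disjnt (E n) (M.mball x r)"
      then obtain u where u: "u \<in> carrier X" "hn (T u) \<le> real n" "hd' x u < r"
        by (auto simp: disjnt_def E_def)
      have "(hn (T x))\<^sup>2 = nrm B (inner X x v)" using x Tc(1) Tc(3)[of x "T x"] by (simp add: hnorm_sq v_def)
      also have "\<dots> \<le> nrm B (inner X u v) + cdist B (inner X x v) (inner X u v)"
        using B.nrm_cdist_le[of "inner X x v" "inner X u v"] x u v by (simp add: abs_le_iff)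
      finally have f1: "(hn (T x))\<^sup>2 \<le> nrm B (inner X u v) + cdist B (inner X x v) (inner X u v)" .
      have "inner X u v = inner X (T u) (T x)" using x u Tc(1) by (simp add: v_def Tc(3)[of u "T x"])
      then have "nrm B (inner X u v) \<le> hn (T u) * hn (T x)"
        using x u Tc(1) cauchy_schwarz[of "T u" "T x"] by simp
      also have "\<dots> \<le> real n * hn (T x)" using u h0 by (intro mult_right_mono) auto
      finally have f2: "nrm B (inner X u v) \<le> real n * hn (T x)" .
      have f3: "cdist B (inner X x v) (inner X u v) \<le> hd' x u * hn v"
        using cdist_inner[of x v u v] x u v by simp
      from f1 f2 f3 have "(hn (T x))\<^sup>2 \<le> real n * hn (T x) + hd' x u * hn v" by linarith
      moreover have "hd' x u * hn v \<le> hd' x u * (hn v + 1)" by (simp add: algebra_simps)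
      moreover have "hd' x u * (hn v + 1) < r * (hn v + 1)"
        using u v hnorm_nonneg[of v] by (intro mult_strict_right_mono) linarith+
      moreover have "r * (hn v + 1) = hn (T x) * (hn (T x) - real n)"
        using hnorm_nonneg[OF v] unfolding r_def by (simp add: add_nonneg_eq_0_iff)
      moreover have "hn (T x) * (hn (T x) - real n) = (hn (T x))\<^sup>2 - real n * hn (T x)"
        by (simp add: monoid_mult_class.power2_eq_square algebra_simps)
      ultimately show False by linarith
    qed
    ultimately show "\<exists>r>0. disjnt (E n) (M.mball x r)" by blast
  qed (auto simp: E_def)
  have "\<Union>(range E) = carrier X"
    unfolding E_def using real_arch_simple by (auto intro!: exI)
  then have "M.mtopology interior_of \<Union>(range E) \<noteq> {}"
    using interior_of_topspace[of M.mtopology] zero_closed by auto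
  then have "\<exists>n. M.mtopology interior_of (E n) \<noteq> {}"
    using M.metric_Baire_category_alt[of "range E"] complete closed by auto
  then obtain n x0 where "x0 \<in> M.mtopology interior_of (E n)" by blast
  then obtain U where U: "openin M.mtopology U" "x0 \<in> U" "U \<subseteq> E n" by (auto simp: interior_of_def)
  then obtain r where r: "r > 0" "M.mball x0 r \<subseteq> E n" by (meson M.openin_mtopology order_trans)
  have x0: "x0 \<in> carrier X" using U by (auto simp: E_def)
  have "hn (T u) \<le> (4 * real n / r) * hn u" if u: "u \<in> carrier X" for u
  proof (cases "hn u = 0")
    case True
    then have "u = \<zero>\<^bsub>X\<^esub>" using u hdist_zeroD[of u "\<zero>\<^bsub>X\<^esub>"] by (simp add: hnorm_hdist)
    then show ?thesis using True by (simp add: adjointable_zero[OF T])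
  next
    case False
    then have h: "hn u > 0" using hnorm_nonneg[OF u] by simp
    define s where "s = r / (2 * hn u)"
    have s: "s > 0" using h r by (simp add: s_def)
    define w where "w = x0 \<oplus>\<^bsub>X\<^esub> complex_of_real s \<odot>\<^bsub>X\<^esub> u"
    have w: "w \<in> carrier X" using x0 u by (simp add: w_def)
    have dw: "hd' w x0 = s * hn u"
    proof -
      have "w \<oplus>\<^bsub>X\<^esub> (-1) \<odot>\<^bsub>X\<^esub> x0 = complex_of_real s \<odot>\<^bsub>X\<^esub> u"
        using x0 u by (simp add: w_def cX.csmult_m1 X.a_ac X.r_neg1 X.r_neg2)
      then show ?thesis using w x0 u s by (simp add: hdist_eq hnorm_smult)
    qed
    have "hd' x0 w < r" using dw r h by (simp add: hdist_commute[of x0] s_def)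
    then have "w \<in> E n" "x0 \<in> E n" using r x0 w by auto
    then have "hn (T w) + hn (T x0) \<le> 2 * real n" by (simp add: E_def)
    moreover have "s * hn (T u) \<le> hn (T w) + hn (T x0)"
    proof -
      have "hd' (T w) (T x0) = hn (T (complex_of_real s \<odot>\<^bsub>X\<^esub> u))"
        using w x0 u by (simp add: hdist_adjointable[OF T])
          (simp add: w_def cX.csmult_m1 X.a_ac X.r_neg1 X.r_neg2)
      also have "\<dots> = s * hn (T u)" using u s Tc by (simp add: adjointable_smult[OF T] hnorm_smult)
      finally show ?thesis
        using hdist_triangle[of "T w" "\<zero>\<^bsub>X\<^esub>" "T x0"] w x0 Tc by (simp add: hnorm_hdist hdist_commute)
    qed
    ultimately have "s * hn (T u) \<le> 2 * real n" by linarith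
    then show ?thesis using r h by (simp add: s_def field_simps)
  qed
  then show ?thesis using r by (intro exI[of _ "4 * real n / r"]) auto
qed

lemma End_carrier: "T \<in> carrier (End B X) \<longleftrightarrow> T \<in> extensional (carrier X) \<and> (\<exists>S. is_adjoint X X T S)"
  by (simp add: End_def)

lemma EndI: "T \<in> extensional (carrier X) \<Longrightarrow> is_adjoint X X T S \<Longrightarrow> T \<in> carrier (End B X)"
  by (auto simp: End_carrier)

lemma is_adjoint_cong:
  assumes "is_adjoint X X T S" "\<And>x. x \<in> carrier X \<Longrightarrow> T' x = T x" "\<And>x. x \<in> carrier X \<Longrightarrow> S' x = S x"
  shows "is_adjoint X X T' S'"
  using assms by (auto simp: is_adjoint_def Pi_def)

lemma End_star:
  assumes T: "T \<in> carrier (End B X)"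
  shows "is_adjoint X X T (star (End B X) T)" "star (End B X) T \<in> carrier (End B X)"
proof -
  obtain S where S: "is_adjoint X X T S" using T by (auto simp: End_carrier)
  let ?S = "restrict S (carrier X)"
  have S': "is_adjoint X X T ?S" by (rule is_adjoint_cong[OF S]) auto
  have "star (End B X) T = ?S"
    unfolding End_def cstar.simps
  proof (rule the_equality)
    show "U = ?S" if "U \<in> extensional (carrier X) \<and> is_adjoint X X T U" for U
      using that adjoint_unique[OF _ S'] by (intro extensionalityI[of _ "carrier X"]) auto
  qed (use S' in auto)
  then show "is_adjoint X X T (star (End B X) T)" "star (End B X) T \<in> carrier (End B X)"
    using S' is_adjoint_self_sym[OF S'] by (auto intro: EndI)
qed

lemma End_starI:
  assumes "is_adjoint X X T S" "T \<in> extensional (carrier X)" "S \<in> extensional (carrier X)"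
  shows "star (End B X) T = S"
proof -
  have T: "T \<in> carrier (End B X)" using assms by (auto intro: EndI)
  have "star (End B X) T \<in> extensional (carrier X)" using End_star(2)[OF T] by (simp add: End_carrier)
  then show ?thesis using assms adjoint_unique[OF End_star(1)[OF T] assms(1)]
    by (intro extensionalityI[of _ "carrier X"]) auto
qed

lemma End_ext: "T \<in> carrier (End B X) \<Longrightarrow> T \<in> extensional (carrier X)"
  by (simp add: End_carrier)

lemma End_eqI:
  assumes "S \<in> carrier (End B X)" "T \<in> carrier (End B X)" "\<And>x. x \<in> carrier X \<Longrightarrow> S x = T x" shows "S = T"
  using assms by (intro extensionalityI[of _ "carrier X"]) (auto simp: End_ext)

lemma End_in [simp]: "T \<in> carrier (End B X) \<Longrightarrow> x \<in> carrier X \<Longrightarrow> T x \<in> carrier X"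
  by (rule is_adjointD(1)[OF End_star(1)])

lemma End_apply:
  "x \<in> carrier X \<Longrightarrow> (S \<otimes>\<^bsub>E\<^esub> T) x = S (T x)"
  "x \<in> carrier X \<Longrightarrow> (S \<oplus>\<^bsub>E\<^esub> T) x = S x \<oplus>\<^bsub>X\<^esub> T x"
  "x \<in> carrier X \<Longrightarrow> (z \<odot>\<^bsub>E\<^esub> T) x = z \<odot>\<^bsub>X\<^esub> T x"
  "x \<in> carrier X \<Longrightarrow> \<zero>\<^bsub>E\<^esub> x = \<zero>\<^bsub>X\<^esub>" if "E = End B X"
  by (simp_all add: that End_def compose_eq)

lemmas End_app [simp] = End_apply[OF refl]

lemma End_inner:
  assumes "T \<in> carrier (End B X)" "x \<in> carrier X" "y \<in> carrier X"
  shows "inner X (star (End B X) T x) y = inner X x (T y)" "inner X x (star (End B X) T y) = inner X (T x) y"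
  using is_adjointD(3,4)[OF End_star(1)[OF assms(1)]] assms(2,3) by simp_all

lemma End_closed:
  "S \<in> carrier E \<Longrightarrow> T \<in> carrier E \<Longrightarrow> S \<otimes>\<^bsub>E\<^esub> T \<in> carrier E"
  "S \<in> carrier E \<Longrightarrow> T \<in> carrier E \<Longrightarrow> S \<oplus>\<^bsub>E\<^esub> T \<in> carrier E"
  "T \<in> carrier E \<Longrightarrow> z \<odot>\<^bsub>E\<^esub> T \<in> carrier E"
  "\<zero>\<^bsub>E\<^esub> \<in> carrier E" if E: "E = End B X"
proof -
  show "S \<in> carrier E \<Longrightarrow> T \<in> carrier E \<Longrightarrow> S \<otimes>\<^bsub>E\<^esub> T \<in> carrier E"
    unfolding E
    by (rule EndI[where S="\<lambda>x. star (End B X) T (star (End B X) S x)"])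
      (simp add: End_def compose_def, auto simp: is_adjoint_def End_inner End_star(2))
  show "S \<in> carrier E \<Longrightarrow> T \<in> carrier E \<Longrightarrow> S \<oplus>\<^bsub>E\<^esub> T \<in> carrier E"
    unfolding E
    by (rule EndI[where S="\<lambda>x. star (End B X) S x \<oplus>\<^bsub>X\<^esub> star (End B X) T x"])
      (simp add: End_def, auto simp: is_adjoint_def End_inner End_star(2) inner_simps)
  show "T \<in> carrier E \<Longrightarrow> z \<odot>\<^bsub>E\<^esub> T \<in> carrier E"
    unfolding E
    by (rule EndI[where S="\<lambda>x. cnj z \<odot>\<^bsub>X\<^esub> star (End B X) T x"])
      (simp add: End_def, auto simp: is_adjoint_def End_inner End_star(2) inner_simps)
  show "\<zero>\<^bsub>E\<^esub> \<in> carrier E"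
    unfolding E by (rule EndI[where S="\<lambda>x. \<zero>\<^bsub>X\<^esub>"]) (simp add: End_def, auto simp: is_adjoint_def)
qed

lemmas End_closed' [simp, intro] = End_closed[OF refl] End_star(2)

lemma abelian_group_End: "abelian_group (End B X)"
proof (rule abelian_groupI)
  let ?E = "End B X"
  fix S T U
  show "S \<in> carrier ?E \<Longrightarrow> T \<in> carrier ?E \<Longrightarrow> U \<in> carrier ?E \<Longrightarrow> (S \<oplus>\<^bsub>?E\<^esub> T) \<oplus>\<^bsub>?E\<^esub> U = S \<oplus>\<^bsub>?E\<^esub> (T \<oplus>\<^bsub>?E\<^esub> U)"
    by (rule End_eqI) (auto simp: X.a_assoc)
  show "S \<in> carrier ?E \<Longrightarrow> T \<in> carrier ?E \<Longrightarrow> S \<oplus>\<^bsub>?E\<^esub> T = T \<oplus>\<^bsub>?E\<^esub> S"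
    by (rule End_eqI) (auto simp: X.a_comm)
  show "S \<in> carrier ?E \<Longrightarrow> \<zero>\<^bsub>?E\<^esub> \<oplus>\<^bsub>?E\<^esub> S = S" by (rule End_eqI) auto
  show "S \<in> carrier ?E \<Longrightarrow> \<exists>T\<in>carrier ?E. T \<oplus>\<^bsub>?E\<^esub> S = \<zero>\<^bsub>?E\<^esub>"
    by (rule bexI[of _ "smult (End B X) (-1) S"], rule End_eqI) (auto simp: X.a_comm)
qed auto

lemma End_star_simps:
  "S \<in> carrier E \<Longrightarrow> T \<in> carrier E \<Longrightarrow> star E (S \<otimes>\<^bsub>E\<^esub> T) = star E T \<otimes>\<^bsub>E\<^esub> star E S"
  "T \<in> carrier E \<Longrightarrow> star E (star E T) = T" if E: "E = End B X"
proof -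
  show "S \<in> carrier E \<Longrightarrow> T \<in> carrier E \<Longrightarrow> star E (S \<otimes>\<^bsub>E\<^esub> T) = star E T \<otimes>\<^bsub>E\<^esub> star E S"
    unfolding E by (rule End_starI) (auto simp: is_adjoint_def End_inner intro: End_ext)
  show "T \<in> carrier E \<Longrightarrow> star E (star E T) = T"
    unfolding E by (rule End_starI) (auto simp: is_adjoint_def End_inner intro: End_ext)
qed

lemma End_bounded:
  "T \<in> carrier (End B X) \<Longrightarrow> \<exists>K\<ge>0. \<forall>x\<in>carrier X. hnorm B X (T x) \<le> K * hnorm B X x"
  using adjointable_bounded by (auto simp: End_carrier)

lemma End_linear:
  assumes "T \<in> carrier (End B X)"
  shows "x \<in> carrier X \<Longrightarrow> y \<in> carrier X \<Longrightarrow> T (x \<oplus>\<^bsub>X\<^esub> y) = T x \<oplus>\<^bsub>X\<^esub> T y"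
    "x \<in> carrier X \<Longrightarrow> T (z \<odot>\<^bsub>X\<^esub> x) = z \<odot>\<^bsub>X\<^esub> T x"
    "x \<in> carrier X \<Longrightarrow> b \<in> carrier B \<Longrightarrow> T (ract X x b) = ract X (T x) b" "T \<zero>\<^bsub>X\<^esub> = \<zero>\<^bsub>X\<^esub>"
  by (rule adjointable_add[OF End_star(1)[OF assms]] adjointable_smult[OF End_star(1)[OF assms]]
      adjointable_ract[OF End_star(1)[OF assms]] adjointable_zero[OF End_star(1)[OF assms]]; assumption)+

lemma finsum_End_apply:
  assumes "finite K" "F \<in> K \<rightarrow> carrier (End B X)" "x \<in> carrier X"
  shows "(finsum (End B X) F K) x = finsum X (\<lambda>k. F k x) K"
proof -
  interpret E: abelian_group "End B X" by (rule abelian_group_End)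
  show ?thesis using assms
  proof (induct K)
    case (insert k K)
    then show ?case by (subst E.finsum_insert) (auto simp: X.finsum_insert Pi_def)
  qed simp
qed

lemma inner_finsum:
  "finite K \<Longrightarrow> f \<in> K \<rightarrow> carrier X \<Longrightarrow> x \<in> carrier X \<Longrightarrow>
    inner X x (finsum X f K) = finsum B (\<lambda>k. inner X x (f k)) K"
  by (induct K rule: finite_induct) (auto simp: X.finsum_insert B.finsum_insert inner_simps Pi_def)

lemma finsum_inner:
  "finite K \<Longrightarrow> f \<in> K \<rightarrow> carrier X \<Longrightarrow> x \<in> carrier X \<Longrightarrow>
    inner X (finsum X f K) x = finsum B (\<lambda>k. inner X (f k) x) K"
  by (induct K rule: finite_induct) (auto simp: X.finsum_insert B.finsum_insert inner_simps Pi_def)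

lemma cpos_finsum_swap:
  fixes n m :: nat
  assumes c: "\<And>i j k. i < n \<Longrightarrow> j < n \<Longrightarrow> k < m \<Longrightarrow> c i j k \<in> carrier B"
    and p: "\<And>k. k < m \<Longrightarrow> cpos B (\<Oplus>\<^bsub>B\<^esub>i\<in>{..<n}. \<Oplus>\<^bsub>B\<^esub>j\<in>{..<n}. c i j k)"
  shows "cpos B (\<Oplus>\<^bsub>B\<^esub>i\<in>{..<n}. \<Oplus>\<^bsub>B\<^esub>j\<in>{..<n}. \<Oplus>\<^bsub>B\<^esub>k\<in>{..<m}. c i j k)"
  using assms
proof (induct m)
  case 0
  then show ?case by (simp add: B.finsum_zero)
next
  case (Suc m)
  have "(\<Oplus>\<^bsub>B\<^esub>i\<in>{..<n}. \<Oplus>\<^bsub>B\<^esub>j\<in>{..<n}. \<Oplus>\<^bsub>B\<^esub>k\<in>{..<Suc m}. c i j k)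
      = (\<Oplus>\<^bsub>B\<^esub>i\<in>{..<n}. \<Oplus>\<^bsub>B\<^esub>j\<in>{..<n}. c i j m \<oplus>\<^bsub>B\<^esub> (\<Oplus>\<^bsub>B\<^esub>k\<in>{..<m}. c i j k))"
    using Suc.prems(1) by (intro B.finsum_cong' refl) (auto simp: lessThan_Suc B.finsum_insert Pi_def intro!: B.finsum_closed)
  also have "\<dots> = (\<Oplus>\<^bsub>B\<^esub>i\<in>{..<n}. (\<Oplus>\<^bsub>B\<^esub>j\<in>{..<n}. c i j m) \<oplus>\<^bsub>B\<^esub> (\<Oplus>\<^bsub>B\<^esub>j\<in>{..<n}. \<Oplus>\<^bsub>B\<^esub>k\<in>{..<m}. c i j k))"
    using Suc.prems(1)
    by (intro B.finsum_cong' refl B.finsum_addf) (auto simp: Pi_def intro!: B.finsum_closed B.a_closed)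
  also have "\<dots> = (\<Oplus>\<^bsub>B\<^esub>i\<in>{..<n}. \<Oplus>\<^bsub>B\<^esub>j\<in>{..<n}. c i j m) \<oplus>\<^bsub>B\<^esub> (\<Oplus>\<^bsub>B\<^esub>i\<in>{..<n}. \<Oplus>\<^bsub>B\<^esub>j\<in>{..<n}. \<Oplus>\<^bsub>B\<^esub>k\<in>{..<m}. c i j k)"
    using Suc.prems(1) by (intro B.finsum_addf) (auto simp: Pi_def intro!: B.finsum_closed)
  also have "cpos B \<dots>" using Suc by (intro B.cpos_add) auto
  finally show ?case .
qed

text \<open>The form of a positive operator matrix \<open>N*N\<close> at \<open>(y\<^sub>i)\<close> is the sum over \<open>k\<close> of the inner squares of \<open>\<Sum>\<^sub>i N\<^sub>k\<^sub>i y\<^sub>i\<close>.\<close>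

lemma mat_pos_End_form:
  assumes M: "mat_pos n (End B X) M" and y: "\<And>i. i < n \<Longrightarrow> y i \<in> carrier X"
  shows "cpos B (\<Oplus>\<^bsub>B\<^esub>i\<in>{..<n}. \<Oplus>\<^bsub>B\<^esub>j\<in>{..<n}. inner X (y i) (M i j (y j)))"
proof -
  let ?E = "End B X"
  obtain N where N: "\<And>i j. i < n \<Longrightarrow> j < n \<Longrightarrow> N i j \<in> carrier ?E"
    "\<And>i j. i < n \<Longrightarrow> j < n \<Longrightarrow> M i j = (\<Oplus>\<^bsub>?E\<^esub>k\<in>{..<n}. star ?E (N k i) \<otimes>\<^bsub>?E\<^esub> N k j)"
    using M unfolding mat_pos_def by blast
  have Ny: "N k i (y i) \<in> carrier X" if "k < n" "i < n" for k i using N y that by simp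
  have e: "inner X (y i) (M i j (y j)) = (\<Oplus>\<^bsub>B\<^esub>k\<in>{..<n}. inner X (N k i (y i)) (N k j (y j)))"
    if ij: "i < n" "j < n" for i j
  proof -
    have "M i j (y j) = (\<Oplus>\<^bsub>X\<^esub>k\<in>{..<n}. star (End B X) (N k i) (N k j (y j)))"
      unfolding N(2)[OF ij] using ij N(1) y
      by (subst finsum_End_apply) (auto intro!: X.finsum_cong' End_closed')
    also have "inner X (y i) \<dots> = (\<Oplus>\<^bsub>B\<^esub>k\<in>{..<n}. inner X (y i) (star (End B X) (N k i) (N k j (y j))))"
      using ij N y by (intro inner_finsum) auto
    also have "\<dots> = (\<Oplus>\<^bsub>B\<^esub>k\<in>{..<n}. inner X (N k i (y i)) (N k j (y j)))"
      using ij N y Ny by (intro B.finsum_cong' refl) (auto simp: End_inner)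
    finally show ?thesis .
  qed
  have "(\<Oplus>\<^bsub>B\<^esub>i\<in>{..<n}. \<Oplus>\<^bsub>B\<^esub>j\<in>{..<n}. inner X (y i) (M i j (y j)))
      = (\<Oplus>\<^bsub>B\<^esub>i\<in>{..<n}. \<Oplus>\<^bsub>B\<^esub>j\<in>{..<n}. \<Oplus>\<^bsub>B\<^esub>k\<in>{..<n}. inner X (N k i (y i)) (N k j (y j)))"
    using Ny by (intro B.finsum_cong' refl) (auto simp: e Pi_def intro!: B.finsum_closed)
  also have "cpos B \<dots>"
  proof (rule cpos_finsum_swap)
    fix k assume k: "k < n"
    let ?w = "\<Oplus>\<^bsub>X\<^esub>i\<in>{..<n}. N k i (y i)"
    have w: "?w \<in> carrier X" using Ny k by (intro X.finsum_closed) auto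
    have "inner X ?w ?w = (\<Oplus>\<^bsub>B\<^esub>i\<in>{..<n}. inner X (N k i (y i)) ?w)"
      using Ny k w by (intro finsum_inner) auto
    also have "\<dots> = (\<Oplus>\<^bsub>B\<^esub>i\<in>{..<n}. \<Oplus>\<^bsub>B\<^esub>j\<in>{..<n}. inner X (N k i (y i)) (N k j (y j)))"
      using Ny k w by (intro B.finsum_cong' refl inner_finsum) (auto intro!: B.finsum_closed)
    finally show "cpos B (\<Oplus>\<^bsub>B\<^esub>i\<in>{..<n}. \<Oplus>\<^bsub>B\<^esub>j\<in>{..<n}. inner X (N k i (y i)) (N k j (y j)))"
      using inner_pos[OF w] by simp
  qed (use Ny in auto)
  finally show ?thesis .
qed

end

section \<open>Completely positive maps into operators\<close>

text \<open>A factorization \<open>M = N*N\<close> of a matrix is mapped to a factorization.\<close>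

lemma star_hom_mat_pos:
  assumes h: "star_hom D E \<phi>" and D: "abelian_group D" and E: "abelian_group E"
    and cl: "\<And>a b. a \<in> carrier D \<Longrightarrow> b \<in> carrier D \<Longrightarrow> a \<otimes>\<^bsub>D\<^esub> b \<in> carrier D" "\<And>a. a \<in> carrier D \<Longrightarrow> star D a \<in> carrier D"
    and M: "mat_pos n D M"
  shows "mat_pos n E (\<lambda>i j. \<phi> (M i j))"
proof -
  interpret D: abelian_group D by fact
  interpret E: abelian_group E by fact
  have c: "\<phi> a \<in> carrier E" if "a \<in> carrier D" for a using h that by (auto simp: star_hom_def lin_map_def)
  have add: "\<phi> (a \<oplus>\<^bsub>D\<^esub> b) = \<phi> a \<oplus>\<^bsub>E\<^esub> \<phi> b" if "a \<in> carrier D" "b \<in> carrier D" for a b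
    using h that by (auto simp: star_hom_def lin_map_def)
  have "\<phi> \<zero>\<^bsub>D\<^esub> \<oplus>\<^bsub>E\<^esub> \<phi> \<zero>\<^bsub>D\<^esub> = \<phi> \<zero>\<^bsub>D\<^esub>" using add[of "\<zero>\<^bsub>D\<^esub>" "\<zero>\<^bsub>D\<^esub>"] by simp
  then have z: "\<phi> \<zero>\<^bsub>D\<^esub> = \<zero>\<^bsub>E\<^esub>" using c[of "\<zero>\<^bsub>D\<^esub>"] by (metis D.zero_closed E.add.r_cancel_one')
  have fs: "\<phi> (finsum D f K) = finsum E (\<lambda>k. \<phi> (f k)) K" if "finite K" "f \<in> K \<rightarrow> carrier D" for f and K :: "nat set"
    using that
  proof (induct K)
    case (insert k K)
    then have "finsum D f K \<in> carrier D" by (intro D.finsum_closed) auto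
    then show ?case using insert by (simp add: add c Pi_def E.finsum_insert)
  qed (simp add: z)
  obtain N where N: "\<And>i j. i < n \<Longrightarrow> j < n \<Longrightarrow> N i j \<in> carrier D"
    "\<And>i j. i < n \<Longrightarrow> j < n \<Longrightarrow> M i j = (\<Oplus>\<^bsub>D\<^esub>k\<in>{..<n}. star D (N k i) \<otimes>\<^bsub>D\<^esub> N k j)"
    using M unfolding mat_pos_def by blast
  have "\<phi> (M i j) = (\<Oplus>\<^bsub>E\<^esub>k\<in>{..<n}. star E (\<phi> (N k i)) \<otimes>\<^bsub>E\<^esub> \<phi> (N k j))" if "i < n" "j < n" for i j
  proof -
    have "\<phi> (M i j) = (\<Oplus>\<^bsub>E\<^esub>k\<in>{..<n}. \<phi> (star D (N k i) \<otimes>\<^bsub>D\<^esub> N k j))"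
      unfolding N(2)[OF that] using N(1) that cl by (intro fs) auto
    also have "\<dots> = (\<Oplus>\<^bsub>E\<^esub>k\<in>{..<n}. star E (\<phi> (N k i)) \<otimes>\<^bsub>E\<^esub> \<phi> (N k j))"
    proof (rule E.finsum_cong'[OF refl])
      have eq: "\<phi> (star D (N k i) \<otimes>\<^bsub>D\<^esub> N k j) = star E (\<phi> (N k i)) \<otimes>\<^bsub>E\<^esub> \<phi> (N k j)" if "k < n" for k
        using h N(1) \<open>i < n\<close> \<open>j < n\<close> that cl by (auto simp: star_hom_def)
      then show "(\<lambda>k. star E (\<phi> (N k i)) \<otimes>\<^bsub>E\<^esub> \<phi> (N k j)) \<in> {..<n} \<rightarrow> carrier E"
        using c cl N(1) \<open>i < n\<close> \<open>j < n\<close> by (auto simp flip: eq)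
      show "\<phi> (star D (N k i) \<otimes>\<^bsub>D\<^esub> N k j) = star E (\<phi> (N k i)) \<otimes>\<^bsub>E\<^esub> \<phi> (N k j)" if "k \<in> {..<n}" for k
        using eq that by simp
    qed
    finally show ?thesis .
  qed
  then show ?thesis unfolding mat_pos_def using N(1) c by (intro exI[of _ "\<lambda>i j. \<phi> (N i j)"]) auto
qed

lemma star_hom_cp:
  assumes "star_hom A E \<phi>" "cstar_algebra A" "abelian_group E" shows "cp_map A E \<phi>"
proof -
  interpret A: cstar_algebra A by fact
  show ?thesis
    using assms star_hom_mat_pos[OF assms(1) A.abelian_group_axioms assms(3)]
    by (auto simp: cp_map_def star_hom_def)
qed

locale cp_rep = A: cstar_algebra A + hilbert_module B X
  for A :: "'a cstar" and B :: "'b cstar" and X :: "('b, 'x) hmod" +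
  fixes \<rho> :: "'a \<Rightarrow> 'x \<Rightarrow> 'x"
  assumes cp: "cp_map A (End B X) \<rho>"
begin

lemma rho_End [simp, intro]: "a \<in> carrier A \<Longrightarrow> \<rho> a \<in> carrier (End B X)"
  using cp by (auto simp: cp_map_def lin_map_def)

lemma rho_add: "a \<in> carrier A \<Longrightarrow> b \<in> carrier A \<Longrightarrow> x \<in> carrier X \<Longrightarrow> \<rho> (a \<oplus>\<^bsub>A\<^esub> b) x = \<rho> a x \<oplus>\<^bsub>X\<^esub> \<rho> b x"
  using cp by (simp add: cp_map_def lin_map_def)

lemma rho_smult: "a \<in> carrier A \<Longrightarrow> x \<in> carrier X \<Longrightarrow> \<rho> (z \<odot>\<^bsub>A\<^esub> a) x = z \<odot>\<^bsub>X\<^esub> \<rho> a x"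
  using cp by (simp add: cp_map_def lin_map_def)

lemma rho_zero: "x \<in> carrier X \<Longrightarrow> \<rho> \<zero>\<^bsub>A\<^esub> x = \<zero>\<^bsub>X\<^esub>"
  using rho_smult[of "\<zero>\<^bsub>A\<^esub>" x 0] by simp

lemmas rho_linear = rho_add rho_smult rho_zero

lemma rho_pos:
  assumes "cpos A a" obtains L where "L \<in> carrier (End B X)" "\<And>x. x \<in> carrier X \<Longrightarrow> \<rho> a x = star (End B X) L (L x)"
proof -
  let ?E = "End B X"
  interpret E: abelian_group ?E by (rule abelian_group_End)
  obtain b where b: "b \<in> carrier A" "a = star A b \<otimes>\<^bsub>A\<^esub> b" using assms by (auto simp: cpos_def)
  have "mat_pos 1 A (\<lambda>_ _. a)"
    unfolding mat_pos_def using b by (intro exI[of _ "\<lambda>_ _. b"]) (simp add: lessThan_Suc A.finsum_insert)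
  then have "mat_pos 1 ?E (\<lambda>_ _. \<rho> a)" using cp unfolding cp_map_def by blast
  then obtain N where N: "N 0 0 \<in> carrier ?E" "\<rho> a = (\<Oplus>\<^bsub>?E\<^esub>k\<in>{..<1::nat}. star ?E (N k 0) \<otimes>\<^bsub>?E\<^esub> N k 0)"
    unfolding mat_pos_def by auto
  have "\<rho> a = star ?E (N 0 0) \<otimes>\<^bsub>?E\<^esub> N 0 0"
    unfolding N(2) using N(1) by (simp add: lessThan_Suc E.finsum_insert)
  then show ?thesis using that[of "N 0 0"] N(1) by simp
qed

lemma rho_cpos:
  assumes "cpos A a" "x \<in> carrier X" shows "cpos B (inner X x (\<rho> a x))"
proof -
  obtain L where L: "L \<in> carrier (End B X)" "\<And>x. x \<in> carrier X \<Longrightarrow> \<rho> a x = star (End B X) L (L x)"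
    using rho_pos[OF assms(1)] by metis
  then have "inner X x (\<rho> a x) = inner X (L x) (L x)" using assms by (simp add: End_inner)
  then show ?thesis using L assms by (simp add: inner_pos)
qed

text \<open>On positive elements the adjoint relation holds because \<open>\<rho> a\<close> has the form \<open>L*L\<close>, and positive elements
  span the algebra.\<close>

lemma rho_adjoint: assumes "a \<in> carrier A" shows "is_adjoint X X (\<rho> a) (\<rho> (star A a))"
proof -
  define G where "G = {a \<in> carrier A. \<forall>x\<in>carrier X. \<forall>y\<in>carrier X. inner X (\<rho> a x) y = inner X x (\<rho> (star A a) y)}"
  have pos: "a \<in> G" if a: "cpos A a" for a
  proof -
    obtain L where L: "L \<in> carrier (End B X)" "\<And>x. x \<in> carrier X \<Longrightarrow> \<rho> a x = star (End B X) L (L x)"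
      using rho_pos[OF a] by metis
    then show ?thesis using A.cpos_carrier[OF a] A.cpos_star[OF a] by (simp add: G_def End_inner)
  qed
  have add: "a \<oplus>\<^bsub>A\<^esub> b \<in> G" if "a \<in> G" "b \<in> G" for a b
    using that by (auto simp: G_def rho_linear A.star_add inner_simps)
  have smult: "z \<odot>\<^bsub>A\<^esub> a \<in> G" if "a \<in> G" for a z
    using that by (auto simp: G_def rho_linear A.star_smult inner_simps)
  obtain p q r s where "cpos A p" "cpos A q" "cpos A r" "cpos A s"
    "a = p \<oplus>\<^bsub>A\<^esub> (-1) \<odot>\<^bsub>A\<^esub> q \<oplus>\<^bsub>A\<^esub> \<i> \<odot>\<^bsub>A\<^esub> r \<oplus>\<^bsub>A\<^esub> (-\<i>) \<odot>\<^bsub>A\<^esub> s" using A.cpos_decomposition[OF assms] by blast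
  then have "a \<in> G" using pos add smult by simp
  then show ?thesis using assms by (auto simp: is_adjoint_def G_def)
qed

lemmas rho_adjD = is_adjointD[OF rho_adjoint]

lemma star_rho: "a \<in> carrier A \<Longrightarrow> star (End B X) (\<rho> a) = \<rho> (star A a)"
  by (rule End_starI[OF rho_adjoint]) (auto intro: End_ext)

text \<open>Otherwise there are positive contractions \<open>a\<^sub>n\<close> such that \<open>\<rho> a\<^sub>n\<close> is at least of size \<open>4\<^sup>n\<close> on some unit
  vector; the operator \<open>\<rho> s\<close> with \<open>s = \<Sum> 2\<^sup>-\<^sup>n a\<^sub>n\<close> would then be unbounded.\<close>

lemma rho_bounded_on_positive:
  "\<exists>K\<ge>0. \<forall>a x. cpos A a \<longrightarrow> nrm A a \<le> 1 \<longrightarrow> x \<in> carrier X \<longrightarrow> hnorm B X x \<le> 1 \<longrightarrow> nrm B (inner X x (\<rho> a x)) \<le> K"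
proof (rule ccontr)
  assume neg: "\<not> ?thesis"
  have "\<exists>a x. cpos A a \<and> nrm A a \<le> 1 \<and> x \<in> carrier X \<and> hn x \<le> 1 \<and> nrm B (inner X x (\<rho> a x)) > 4 ^ n" for n :: nat
  proof (rule ccontr)
    assume "\<not> ?thesis"
    then have "(0::real) \<le> 4 ^ n \<and> (\<forall>a x. cpos A a \<longrightarrow> nrm A a \<le> 1 \<longrightarrow> x \<in> carrier X \<longrightarrow> hn x \<le> 1 \<longrightarrow>
        nrm B (inner X x (\<rho> a x)) \<le> 4 ^ n)" by (auto simp: not_less)
    with neg show False by blast
  qed
  then obtain a x where ax: "\<And>n::nat. cpos A (a n)" "\<And>n. nrm A (a n) \<le> 1" "\<And>n. x n \<in> carrier X" "\<And>n. hn (x n) \<le> 1"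
    "\<And>n. nrm B (inner X (x n) (\<rho> (a n) (x n))) > 4 ^ n" by metis
  obtain s where s: "cpos A s" "\<And>n. \<exists>c. cpos A c \<and> s = complex_of_real ((1/2) ^ n) \<odot>\<^bsub>A\<^esub> a n \<oplus>\<^bsub>A\<^esub> c"
    using A.cpos_weighted_sum[of a] ax by metis
  obtain K where K: "K \<ge> 0" "\<And>x. x \<in> carrier X \<Longrightarrow> hn (\<rho> s x) \<le> K * hn x"
    using End_bounded[OF rho_End[OF A.cpos_carrier[OF s(1)]]] by blast
  have "2 ^ n \<le> K" for n :: nat
  proof -
    obtain c where c: "cpos A c" "s = complex_of_real ((1/2) ^ n) \<odot>\<^bsub>A\<^esub> a n \<oplus>\<^bsub>A\<^esub> c" using s(2) by blast
    let ?u = "inner X (x n) (\<rho> (a n) (x n))"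
    have cc: "a n \<in> carrier A" "c \<in> carrier A" "s \<in> carrier A" using ax c s A.cpos_carrier by auto
    have u: "cpos B ?u" using rho_cpos ax by simp
    have "2 ^ n = (1/2) ^ n * (4::real) ^ n" by (simp add: power_mult_distrib[symmetric])
    also have "\<dots> \<le> (1/2) ^ n * nrm B ?u" using ax(5)[of n] by (intro mult_left_mono) auto
    also have "\<dots> = nrm B (complex_of_real ((1/2) ^ n) \<odot>\<^bsub>B\<^esub> ?u)"
      using B.cpos_carrier[OF u] by (simp add: B.nrm_smult norm_power norm_divide)
    also have "\<dots> \<le> nrm B (complex_of_real ((1/2) ^ n) \<odot>\<^bsub>B\<^esub> ?u \<oplus>\<^bsub>B\<^esub> inner X (x n) (\<rho> c (x n)))"
      by (intro B.cpos_nrm_mono B.cpos_scale u rho_cpos c ax) auto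
    also have "\<dots> = nrm B (inner X (x n) (\<rho> s (x n)))"
      using cc ax(3) by (simp only: c(2)) (simp add: rho_linear inner_simps)
    also have "\<dots> \<le> hn (x n) * hn (\<rho> s (x n))" using cc ax by (intro cauchy_schwarz) auto
    also have "\<dots> \<le> 1 * (K * 1)"
      using ax(3,4)[of n] K cc
      by (intro mult_mono order_trans[OF K(2)] mult_left_mono) auto
    finally show ?thesis by simp
  qed
  moreover obtain n :: nat where "K < 2 ^ n" using real_arch_pow[of 2 K] by auto
  ultimately show False by (meson not_less)
qed

text \<open>Every value \<open>\<langle>x, \<rho>(a*a)x\<rangle>\<close> is reduced to a positive contraction and a unit vector by scaling.\<close>

lemma rho_bounded:
  "\<exists>K\<ge>0. \<forall>a\<in>carrier A. \<forall>x\<in>carrier X. nrm B (inner X x (\<rho> (star A a \<otimes>\<^bsub>A\<^esub> a) x)) \<le> K * (nrm A a)\<^sup>2 * (hnorm B X x)\<^sup>2"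
proof -
  obtain K where K: "K \<ge> 0" "\<And>a x. cpos A a \<Longrightarrow> nrm A a \<le> 1 \<Longrightarrow> x \<in> carrier X \<Longrightarrow> hn x \<le> 1 \<Longrightarrow> nrm B (inner X x (\<rho> a x)) \<le> K"
    using rho_bounded_on_positive by blast
  have "nrm B (inner X x (\<rho> (star A a \<otimes>\<^bsub>A\<^esub> a) x)) \<le> K * (nrm A a)\<^sup>2 * (hn x)\<^sup>2"
    if a: "a \<in> carrier A" and x: "x \<in> carrier X" for a x
  proof (cases "nrm A a = 0 \<or> hn x = 0")
    case True
    then have "a = \<zero>\<^bsub>A\<^esub> \<or> x = \<zero>\<^bsub>X\<^esub>"
      using A.nrm_eq_zero_iff[OF a] hdist_zeroD[of x "\<zero>\<^bsub>X\<^esub>"] x by (auto simp: hnorm_hdist)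
    then have "inner X x (\<rho> (star A a \<otimes>\<^bsub>A\<^esub> a) x) = \<zero>\<^bsub>B\<^esub>"
      using a x by (auto simp: rho_zero)
    then show ?thesis using K by simp
  next
    case False
    define r s where "r = nrm A a" and "s = hn x"
    have rs: "r > 0" "s > 0" using False A.nrm_nonneg[OF a] hnorm_nonneg[OF x] by (auto simp: r_def s_def)
    define b where "b = complex_of_real (1 / r\<^sup>2) \<odot>\<^bsub>A\<^esub> (star A a \<otimes>\<^bsub>A\<^esub> a)"
    define u where "u = complex_of_real (1 / s) \<odot>\<^bsub>X\<^esub> x"
    have aa: "star A a \<otimes>\<^bsub>A\<^esub> a \<in> carrier A" using a by simp
    have "cpos A b" unfolding b_def using a by (intro A.cpos_scale A.cpos_star_mult) auto
    moreover have "nrm A b \<le> 1"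
      using rs a by (simp add: b_def A.nrm_smult A.cstar_identity norm_divide norm_power r_def[symmetric])
    moreover have "u \<in> carrier X" "hn u \<le> 1" using x rs by (auto simp: u_def hnorm_smult s_def[symmetric] norm_divide)
    ultimately have "nrm B (inner X u (\<rho> b u)) \<le> K" using K(2) by blast
    also have "inner X u (\<rho> b u) = complex_of_real (1 / (s\<^sup>2 * r\<^sup>2)) \<odot>\<^bsub>B\<^esub> inner X x (\<rho> (star A a \<otimes>\<^bsub>A\<^esub> a) x)"
      using x aa rs by (simp add: u_def b_def rho_linear inner_simps End_linear[OF rho_End] B.cm.csmult_assoc
          monoid_mult_class.power2_eq_square mult_ac)
    finally have "1 / (s\<^sup>2 * r\<^sup>2) * nrm B (inner X x (\<rho> (star A a \<otimes>\<^bsub>A\<^esub> a) x)) \<le> K"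
      using x aa rs by (simp add: B.nrm_smult norm_divide norm_mult norm_power)
    then show ?thesis using rs by (simp add: r_def[symmetric] s_def[symmetric] field_simps)
  qed
  then show ?thesis using K(1) by blast
qed

lemma rho_contraction_bounded:
  "\<exists>K\<ge>0. \<forall>a x. cpos A a \<longrightarrow> nrm A a \<le> 1 \<longrightarrow> x \<in> carrier X \<longrightarrow> hnorm B X (\<rho> a x) \<le> K * hnorm B X x"
proof -
  obtain K where K: "K \<ge> 0" "\<And>a x. a \<in> carrier A \<Longrightarrow> x \<in> carrier X \<Longrightarrow>
    nrm B (inner X x (\<rho> (star A a \<otimes>\<^bsub>A\<^esub> a) x)) \<le> K * (nrm A a)\<^sup>2 * (hn x)\<^sup>2" using rho_bounded by blast
  have "hn (\<rho> a x) \<le> K * hn x" if a: "cpos A a" "nrm A a \<le> 1" and x: "x \<in> carrier X" for a x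
  proof -
    obtain L where L: "L \<in> carrier (End B X)" "\<And>x. x \<in> carrier X \<Longrightarrow> \<rho> a x = star (End B X) L (L x)"
      using rho_pos[OF a(1)] by metis
    obtain b where b: "b \<in> carrier A" "a = star A b \<otimes>\<^bsub>A\<^esub> b" using a by (auto simp: cpos_def)
    have nb: "(nrm A b)\<^sup>2 \<le> 1" using a(2) b by (simp add: A.cstar_identity)
    let ?L = "star (End B X) L"
    have lb: "hn (L v) \<le> sqrt K * hn v" if v: "v \<in> carrier X" for v
    proof (rule power2_le_imp_le)
      have "(hn (L v))\<^sup>2 = nrm B (inner X v (\<rho> a v))" using L v by (simp add: hnorm_sq End_inner)
      also have "\<dots> \<le> K * (nrm A b)\<^sup>2 * (hn v)\<^sup>2" using K(2)[OF b(1) v] b by simp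
      also have "\<dots> \<le> K * 1 * (hn v)\<^sup>2" using nb K(1) by (intro mult_right_mono mult_left_mono) auto
      finally show "(hn (L v))\<^sup>2 \<le> (sqrt K * hn v)\<^sup>2" using K(1) by (simp add: power_mult_distrib)
    qed (use K v in auto)
    have lb': "hn (?L v) \<le> sqrt K * hn v" if v: "v \<in> carrier X" for v
    proof -
      have "(hn (?L v))\<^sup>2 = nrm B (inner X v (L (?L v)))" using L v by (simp add: hnorm_sq End_inner(1))
      also have "\<dots> \<le> hn v * hn (L (?L v))" using L v by (intro cauchy_schwarz) auto
      also have "\<dots> \<le> hn v * (sqrt K * hn (?L v))" using L v by (intro mult_left_mono lb) auto
      finally have "hn (?L v) * hn (?L v) \<le> (sqrt K * hn v) * hn (?L v)"
        by (simp add: monoid_mult_class.power2_eq_square mult_ac)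
      moreover have "0 \<le> hn (?L v)" "0 \<le> sqrt K * hn v" using L v K(1) by auto
      ultimately show ?thesis by (metis mult_right_le_imp_le order_le_less)
    qed
    have "hn (\<rho> a x) \<le> sqrt K * (sqrt K * hn x)"
      unfolding L(2)[OF x] using L x K(1) by (intro order_trans[OF lb'] mult_left_mono lb) auto
    then show ?thesis using K(1) by (simp flip: mult.assoc)
  qed
  then show ?thesis using K(1) by blast
qed

end

section \<open>Extension of operators to completions\<close>

context semi_module
begin

text \<open>With \<open>R = ST\<close>, the inequality \<open>\<Parallel>R\<^sup>nz\<Parallel>\<^sup>2 \<le> \<Parallel>z\<Parallel> \<Parallel>R\<^sup>2\<^sup>nz\<Parallel>\<close> turns a bound on the growth of \<open>R\<^sup>nz\<close> whose constant
  depends on \<open>z\<close> into a uniform bound.\<close>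

lemma formal_adjoint_bound:
  assumes T: "\<And>p. p \<in> carrier P \<Longrightarrow> T p \<in> carrier P" and S: "\<And>p. p \<in> carrier P \<Longrightarrow> S p \<in> carrier P"
    and adj: "\<And>p q. p \<in> carrier P \<Longrightarrow> q \<in> carrier P \<Longrightarrow> inner P (T p) q = inner P p (S q)"
    and M: "M \<ge> 0" and growth: "\<And>n. hnorm B P (((\<lambda>p. S (T p)) ^^ n) z) \<le> c * M ^ n"
    and z: "z \<in> carrier P"
  shows "(hnorm B P (T z))\<^sup>2 \<le> M * (hnorm B P z)\<^sup>2"
proof -
  define R where "R = (\<lambda>p. S (T p))"
  have Rn: "(R ^^ n) p \<in> carrier P" if "p \<in> carrier P" for n p
    using that by (induct n) (auto simp: R_def T S)
  have adj': "inner P (S p) q = inner P p (T q)" if "p \<in> carrier P" "q \<in> carrier P" for p q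
  proof -
    have "star B (inner P (T q) p) = star B (inner P q (S p))" using adj that by simp
    then show ?thesis using that T S by (simp add: inner_star)
  qed
  have Rs: "inner P (R p) q = inner P p (R q)" if "p \<in> carrier P" "q \<in> carrier P" for p q
    using that adj adj' T S by (simp add: R_def)
  have Rsn: "inner P ((R ^^ n) p) q = inner P p ((R ^^ n) q)" if "p \<in> carrier P" "q \<in> carrier P" for n p q
    using that(2)
  proof (induct n arbitrary: q)
    case (Suc n)
    have "inner P ((R ^^ Suc n) p) q = inner P ((R ^^ n) p) (R q)" using Rs[OF Rn Suc.prems] that(1) by simp
    also have "\<dots> = inner P p ((R ^^ n) (R q))" using Suc that Rn[of q 1] by simp
    finally show ?case by (simp add: funpow_swap1)
  qed simp
  define a where "a n = hn ((R ^^ n) z)" for n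
  define h where "h = hn z"
  have h0: "h \<ge> 0" and a0: "a n \<ge> 0" for n using z Rn by (auto simp: h_def a_def)
  have a2: "(a n)\<^sup>2 \<le> h * a (2 * n)" for n
  proof -
    have "(a n)\<^sup>2 = nrm B (inner P z ((R ^^ n) ((R ^^ n) z)))"
      using Rn[OF z] by (simp add: a_def hnorm_sq Rsn[OF z])
    also have "\<dots> = nrm B (inner P z ((R ^^ (2 * n)) z))" by (simp add: mult_2 funpow_add)
    also have "\<dots> \<le> h * a (2 * n)" unfolding h_def a_def using z Rn by (intro cauchy_schwarz) auto
    finally show ?thesis .
  qed
  have Tz: "(hn (T z))\<^sup>2 \<le> h * a 1"
  proof -
    have "(hn (T z))\<^sup>2 = nrm B (inner P z (R z))" using z T by (simp add: hnorm_sq adj R_def)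
    also have "\<dots> \<le> h * a 1" unfolding h_def a_def using z Rn[OF z, of 1] by (simp add: cauchy_schwarz)
    finally show ?thesis .
  qed
  show ?thesis
  proof (cases "h = 0")
    case True
    then show ?thesis using Tz M by (simp add: h_def[symmetric])
  next
    case False
    then have h: "h > 0" using h0 by simp
    \<comment> \<open>the inequality \<open>a n\<^sup>2 \<le> h a (2n)\<close>, iterated along the powers of two\<close>
    have key: "a 1 ^ (2 ^ k) * h \<le> h ^ (2 ^ k) * a (2 ^ k)" for k
    proof (induct k)
      case (Suc k)
      have "(a 1 ^ (2 ^ k) * h)\<^sup>2 \<le> (h ^ (2 ^ k) * a (2 ^ k))\<^sup>2"
        using Suc a0 h0 by (intro power_mono) auto
      also have "\<dots> = (h ^ (2 ^ k))\<^sup>2 * (a (2 ^ k))\<^sup>2" by (rule power_mult_distrib)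
      also have "\<dots> \<le> (h ^ (2 ^ k))\<^sup>2 * (h * a (2 ^ Suc k))"
        using a2[of "2 ^ k"] by (intro mult_left_mono) auto
      finally have "(a 1 ^ (2 ^ Suc k) * h) * h \<le> (h ^ (2 ^ Suc k) * a (2 ^ Suc k)) * h"
        by (simp add: monoid_mult_class.power2_eq_square power_add[symmetric] mult_2 mult_ac)
      then show ?case using h by (rule mult_right_le_imp_le)
    qed simp
    have "a 1 \<le> h * M"
    proof (rule ccontr)
      assume "\<not> a 1 \<le> h * M"
      define q where "q = h * M / a 1"
      have big: "a 1 > h * M" "a 1 > 0" using \<open>\<not> a 1 \<le> h * M\<close> h M by (auto intro: le_less_trans[of 0 "h * M"])
      have q: "0 \<le> q" "q < 1" using big h M by (auto simp: q_def)
      have bound: "h \<le> c * q ^ (2 ^ k)" for k :: nat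
      proof -
        have "a 1 ^ (2 ^ k) * h \<le> h ^ (2 ^ k) * (c * M ^ (2 ^ k))"
          using key[of k] growth[of "2 ^ k"] h unfolding R_def[symmetric] a_def[symmetric]
          by (meson mult_left_mono order_trans zero_le_power less_imp_le)
        then show ?thesis using big by (simp add: q_def power_divide power_mult_distrib field_simps)
      qed
      have "(\<lambda>m. c * q ^ m) \<longlonglongrightarrow> c * 0" using q by (intro tendsto_intros LIMSEQ_power_zero) auto
      then have "eventually (\<lambda>m. c * q ^ m < h) sequentially" using h by (intro order_tendstoD) auto
      then obtain N where N: "\<And>m. m \<ge> N \<Longrightarrow> c * q ^ m < h" by (auto simp: eventually_sequentially)
      have "N \<le> 2 ^ N" by (simp add: less_imp_le)
      then show False using N[of "2 ^ N"] bound[of N] by simp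
    qed
    then have "h * a 1 \<le> h * (h * M)" using h by (intro mult_left_mono) auto
    then show ?thesis using Tz by (simp add: h_def[symmetric] monoid_mult_class.power2_eq_square mult_ac)
  qed
qed

context
  fixes T S K
  assumes T: "\<And>p. p \<in> carrier P \<Longrightarrow> T p \<in> carrier P" and S: "\<And>p. p \<in> carrier P \<Longrightarrow> S p \<in> carrier P"
    and adj: "\<And>p q. p \<in> carrier P \<Longrightarrow> q \<in> carrier P \<Longrightarrow> inner P (T p) q = inner P p (S q)"
    and bound: "\<And>p. p \<in> carrier P \<Longrightarrow> hnorm B P (T p) \<le> K * hnorm B P p"
begin

lemma formal_adjoint_hdist:
  assumes "p \<in> carrier P" "q \<in> carrier P" shows "hd' (T p) (T q) \<le> K * hd' p q"
proof -
  have "inner P (T p \<oplus>\<^bsub>P\<^esub> (-1) \<odot>\<^bsub>P\<^esub> T q) w = inner P (T (p \<oplus>\<^bsub>P\<^esub> (-1) \<odot>\<^bsub>P\<^esub> q)) w" if "w \<in> carrier P" for w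
    using assms that T S by (simp add: adj inner_simps)
  then have "eqv (T p \<oplus>\<^bsub>P\<^esub> (-1) \<odot>\<^bsub>P\<^esub> T q) (T (p \<oplus>\<^bsub>P\<^esub> (-1) \<odot>\<^bsub>P\<^esub> q))"
    using assms T unfolding eqv_def
    by (metis (no_types, lifting) add_closed smult_closed inner_star)
  from hnorm_cong[OF this] show ?thesis using assms T bound by (simp add: hdist_eq)
qed

lemma hcauchy_op: "s \<in> hcauchy B P \<Longrightarrow> (\<lambda>n. T (s n)) \<in> hcauchy B P"
  by (rule hcauchy_cmp[of s _ K]) (auto simp: hcauchy_carrier T formal_adjoint_hdist)

lemma extend_op_cls:
  assumes "s \<in> hcauchy B P" shows "extend_op B P T (cls s) = cls (\<lambda>n. T (s n))"
proof -
  have "congruent (null_rel B P) (\<lambda>s. cls (\<lambda>n. T (s n)))"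
    by (rule congruentI, rule cls_eqI_null, rule null_relI_cmp[where K=K], assumption)
      (auto dest!: null_relD simp: hcauchy_op formal_adjoint_hdist hcauchy_carrier)
  from UN_equiv_class[OF equiv_null_rel this assms] show ?thesis using assms by (simp add: extend_op_def)
qed

lemma extend_op_emb_c: "p \<in> carrier P \<Longrightarrow> extend_op B P T (emb_c p) = emb_c (T p)"
  by (simp add: emb_c_def extend_op_cls hcauchy_const)

end

lemma extend_op_adjoint:
  assumes T: "\<And>p. p \<in> carrier P \<Longrightarrow> T p \<in> carrier P" and S: "\<And>p. p \<in> carrier P \<Longrightarrow> S p \<in> carrier P"
    and adj: "\<And>p q. p \<in> carrier P \<Longrightarrow> q \<in> carrier P \<Longrightarrow> inner P (T p) q = inner P p (S q)"
    and bT: "\<And>p. p \<in> carrier P \<Longrightarrow> hnorm B P (T p) \<le> K * hnorm B P p"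
    and bS: "\<And>p. p \<in> carrier P \<Longrightarrow> hnorm B P (S p) \<le> L * hnorm B P p"
  shows "is_adjoint Q Q (extend_op B P T) (extend_op B P S)"
proof -
  have adj': "inner P (S p) q = inner P p (T q)" if "p \<in> carrier P" "q \<in> carrier P" for p q
  proof -
    have "star B (inner P (T q) p) = star B (inner P q (S p))" using adj that by simp
    then show ?thesis using that T S by (simp add: inner_star)
  qed
  note eT = extend_op_cls[OF T S adj bT] hcauchy_op[OF T S adj bT]
  note eS = extend_op_cls[OF S T adj' bS] hcauchy_op[OF S T adj' bS]
  show ?thesis unfolding is_adjoint_def
  proof (intro conjI ballI)
    show "extend_op B P T \<in> carrier Q \<rightarrow> carrier Q" by (auto elim!: completionE simp: eT)
    show "extend_op B P S \<in> carrier Q \<rightarrow> carrier Q" by (auto elim!: completionE simp: eS)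
    fix x y assume "x \<in> carrier Q" "y \<in> carrier Q"
    then obtain s t where st: "s \<in> hcauchy B P" "x = cls s" "t \<in> hcauchy B P" "y = cls t" by (metis completionE)
    have "tends (\<lambda>n. inner P (T (s n)) (t n)) (inner Q (cls (\<lambda>n. T (s n))) (cls t))"
      by (intro inner_cls eT st)
    moreover have "tends (\<lambda>n. inner P (s n) (S (t n))) (inner Q (cls s) (cls (\<lambda>n. S (t n))))"
      by (intro inner_cls eS st)
    moreover have "inner P (T (s n)) (t n) = inner P (s n) (S (t n))" for n
      using st by (simp add: adj hcauchy_carrier)
    ultimately show "inner Q (extend_op B P T x) y = inner Q x (extend_op B P S y)"
      using st tends_unique by (simp add: eT eS)
  qed
qed

end

section \<open>Tensor products\<close>

declare in_listsD [rule del] in_listsI [rule del]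

lemma (in abelian_monoid) finsum_lessThan_Suc_shift:
  assumes "f \<in> {..<Suc n} \<rightarrow> carrier G"
  shows "finsum G f {..<Suc n} = f 0 \<oplus> finsum G (\<lambda>i. f (Suc i)) {..<n}"
proof (cases n)
  case 0
  then show ?thesis using assms by (simp add: lessThan_Suc finsum_insert)
next
  case (Suc m)
  have "finsum G f {..Suc m} = finsum G (\<lambda>i. f (Suc i)) {..m} \<oplus> f 0"
    using assms by (intro finsum_Suc2) (auto simp: Suc Pi_def lessThan_Suc_atMost)
  then show ?thesis
    using assms by (subst (asm) a_comm) (auto simp: Suc lessThan_Suc_atMost intro!: finsum_closed)
qed

locale tensor_form = X: hilbert_module B X + Y: cp_rep B C Y \<sigma>
  for B :: "'b cstar" and X :: "('b, 'x) hmod" and C :: "'c cstar" and Y :: "('c, 'y) hmod"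
    and \<sigma> :: "'b \<Rightarrow> 'y \<Rightarrow> 'y"
begin

abbreviation T where "T \<equiv> alg_tensor X C (\<sigma>, Y)"

lemma T_simps [simp]:
  "carrier T = lists (carrier X \<times> carrier Y)" "\<zero>\<^bsub>T\<^esub> = []" "s \<oplus>\<^bsub>T\<^esub> t = s @ t"
  "z \<odot>\<^bsub>T\<^esub> s = map (\<lambda>(x, y). (z \<odot>\<^bsub>X\<^esub> x, y)) s" "ract T s c = map (\<lambda>(x, y). (x, ract Y y c)) s"
  by (simp_all add: alg_tensor_def)

text \<open>The vector \<open>contract x t\<close> is characterized by \<open>\<langle>y, contract x t\<rangle> = \<langle>x \<otimes> y, t\<rangle>\<close>.\<close>

primrec contract :: "'x \<Rightarrow> ('x \<times> 'y) list \<Rightarrow> 'y" where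
  "contract x [] = \<zero>\<^bsub>Y\<^esub>"
| "contract x (p # t) = \<sigma> (inner X x (fst p)) (snd p) \<oplus>\<^bsub>Y\<^esub> contract x t"

lemmas sig_simps = Y.rho_linear Y.End_linear[OF Y.rho_End]

lemma contract_in [simp, intro]: "x \<in> carrier X \<Longrightarrow> t \<in> carrier T \<Longrightarrow> contract x t \<in> carrier Y"
  by (induct t) auto

lemma inner_contract:
  "x \<in> carrier X \<Longrightarrow> y \<in> carrier Y \<Longrightarrow> t \<in> carrier T \<Longrightarrow> inner Y y (contract x t) =
    (\<Oplus>\<^bsub>C\<^esub>j\<in>{..<length t}. inner Y y (\<sigma> (inner X x (fst (t ! j))) (snd (t ! j))))"
proof (induct t)
  case (Cons p t)
  have c: "inner Y y (\<sigma> (inner X x (fst ((p # t) ! j))) (snd ((p # t) ! j))) \<in> carrier C"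
    if "j < Suc (length t)" for j
  proof -
    have "(p # t) ! j \<in> carrier X \<times> carrier Y" using Cons.prems(3) that nth_mem[of j "p # t"] unfolding T_simps in_lists_conv_set by auto
    then show ?thesis using Cons.prems by (auto simp: mem_Times_iff)
  qed
  have "(\<Oplus>\<^bsub>C\<^esub>j\<in>{..<length (p # t)}. inner Y y (\<sigma> (inner X x (fst ((p # t) ! j))) (snd ((p # t) ! j))))
      = inner Y y (\<sigma> (inner X x (fst p)) (snd p)) \<oplus>\<^bsub>C\<^esub>
        (\<Oplus>\<^bsub>C\<^esub>j\<in>{..<length t}. inner Y y (\<sigma> (inner X x (fst (t ! j))) (snd (t ! j))))"
    using Y.B.finsum_lessThan_Suc_shift[of "\<lambda>j. inner Y y (\<sigma> (inner X x (fst ((p # t) ! j))) (snd ((p # t) ! j)))" "length t"] c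
    by auto
  then show ?case using Cons by (auto simp: Y.inner_simps)
qed simp

lemma T_Nil [simp]: "inner T [] t = \<zero>\<^bsub>C\<^esub>"
  by (simp add: alg_tensor_def)

lemma T_Cons:
  assumes "x \<in> carrier X" "y \<in> carrier Y" "s \<in> carrier T" "t \<in> carrier T"
  shows "inner T ((x, y) # s) t = inner Y y (contract x t) \<oplus>\<^bsub>C\<^esub> inner T s t"
proof -
  let ?r = "\<lambda>p. \<Oplus>\<^bsub>C\<^esub>j\<in>{..<length t}. inner Y (snd p) (\<sigma> (inner X (fst p) (fst (t ! j))) (snd (t ! j)))"
  have r: "?r p = inner Y (snd p) (contract (fst p) t)" if "p \<in> carrier X \<times> carrier Y" for p
    using that assms by (subst inner_contract) auto
  have c: "((x, y) # s) ! i \<in> carrier X \<times> carrier Y" if "i < Suc (length s)" for i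
  proof -
    have "(x, y) # s \<in> lists (carrier X \<times> carrier Y)" using assms by simp
    then show ?thesis using that nth_mem[of i "(x, y) # s"] unfolding in_lists_conv_set by auto
  qed
  have "inner T ((x, y) # s) t = (\<Oplus>\<^bsub>C\<^esub>i\<in>{..<Suc (length s)}. ?r (((x, y) # s) ! i))"
    by (simp add: alg_tensor_def)
  also have "\<dots> = ?r (x, y) \<oplus>\<^bsub>C\<^esub> (\<Oplus>\<^bsub>C\<^esub>i\<in>{..<length s}. ?r (s ! i))"
    using Y.B.finsum_lessThan_Suc_shift[of "\<lambda>i. ?r (((x, y) # s) ! i)" "length s"] c r assms
    by (force simp: mem_Times_iff)
  finally show ?thesis using r[of "(x, y)"] assms by (simp add: alg_tensor_def)
qed

lemma T_in [simp, intro]: "s \<in> carrier T \<Longrightarrow> t \<in> carrier T \<Longrightarrow> inner T s t \<in> carrier C"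
  by (induct s) (auto simp: T_Cons)

lemma contract_append:
  "x \<in> carrier X \<Longrightarrow> s \<in> carrier T \<Longrightarrow> t \<in> carrier T \<Longrightarrow> contract x (s @ t) = contract x s \<oplus>\<^bsub>Y\<^esub> contract x t"
  by (induct s) (auto simp: Y.X.a_assoc)

lemma contract_smult:
  "x \<in> carrier X \<Longrightarrow> t \<in> carrier T \<Longrightarrow> contract x (map (\<lambda>(x, y). (z \<odot>\<^bsub>X\<^esub> x, y)) t) = z \<odot>\<^bsub>Y\<^esub> contract x t"
  by (induct t) (auto simp: X.inner_simps sig_simps Y.cX.csmult_r_distr)

lemma contract_ract:
  "x \<in> carrier X \<Longrightarrow> t \<in> carrier T \<Longrightarrow> c \<in> carrier C \<Longrightarrow>
    contract x (map (\<lambda>(x, y). (x, ract Y y c)) t) = ract Y (contract x t) c"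
proof (induct t)
  case Nil
  have "ract Y \<zero>\<^bsub>Y\<^esub> c = \<zero>\<^bsub>Y\<^esub>" using Y.ract_smult_left[of "\<zero>\<^bsub>Y\<^esub>" c 0] Nil by simp
  then show ?case by simp
qed (auto simp: sig_simps Y.ract_add_left)

lemma T_append_left:
  "s \<in> carrier T \<Longrightarrow> t \<in> carrier T \<Longrightarrow> u \<in> carrier T \<Longrightarrow> inner T (s @ t) u = inner T s u \<oplus>\<^bsub>C\<^esub> inner T t u"
  by (induct s) (auto simp: T_Cons Y.B.a_assoc)

lemma T_append_right:
  "s \<in> carrier T \<Longrightarrow> t \<in> carrier T \<Longrightarrow> u \<in> carrier T \<Longrightarrow> inner T s (t @ u) = inner T s t \<oplus>\<^bsub>C\<^esub> inner T s u"
  by (induct s) (auto simp: T_Cons contract_append Y.inner_simps Y.B.a_ac)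

lemma T_single:
  "x \<in> carrier X \<Longrightarrow> y \<in> carrier Y \<Longrightarrow> x' \<in> carrier X \<Longrightarrow> y' \<in> carrier Y \<Longrightarrow>
    inner T [(x, y)] [(x', y')] = inner Y y (\<sigma> (inner X x x') y')"
  by (simp add: T_Cons)

lemma T_star: "s \<in> carrier T \<Longrightarrow> t \<in> carrier T \<Longrightarrow> star C (inner T s t) = inner T t s"
proof (induct s)
  case Nil
  have "inner T t [] = \<zero>\<^bsub>C\<^esub>" if "t \<in> carrier T" for t using that by (induct t) (auto simp: T_Cons)
  then show ?case using Nil by simp
next
  case (Cons p s)
  obtain x y where p: "p = (x, y)" "x \<in> carrier X" "y \<in> carrier Y" using Cons.prems(1) by auto
  have s: "s \<in> carrier T" using Cons.prems(1) by simp
  have single: "star C (inner T [(x, y)] t) = inner T t [(x, y)]" if "t \<in> carrier T" for t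
    using that
  proof (induct t)
    case (Cons q t)
    obtain x' y' where q: "q = (x', y')" "x' \<in> carrier X" "y' \<in> carrier Y" using Cons.prems by auto
    have t: "t \<in> carrier T" using Cons.prems by simp
    have "star C (inner Y y (\<sigma> (inner X x x') y')) = inner Y (\<sigma> (inner X x x') y') y"
      using p q by (simp add: Y.inner_star)
    also have "\<dots> = inner Y y' (\<sigma> (inner X x' x) y)"
      using p q by (simp add: Y.rho_adjD(3) X.inner_star)
    finally show ?case using Cons(1)[OF t] p q t
      T_append_right[of "[(x, y)]" "[q]" t] T_append_left[of "[q]" t "[(x, y)]"]
      by (simp add: T_single Y.B.star_add)
  qed (use p in \<open>simp add: T_Cons\<close>)
  show ?case
    using Cons.hyps[OF s Cons.prems(2)] single[OF Cons.prems(2)] p s Cons.prems(2)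
      T_append_left[of "[(x, y)]" s t] T_append_right[of t "[(x, y)]" s]
    by (simp add: Y.B.star_add)
qed

lemma form_module_T: "form_module C T"
proof (intro form_module.intro form_module_axioms.intro)
  show "cstar_algebra C" by (rule Y.B.cstar_algebra_axioms)
  fix s t u z c
  show "\<zero>\<^bsub>T\<^esub> \<in> carrier T" by simp
  show "s \<in> carrier T \<Longrightarrow> t \<in> carrier T \<Longrightarrow> s \<oplus>\<^bsub>T\<^esub> t \<in> carrier T" by simp
  show "s \<in> carrier T \<Longrightarrow> z \<odot>\<^bsub>T\<^esub> s \<in> carrier T" by (induct s) auto
  show "s \<in> carrier T \<Longrightarrow> c \<in> carrier C \<Longrightarrow> ract T s c \<in> carrier T" by (induct s) auto
  show "s \<in> carrier T \<Longrightarrow> t \<in> carrier T \<Longrightarrow> inner T s t \<in> carrier C" by simp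
  show "s \<in> carrier T \<Longrightarrow> inner T s \<zero>\<^bsub>T\<^esub> = \<zero>\<^bsub>C\<^esub>" by (induct s) (auto simp: T_Cons)
  show "s \<in> carrier T \<Longrightarrow> t \<in> carrier T \<Longrightarrow> u \<in> carrier T \<Longrightarrow>
      inner T s (t \<oplus>\<^bsub>T\<^esub> u) = inner T s t \<oplus>\<^bsub>C\<^esub> inner T s u" by (simp add: T_append_right)
  show "s \<in> carrier T \<Longrightarrow> t \<in> carrier T \<Longrightarrow> inner T s (z \<odot>\<^bsub>T\<^esub> t) = z \<odot>\<^bsub>C\<^esub> inner T s t"
  proof (induct s)
    case (Cons p s)
    have "map (\<lambda>(x, y). (z \<odot>\<^bsub>X\<^esub> x, y)) t \<in> carrier T" using Cons.prems(2) by (induct t) auto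
    then show ?case using Cons by (auto simp: T_Cons contract_smult Y.inner_simps Y.B.cm.csmult_r_distr)
  qed simp
  show "s \<in> carrier T \<Longrightarrow> t \<in> carrier T \<Longrightarrow> c \<in> carrier C \<Longrightarrow> inner T s (ract T t c) = inner T s t \<otimes>\<^bsub>C\<^esub> c"
  proof (induct s)
    case (Cons p s)
    have "map (\<lambda>(x, y). (x, ract Y y c)) t \<in> carrier T" using Cons.prems(2,3) by (induct t) auto
    then show ?case using Cons by (auto simp: T_Cons contract_ract Y.inner_simps Y.B.distr_left)
  qed simp
  show "s \<in> carrier T \<Longrightarrow> t \<in> carrier T \<Longrightarrow> star C (inner T s t) = inner T t s" by (rule T_star)
qed

lemma map_fst_in: "(\<And>x. x \<in> carrier X \<Longrightarrow> R x \<in> carrier X) \<Longrightarrow> s \<in> carrier T \<Longrightarrow>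
    map (\<lambda>(x, y). (R x, y)) s \<in> carrier T"
  by (induct s) auto

lemma T_adjoint:
  assumes R: "is_adjoint X X R S"
  shows "s \<in> carrier T \<Longrightarrow> t \<in> carrier T \<Longrightarrow>
    inner T (map (\<lambda>(x, y). (R x, y)) s) t = inner T s (map (\<lambda>(x, y). (S x, y)) t)"
proof (induct s)
  case (Cons p s)
  note Rc = X.is_adjointD[OF R]
  obtain x y where p: "p = (x, y)" "x \<in> carrier X" "y \<in> carrier Y" using Cons.prems(1) by auto
  have s: "s \<in> carrier T" using Cons.prems(1) by simp
  have t': "map (\<lambda>(x, y). (S x, y)) t \<in> carrier T" by (rule map_fst_in) (use Cons.prems(2) Rc(2) in auto)
  have s': "map (\<lambda>(x, y). (R x, y)) s \<in> carrier T" by (rule map_fst_in) (use s Rc(1) in auto)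
  have "contract (R x) u = contract x (map (\<lambda>(x, y). (S x, y)) u)" if "u \<in> carrier T" for u
    using that by (induct u) (auto simp: Rc(3) p)
  then show ?case
    using Cons.hyps[OF s Cons.prems(2)] Cons.prems(2) p s s' t' Rc(1)[OF p(2)]
    by (simp only: p list.map prod.case T_Cons)
qed simp

end

locale tensor = tensor_form B X C Y \<sigma>
  for B :: "'b cstar" and X :: "('b, 'x) hmod" and C :: "'c cstar" and Y :: "('c, 'y) hmod"
    and \<sigma> :: "'b \<Rightarrow> 'y \<Rightarrow> 'y" +
  assumes tensor_pos: "s \<in> lists (carrier X \<times> carrier Y) \<Longrightarrow> cpos C (inner (alg_tensor X C (\<sigma>, Y)) s s)"
begin

sublocale T: semi_module C "alg_tensor X C (\<sigma>, Y)"
  by (intro semi_module.intro form_module_T semi_module_axioms.intro) (simp add: tensor_pos)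

sublocale Z: hilbert_module C "completion C (alg_tensor X C (\<sigma>, Y))"
  by (rule T.hilbert_module_completion)

abbreviation Z where "Z \<equiv> completion C T"

definition tens :: "'x \<Rightarrow> 'y \<Rightarrow> (nat \<Rightarrow> ('x \<times> 'y) list) set" where
  "tens x y = T.emb_c [(x, y)]"

lemma tens_in [simp, intro]: "x \<in> carrier X \<Longrightarrow> y \<in> carrier Y \<Longrightarrow> tens x y \<in> carrier Z"
  unfolding tens_def by (rule T.emb_c_in) simp

lemma inner_tens:
  "x \<in> carrier X \<Longrightarrow> y \<in> carrier Y \<Longrightarrow> x' \<in> carrier X \<Longrightarrow> y' \<in> carrier Y \<Longrightarrow>
    inner Z (tens x y) (tens x' y') = inner Y y (\<sigma> (inner X x x') y')"
  unfolding tens_def by (subst T.inner_emb_c) (simp_all add: T_single)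

abbreviation tens_set where "tens_set \<equiv> (\<lambda>(x, y). tens x y) ` (carrier X \<times> carrier Y)"

lemma emb_c_Cons:
  assumes "x \<in> carrier X" "y \<in> carrier Y" "s \<in> carrier T"
  shows "T.emb_c ((x, y) # s) = tens x y \<oplus>\<^bsub>Z\<^esub> T.emb_c s"
  using T.emb_c_simps(1)[of "[(x, y)]" s] assms by (simp add: tens_def)

text \<open>A class is a limit of classes of lists, and a list is the sum of its entries.\<close>

lemma total_tens: "Z.total tens_set"
proof (rule Z.totalI)
  show "tens_set \<subseteq> carrier Z" by auto
  fix D assume D: "Z.closed_subspace D" "tens_set \<subseteq> D"
  have e: "T.emb_c s \<in> D" if "s \<in> carrier T" for s
    using that
  proof (induct s)
    case Nil
    have "T.emb_c [] = \<zero>\<^bsub>Z\<^esub>" using T.emb_c_simps(4) by simp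
    then show ?case using D by (simp add: Z.closed_subspace_def)
  next
    case (Cons p s)
    then show ?case using D by (cases p) (auto simp: emb_c_Cons Z.closed_subspace_def)
  qed
  show "carrier Z \<subseteq> D"
  proof
    fix z assume z: "z \<in> carrier Z"
    have "\<exists>y\<in>D. hdist C Z y z < \<epsilon>" if "\<epsilon> > 0" for \<epsilon>
      using T.emb_c_dense[OF z that] e by blast
    then show "z \<in> D" using D(1) z by (auto simp: Z.closed_subspace_def)
  qed
qed

lemma tens_eqI:
  assumes "u \<in> carrier Z" "v \<in> carrier Z"
    "\<And>x y. x \<in> carrier X \<Longrightarrow> y \<in> carrier Y \<Longrightarrow> inner Z (tens x y) u = inner Z (tens x y) v"
  shows "u = v"
  using assms by (intro Z.total_eqI[OF total_tens]) auto

lemma tens_linear: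
  "x \<in> carrier X \<Longrightarrow> x' \<in> carrier X \<Longrightarrow> y \<in> carrier Y \<Longrightarrow> tens (x \<oplus>\<^bsub>X\<^esub> x') y = tens x y \<oplus>\<^bsub>Z\<^esub> tens x' y"
  "x \<in> carrier X \<Longrightarrow> y \<in> carrier Y \<Longrightarrow> tens (z \<odot>\<^bsub>X\<^esub> x) y = z \<odot>\<^bsub>Z\<^esub> tens x y"
  "x \<in> carrier X \<Longrightarrow> y \<in> carrier Y \<Longrightarrow> y' \<in> carrier Y \<Longrightarrow> tens x (y \<oplus>\<^bsub>Y\<^esub> y') = tens x y \<oplus>\<^bsub>Z\<^esub> tens x y'"
  "x \<in> carrier X \<Longrightarrow> y \<in> carrier Y \<Longrightarrow> tens x (z \<odot>\<^bsub>Y\<^esub> y) = z \<odot>\<^bsub>Z\<^esub> tens x y"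
  by (rule tens_eqI; auto simp: inner_tens Z.inner_simps X.inner_simps Y.inner_simps sig_simps)+

lemma tens_zero:
  "y \<in> carrier Y \<Longrightarrow> tens \<zero>\<^bsub>X\<^esub> y = \<zero>\<^bsub>Z\<^esub>" "x \<in> carrier X \<Longrightarrow> tens x \<zero>\<^bsub>Y\<^esub> = \<zero>\<^bsub>Z\<^esub>"
  using tens_linear(2)[of "\<zero>\<^bsub>X\<^esub>" y 0] tens_linear(4)[of x "\<zero>\<^bsub>Y\<^esub>" 0] by simp_all

text \<open>Since \<open>\<langle>x, x\<rangle> = b*b\<close>, the inner square of \<open>x \<otimes> y\<close> is \<open>\<langle>y, \<sigma>(b*b)y\<rangle>\<close>.\<close>

lemma tens_bounded:
  "\<exists>K\<ge>0. \<forall>x\<in>carrier X. \<forall>y\<in>carrier Y. hnorm C T [(x, y)] \<le> K * hnorm B X x * hnorm C Y y"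
proof -
  obtain K where K: "K \<ge> 0" "\<And>b y. b \<in> carrier B \<Longrightarrow> y \<in> carrier Y \<Longrightarrow>
    nrm C (inner Y y (\<sigma> (star B b \<otimes>\<^bsub>B\<^esub> b) y)) \<le> K * (nrm B b)\<^sup>2 * (hnorm C Y y)\<^sup>2" using Y.rho_bounded by blast
  have "hnorm C T [(x, y)] \<le> sqrt K * hnorm B X x * hnorm C Y y" if xy: "x \<in> carrier X" "y \<in> carrier Y" for x y
  proof (rule T.hnorm_leI)
    obtain b where b: "b \<in> carrier B" "inner X x x = star B b \<otimes>\<^bsub>B\<^esub> b" using X.inner_pos[OF xy(1)] by (auto simp: cpos_def)
    have "(nrm B b)\<^sup>2 = (hnorm B X x)\<^sup>2" using X.hnorm_sq[OF xy(1)] b by (simp add: X.B.cstar_identity)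
    then show "nrm C (inner T [(x, y)] [(x, y)]) \<le> (sqrt K * hnorm B X x * hnorm C Y y)\<^sup>2"
      using K(2)[OF b(1) xy(2)] K(1) xy b by (simp add: T_single power_mult_distrib)
  qed (use xy K in auto)
  then show ?thesis using K(1) by (intro exI[of _ "sqrt K"]) auto
qed

lemma hnorm_tens: "x \<in> carrier X \<Longrightarrow> y \<in> carrier Y \<Longrightarrow> hnorm C Z (tens x y) = hnorm C T [(x, y)]"
  by (simp add: hnorm_def inner_tens T_single)

lemma tens_limit_left:
  assumes "\<And>n::nat. s n \<in> carrier X" "x \<in> carrier X" "(\<lambda>n. hdist B X (s n) x) \<longlonglongrightarrow> 0" "y \<in> carrier Y"
  shows "(\<lambda>n. hdist C Z (tens (s n) y) (tens x y)) \<longlonglongrightarrow> 0"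
proof -
  obtain K where K: "K \<ge> 0" "\<And>x y. x \<in> carrier X \<Longrightarrow> y \<in> carrier Y \<Longrightarrow>
    hnorm C T [(x, y)] \<le> K * hnorm B X x * hnorm C Y y" using tens_bounded by blast
  have "(\<lambda>n. K * hdist B X (s n) x * hnorm C Y y) \<longlonglongrightarrow> K * 0 * hnorm C Y y"
    by (intro tendsto_intros assms)
  moreover have "hdist C Z (tens (s n) y) (tens x y) \<le> K * hdist B X (s n) x * hnorm C Y y" for n
  proof -
    have "tens (s n) y \<oplus>\<^bsub>Z\<^esub> (-1) \<odot>\<^bsub>Z\<^esub> tens x y = tens (s n \<oplus>\<^bsub>X\<^esub> (-1) \<odot>\<^bsub>X\<^esub> x) y"
      using assms by (simp add: tens_linear)
    then show ?thesis using K(2)[of "s n \<oplus>\<^bsub>X\<^esub> (-1) \<odot>\<^bsub>X\<^esub> x" y] assms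
      by (simp add: Z.hdist_eq X.hdist_eq hnorm_tens)
  qed
  ultimately show ?thesis by - (erule null_cmp, auto)
qed

lemma tens_limit_right:
  assumes "\<And>n::nat. s n \<in> carrier Y" "y \<in> carrier Y" "(\<lambda>n. hdist C Y (s n) y) \<longlonglongrightarrow> 0" "x \<in> carrier X"
  shows "(\<lambda>n. hdist C Z (tens x (s n)) (tens x y)) \<longlonglongrightarrow> 0"
proof -
  obtain K where K: "K \<ge> 0" "\<And>x y. x \<in> carrier X \<Longrightarrow> y \<in> carrier Y \<Longrightarrow>
    hnorm C T [(x, y)] \<le> K * hnorm B X x * hnorm C Y y" using tens_bounded by blast
  have "(\<lambda>n. K * hnorm B X x * hdist C Y (s n) y) \<longlonglongrightarrow> K * hnorm B X x * 0"
    by (intro tendsto_intros assms)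
  moreover have "hdist C Z (tens x (s n)) (tens x y) \<le> K * hnorm B X x * hdist C Y (s n) y" for n
  proof -
    have "tens x (s n) \<oplus>\<^bsub>Z\<^esub> (-1) \<odot>\<^bsub>Z\<^esub> tens x y = tens x (s n \<oplus>\<^bsub>Y\<^esub> (-1) \<odot>\<^bsub>Y\<^esub> y)"
      using assms by (simp add: tens_linear)
    then show ?thesis using K(2)[of x "s n \<oplus>\<^bsub>Y\<^esub> (-1) \<odot>\<^bsub>Y\<^esub> y"] assms
      by (simp add: Z.hdist_eq Y.hdist_eq hnorm_tens)
  qed
  ultimately show ?thesis by - (erule null_cmp, auto)
qed

lemma closed_subspace_tens_left:
  assumes D: "Z.closed_subspace D" and y: "y \<in> carrier Y"
  shows "X.closed_subspace {x \<in> carrier X. tens x y \<in> D}"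
proof (rule X.closed_subspaceI)
  fix s x assume s: "\<And>n::nat. s n \<in> {x \<in> carrier X. tens x y \<in> D}"
    and x: "x \<in> carrier X" "(\<lambda>n. hdist B X (s n) x) \<longlonglongrightarrow> 0"
  have lim: "(\<lambda>n. hdist C Z (tens (s n) y) (tens x y)) \<longlonglongrightarrow> 0" using s x y by (intro tens_limit_left) auto
  have "\<exists>v\<in>D. hdist C Z v (tens x y) < \<epsilon>" if "\<epsilon> > 0" for \<epsilon>
    using LIMSEQ_D[OF lim that] s by auto
  then show "x \<in> {x \<in> carrier X. tens x y \<in> D}" using D x y by (auto simp: Z.closed_subspace_def)
qed (use D y in \<open>auto simp: Z.closed_subspace_def tens_zero tens_linear\<close>)

lemma closed_subspace_tens_right:
  assumes D: "Z.closed_subspace D" and x: "x \<in> carrier X"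
  shows "Y.closed_subspace {y \<in> carrier Y. tens x y \<in> D}"
proof (rule Y.closed_subspaceI)
  fix s y assume s: "\<And>n::nat. s n \<in> {y \<in> carrier Y. tens x y \<in> D}"
    and y: "y \<in> carrier Y" "(\<lambda>n. hdist C Y (s n) y) \<longlonglongrightarrow> 0"
  have lim: "(\<lambda>n. hdist C Z (tens x (s n)) (tens x y)) \<longlonglongrightarrow> 0" using s x y by (intro tens_limit_right) auto
  have "\<exists>v\<in>D. hdist C Z v (tens x y) < \<epsilon>" if "\<epsilon> > 0" for \<epsilon>
    using LIMSEQ_D[OF lim that] s by auto
  then show "y \<in> {y \<in> carrier Y. tens x y \<in> D}" using D x y by (auto simp: Z.closed_subspace_def)
qed (use D x in \<open>auto simp: Z.closed_subspace_def tens_zero tens_linear\<close>)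

lemma total_tens_of_total:
  assumes S: "X.total S" and R: "Y.total R"
  shows "Z.total ((\<lambda>(x, y). tens x y) ` (S \<times> R))"
proof (rule Z.totalI)
  have SR: "S \<subseteq> carrier X" "R \<subseteq> carrier Y" using S R by (auto simp: X.total_def Y.total_def)
  then show "(\<lambda>(x, y). tens x y) ` (S \<times> R) \<subseteq> carrier Z" by auto
  fix D assume D: "Z.closed_subspace D" "(\<lambda>(x, y). tens x y) ` (S \<times> R) \<subseteq> D"
  have 1: "tens x y \<in> D" if "x \<in> carrier X" "y \<in> R" for x y
    using X.total_induct[OF S closed_subspace_tens_left[OF D(1), of y] _ that(1)] that(2) SR D(2) by auto
  have 2: "tens x y \<in> D" if "x \<in> carrier X" "y \<in> carrier Y" for x y
    using Y.total_induct[OF R closed_subspace_tens_right[OF D(1) that(1)] _ that(2)] SR 1 that(1) by auto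
  show "carrier Z \<subseteq> D"
  proof
    show "z \<in> D" if "z \<in> carrier Z" for z by (rule Z.total_induct[OF total_tens D(1) _ that]) (use 2 in auto)
  qed
qed

subsection \<open>Amplification of operators\<close>

definition ampl :: "('x \<Rightarrow> 'x) \<Rightarrow> (nat \<Rightarrow> ('x \<times> 'y) list) set \<Rightarrow> (nat \<Rightarrow> ('x \<times> 'y) list) set" where
  "ampl R = extend_op C T (map (\<lambda>(x, y). (R x, y)))"

text \<open>By the triangle inequality; the constant is the sum of the sizes of the entries, so it depends on the list.\<close>

lemma list_growth:
  assumes R: "\<And>n x. x \<in> carrier X \<Longrightarrow> hnorm B X (R n x) \<le> M n * hnorm B X x" "\<And>n x. x \<in> carrier X \<Longrightarrow> R n x \<in> carrier X"
    and s: "s \<in> carrier T"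
  shows "\<exists>c. \<forall>n::nat. hnorm C T (map (\<lambda>(x, y). (R n x, y)) s) \<le> c * M n"
  using s
proof (induct s)
  case Nil
  have "hnorm C T [] = 0" using T.hnorm_zero by simp
  then show ?case by (intro exI[of _ 0]) simp
next
  case (Cons p s)
  obtain x y where p: "p = (x, y)" "x \<in> carrier X" "y \<in> carrier Y" using Cons.prems by auto
  have s: "s \<in> carrier T" using Cons.prems by simp
  obtain c where c: "\<And>n. hnorm C T (map (\<lambda>(x, y). (R n x, y)) s) \<le> c * M n" using Cons.hyps s by auto
  obtain K where K: "K \<ge> 0" "\<And>x y. x \<in> carrier X \<Longrightarrow> y \<in> carrier Y \<Longrightarrow>
    hnorm C T [(x, y)] \<le> K * hnorm B X x * hnorm C Y y" using tens_bounded by blast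
  have "hnorm C T (map (\<lambda>(x, y). (R n x, y)) (p # s)) \<le> (K * hnorm B X x * hnorm C Y y + c) * M n" for n
  proof -
    have ms: "map (\<lambda>(x, y). (R n x, y)) s \<in> carrier T" using s R(2) by (intro map_fst_in)
    have "hnorm C T (map (\<lambda>(x, y). (R n x, y)) (p # s)) = hnorm C T ([(R n x, y)] \<oplus>\<^bsub>T\<^esub> map (\<lambda>(x, y). (R n x, y)) s)"
      by (simp add: p)
    also have "\<dots> \<le> hnorm C T [(R n x, y)] + hnorm C T (map (\<lambda>(x, y). (R n x, y)) s)"
      using ms p R(2) by (intro T.hnorm_triangle) auto
    also have "\<dots> \<le> K * (M n * hnorm B X x) * hnorm C Y y + c * M n"
      using p R K(1) by (intro add_mono c order_trans[OF K(2)] mult_right_mono mult_left_mono) auto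
    finally show ?thesis by (simp add: algebra_simps)
  qed
  then show ?case by blast
qed

text \<open>The constant provided by \<open>list_growth\<close> depends on the list, but for powers of \<open>SR\<close> it is absorbed by
  \<open>formal_adjoint_bound\<close>.\<close>

lemma list_bound:
  assumes R: "is_adjoint X X R S" and M: "M \<ge> 0" "\<And>x. x \<in> carrier X \<Longrightarrow> hnorm B X (S (R x)) \<le> M * hnorm B X x"
    and s: "s \<in> carrier T"
  shows "hnorm C T (map (\<lambda>(x, y). (R x, y)) s) \<le> sqrt M * hnorm C T s"
proof (rule power2_le_imp_le)
  note Rc = X.is_adjointD[OF R]
  let ?R = "map (\<lambda>(x, y). (R x, y)) :: ('x \<times> 'y) list \<Rightarrow> _" and ?S = "map (\<lambda>(x, y). (S x, y)) :: ('x \<times> 'y) list \<Rightarrow> _"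
  have cl: "((\<lambda>x. S (R x)) ^^ n) x \<in> carrier X" if "x \<in> carrier X" for n x
    using that by (induct n) (auto simp: Rc)
  have gr: "hnorm B X (((\<lambda>x. S (R x)) ^^ n) x) \<le> M ^ n * hnorm B X x" if x: "x \<in> carrier X" for n x
  proof (induct n)
    case (Suc n)
    have "hnorm B X (((\<lambda>x. S (R x)) ^^ Suc n) x) \<le> M * hnorm B X (((\<lambda>x. S (R x)) ^^ n) x)"
      using M(2)[OF cl[OF x]] by simp
    also have "\<dots> \<le> M * (M ^ n * hnorm B X x)" using Suc M(1) by (intro mult_left_mono)
    finally show ?case by (simp add: mult.assoc)
  qed simp
  have pw: "((\<lambda>p. ?S (?R p)) ^^ n) s = map (\<lambda>(x, y). (((\<lambda>x. S (R x)) ^^ n) x, y)) s" for n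
    by (induct n) (auto simp: case_prod_unfold)
  obtain c where "\<And>n. hnorm C T (map (\<lambda>(x, y). (((\<lambda>x. S (R x)) ^^ n) x, y)) s) \<le> c * M ^ n"
    using list_growth[of "\<lambda>n x. ((\<lambda>x. S (R x)) ^^ n) x" "\<lambda>n. M ^ n", OF gr cl s] by blast
  then have g: "hnorm C T (((\<lambda>p. ?S (?R p)) ^^ n) s) \<le> c * M ^ n" for n unfolding pw .
  have "(hnorm C T (?R s))\<^sup>2 \<le> M * (hnorm C T s)\<^sup>2"
    by (rule T.formal_adjoint_bound[where S="?S" and T="?R", OF _ _ _ M(1) g s])
      (simp_all only: map_fst_in Rc T_adjoint[OF R])
  then show "(hnorm C T (?R s))\<^sup>2 \<le> (sqrt M * hnorm C T s)\<^sup>2" using M(1) by (simp add: power_mult_distrib)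
qed (use M s in auto)

lemma End_square_bounded:
  assumes "R \<in> carrier (End B X)"
  obtains M where "M \<ge> 0" "\<And>x. x \<in> carrier X \<Longrightarrow> hnorm B X (star (End B X) R (R x)) \<le> M * hnorm B X x"
  using X.End_bounded[of "star (End B X) R \<otimes>\<^bsub>End B X\<^esub> R"] assms that by auto

lemma ampl_basic:
  assumes R: "R \<in> carrier (End B X)"
  shows "is_adjoint Z Z (ampl R) (ampl (star (End B X) R))" "ampl R \<in> carrier (End C Z)"
    "x \<in> carrier X \<Longrightarrow> y \<in> carrier Y \<Longrightarrow> ampl R (tens x y) = tens (R x) y"
proof -
  let ?S = "star (End B X) R"
  note adj = X.End_star(1)[OF R] note adj' = X.is_adjoint_self_sym[OF adj]
  obtain M where M: "M \<ge> 0" "\<And>x. x \<in> carrier X \<Longrightarrow> hnorm B X (?S (R x)) \<le> M * hnorm B X x"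
    using End_square_bounded[OF R] by blast
  have S: "?S \<in> carrier (End B X)" using R by simp
  obtain M' where M': "M' \<ge> 0" "\<And>x. x \<in> carrier X \<Longrightarrow> hnorm B X (R (?S x)) \<le> M' * hnorm B X x"
    using End_square_bounded[OF S] R by (auto simp: X.End_star_simps)
  have mp: "map (\<lambda>(x, y). (R x, y)) s \<in> carrier T" "map (\<lambda>(x, y). (?S x, y)) s \<in> carrier T" if "s \<in> carrier T" for s
    using that R by (auto intro: map_fst_in simp del: T_simps)
  show a: "is_adjoint Z Z (ampl R) (ampl ?S)"
    unfolding ampl_def
    by (rule T.extend_op_adjoint[OF mp T_adjoint[OF adj] list_bound[OF adj M] list_bound[OF adj' M']])
  show "ampl R \<in> carrier (End C Z)"
    by (rule Z.EndI[OF _ a]) (simp add: ampl_def extend_op_def)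
  show "ampl R (tens x y) = tens (R x) y" if "x \<in> carrier X" "y \<in> carrier Y"
    using T.extend_op_emb_c[OF mp T_adjoint[OF adj] list_bound[OF adj M], of "[(x, y)]"] that
    by (simp add: tens_def ampl_def)
qed

lemma End_tens_eqI:
  assumes "S \<in> carrier (End C Z)" "R \<in> carrier (End C Z)"
    "\<And>x y. x \<in> carrier X \<Longrightarrow> y \<in> carrier Y \<Longrightarrow> S (tens x y) = R (tens x y)"
  shows "S = R"
proof -
  have "star (End C Z) S w = star (End C Z) R w" if w: "w \<in> carrier Z" for w
    using assms w by (intro tens_eqI) (auto simp: Z.End_inner)
  then have "star (End C Z) S = star (End C Z) R" using assms by (intro Z.End_eqI) auto
  then show ?thesis using assms Z.End_star_simps(2)[OF refl] by metis
qed

text \<open>Operators on the tensor product are equal if they agree on simple tensors.\<close>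

lemma star_hom_ampl: "star_hom (End B X) (End C Z) ampl"
  unfolding star_hom_def lin_map_def
proof (intro conjI ballI allI)
  show "ampl \<in> carrier (End B X) \<rightarrow> carrier (End C Z)" by (auto simp: ampl_basic)
  fix R S z assume R: "R \<in> carrier (End B X)"
  show "ampl (z \<odot>\<^bsub>End B X\<^esub> R) = z \<odot>\<^bsub>End C Z\<^esub> ampl R"
    using R by (intro End_tens_eqI) (auto simp: ampl_basic tens_linear)
  show "ampl (star (End B X) R) = star (End C Z) (ampl R)"
    using ampl_basic(1)[OF R] ampl_basic(2) R by (intro Z.End_starI[symmetric]) (auto intro: Z.End_ext)
  assume S: "S \<in> carrier (End B X)"
  show "ampl (R \<oplus>\<^bsub>End B X\<^esub> S) = ampl R \<oplus>\<^bsub>End C Z\<^esub> ampl S" "ampl (R \<otimes>\<^bsub>End B X\<^esub> S) = ampl R \<otimes>\<^bsub>End C Z\<^esub> ampl S"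
    using R S by (intro End_tens_eqI; auto simp: ampl_basic tens_linear)+
qed

end

section \<open>The two cases in which the tensor product is positive\<close>

subsection \<open>The algebra as a module over itself\<close>

abbreviation self_module :: "'a cstar \<Rightarrow> ('a, 'a) hmod" where "self_module A \<equiv> snd (self_corr A)"

lemma self_module_simps [simp]:
  "carrier (self_module A) = carrier A" "zero (self_module A) = \<zero>\<^bsub>A\<^esub>" "add (self_module A) = add A"
  "smult (self_module A) = smult A" "ract (self_module A) = mult A"
  "inner (self_module A) a b = star A a \<otimes>\<^bsub>A\<^esub> b"
  by (simp_all add: self_corr_def)

lemma (in cstar_algebra) hnorm_self: "a \<in> carrier A \<Longrightarrow> hnorm A (self_module A) a = nrm A a"
  by (simp add: hnorm_def cstar_identity nrm_nonneg)

lemma (in cstar_algebra) hdist_self_module: "hdist A (self_module A) = cdist A"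
  by (intro ext) (simp add: hdist_def cdist_eq hnorm_self, simp add: cdist_def)

lemma (in cstar_algebra) hilbert_self: "hilbert_module A (self_module A)"
proof (intro hilbert_module.intro hilbert_module_axioms.intro cstar_algebra_axioms)
  have "\<exists>y\<in>carrier A. y \<oplus>\<^bsub>A\<^esub> x = \<zero>\<^bsub>A\<^esub>" if "x \<in> carrier A" for x using l_neg[OF that] that by blast
  then have "abelian_group (self_module A)"
    by (intro abelian_groupI) (auto simp: a_ac)
  then show "module complex_ring (self_module A)"
    by (rule moduleI[OF cring_class])
      (auto simp: plus_class times_class one_class cm.csmult_l_distr cm.csmult_r_distr cm.csmult_assoc)
  show "Metric_space.mcomplete (carrier (self_module A)) (hdist A (self_module A))"
    using complete by (simp add: hdist_self_module)
  fix x assume x: "x \<in> carrier (self_module A)" "inner (self_module A) x x = \<zero>\<^bsub>A\<^esub>"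
  then have "(nrm A x)\<^sup>2 = 0" using cstar_identity[of x] by simp
  then show "x = zero (self_module A)" using x by (simp add: nrm_eq_zero_iff)
qed (auto simp: distr_left distr_right mult_assoc smult_mult_left smult_mult_right star_mult star_star cpos_star_mult)

text \<open>For \<open>X = A\<close>, positivity of the form is complete positivity of \<open>\<sigma>\<close> at the matrix \<open>(a\<^sub>i* a\<^sub>j)\<close>, whose
  factorization has the \<open>a\<^sub>i\<close> as its only nonzero row.\<close>

lemma tensor_self:
  assumes "cp_rep A C Y \<sigma>" shows "tensor A (self_module A) C Y \<sigma>"
proof -
  interpret Y: cp_rep A C Y \<sigma> by fact
  interpret X: hilbert_module A "self_module A" by (rule Y.A.hilbert_self)
  show ?thesis
  proof (intro tensor.intro tensor_form.intro tensor_axioms.intro)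
    fix s :: "('a \<times> 'c) list" assume s: "s \<in> lists (carrier (self_module A) \<times> carrier Y)"
    have si: "fst (s ! i) \<in> carrier A" "snd (s ! i) \<in> carrier Y" if "i < length s" for i
      using s nth_mem[OF that] unfolding in_lists_conv_set by (auto simp: mem_Times_iff)
    have "mat_pos (length s) A (\<lambda>i j. star A (fst (s ! i)) \<otimes>\<^bsub>A\<^esub> fst (s ! j))"
      unfolding mat_pos_def
    proof (rule exI[of _ "\<lambda>k i. if k = 0 then fst (s ! i) else \<zero>\<^bsub>A\<^esub>"], intro conjI allI impI)
      fix i j assume ij: "i < length s" "j < length s"
      then obtain m where m: "length s = Suc m" by (cases "length s") auto
      show "star A (fst (s ! i)) \<otimes>\<^bsub>A\<^esub> fst (s ! j) = (\<Oplus>\<^bsub>A\<^esub>k\<in>{..<length s}.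
          star A (if k = 0 then fst (s ! i) else \<zero>\<^bsub>A\<^esub>) \<otimes>\<^bsub>A\<^esub> (if k = 0 then fst (s ! j) else \<zero>\<^bsub>A\<^esub>))"
        using si[OF ij(1)] si[OF ij(2)] unfolding m
        by (subst Y.A.finsum_lessThan_Suc_shift) (auto simp: Y.A.finsum_zero)
    qed (use si in auto)
    then have "mat_pos (length s) (End C Y) (\<lambda>i j. \<sigma> (star A (fst (s ! i)) \<otimes>\<^bsub>A\<^esub> fst (s ! j)))"
      using Y.cp unfolding cp_map_def by blast
    from Y.mat_pos_End_form[OF this, of "\<lambda>i. snd (s ! i)"] si
    show "cpos C (inner (alg_tensor (self_module A) C (\<sigma>, Y)) s s)"
      by (simp add: alg_tensor_def)
  qed (rule X.hilbert_module_axioms Y.cp_rep_axioms)+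
qed

subsection \<open>Homomorphisms\<close>

text \<open>A Cholesky step.  With \<open>b = \<langle>x, x\<rangle>\<close> and an approximate inverse \<open>f\<close> of \<open>b\<close>, replace \<open>x\<^sub>i\<close> by
  \<open>x\<^sub>i - x f \<langle>x, x\<^sub>i\<rangle>\<close> in the remaining terms and collect the differences at \<open>x\<close>.  What remains of the mixed
  terms is either positive or small, because \<open>bf\<langle>x, x\<^sub>i\<rangle>\<close> is close to \<open>\<langle>x, x\<^sub>i\<rangle>\<close>.\<close>

locale hom_form = tensor_form B X C Y \<sigma>
  for B :: "'b cstar" and X :: "('b, 'x) hmod" and C :: "'c cstar" and Y :: "('c, 'y) hmod"
    and \<sigma> :: "'b \<Rightarrow> 'y \<Rightarrow> 'y" +
  assumes sig_mult: "a \<in> carrier B \<Longrightarrow> b \<in> carrier B \<Longrightarrow> y \<in> carrier Y \<Longrightarrow> \<sigma> (a \<otimes>\<^bsub>B\<^esub> b) y = \<sigma> a (\<sigma> b y)"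
begin

lemma sig_bounded: "\<exists>K\<ge>0. \<forall>a\<in>carrier B. \<forall>b\<in>carrier B. \<forall>y\<in>carrier Y. hdist C Y (\<sigma> a y) (\<sigma> b y) \<le> K * cdist B a b * hnorm C Y y"
proof -
  obtain K where K: "K \<ge> 0" "\<And>b y. b \<in> carrier B \<Longrightarrow> y \<in> carrier Y \<Longrightarrow>
    nrm C (inner Y y (\<sigma> (star B b \<otimes>\<^bsub>B\<^esub> b) y)) \<le> K * (nrm B b)\<^sup>2 * (hnorm C Y y)\<^sup>2" using Y.rho_bounded by blast
  have "hdist C Y (\<sigma> a y) (\<sigma> b y) \<le> sqrt K * cdist B a b * hnorm C Y y"
    if c: "a \<in> carrier B" "b \<in> carrier B" "y \<in> carrier Y" for a b y
  proof -
    let ?d = "a \<oplus>\<^bsub>B\<^esub> (-1) \<odot>\<^bsub>B\<^esub> b"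
    have d: "?d \<in> carrier B" using c by simp
    have "hdist C Y (\<sigma> a y) (\<sigma> b y) = hnorm C Y (\<sigma> ?d y)" using c by (simp add: Y.hdist_eq sig_simps)
    also have "\<dots> \<le> sqrt K * nrm B ?d * hnorm C Y y"
    proof (rule Y.hnorm_leI)
      have "inner Y (\<sigma> ?d y) (\<sigma> ?d y) = inner Y y (\<sigma> (star B ?d \<otimes>\<^bsub>B\<^esub> ?d) y)"
        using c d by (simp add: sig_mult Y.rho_adjD(3))
      then show "nrm C (inner Y (\<sigma> ?d y) (\<sigma> ?d y)) \<le> (sqrt K * nrm B ?d * hnorm C Y y)\<^sup>2"
        using K(2)[OF d c(3)] K(1) by (simp add: power_mult_distrib)
    qed (use c d K in \<open>auto simp: X.B.nrm_nonneg\<close>)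
    finally show ?thesis using c by (simp add: X.B.cdist_eq)
  qed
  then show ?thesis using K(1) by (intro exI[of _ "sqrt K"]) auto
qed

context
  fixes x f b
  assumes x: "x \<in> carrier X" and f: "f \<in> carrier B" "star B f = f"
  defines "b \<equiv> inner X x x"
begin

abbreviation reduce :: "('x \<times> 'y) list \<Rightarrow> ('x \<times> 'y) list" where
  "reduce \<equiv> map (\<lambda>(u, v). (u \<oplus>\<^bsub>X\<^esub> (-1) \<odot>\<^bsub>X\<^esub> ract X x (f \<otimes>\<^bsub>B\<^esub> inner X x u), v))"

lemma reduce_in: "s \<in> carrier T \<Longrightarrow> reduce s \<in> carrier T"
  by (rule map_fst_in) (use x f in auto)

lemma contract_reduce:
  "u \<in> carrier X \<Longrightarrow> s \<in> carrier T \<Longrightarrow>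
    contract u (reduce s) = contract u s \<oplus>\<^bsub>Y\<^esub> (-1) \<odot>\<^bsub>Y\<^esub> \<sigma> (inner X u x \<otimes>\<^bsub>B\<^esub> f) (contract x s)"
proof (induct s)
  case (Cons p s)
  obtain x' y' where p: "p = (x', y')" "x' \<in> carrier X" "y' \<in> carrier Y" using Cons.prems by auto
  have s: "s \<in> carrier T" using Cons.prems by simp
  let ?t = "\<sigma> (inner X u x') y'" and ?w = "\<sigma> (inner X u x \<otimes>\<^bsub>B\<^esub> f) (\<sigma> (inner X x x') y')"
    and ?h = "contract u s" and ?k = "\<sigma> (inner X u x \<otimes>\<^bsub>B\<^esub> f) (contract x s)"
  have c: "?t \<in> carrier Y" "?w \<in> carrier Y" "?h \<in> carrier Y" "?k \<in> carrier Y"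
    using p s x f Cons.prems by auto
  have "inner X u (x' \<oplus>\<^bsub>X\<^esub> (-1) \<odot>\<^bsub>X\<^esub> ract X x (f \<otimes>\<^bsub>B\<^esub> inner X x x'))
      = inner X u x' \<oplus>\<^bsub>B\<^esub> (-1) \<odot>\<^bsub>B\<^esub> ((inner X u x \<otimes>\<^bsub>B\<^esub> f) \<otimes>\<^bsub>B\<^esub> inner X x x')"
    using p x f Cons.prems by (simp add: X.inner_simps X.B.mult_assoc)
  then have 1: "\<sigma> (inner X u (x' \<oplus>\<^bsub>X\<^esub> (-1) \<odot>\<^bsub>X\<^esub> ract X x (f \<otimes>\<^bsub>B\<^esub> inner X x x'))) y' = ?t \<oplus>\<^bsub>Y\<^esub> (-1) \<odot>\<^bsub>Y\<^esub> ?w"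
    using p x f Cons.prems by (simp add: sig_simps sig_mult)
  have 2: "\<sigma> (inner X u x \<otimes>\<^bsub>B\<^esub> f) (contract x (p # s)) = ?w \<oplus>\<^bsub>Y\<^esub> ?k"
    using p s x f Cons.prems by (simp add: sig_simps)
  have "contract u (reduce (p # s)) = (?t \<oplus>\<^bsub>Y\<^esub> (-1) \<odot>\<^bsub>Y\<^esub> ?w) \<oplus>\<^bsub>Y\<^esub> (?h \<oplus>\<^bsub>Y\<^esub> (-1) \<odot>\<^bsub>Y\<^esub> ?k)"
    using Cons.hyps[OF Cons.prems(1) s] p by (simp add: 1)
  also have "\<dots> = (?t \<oplus>\<^bsub>Y\<^esub> ?h) \<oplus>\<^bsub>Y\<^esub> (-1) \<odot>\<^bsub>Y\<^esub> (?w \<oplus>\<^bsub>Y\<^esub> ?k)"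
    using c by (simp add: Y.cX.csmult_r_distr Y.X.a_ac)
  finally show ?case using p 2 by simp
qed (use x f in \<open>simp add: sig_simps\<close>)

lemma inner_reduce:
  "t \<in> carrier T \<Longrightarrow> s \<in> carrier T \<Longrightarrow>
    inner T t (reduce s) = inner T t s \<oplus>\<^bsub>C\<^esub> (-1) \<odot>\<^bsub>C\<^esub> inner Y (contract x t) (\<sigma> f (contract x s))"
proof (induct t)
  case (Cons p t)
  obtain u v where p: "p = (u, v)" "u \<in> carrier X" "v \<in> carrier Y" using Cons.prems by auto
  have t: "t \<in> carrier T" using Cons.prems by simp
  let ?\<eta> = "contract x s"
  have "inner Y v (contract u (reduce s)) = inner Y v (contract u s) \<oplus>\<^bsub>C\<^esub> (-1) \<odot>\<^bsub>C\<^esub> inner Y (\<sigma> (inner X x u) v) (\<sigma> f ?\<eta>)"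
    using p Cons.prems x f
    by (simp add: contract_reduce Y.inner_simps sig_mult Y.rho_adjD(3) X.inner_star)
  then show ?case using Cons.hyps[OF t Cons.prems(2)] p t Cons.prems(2) x f reduce_in[OF Cons.prems(2)]
    by (simp add: T_Cons Y.inner_simps Y.B.cm.csmult_r_distr Y.B.a_ac)
qed (use x f in simp)

text \<open>The form at \<open>s\<close> is the form at the reduced list plus \<open>2\<langle>\<eta>, f\<eta>\<rangle> - \<langle>\<eta>, fbf\<eta>\<rangle>\<close>; for an exact inverse \<open>f\<close> of \<open>b\<close> the
  correction would be \<open>\<langle>\<eta>, f\<eta>\<rangle>\<close>.\<close>

lemma form_reduce:
  assumes s: "s \<in> carrier T"
  defines "\<eta> \<equiv> contract x s"
  shows "inner T s s = inner T (reduce s) (reduce s) \<oplus>\<^bsub>C\<^esub> (inner Y \<eta> (\<sigma> f \<eta>) \<oplus>\<^bsub>C\<^esub>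
    (inner Y \<eta> (\<sigma> f \<eta>) \<oplus>\<^bsub>C\<^esub> (-1) \<odot>\<^bsub>C\<^esub> inner Y \<eta> (\<sigma> (f \<otimes>\<^bsub>B\<^esub> b \<otimes>\<^bsub>B\<^esub> f) \<eta>)))"
proof -
  have \<eta>: "\<eta> \<in> carrier Y" using x s by (simp add: \<eta>_def)
  have b: "b \<in> carrier B" using x by (simp add: b_def)
  let ?r = "reduce s" let ?q = "inner Y \<eta> (\<sigma> f \<eta>)" let ?o = "inner Y \<eta> (\<sigma> (f \<otimes>\<^bsub>B\<^esub> b \<otimes>\<^bsub>B\<^esub> f) \<eta>)"
  have r: "?r \<in> carrier T" by (rule reduce_in[OF s])
  have q: "?q \<in> carrier C" "?o \<in> carrier C" "inner T s s \<in> carrier C" using \<eta> f b s by auto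
  have sq: "star C ?q = ?q" using \<eta> f by (simp add: Y.inner_star Y.rho_adjD(3))
  have 1: "inner T s ?r = inner T s s \<oplus>\<^bsub>C\<^esub> (-1) \<odot>\<^bsub>C\<^esub> ?q" using inner_reduce[OF s s] by (simp add: \<eta>_def)
  have "inner T ?r s = star C (inner T s ?r)" using T_star[OF s r] by simp
  also have "\<dots> = inner T s s \<oplus>\<^bsub>C\<^esub> (-1) \<odot>\<^bsub>C\<^esub> ?q"
    unfolding 1 using q by (simp add: Y.B.star_add Y.B.star_smult sq T_star[OF s s])
  finally have 2: "inner T ?r s = inner T s s \<oplus>\<^bsub>C\<^esub> (-1) \<odot>\<^bsub>C\<^esub> ?q" .
  have "contract x ?r = \<eta> \<oplus>\<^bsub>Y\<^esub> (-1) \<odot>\<^bsub>Y\<^esub> \<sigma> (b \<otimes>\<^bsub>B\<^esub> f) \<eta>"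
    using contract_reduce[OF x s] by (simp add: \<eta>_def b_def)
  then have "inner Y (contract x ?r) (\<sigma> f \<eta>) = ?q \<oplus>\<^bsub>C\<^esub> (-1) \<odot>\<^bsub>C\<^esub> ?o"
    using \<eta> f b by (simp add: Y.inner_simps Y.rho_adjD(3) sig_mult X.B.star_mult X.B.mult_assoc X.inner_star x b_def)
  then have "inner T ?r ?r = (inner T s s \<oplus>\<^bsub>C\<^esub> (-1) \<odot>\<^bsub>C\<^esub> ?q) \<oplus>\<^bsub>C\<^esub> (-1) \<odot>\<^bsub>C\<^esub> (?q \<oplus>\<^bsub>C\<^esub> (-1) \<odot>\<^bsub>C\<^esub> ?o)"
    using inner_reduce[OF r s] 2 by (simp add: \<eta>_def)
  then show ?thesis
    using q by (simp add: Y.B.cm.csmult_m1 Y.B.minus_add Y.B.a_ac Y.B.r_neg Y.B.r_neg1 Y.B.r_neg2)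
qed

end

text \<open>A local unit \<open>e\<close> for \<open>b = \<langle>x, x\<rangle>\<close> acts almost as the identity on \<open>\<langle>x, u\<rangle>\<close>, because
  \<open>\<langle>x, u\<rangle>\<langle>u, x\<rangle> \<le> \<Parallel>u\<Parallel>\<^sup>2 b\<close> by the Cauchy-Schwarz inequality.\<close>

lemma hdist_contract:
  assumes x: "x \<in> carrier X" and s: "s \<in> carrier T"
  shows "\<exists>L\<ge>0. \<forall>e\<in>carrier B. \<forall>\<tau>\<ge>0. (\<forall>a\<in>carrier B. \<forall>c. cpos B c \<longrightarrow> inner X x x = a \<otimes>\<^bsub>B\<^esub> star B a \<oplus>\<^bsub>B\<^esub> c \<longrightarrow>
      (cdist B (e \<otimes>\<^bsub>B\<^esub> a) a)\<^sup>2 \<le> \<tau>) \<longrightarrow> hdist C Y (\<sigma> e (contract x s)) (contract x s) \<le> L * sqrt \<tau>"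
  using s
proof (induct s)
  case Nil
  then show ?case by (intro exI[of _ 0]) (simp add: sig_simps)
next
  case (Cons p s)
  obtain u v where p: "p = (u, v)" "u \<in> carrier X" "v \<in> carrier Y" using Cons.prems by auto
  have s: "s \<in> carrier T" using Cons.prems by simp
  let ?P = "\<lambda>e \<tau>. \<forall>a\<in>carrier B. \<forall>c. cpos B c \<longrightarrow> inner X x x = a \<otimes>\<^bsub>B\<^esub> star B a \<oplus>\<^bsub>B\<^esub> c \<longrightarrow>
      (cdist B (e \<otimes>\<^bsub>B\<^esub> a) a)\<^sup>2 \<le> \<tau>"
  obtain L where L: "L \<ge> 0" "\<And>e \<tau>. e \<in> carrier B \<Longrightarrow> \<tau> \<ge> 0 \<Longrightarrow> ?P e \<tau> \<Longrightarrow>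
      hdist C Y (\<sigma> e (contract x s)) (contract x s) \<le> L * sqrt \<tau>" using Cons.hyps s by blast
  obtain K where K: "K \<ge> 0" "\<And>a b y. a \<in> carrier B \<Longrightarrow> b \<in> carrier B \<Longrightarrow> y \<in> carrier Y \<Longrightarrow>
      hdist C Y (\<sigma> a y) (\<sigma> b y) \<le> K * cdist B a b * hnorm C Y y" using sig_bounded by blast
  \<comment> \<open>an upper bound of \<open>\<Parallel>u\<Parallel>\<^sup>2\<close> that is not zero\<close>
  define t where "t = nrm B (inner X u u) + 1"
  have t: "t > 0" using p X.B.nrm_nonneg[of "inner X u u"] by (simp add: t_def add_nonneg_pos)
  define c where "c = inner X x u"
  have c: "c \<in> carrier B" "star B c = inner X u x" using x p by (auto simp: c_def X.inner_star)
  let ?a = "complex_of_real (1 / sqrt t) \<odot>\<^bsub>B\<^esub> c"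
  let ?r = "complex_of_real t \<odot>\<^bsub>B\<^esub> inner X x x \<oplus>\<^bsub>B\<^esub> (-1) \<odot>\<^bsub>B\<^esub> (c \<otimes>\<^bsub>B\<^esub> star B c)"
  have r: "cpos B ?r" unfolding c(2) unfolding c_def
    using X.cauchy_schwarz_order[OF p(2) x t] by (simp add: t_def)
  have b: "inner X x x = ?a \<otimes>\<^bsub>B\<^esub> star B ?a \<oplus>\<^bsub>B\<^esub> complex_of_real (1/t) \<odot>\<^bsub>B\<^esub> ?r"
  proof -
    have "complex_of_real (1/t) \<odot>\<^bsub>B\<^esub> ?r = inner X x x \<oplus>\<^bsub>B\<^esub> (-1) \<odot>\<^bsub>B\<^esub> (complex_of_real (1/t) \<odot>\<^bsub>B\<^esub> (c \<otimes>\<^bsub>B\<^esub> star B c))"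
      using t x c(1) by (simp add: X.B.cm.csmult_r_distr X.B.cm.csmult_assoc)
    moreover have "?a \<otimes>\<^bsub>B\<^esub> star B ?a = complex_of_real (1/t) \<odot>\<^bsub>B\<^esub> (c \<otimes>\<^bsub>B\<^esub> star B c)"
      using c(1) t by (simp add: X.B.smult_mult_left X.B.smult_mult_right X.B.star_smult X.B.cm.csmult_assoc
          flip: of_real_mult)
    ultimately show ?thesis using x c(1) by (simp add: X.B.cm.csmult_m1 X.B.a_lcomm[of _ "inner X x x"] X.B.r_neg)
  qed
  let ?L = "K * sqrt t * hnorm C Y v + L"
  have "hdist C Y (\<sigma> e (contract x (p # s))) (contract x (p # s)) \<le> ?L * sqrt \<tau>"
    if e: "e \<in> carrier B" and \<tau>: "\<tau> \<ge> 0" and P: "?P e \<tau>" for e \<tau>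
  proof -
    have "(cdist B (e \<otimes>\<^bsub>B\<^esub> ?a) ?a)\<^sup>2 \<le> \<tau>"
      using P b X.B.cpos_scale[OF r, of "1/t"] c(1) t by auto
    then have "cdist B (e \<otimes>\<^bsub>B\<^esub> ?a) ?a \<le> sqrt \<tau>" by (simp add: real_le_rsqrt)
    moreover have "cdist B (e \<otimes>\<^bsub>B\<^esub> ?a) ?a = cdist B (e \<otimes>\<^bsub>B\<^esub> c) c / sqrt t"
      using e c(1) t by (simp add: X.B.smult_mult_right X.B.cdist_smult norm_divide)
    ultimately have ec: "cdist B (e \<otimes>\<^bsub>B\<^esub> c) c \<le> sqrt \<tau> * sqrt t" using t by (simp add: pos_divide_le_eq)
    have "hdist C Y (\<sigma> e (contract x (p # s))) (contract x (p # s))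
        \<le> hdist C Y (\<sigma> e (\<sigma> c v)) (\<sigma> c v) + hdist C Y (\<sigma> e (contract x s)) (contract x s)"
      using Y.hdist_add[of "\<sigma> e (\<sigma> c v)" "\<sigma> e (contract x s)" "\<sigma> c v" "contract x s"] e c(1) p x s
      by (simp add: sig_simps c_def[symmetric])
    also have "hdist C Y (\<sigma> e (\<sigma> c v)) (\<sigma> c v) = hdist C Y (\<sigma> (e \<otimes>\<^bsub>B\<^esub> c) v) (\<sigma> c v)"
      using e c(1) p by (simp add: sig_mult)
    also have "\<dots> \<le> K * cdist B (e \<otimes>\<^bsub>B\<^esub> c) c * hnorm C Y v" using e c(1) p by (intro K) auto
    also have "\<dots> \<le> K * (sqrt \<tau> * sqrt t) * hnorm C Y v" using K ec p by (intro mult_right_mono mult_left_mono) auto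
    also have "hdist C Y (\<sigma> e (contract x s)) (contract x s) \<le> L * sqrt \<tau>" using L e \<tau> P by blast
    finally show ?thesis by (simp add: algebra_simps)
  qed
  moreover have "?L \<ge> 0" using K L t p by simp
  ultimately show ?case by blast
qed

text \<open>By induction on the length of the list.  Splitting off the first entry \<open>(x, y)\<close> writes the form, up to
  an arbitrarily small error, as a sum of the form at the reduced rest, \<open>\<langle>w, bw\<rangle>\<close> with \<open>w = y + f\<eta>\<close>, and two
  copies of \<open>\<langle>g\<eta>, g\<eta>\<rangle>\<close> with \<open>g\<^sup>2 = f - fbf\<close>; the cone is closed.\<close>

lemma hom_form_pos: "s \<in> carrier T \<Longrightarrow> cpos C (inner T s s)"
proof (induct "length s" arbitrary: s)
  case 0
  then show ?case by simp
next
  case (Suc n)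
  obtain x y s' where s: "s = (x, y) # s'" "x \<in> carrier X" "y \<in> carrier Y" "s' \<in> carrier T" "length s' = n"
    using Suc.hyps(2) Suc.prems by (cases s) auto
  let ?b = "inner X x x" and ?\<eta> = "contract x s'"
  have b: "?b \<in> carrier B" "star B ?b = ?b" and \<eta>: "?\<eta> \<in> carrier Y" using s by (auto simp: X.inner_star)
  have approx: "\<exists>p. cpos C p \<and> cdist C p (inner T s s) \<le> \<epsilon>" if \<epsilon>: "\<epsilon> > 0" for \<epsilon>
  proof -
    obtain L where L: "L \<ge> 0" "\<And>e \<tau>. e \<in> carrier B \<Longrightarrow> \<tau> \<ge> 0 \<Longrightarrow> (\<And>a c. a \<in> carrier B \<Longrightarrow> cpos B c \<Longrightarrow>
      ?b = a \<otimes>\<^bsub>B\<^esub> star B a \<oplus>\<^bsub>B\<^esub> c \<Longrightarrow> (cdist B (e \<otimes>\<^bsub>B\<^esub> a) a)\<^sup>2 \<le> \<tau>) \<Longrightarrow> hdist C Y (\<sigma> e ?\<eta>) ?\<eta> \<le> L * sqrt \<tau>"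
      using hdist_contract[OF s(2,4)] by meson
    \<comment> \<open>each of the two mixed terms contributes an error of at most \<open>\<Parallel>y\<Parallel> L \<surd>\<tau>\<close>\<close>
    define M where "M = 2 * hnorm C Y y * L + 1"
    have M: "M > 0" using L(1) s by (simp add: M_def add_nonneg_pos)
    define \<tau> where "\<tau> = (\<epsilon> / M)\<^sup>2"
    have \<tau>: "\<tau> > 0" "sqrt \<tau> = \<epsilon> / M" using \<epsilon> M by (auto simp: \<tau>_def)
    obtain f g where f: "f \<in> carrier B" "g \<in> carrier B" "star B f = f" "star B g = g" "?b \<otimes>\<^bsub>B\<^esub> f = f \<otimes>\<^bsub>B\<^esub> ?b"
      and ff: "f = f \<otimes>\<^bsub>B\<^esub> ?b \<otimes>\<^bsub>B\<^esub> f \<oplus>\<^bsub>B\<^esub> g \<otimes>\<^bsub>B\<^esub> g"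
      and lu: "\<And>a c. a \<in> carrier B \<Longrightarrow> cpos B c \<Longrightarrow> ?b = a \<otimes>\<^bsub>B\<^esub> star B a \<oplus>\<^bsub>B\<^esub> c \<Longrightarrow> (cdist B (?b \<otimes>\<^bsub>B\<^esub> f \<otimes>\<^bsub>B\<^esub> a) a)\<^sup>2 \<le> \<tau>"
      using X.B.cpos_local_unit[OF X.inner_pos[OF s(2)] \<tau>(1)] by metis
    let ?e = "?b \<otimes>\<^bsub>B\<^esub> f" and ?r = "reduce x f s'"
    have small: "hdist C Y (\<sigma> ?e ?\<eta>) ?\<eta> \<le> L * sqrt \<tau>" 
      by (rule L(2)[OF _ _ lu]) (use b f \<tau> in simp_all)
    define o' where "o' = inner Y ?\<eta> (\<sigma> (f \<otimes>\<^bsub>B\<^esub> ?b \<otimes>\<^bsub>B\<^esub> f) ?\<eta>)"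
    define k where "k = inner Y (\<sigma> g ?\<eta>) (\<sigma> g ?\<eta>)"
    define F where "F = inner T ?r ?r"
    have gg: "inner Y ?\<eta> (\<sigma> f ?\<eta>) = o' \<oplus>\<^bsub>C\<^esub> k"
      using f b \<eta> by (subst ff) (simp add: o'_def k_def sig_simps sig_mult Y.inner_simps Y.rho_adjD(3))
    define w where "w = y \<oplus>\<^bsub>Y\<^esub> \<sigma> f ?\<eta>"
    define G where "G = inner Y w (\<sigma> ?b w)"
    define m where "m = inner Y y (\<sigma> ?e ?\<eta>)"
    define m' where "m' = inner Y (\<sigma> ?e ?\<eta>) y"
    have c: "o' \<in> carrier C" "k \<in> carrier C" "F \<in> carrier C" "G \<in> carrier C" "m \<in> carrier C" "m' \<in> carrier C" "w \<in> carrier Y"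
      using reduce_in[OF s(2) f(1,3) s(4)] f b \<eta> s by (auto simp: o'_def k_def F_def w_def G_def m_def m'_def)
    let ?d = "inner Y y (\<sigma> ?b y)"
    have Gexp: "G = ?d \<oplus>\<^bsub>C\<^esub> m \<oplus>\<^bsub>C\<^esub> (m' \<oplus>\<^bsub>C\<^esub> o')"
      using f(1-4) b \<eta> s unfolding G_def w_def m_def m'_def o'_def
      by (simp add: sig_simps sig_mult Y.inner_simps Y.rho_adjD(3) X.B.star_mult X.B.mult_assoc Y.B.a_ac)
    have dd: "?d \<in> carrier C" using s b by simp
    define p where "p = F \<oplus>\<^bsub>C\<^esub> (G \<oplus>\<^bsub>C\<^esub> (k \<oplus>\<^bsub>C\<^esub> k))"
    have "cpos C F"
      unfolding F_def by (rule Suc.hyps(1)) (use reduce_in[OF s(2) f(1,3) s(4)] s in auto)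
    moreover have "cpos C G" unfolding G_def using X.inner_pos[OF s(2)] c by (intro Y.rho_cpos)
    moreover have "cpos C k" unfolding k_def using f \<eta> by (intro Y.inner_pos) auto
    ultimately have pp: "cpos C p" unfolding p_def by (intro Y.B.cpos_add)
    have "inner T s' s' = F \<oplus>\<^bsub>C\<^esub> ((o' \<oplus>\<^bsub>C\<^esub> k) \<oplus>\<^bsub>C\<^esub> ((o' \<oplus>\<^bsub>C\<^esub> k) \<oplus>\<^bsub>C\<^esub> (-1) \<odot>\<^bsub>C\<^esub> o'))"
      using form_reduce[OF s(2) f(1,3) s(4)] gg by (simp add: F_def o'_def)
    also have "\<dots> = F \<oplus>\<^bsub>C\<^esub> (o' \<oplus>\<^bsub>C\<^esub> (k \<oplus>\<^bsub>C\<^esub> k))"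
      using c by (simp add: Y.B.cm.csmult_m1 Y.B.a_ac Y.B.r_neg Y.B.r_neg1 Y.B.r_neg2)
    finally have Fs: "inner T s' s' = F \<oplus>\<^bsub>C\<^esub> (o' \<oplus>\<^bsub>C\<^esub> (k \<oplus>\<^bsub>C\<^esub> k))" .
    have "inner T s' [(x, y)] = star C (inner T [(x, y)] s')"
      using T_star[of "[(x, y)]" s'] s by simp
    also have "\<dots> = inner Y ?\<eta> y" using s \<eta> by (simp add: T_Cons Y.inner_star)
    finally have "inner T s s = (?d \<oplus>\<^bsub>C\<^esub> inner Y y ?\<eta>) \<oplus>\<^bsub>C\<^esub> (inner Y ?\<eta> y \<oplus>\<^bsub>C\<^esub> inner T s' s')"
      using T_append_left[of "[(x, y)]" s' s] T_append_right[of "[(x, y)]" "[(x, y)]" s']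
        T_append_right[of s' "[(x, y)]" s'] s \<eta> by (simp add: T_single) (simp add: T_Cons)
    then have S: "inner T s s = (F \<oplus>\<^bsub>C\<^esub> (?d \<oplus>\<^bsub>C\<^esub> (o' \<oplus>\<^bsub>C\<^esub> (k \<oplus>\<^bsub>C\<^esub> k)))) \<oplus>\<^bsub>C\<^esub> (inner Y y ?\<eta> \<oplus>\<^bsub>C\<^esub> inner Y ?\<eta> y)"
      using c dd s \<eta> by (simp add: Fs Y.B.a_ac)
    have P: "p = (F \<oplus>\<^bsub>C\<^esub> (?d \<oplus>\<^bsub>C\<^esub> (o' \<oplus>\<^bsub>C\<^esub> (k \<oplus>\<^bsub>C\<^esub> k)))) \<oplus>\<^bsub>C\<^esub> (m \<oplus>\<^bsub>C\<^esub> m')"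
      using c dd by (simp add: p_def Gexp Y.B.a_ac)
    let ?c = "F \<oplus>\<^bsub>C\<^esub> (?d \<oplus>\<^bsub>C\<^esub> (o' \<oplus>\<^bsub>C\<^esub> (k \<oplus>\<^bsub>C\<^esub> k)))"
    have ei: "\<sigma> ?e ?\<eta> \<in> carrier Y" using b f \<eta> by simp
    have "cdist C p (inner T s s) \<le> cdist C ?c ?c + cdist C (m \<oplus>\<^bsub>C\<^esub> m') (inner Y y ?\<eta> \<oplus>\<^bsub>C\<^esub> inner Y ?\<eta> y)"
      unfolding S P using c dd s \<eta> by (intro Y.B.cdist_add) auto
    also have "\<dots> \<le> 0 + (cdist C m (inner Y y ?\<eta>) + cdist C m' (inner Y ?\<eta> y))"
      using c s \<eta> by (intro add_mono Y.B.cdist_add) auto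
    also have "\<dots> \<le> 0 + (hnorm C Y y * hdist C Y (\<sigma> ?e ?\<eta>) ?\<eta> + hdist C Y (\<sigma> ?e ?\<eta>) ?\<eta> * hnorm C Y y)"
      unfolding m_def m'_def
      using Y.cdist_inner[of y "\<sigma> ?e ?\<eta>" y ?\<eta>] Y.cdist_inner[of "\<sigma> ?e ?\<eta>" y ?\<eta> y] ei \<eta> s
      by (intro add_mono) auto
    also have "\<dots> = 2 * hnorm C Y y * hdist C Y (\<sigma> ?e ?\<eta>) ?\<eta>" by simp
    also have "\<dots> \<le> 2 * hnorm C Y y * (L * sqrt \<tau>)" using small s by (intro mult_left_mono) auto
    also have "\<dots> \<le> M * sqrt \<tau>" using real_sqrt_ge_zero[of \<tau>] \<tau>(1) by (simp add: M_def distrib_right mult.assoc)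
    also have "\<dots> = \<epsilon>" using \<tau> M by simp
    finally show ?thesis using pp by blast
  qed
  have "\<exists>p. cpos C p \<and> cdist C p (inner T s s) \<le> inverse (real (Suc n))" for n using approx by simp
  then obtain p where p: "\<And>n. cpos C (p n)" "\<And>n. cdist C (p n) (inner T s s) \<le> inverse (real (Suc n))" by metis
  have "(\<lambda>n. cdist C (p n) (inner T s s)) \<longlonglongrightarrow> 0"
    using LIMSEQ_inverse_real_of_nat p(2) by - (erule null_cmp, auto)
  then show ?case by (rule Y.B.cpos_limit[OF p(1) T_in[OF Suc.prems Suc.prems]])
qed

end

lemma tensor_hom:
  assumes X: "hilbert_module B X" and Y: "hilbert_module C Y" and h: "star_hom B (End C Y) \<sigma>"
  shows "tensor B X C Y \<sigma>"
proof -
  interpret X: hilbert_module B X by fact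
  interpret Y: hilbert_module C Y by fact
  have "cp_rep B C Y \<sigma>"
    by (intro cp_rep.intro cp_rep_axioms.intro star_hom_cp[OF h] X.B.cstar_algebra_axioms Y Y.abelian_group_End)
  then have "hom_form B X C Y \<sigma>"
    using X h by (intro hom_form.intro tensor_form.intro hom_form_axioms.intro) (auto simp: star_hom_def)
  then interpret hom_form B X C Y \<sigma> .
  show ?thesis
    using hom_form_pos by (intro tensor.intro tensor_form_axioms tensor_axioms.intro) simp
qed

section \<open>Approximate units and separability\<close>

lemma separable_denseE:
  assumes "separable_cstar A"
  obtains d :: "nat \<Rightarrow> 'a" where "\<And>n. d n \<in> carrier A" "\<And>a \<epsilon>. a \<in> carrier A \<Longrightarrow> \<epsilon> > 0 \<Longrightarrow> \<exists>n. cdist A (d n) a < \<epsilon>"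
proof -
  interpret cstar_algebra A using assms by (simp add: separable_cstar_def)
  obtain D where D: "countable D" "D \<subseteq> carrier A"
    "Metric_space.mtopology (carrier A) (cdist A) closure_of D = carrier A"
    using assms by (auto simp: separable_cstar_def separable_space_def Metric_space.topspace_mtopology[OF metric])
  have dense: "\<exists>y\<in>D. cdist A y a < \<epsilon>" if a: "a \<in> carrier A" and \<epsilon>: "\<epsilon> > 0" for a \<epsilon>
  proof -
    have "a \<in> Metric_space.mtopology (carrier A) (cdist A) closure_of D" using a D(3) by simp
    then obtain y where "y \<in> D" "y \<in> Metric_space.mball (carrier A) (cdist A) a \<epsilon>"
      unfolding Metric_space.metric_closure_of[OF metric] using \<epsilon> by blast
    then show ?thesis by (auto simp: Metric_space.in_mball[OF metric] cdist_commute)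
  qed
  then have "D \<noteq> {}" using zero_closed zero_less_one by blast
  then show ?thesis
    using that[of "from_nat_into D"] D from_nat_into[of D] dense from_nat_into_to_nat_on[OF D(1)] by (metis subsetD)
qed

text \<open>A local unit for \<open>\<Sum>\<^sub>k d\<^sub>k d\<^sub>k*\<close> with \<open>k < n\<close> is an approximate unit on the first \<open>n\<close> members of a dense sequence.\<close>

lemma approximate_unit_sequence:
  fixes A :: "'a cstar"
  assumes sep: "separable_cstar A"
  obtains e :: "nat \<Rightarrow> 'a" where "\<And>n. cpos A (e n)" "\<And>n. nrm A (e n) \<le> 1"
    "\<And>a. a \<in> carrier A \<Longrightarrow> (\<lambda>n. cdist A (e n \<otimes>\<^bsub>A\<^esub> a) a) \<longlonglongrightarrow> 0"
    "\<And>a. a \<in> carrier A \<Longrightarrow> (\<lambda>n. cdist A (a \<otimes>\<^bsub>A\<^esub> e n) a) \<longlonglongrightarrow> 0"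
proof -
  interpret cstar_algebra A using assms by (simp add: separable_cstar_def)
  obtain d :: "nat \<Rightarrow> 'a" where d: "\<And>n. d n \<in> carrier A" "\<And>a \<epsilon>. a \<in> carrier A \<Longrightarrow> \<epsilon> > 0 \<Longrightarrow> \<exists>n. cdist A (d n) a < \<epsilon>"
    using separable_denseE[OF sep] by blast
  define h where "h n = (\<Oplus>\<^bsub>A\<^esub>k\<in>{..<n}. d k \<otimes>\<^bsub>A\<^esub> star A (d k))" for n :: nat
  have fin: "cpos A (\<Oplus>\<^bsub>A\<^esub>k\<in>K. d k \<otimes>\<^bsub>A\<^esub> star A (d k))" if "finite K" for K :: "nat set"
    using that by induct (auto simp: finsum_insert cpos_add cpos_mult_star d Pi_def)
  have "\<exists>e. cpos A e \<and> nrm A e \<le> 1 \<and> (\<forall>k<n. (cdist A (e \<otimes>\<^bsub>A\<^esub> d k) (d k))\<^sup>2 \<le> inverse (real (Suc n)))" for n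
  proof -
    have hp: "cpos A (h n)" unfolding h_def by (rule fin) simp
    obtain f where f: "cpos A (h n \<otimes>\<^bsub>A\<^esub> f)" "nrm A (h n \<otimes>\<^bsub>A\<^esub> f) \<le> 1"
      "\<And>a c. a \<in> carrier A \<Longrightarrow> cpos A c \<Longrightarrow> h n = a \<otimes>\<^bsub>A\<^esub> star A a \<oplus>\<^bsub>A\<^esub> c \<Longrightarrow>
        (cdist A (h n \<otimes>\<^bsub>A\<^esub> f \<otimes>\<^bsub>A\<^esub> a) a)\<^sup>2 \<le> inverse (real (Suc n))"
      using cpos_local_unit[OF hp, of "inverse (real (Suc n))"] by (metis inverse_positive_iff_positive of_nat_0_less_iff zero_less_Suc)
    have "h n = d k \<otimes>\<^bsub>A\<^esub> star A (d k) \<oplus>\<^bsub>A\<^esub> (\<Oplus>\<^bsub>A\<^esub>k\<in>{..<n} - {k}. d k \<otimes>\<^bsub>A\<^esub> star A (d k))" if "k < n" for k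
    proof -
      have "{..<n} = insert k ({..<n} - {k})" using that by auto
      then show ?thesis unfolding h_def using d by (subst (1) \<open>{..<n} = _\<close>, subst finsum_insert) auto
    qed
    then show ?thesis using f(1,2) f(3)[OF d(1) fin] by (intro exI[of _ "h n \<otimes>\<^bsub>A\<^esub> f"]) auto
  qed
  then obtain e where e: "\<And>n. cpos A (e n)" "\<And>n. nrm A (e n) \<le> 1"
    "\<And>n k. k < n \<Longrightarrow> (cdist A (e n \<otimes>\<^bsub>A\<^esub> d k) (d k))\<^sup>2 \<le> inverse (real (Suc n))" by metis
  have ec: "e n \<in> carrier A" for n using e(1) by (rule cpos_carrier)
  have dk: "(\<lambda>n. cdist A (e n \<otimes>\<^bsub>A\<^esub> d k) (d k)) \<longlonglongrightarrow> 0" for k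
  proof (rule Lim_null_comparison)
    show "eventually (\<lambda>n. norm (cdist A (e n \<otimes>\<^bsub>A\<^esub> d k) (d k)) \<le> sqrt (inverse (real (Suc n)))) sequentially"
      using eventually_gt_at_top[of k] by eventually_elim (use e(3) in \<open>auto intro: real_le_rsqrt\<close>)
    show "(\<lambda>n. sqrt (inverse (real (Suc n)))) \<longlonglongrightarrow> 0"
      using tendsto_real_sqrt[OF LIMSEQ_inverse_real_of_nat] by simp
  qed
  have left: "(\<lambda>n. cdist A (e n \<otimes>\<^bsub>A\<^esub> a) a) \<longlonglongrightarrow> 0" if a: "a \<in> carrier A" for a
  proof (rule LIMSEQ_I)
    fix \<epsilon> :: real assume "\<epsilon> > 0"
    then obtain k where k: "cdist A (d k) a < \<epsilon>/3" using d(2)[OF a, of "\<epsilon>/3"] by auto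
    obtain N where N: "\<And>n. n \<ge> N \<Longrightarrow> cdist A (e n \<otimes>\<^bsub>A\<^esub> d k) (d k) < \<epsilon>/3"
      using LIMSEQ_D[OF dk[of k], of "\<epsilon>/3"] \<open>\<epsilon> > 0\<close> by auto
    have "cdist A (e n \<otimes>\<^bsub>A\<^esub> a) a < \<epsilon>" if "n \<ge> N" for n
    proof -
      have "cdist A (e n \<otimes>\<^bsub>A\<^esub> a) (e n \<otimes>\<^bsub>A\<^esub> d k) \<le> nrm A (e n) * cdist A a (d k)"
        using a d ec by (intro cdist_mult_left) auto
      also have "\<dots> \<le> 1 * cdist A a (d k)" using e(2) by (intro mult_right_mono) auto
      finally have "cdist A (e n \<otimes>\<^bsub>A\<^esub> a) (e n \<otimes>\<^bsub>A\<^esub> d k) < \<epsilon>/3" using k by (simp add: cdist_commute)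
      then show ?thesis
        using cdist_triangle[of "e n \<otimes>\<^bsub>A\<^esub> a" "e n \<otimes>\<^bsub>A\<^esub> d k" a] cdist_triangle[of "e n \<otimes>\<^bsub>A\<^esub> d k" "d k" a]
          N[OF that] k a d ec by auto
    qed
    then show "\<exists>N. \<forall>n\<ge>N. norm (cdist A (e n \<otimes>\<^bsub>A\<^esub> a) a - 0) < \<epsilon>" by auto
  qed
  have right: "(\<lambda>n. cdist A (a \<otimes>\<^bsub>A\<^esub> e n) a) \<longlonglongrightarrow> 0" if a: "a \<in> carrier A" for a
  proof -
    have "cdist A (a \<otimes>\<^bsub>A\<^esub> e n) a = cdist A (e n \<otimes>\<^bsub>A\<^esub> star A a) (star A a)" for n
      using cdist_star[of "a \<otimes>\<^bsub>A\<^esub> e n" a] a ec by (simp add: star_mult cpos_star[OF e(1)])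
    then show ?thesis using left[of "star A a"] a by simp
  qed
  show ?thesis using that e(1,2) left right by blast
qed

lemma approx_unit_filtermap:
  assumes e: "\<And>n::nat. cpos A (e n)" "\<And>n. nrm A (e n) \<le> 1" and A: "cstar_algebra A"
    "\<And>a. a \<in> carrier A \<Longrightarrow> (\<lambda>n. cdist A (e n \<otimes>\<^bsub>A\<^esub> a) a) \<longlonglongrightarrow> 0"
    "\<And>a. a \<in> carrier A \<Longrightarrow> (\<lambda>n. cdist A (a \<otimes>\<^bsub>A\<^esub> e n) a) \<longlonglongrightarrow> 0"
  shows "approx_unit A (filtermap e sequentially)"
  unfolding approx_unit_def filterlim_filtermap eventually_filtermap
  using e A cstar_algebra.cpos_carrier[OF A(1) e(1)] by (simp add: filtermap_bot_iff)

context hilbert_module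
begin

text \<open>\<open>\<Parallel>xe - x\<Parallel>\<^sup>2\<close> is at most \<open>2\<Parallel>be - b\<Parallel>\<close> for \<open>b = \<langle>x, x\<rangle>\<close>.\<close>

lemma ract_approximate:
  assumes sep: "separable_cstar B" and x: "x \<in> carrier X"
  obtains e :: "nat \<Rightarrow> 'b" where "\<And>n. e n \<in> carrier B" "(\<lambda>n. hdist B X (ract X x (e n)) x) \<longlonglongrightarrow> 0"
proof -
  obtain e :: "nat \<Rightarrow> 'b" where e: "\<And>n. cpos B (e n)" "\<And>n. nrm B (e n) \<le> 1"
    "\<And>a. a \<in> carrier B \<Longrightarrow> (\<lambda>n. cdist B (a \<otimes>\<^bsub>B\<^esub> e n) a) \<longlonglongrightarrow> 0" using approximate_unit_sequence[OF sep] by metis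
  have ec: "e n \<in> carrier B" for n using e(1) by (rule B.cpos_carrier)
  let ?b = "inner X x x"
  have b: "?b \<in> carrier B" using x by simp
  have le: "(hdist B X (ract X x (e n)) x)\<^sup>2 \<le> 2 * cdist B (?b \<otimes>\<^bsub>B\<^esub> e n) ?b" for n
  proof -
    let ?u = "ract X x (e n) \<oplus>\<^bsub>X\<^esub> (-1) \<odot>\<^bsub>X\<^esub> x"
    have u: "?u \<in> carrier X" using x ec by simp
    let ?w = "?b \<otimes>\<^bsub>B\<^esub> e n \<oplus>\<^bsub>B\<^esub> (-1) \<odot>\<^bsub>B\<^esub> ?b"
    have xu: "inner X x ?u = ?w" using x ec by (simp add: inner_simps)
    have "inner X ?u ?u = e n \<otimes>\<^bsub>B\<^esub> ?w \<oplus>\<^bsub>B\<^esub> (-1) \<odot>\<^bsub>B\<^esub> ?w"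
      using inner_add_left[of "ract X x (e n)" "(-1) \<odot>\<^bsub>X\<^esub> x" ?u] x ec u
      by (simp only: inner_ract_left inner_smult_left smult_closed ract_closed xu B.cpos_star[OF e(1)]) simp
    then have "(hn ?u)\<^sup>2 = nrm B (e n \<otimes>\<^bsub>B\<^esub> ?w \<oplus>\<^bsub>B\<^esub> (-1) \<odot>\<^bsub>B\<^esub> ?w)" by (simp only: hnorm_sq[OF u])
    also have "\<dots> \<le> nrm B (e n \<otimes>\<^bsub>B\<^esub> ?w) + nrm B ((-1) \<odot>\<^bsub>B\<^esub> ?w)" using b ec by (intro B.nrm_add) auto
    also have "\<dots> \<le> nrm B (e n) * nrm B ?w + nrm B ?w"
      using b ec by (intro add_mono B.nrm_mult) (auto simp: B.nrm_smult)
    also have "\<dots> \<le> 1 * nrm B ?w + nrm B ?w"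
      using e(2) b ec by (intro add_mono mult_right_mono) (auto simp: B.nrm_nonneg)
    finally show ?thesis using x b ec by (simp add: hdist_eq B.cdist_eq)
  qed
  have "(\<lambda>n. 2 * cdist B (?b \<otimes>\<^bsub>B\<^esub> e n) ?b) \<longlonglongrightarrow> 2 * 0" by (intro tendsto_intros e b)
  then have "(\<lambda>n. (hdist B X (ract X x (e n)) x)\<^sup>2) \<longlonglongrightarrow> 0" using le by - (erule null_cmp, auto)
  then have "(\<lambda>n. sqrt ((hdist B X (ract X x (e n)) x)\<^sup>2)) \<longlonglongrightarrow> sqrt 0" by (rule tendsto_real_sqrt)
  then have "(\<lambda>n. hdist B X (ract X x (e n)) x) \<longlonglongrightarrow> 0" by simp
  then show ?thesis using that ec by blast
qed

lemma closed_subspace_ract: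
  assumes D: "closed_subspace D" and x: "x \<in> carrier X" and lim: "\<And>n::nat. b n \<in> carrier B" "a \<in> carrier B"
    "(\<lambda>n. cdist B (b n) a) \<longlonglongrightarrow> 0" and mem: "\<And>n. ract X x (b n) \<in> D"
  shows "ract X x a \<in> D"
proof -
  have "(\<lambda>n. hn x * cdist B (b n) a) \<longlonglongrightarrow> hn x * 0" using lim by (intro tendsto_intros)
  moreover have "hdist B X (ract X x (b n)) (ract X x a) \<le> hn x * cdist B (b n) a" for n
  proof -
    have "ract X x (b n) \<oplus>\<^bsub>X\<^esub> (-1) \<odot>\<^bsub>X\<^esub> ract X x a = ract X x (b n \<oplus>\<^bsub>B\<^esub> (-1) \<odot>\<^bsub>B\<^esub> a)"
      using x lim by (simp add: ract_add_right ract_smult_right)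
    then show ?thesis using x lim hnorm_ract[of x "b n \<oplus>\<^bsub>B\<^esub> (-1) \<odot>\<^bsub>B\<^esub> a"] by (simp add: hdist_eq B.cdist_eq)
  qed
  ultimately have "(\<lambda>n. hdist B X (ract X x (b n)) (ract X x a)) \<longlonglongrightarrow> 0" by - (erule null_cmp, auto)
  then have "\<exists>y\<in>D. hdist B X y (ract X x a) < \<epsilon>" if "\<epsilon> > 0" for \<epsilon>
    using LIMSEQ_D[OF _ that] mem by fastforce
  then show ?thesis using D x lim by (auto simp: closed_subspace_def)
qed

end

text \<open>Over a separable algebra, being countably generated as a module is the same as having a countable
  total set; the latter notion does not refer to the module structure.\<close>

lemma cstar_module_total:
  assumes "cstar_module B X"
  obtains S where "countable S" "hilbert_module.total B X S"
proof -
  interpret hilbert_module B X using assms by (simp add: cstar_module_def)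
  obtain d :: "nat \<Rightarrow> 'a" where d: "\<And>n. d n \<in> carrier B" "\<And>a \<epsilon>. a \<in> carrier B \<Longrightarrow> \<epsilon> > 0 \<Longrightarrow> \<exists>n. cdist B (d n) a < \<epsilon>"
    using separable_denseE assms unfolding cstar_module_def by metis
  obtain G where G: "countable G" "G \<subseteq> carrier X" "closed_span B X {ract X x b | x b. x \<in> G \<and> b \<in> carrier B} = carrier X"
    using assms by (auto simp: cstar_module_def countably_generated_def)
  let ?S = "(\<lambda>(x, n). ract X x (d n)) ` (G \<times> UNIV)"
  have "total ?S"
  proof (rule totalI)
    show "?S \<subseteq> carrier X" using G d by auto
    fix D assume D: "closed_subspace D" "?S \<subseteq> D"
    have "ract X x b \<in> D" if x: "x \<in> G" and b: "b \<in> carrier B" for x b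
    proof -
      have "\<exists>k. cdist B (d k) b < inverse (real (Suc n))" for n using d(2)[OF b] by simp
      then obtain k where k: "\<And>n. cdist B (d (k n)) b < inverse (real (Suc n))" by metis
      have "(\<lambda>n. cdist B (d (k n)) b) \<longlonglongrightarrow> 0"
        using LIMSEQ_inverse_real_of_nat k by - (erule null_cmp, auto intro: less_imp_le)
      then show ?thesis using D x b d G(2) by (intro closed_subspace_ract[of D x "\<lambda>n. d (k n)" b]) auto
    qed
    then have "{ract X x b | x b. x \<in> G \<and> b \<in> carrier B} \<subseteq> D" by auto
    from closed_span_least[OF this D(1)] show "carrier X \<subseteq> D" by (simp only: G(3))
  qed
  moreover have "countable ?S" using G(1) by auto
  ultimately show ?thesis using that by blast
qed

lemma cstar_moduleI:
  assumes sep: "separable_cstar B" and X: "hilbert_module B X" and S: "countable S" "hilbert_module.total B X S"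
  shows "cstar_module B X"
proof -
  interpret hilbert_module B X by fact
  have SX: "S \<subseteq> carrier X" using S(2) by (simp add: total_def)
  let ?G = "{ract X x b | x b. x \<in> S \<and> b \<in> carrier B}"
  have G: "?G \<subseteq> carrier X" using SX by auto
  have "S \<subseteq> closed_span B X ?G"
  proof
    fix x assume x: "x \<in> S"
    obtain e :: "nat \<Rightarrow> 'a" where e: "\<And>n. e n \<in> carrier B" "(\<lambda>n. hdist B X (ract X x (e n)) x) \<longlonglongrightarrow> 0"
      using ract_approximate[OF sep] SX x by blast
    have "ract X x (e n) \<in> closed_span B X ?G" for n using closed_span_gen[OF G] x e by blast
    then have "\<exists>y\<in>closed_span B X ?G. hdist B X y x < \<epsilon>" if "\<epsilon> > 0" for \<epsilon>
      using LIMSEQ_D[OF e(2) that] by fastforce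
    then show "x \<in> closed_span B X ?G"
      using closed_subspace_closed_span[OF G] SX x unfolding closed_subspace_def by blast
  qed
  note total_induct[OF S(2) closed_subspace_closed_span[OF G] this]
  then have "carrier X \<subseteq> closed_span B X ?G" by (rule subsetI)
  then have "closed_span B X ?G = carrier X" using closed_span_carrier[OF G] by blast
  then show ?thesis using sep X S(1) SX by (auto simp: cstar_module_def countably_generated_def)
qed

section \<open>Strict and nondegenerate correspondences\<close>

lemma norm_cauchy_cong:
  assumes G: "eventually (\<lambda>e. e \<in> G) F" "\<And>e. e \<in> G \<Longrightarrow> f e = g e" and c: "norm_cauchy B X F f"
  shows "norm_cauchy B X F g"
  unfolding norm_cauchy_def
proof (intro allI impI)
  fix \<epsilon> :: real assume "\<epsilon> > 0"
  then obtain H where H: "eventually (\<lambda>e. e \<in> H) F" "\<forall>d\<in>H. \<forall>e\<in>H. hdist B X (f d) (f e) < \<epsilon>"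
    using c by (auto simp: norm_cauchy_def)
  have "eventually (\<lambda>e. e \<in> G \<inter> H) F" using eventually_conj[OF G(1) H(1)] by simp
  then show "\<exists>G. eventually (\<lambda>e. e \<in> G) F \<and> (\<forall>d\<in>G. \<forall>e\<in>G. hdist B X (g d) (g e) < \<epsilon>)"
  proof (intro exI[of _ "G \<inter> H"] conjI ballI)
    fix d e assume de: "d \<in> G \<inter> H" "e \<in> G \<inter> H"
    then have "hdist B X (f d) (f e) < \<epsilon>" using H(2) by blast
    then show "hdist B X (g d) (g e) < \<epsilon>" using G(2)[of d] G(2)[of e] de by simp
  qed
qed

lemma (in hilbert_module) norm_cauchy_sequence:
  assumes c: "\<And>n. f (e n) \<in> carrier X" "x \<in> carrier X" "(\<lambda>n::nat. hdist B X (f (e n)) x) \<longlonglongrightarrow> 0"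
  shows "norm_cauchy B X (filtermap e sequentially) f"
  unfolding norm_cauchy_def eventually_filtermap
proof (intro allI impI)
  fix \<epsilon> :: real assume "\<epsilon> > 0"
  then obtain N where N: "\<forall>m\<ge>N. \<forall>n\<ge>N. hdist B X (f (e m)) (f (e n)) < \<epsilon>"
    using hcauchyD[OF hcauchy_of_limit[OF c]] by blast
  show "\<exists>G. eventually (\<lambda>n. e n \<in> G) sequentially \<and> (\<forall>d\<in>G. \<forall>e\<in>G. hdist B X (f d) (f e) < \<epsilon>)"
    using N by (intro exI[of _ "e ` {N..}"]) (auto simp: eventually_sequentially)
qed

text \<open>For a bounded net of operators, strong convergence has to be checked on a total set only.\<close>

lemma (in hilbert_module) closed_subspace_norm_cauchy:
  assumes G: "eventually (\<lambda>e. e \<in> G) F" and K: "K \<ge> 0"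
    and f: "\<And>e. e \<in> G \<Longrightarrow> f e \<in> carrier (End B X)" "\<And>e x. e \<in> G \<Longrightarrow> x \<in> carrier X \<Longrightarrow> hnorm B X (f e x) \<le> K * hnorm B X x"
  shows "closed_subspace {x \<in> carrier X. norm_cauchy B X F (\<lambda>e. f e x)}"
    (is "closed_subspace ?C")
proof (rule closed_subspaceI)
  have get: "\<exists>H\<subseteq>G. eventually (\<lambda>e. e \<in> H) F \<and> (\<forall>d\<in>H. \<forall>e\<in>H. hd' (f d x) (f e x) < \<epsilon>)"
    if xe: "x \<in> ?C" "\<epsilon> > 0" for x \<epsilon>
  proof -
    obtain H where H: "eventually (\<lambda>e. e \<in> H) F" "\<forall>d\<in>H. \<forall>e\<in>H. hd' (f d x) (f e x) < \<epsilon>"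
      using xe unfolding norm_cauchy_def by blast
    have "eventually (\<lambda>e. e \<in> G \<inter> H) F" using eventually_conj[OF G H(1)] by simp
    then show ?thesis using H(2) by (intro exI[of _ "G \<inter> H"]) auto
  qed
  have fc: "f e x \<in> carrier X" if "e \<in> G" "x \<in> carrier X" for e x using f(1) that by simp
  show "?C \<subseteq> carrier X" by auto
  show "\<zero>\<^bsub>X\<^esub> \<in> ?C"
    using G f(1) by (auto simp: norm_cauchy_def End_linear intro!: exI[of _ G])
  fix x assume x: "x \<in> ?C"
  show "x \<oplus>\<^bsub>X\<^esub> y \<in> ?C" if y: "y \<in> ?C" for y
  proof -
    have "\<exists>H. eventually (\<lambda>e. e \<in> H) F \<and> (\<forall>d\<in>H. \<forall>e\<in>H. hd' (f d (x \<oplus>\<^bsub>X\<^esub> y)) (f e (x \<oplus>\<^bsub>X\<^esub> y)) < \<epsilon>)"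
      if "\<epsilon> > 0" for \<epsilon>
    proof -
      obtain H where H: "H \<subseteq> G" "eventually (\<lambda>e. e \<in> H) F" "\<forall>d\<in>H. \<forall>e\<in>H. hd' (f d x) (f e x) < \<epsilon>/2"
        using get[OF x, of "\<epsilon>/2"] \<open>\<epsilon> > 0\<close> by auto
      obtain J where J: "J \<subseteq> G" "eventually (\<lambda>e. e \<in> J) F" "\<forall>d\<in>J. \<forall>e\<in>J. hd' (f d y) (f e y) < \<epsilon>/2"
        using get[OF y, of "\<epsilon>/2"] \<open>\<epsilon> > 0\<close> by auto
      have "hd' (f d (x \<oplus>\<^bsub>X\<^esub> y)) (f e (x \<oplus>\<^bsub>X\<^esub> y)) < \<epsilon>" if de: "d \<in> H \<inter> J" "e \<in> H \<inter> J" for d e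
      proof -
        have lt: "hd' (f d x) (f e x) < \<epsilon>/2" "hd' (f d y) (f e y) < \<epsilon>/2" using H(3) J(3) de by auto
        have "d \<in> G" "e \<in> G" "x \<in> carrier X" "y \<in> carrier X" using H(1) de x y by auto
        then show ?thesis using lt hdist_add[of "f d x" "f d y" "f e x" "f e y"] fc f(1) by (simp add: End_linear)
      qed
      moreover have "eventually (\<lambda>e. e \<in> H \<inter> J) F" using eventually_conj[OF H(2) J(2)] by simp
      ultimately show ?thesis by blast
    qed
    then show ?thesis using x y by (simp add: norm_cauchy_def)
  qed
  show "z \<odot>\<^bsub>X\<^esub> x \<in> ?C" for z
  proof -
    have "\<exists>H. eventually (\<lambda>e. e \<in> H) F \<and> (\<forall>d\<in>H. \<forall>e\<in>H. hd' (f d (z \<odot>\<^bsub>X\<^esub> x)) (f e (z \<odot>\<^bsub>X\<^esub> x)) < \<epsilon>)"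
      if "\<epsilon> > 0" for \<epsilon>
    proof -
      have p: "\<epsilon> / (cmod z + 1) > 0" using that by (simp add: add_nonneg_pos)
      obtain H where H: "H \<subseteq> G" "eventually (\<lambda>e. e \<in> H) F" "\<forall>d\<in>H. \<forall>e\<in>H. hd' (f d x) (f e x) < \<epsilon> / (cmod z + 1)"
        using get[OF x p] by auto
      have "hd' (f d (z \<odot>\<^bsub>X\<^esub> x)) (f e (z \<odot>\<^bsub>X\<^esub> x)) < \<epsilon>" if de: "d \<in> H" "e \<in> H" for d e
      proof -
        have "d \<in> G" "e \<in> G" "x \<in> carrier X" using H(1) de x by auto
        then have "hd' (f d (z \<odot>\<^bsub>X\<^esub> x)) (f e (z \<odot>\<^bsub>X\<^esub> x)) = cmod z * hd' (f d x) (f e x)"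
          using f(1) fc by (simp add: End_linear hdist_smult)
        also have "\<dots> \<le> (cmod z + 1) * hd' (f d x) (f e x)" by (intro mult_right_mono) auto
        also have "\<dots> < \<epsilon>" using H(3) de by (simp add: pos_less_divide_eq add_nonneg_pos mult.commute)
        finally show ?thesis .
      qed
      then show ?thesis using H(2) by blast
    qed
    then show ?thesis using x by (simp add: norm_cauchy_def)
  qed
next
  fix s x assume s: "\<And>n::nat. s n \<in> {x \<in> carrier X. norm_cauchy B X F (\<lambda>e. f e x)}"
    and x: "x \<in> carrier X" and lim: "(\<lambda>n. hd' (s n) x) \<longlonglongrightarrow> 0"
  have fc: "f e x \<in> carrier X" if "e \<in> G" "x \<in> carrier X" for e x using f(1) that by simp
  have "\<exists>H. eventually (\<lambda>e. e \<in> H) F \<and> (\<forall>d\<in>H. \<forall>e\<in>H. hd' (f d x) (f e x) < \<epsilon>)" if "\<epsilon> > 0" for \<epsilon>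
  proof -
    have "\<epsilon> / (3 * (K + 1)) > 0" using that K by simp
    then obtain n where n: "hd' (s n) x < \<epsilon> / (3 * (K + 1))" using LIMSEQ_D[OF lim] by fastforce
    then have n': "(K + 1) * hd' (s n) x < \<epsilon>/3" using K by (simp add: field_simps)
    have sc: "s n \<in> carrier X" "norm_cauchy B X F (\<lambda>e. f e (s n))" using s by auto
    obtain H where H: "eventually (\<lambda>e. e \<in> H) F" "\<forall>d\<in>H. \<forall>e\<in>H. hd' (f d (s n)) (f e (s n)) < \<epsilon>/3"
      using sc(2)[unfolded norm_cauchy_def, rule_format, of "\<epsilon>/3"] \<open>\<epsilon> > 0\<close> by auto
    have close: "hd' (f e (s n)) (f e x) < \<epsilon>/3" if e: "e \<in> G" for e
    proof -
      have "hd' (f e (s n)) (f e x) \<le> K * hd' (s n) x"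
        using f(2)[OF e, of "s n \<oplus>\<^bsub>X\<^esub> (-1) \<odot>\<^bsub>X\<^esub> x"] hdist_adjointable[OF End_star(1)[OF f(1)[OF e]] sc(1) x] sc x
        by (simp add: hdist_eq)
      also have "\<dots> \<le> (K + 1) * hd' (s n) x" by (intro mult_right_mono) auto
      finally show ?thesis using n' by simp
    qed
    have "hd' (f d x) (f e x) < \<epsilon>" if de: "d \<in> G \<inter> H" "e \<in> G \<inter> H" for d e
    proof -
      have "hd' (f d x) (f e x) \<le> hd' (f d x) (f d (s n)) + (hd' (f d (s n)) (f e (s n)) + hd' (f e (s n)) (f e x))"
        using de sc x fc hdist_triangle[of "f d x" "f d (s n)" "f e x"] hdist_triangle[of "f d (s n)" "f e (s n)" "f e x"]
        by simp
      moreover have "hd' (f d (s n)) (f e (s n)) < \<epsilon>/3" using H(2) de by blast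
      moreover have "hd' (f d x) (f d (s n)) < \<epsilon>/3" using close[of d] de by (simp add: hdist_commute)
      ultimately show ?thesis using close[of e] de by simp
    qed
    moreover have "eventually (\<lambda>e. e \<in> G \<inter> H) F" using eventually_conj[OF G H(1)] by simp
    ultimately show ?thesis by blast
  qed
  then show "x \<in> {x \<in> carrier X. norm_cauchy B X F (\<lambda>e. f e x)}" using x by (simp add: norm_cauchy_def)
qed

lemma strict_pos_corrD:
  assumes "strict_pos_corr A B (\<rho>, X)"
  shows "separable_cstar A" "cstar_algebra A" "cstar_module B X" "separable_cstar B" "hilbert_module B X"
    "cp_map A (End B X) \<rho>" "strict_map A B (\<rho>, X)" "cp_rep A B X \<rho>"
  using assms
  by (auto simp: strict_pos_corr_def cstar_module_def separable_cstar_def intro!: cp_rep.intro cp_rep_axioms.intro)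

lemma nondeg_corrD:
  assumes "nondeg_corr A B (\<phi>, X)"
  shows "separable_cstar A" "cstar_algebra A" "cstar_module B X" "separable_cstar B" "hilbert_module B X"
    "star_hom A (End B X) \<phi>" "closed_span B X {\<phi> a x | a x. a \<in> carrier A \<and> x \<in> carrier X} = carrier X"
    "cp_rep A B X \<phi>"
proof -
  show 1: "separable_cstar A" "cstar_algebra A" "cstar_module B X" "separable_cstar B" "hilbert_module B X"
    "star_hom A (End B X) \<phi>" "closed_span B X {\<phi> a x | a x. a \<in> carrier A \<and> x \<in> carrier X} = carrier X"
    using assms by (auto simp: nondeg_corr_def correspondence_def cstar_module_def separable_cstar_def)
  interpret hilbert_module B X by fact
  show "cp_rep A B X \<phi>"
    using 1 star_hom_cp[OF 1(6,2) abelian_group_End] by (intro cp_rep.intro cp_rep_axioms.intro)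
qed

lemma nondeg_total:
  assumes "nondeg_corr A B (\<phi>, X)"
  shows "hilbert_module.total B X ((\<lambda>(a, x). \<phi> a x) ` (carrier A \<times> carrier X))"
proof -
  note n = nondeg_corrD[OF assms]
  interpret cp_rep A B X \<phi> by (rule n)
  have "(\<lambda>(a, x). \<phi> a x) ` (carrier A \<times> carrier X) = {\<phi> a x | a x. a \<in> carrier A \<and> x \<in> carrier X}" by auto
  then show ?thesis using n(7) by (auto simp: total_def)
qed

text \<open>On vectors \<open>\<phi>(a)x\<close> the net \<open>\<phi>(e\<^sub>n)\<close> converges by continuity of \<open>\<phi>\<close>, and these vectors are total.\<close>

lemma nondeg_strict_pos:
  assumes "nondeg_corr A B (\<phi>, X)" shows "strict_pos_corr A B (\<phi>, X)"
proof -
  note n = nondeg_corrD[OF assms]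
  interpret cp_rep A B X \<phi> by (rule n)
  interpret S: hilbert_module A "self_module A" by (rule A.hilbert_self)
  interpret h: hom_form A "self_module A" B X \<phi>
    using n(6) by (intro hom_form.intro tensor_form.intro hom_form_axioms.intro S.hilbert_module_axioms
      cp_rep_axioms) (auto simp: star_hom_def)
  obtain e :: "nat \<Rightarrow> 'a" where e: "\<And>n. cpos A (e n)" "\<And>n. nrm A (e n) \<le> 1"
    "\<And>a. a \<in> carrier A \<Longrightarrow> (\<lambda>n. cdist A (e n \<otimes>\<^bsub>A\<^esub> a) a) \<longlonglongrightarrow> 0"
    "\<And>a. a \<in> carrier A \<Longrightarrow> (\<lambda>n. cdist A (a \<otimes>\<^bsub>A\<^esub> e n) a) \<longlonglongrightarrow> 0" using approximate_unit_sequence[OF n(1)] by metis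
  have ec: "e n \<in> carrier A" for n using e(1) by (rule A.cpos_carrier)
  let ?F = "filtermap e sequentially"
  define G where "G = {a. cpos A a \<and> nrm A a \<le> 1}"
  have G: "eventually (\<lambda>e. e \<in> G) ?F" unfolding eventually_filtermap using e by (simp add: G_def)
  have Gc: "a \<in> carrier A" if "a \<in> G" for a using that A.cpos_carrier by (auto simp: G_def)
  obtain K where K: "K \<ge> 0" "\<And>a x. cpos A a \<Longrightarrow> nrm A a \<le> 1 \<Longrightarrow> x \<in> carrier X \<Longrightarrow> hn (\<phi> a x) \<le> K * hn x"
    using rho_contraction_bounded by blast
  obtain L where L: "L \<ge> 0" "\<And>a b y. a \<in> carrier A \<Longrightarrow> b \<in> carrier A \<Longrightarrow> y \<in> carrier X \<Longrightarrow>
      hdist B X (\<phi> a y) (\<phi> b y) \<le> L * cdist A a b * hn y" using h.sig_bounded by blast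
  have cs: "closed_subspace {x \<in> carrier X. norm_cauchy B X ?F (\<lambda>e. \<phi> e x)}"
    by (rule closed_subspace_norm_cauchy[OF G K(1)]) (use K Gc in \<open>auto simp: G_def\<close>)
  have nc: "norm_cauchy B X ?F (\<lambda>e. \<phi> e x)" if "x \<in> carrier X" for x
  proof -
    have "(\<lambda>(a, x). \<phi> a x) ` (carrier A \<times> carrier X) \<subseteq> {x \<in> carrier X. norm_cauchy B X ?F (\<lambda>e. \<phi> e x)}"
    proof clarsimp
      fix a x assume ax: "a \<in> carrier A" "x \<in> carrier X"
      have "(\<lambda>n. L * cdist A (e n \<otimes>\<^bsub>A\<^esub> a) a * hn x) \<longlonglongrightarrow> L * 0 * hn x" by (intro tendsto_intros e ax)
      then have "(\<lambda>n. hdist B X (\<phi> (e n \<otimes>\<^bsub>A\<^esub> a) x) (\<phi> a x)) \<longlonglongrightarrow> 0"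
        using L(2) ax ec by - (erule null_cmp, auto)
      then have "(\<lambda>n. hdist B X (\<phi> (e n) (\<phi> a x)) (\<phi> a x)) \<longlonglongrightarrow> 0" using ax ec by (simp add: h.sig_mult)
      then show "norm_cauchy B X ?F (\<lambda>e. \<phi> e (\<phi> a x))"
        using ax ec by (intro norm_cauchy_sequence) auto
    qed
    from total_induct[OF nondeg_total[OF assms] cs this that] show ?thesis by blast
  qed
  have "norm_cauchy B X ?F (\<lambda>e. star (End B X) (\<phi> e) x)" if "x \<in> carrier X" for x
    by (rule norm_cauchy_cong[OF G _ nc[OF that]]) (auto simp: star_rho Gc A.cpos_star G_def)
  then have "strict_map A B (\<phi>, X)"
    unfolding strict_map_def prod.case
    using nc approx_unit_filtermap[OF e(1,2) n(2) e(3,4)] by (intro exI[of _ ?F]) auto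
  then show ?thesis using n cp by (simp add: strict_pos_corr_def)
qed

text \<open>Nondegeneracy of \<open>A\<close> over itself is the existence of approximate units.\<close>

lemma nondeg_self:
  assumes "separable_cstar A" shows "nondeg_corr A A (self_corr A)"
proof -
  interpret cstar_algebra A using assms by (simp add: separable_cstar_def)
  interpret S: hilbert_module A "self_module A" by (rule hilbert_self)
  let ?E = "End A (self_module A)"
  let ?\<pi> = "fst (self_corr A)"
  have pi: "?\<pi> a = (\<lambda>b\<in>carrier A. a \<otimes>\<^bsub>A\<^esub> b)" for a by (simp add: self_corr_def)
  have adj: "is_adjoint (self_module A) (self_module A) (?\<pi> a) (?\<pi> (star A a))" if "a \<in> carrier A" for a
    using that by (auto simp: is_adjoint_def pi star_mult mult_assoc)
  have E: "?\<pi> a \<in> carrier ?E" if "a \<in> carrier A" for a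
    using S.EndI[OF _ adj[OF that]] by (simp add: pi)
  have hom: "star_hom A ?E ?\<pi>"
    unfolding star_hom_def lin_map_def
  proof (intro conjI ballI allI)
    show "?\<pi> \<in> carrier A \<rightarrow> carrier ?E" using E by auto
    fix a b z assume a: "a \<in> carrier A"
    show "?\<pi> (z \<odot>\<^bsub>A\<^esub> a) = z \<odot>\<^bsub>?E\<^esub> ?\<pi> a"
      by (rule S.End_eqI[OF E[OF cm.csmult_closed[OF a]] S.End_closed'(3)[OF E[OF a]]])
        (use a in \<open>auto simp: pi smult_mult_left\<close>)
    show "?\<pi> (star A a) = star ?E (?\<pi> a)"
      using a by (intro S.End_starI[symmetric, OF adj]) (auto simp: pi)
    assume b: "b \<in> carrier A"
    show "?\<pi> (a \<oplus>\<^bsub>A\<^esub> b) = ?\<pi> a \<oplus>\<^bsub>?E\<^esub> ?\<pi> b" 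
      by (rule S.End_eqI[OF E[OF a_closed[OF a b]] S.End_closed'(2)[OF E[OF a] E[OF b]]])
        (use a b in \<open>auto simp: pi distr_left\<close>)
    show "?\<pi> (a \<otimes>\<^bsub>A\<^esub> b) = ?\<pi> a \<otimes>\<^bsub>?E\<^esub> ?\<pi> b" 
      by (rule S.End_eqI[OF E[OF mult_closed[OF a b]] S.End_closed'(1)[OF E[OF a] E[OF b]]])
        (use a b in \<open>auto simp: pi mult_assoc\<close>)
  qed
  obtain e :: "nat \<Rightarrow> 'a" where e: "\<And>n. cpos A (e n)" "\<And>a. a \<in> carrier A \<Longrightarrow> (\<lambda>n. cdist A (e n \<otimes>\<^bsub>A\<^esub> a) a) \<longlonglongrightarrow> 0"
    using approximate_unit_sequence[OF assms] by metis
  have ec: "e n \<in> carrier A" for n using e(1) by (rule cpos_carrier)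
  let ?P = "{?\<pi> a x | a x. a \<in> carrier A \<and> x \<in> carrier (self_module A)}"
  have P: "?P \<subseteq> carrier (self_module A)" by (auto simp: pi)
  have "carrier A \<subseteq> closed_span A (self_module A) ?P"
  proof
    fix a assume a: "a \<in> carrier A"
    have "e n \<otimes>\<^bsub>A\<^esub> a \<in> closed_span A (self_module A) ?P" for n
    proof -
      have "?\<pi> (e n) a \<in> ?P" using ec a by auto
      moreover have "?\<pi> (e n) a = e n \<otimes>\<^bsub>A\<^esub> a" using a by (simp add: pi)
      ultimately show ?thesis using S.closed_span_gen[OF P] by simp
    qed
    then have "\<exists>y\<in>closed_span A (self_module A) ?P. hdist A (self_module A) y a < \<epsilon>" if "\<epsilon> > 0" for \<epsilon>
      using LIMSEQ_D[OF e(2)[OF a] that] unfolding hdist_self_module by fastforce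
    then show "a \<in> closed_span A (self_module A) ?P"
      using S.closed_subspace_closed_span[OF P] a unfolding S.closed_subspace_def by simp
  qed
  then have span: "closed_span A (self_module A) ?P = carrier (self_module A)"
    using S.closed_span_carrier[OF P] by auto
  obtain d :: "nat \<Rightarrow> 'a" where d: "\<And>n. d n \<in> carrier A" "\<And>a \<epsilon>. a \<in> carrier A \<Longrightarrow> \<epsilon> > 0 \<Longrightarrow> \<exists>n. cdist A (d n) a < \<epsilon>"
    using separable_denseE[OF assms] by metis
  have "S.total (range d)"
  proof (rule S.totalI)
    fix D assume D: "S.closed_subspace D" "range d \<subseteq> D"
    have "\<exists>y\<in>D. cdist A y a < \<epsilon>" if "a \<in> carrier A" "\<epsilon> > 0" for a \<epsilon> using d(2)[OF that] D(2) by blast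
    then show "carrier (self_module A) \<subseteq> D"
      using D(1) unfolding S.closed_subspace_def hdist_self_module by auto
  qed (use d in auto)
  then have "cstar_module A (self_module A)"
    by (intro cstar_moduleI[OF assms S.hilbert_module_axioms, of "range d"]) auto
  then have "nondeg_corr A A (?\<pi>, self_module A)"
    unfolding nondeg_corr_def correspondence_def prod.case using assms hom span by blast
  then show ?thesis by simp
qed

lemma tensor_cstar_module:
  assumes "tensor B X C Y \<sigma>" "cstar_module B X" "cstar_module C Y"
  shows "cstar_module C (completion C (alg_tensor X C (\<sigma>, Y)))"
proof -
  interpret tensor B X C Y \<sigma> by fact
  obtain S where S: "countable S" "X.total S" using cstar_module_total[OF assms(2)] by blast
  obtain R where R: "countable R" "Y.total R" using cstar_module_total[OF assms(3)] by blast
  show ?thesis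
    using S R assms(3)
    by (intro cstar_moduleI[OF _ Z.hilbert_module_axioms _ total_tens_of_total[OF S(2) R(2)]])
      (auto simp: cstar_module_def)
qed

lemma tensor_corr_eq:
  assumes "tensor B X C Y \<sigma>"
  shows "tensor_corr C (\<rho>, X) (\<sigma>, Y) = (\<lambda>a. tensor.ampl X C Y \<sigma> (\<rho> a), completion C (alg_tensor X C (\<sigma>, Y)))"
  by (simp add: tensor_corr_def tensor.ampl_def[OF assms])

text \<open>Strong convergence of \<open>\<rho>(e) \<otimes> Id\<close> is inherited from \<open>\<rho>(e)\<close> on simple tensors; they are total, and the operators
  are uniformly bounded.\<close>

lemma tensor_strict_pos:
  assumes t: "tensor B X C Y \<sigma>" and Z: "strict_pos_corr A B (\<rho>, X)" and Y: "cstar_module C Y"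
  shows "strict_pos_corr A C (tensor_corr C (\<rho>, X) (\<sigma>, Y))"
proof -
  interpret tensor B X C Y \<sigma> by fact
  note s = strict_pos_corrD[OF Z]
  interpret R: cp_rep A B X \<rho> by (rule s)
  have lin: "lin_map A (End C Z) (\<lambda>a. ampl (\<rho> a))"
  proof -
    have "\<rho> (a \<oplus>\<^bsub>A\<^esub> b) = \<rho> a \<oplus>\<^bsub>End B X\<^esub> \<rho> b" "\<rho> (z \<odot>\<^bsub>A\<^esub> a) = z \<odot>\<^bsub>End B X\<^esub> \<rho> a"
      if "a \<in> carrier A" "b \<in> carrier A" for a b z
      using R.cp that by (auto simp: cp_map_def lin_map_def)
    then show ?thesis using star_hom_ampl
      by (auto simp: star_hom_def lin_map_def ampl_basic)
  qed
  have cpz: "cp_map A (End C Z) (\<lambda>a. ampl (\<rho> a))"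
    unfolding cp_map_def
  proof (intro conjI lin allI impI)
    fix n M assume "mat_pos n A M"
    then have "mat_pos n (End B X) (\<lambda>i j. \<rho> (M i j))" using R.cp by (simp add: cp_map_def)
    from star_hom_mat_pos[OF star_hom_ampl X.abelian_group_End Z.abelian_group_End _ _ this]
    show "mat_pos n (End C Z) (\<lambda>i j. ampl (\<rho> (M i j)))" by auto
  qed
  interpret RZ: cp_rep A C "completion C (alg_tensor X C (\<sigma>, Y))" "\<lambda>a. ampl (\<rho> a)"
    using cpz by (intro cp_rep.intro cp_rep_axioms.intro R.A.cstar_algebra_axioms Z.hilbert_module_axioms)
  obtain F where F: "approx_unit A F" "\<And>x. x \<in> carrier X \<Longrightarrow> norm_cauchy B X F (\<lambda>e. \<rho> e x)"
    using s(7) by (auto simp: strict_map_def)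
  define G where "G = {a. cpos A a \<and> nrm A a \<le> 1}"
  have G: "eventually (\<lambda>e. e \<in> G) F"
    using F(1) by (auto simp: approx_unit_def G_def elim: eventually_mono)
  have Gc: "a \<in> carrier A" if "a \<in> G" for a using that R.A.cpos_carrier by (auto simp: G_def)
  obtain K where K: "K \<ge> 0" "\<And>a x. cpos A a \<Longrightarrow> nrm A a \<le> 1 \<Longrightarrow> x \<in> carrier Z \<Longrightarrow>
      hnorm C Z (ampl (\<rho> a) x) \<le> K * hnorm C Z x"
    using RZ.rho_contraction_bounded by blast
  have cs: "Z.closed_subspace {x \<in> carrier Z. norm_cauchy C Z F (\<lambda>e. ampl (\<rho> e) x)}"
    by (rule Z.closed_subspace_norm_cauchy[OF G K(1)]) (use K Gc in \<open>auto simp: G_def\<close>)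
  have nc: "norm_cauchy C Z F (\<lambda>e. ampl (\<rho> e) z)" if z: "z \<in> carrier Z" for z
  proof -
    have "tens x y \<in> {x \<in> carrier Z. norm_cauchy C Z F (\<lambda>e. ampl (\<rho> e) x)}"
      if xy: "x \<in> carrier X" "y \<in> carrier Y" for x y
    proof -
      obtain L where L: "L \<ge> 0" "\<And>x y. x \<in> carrier X \<Longrightarrow> y \<in> carrier Y \<Longrightarrow>
        hnorm C T [(x, y)] \<le> L * hnorm B X x * hnorm C Y y" using tens_bounded by blast
      have le: "hdist C Z (tens u y) (tens v y) \<le> (L * hnorm C Y y) * hdist B X u v"
        if uv: "u \<in> carrier X" "v \<in> carrier X" for u v
      proof -
        have "tens u y \<oplus>\<^bsub>Z\<^esub> (-1) \<odot>\<^bsub>Z\<^esub> tens v y = tens (u \<oplus>\<^bsub>X\<^esub> (-1) \<odot>\<^bsub>X\<^esub> v) y"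
          using uv xy by (simp add: tens_linear)
        then show ?thesis using L(2)[of "u \<oplus>\<^bsub>X\<^esub> (-1) \<odot>\<^bsub>X\<^esub> v" y] uv xy
          by (simp add: Z.hdist_eq X.hdist_eq hnorm_tens mult_ac)
      qed
      have "norm_cauchy C Z F (\<lambda>e. tens (\<rho> e x) y)"
        unfolding norm_cauchy_def
      proof (intro allI impI)
        fix \<epsilon> :: real assume "\<epsilon> > 0"
        have p: "\<epsilon> / (L * hnorm C Y y + 1) > 0" using \<open>\<epsilon> > 0\<close> L(1) xy by (simp add: add_nonneg_pos)
        then obtain H where H: "eventually (\<lambda>e. e \<in> H) F"
          "\<forall>d\<in>H. \<forall>e\<in>H. hdist B X (\<rho> d x) (\<rho> e x) < \<epsilon> / (L * hnorm C Y y + 1)"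
          using F(2)[OF xy(1)] unfolding norm_cauchy_def by blast
        have "hdist C Z (tens (\<rho> d x) y) (tens (\<rho> e x) y) < \<epsilon>" if de: "d \<in> G \<inter> H" "e \<in> G \<inter> H" for d e
        proof -
          have "hdist C Z (tens (\<rho> d x) y) (tens (\<rho> e x) y) \<le> (L * hnorm C Y y) * hdist B X (\<rho> d x) (\<rho> e x)"
            using de Gc xy by (intro le) auto
          also have "\<dots> \<le> (L * hnorm C Y y + 1) * hdist B X (\<rho> d x) (\<rho> e x)" by (intro mult_right_mono) auto
          also have "\<dots> < \<epsilon>" using H(2) de L(1) xy
            by (simp add: pos_less_divide_eq add_nonneg_pos mult.commute)
          finally show ?thesis .
        qed
        moreover have "eventually (\<lambda>e. e \<in> G \<inter> H) F" using eventually_conj[OF G H(1)] by simp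
        ultimately show "\<exists>G. eventually (\<lambda>e. e \<in> G) F \<and>
            (\<forall>d\<in>G. \<forall>e\<in>G. hdist C Z (tens (\<rho> d x) y) (tens (\<rho> e x) y) < \<epsilon>)" by blast
      qed
      from norm_cauchy_cong[OF G _ this, of "\<lambda>e. ampl (\<rho> e) (tens x y)"]
      show ?thesis using xy Gc by (simp add: ampl_basic)
    qed
    then have "tens_set \<subseteq> {x \<in> carrier Z. norm_cauchy C Z F (\<lambda>e. ampl (\<rho> e) x)}" by auto
    from Z.total_induct[OF total_tens cs this z] show ?thesis by blast
  qed
  have "norm_cauchy C Z F (\<lambda>e. star (End C Z) (ampl (\<rho> e)) z)" if "z \<in> carrier Z" for z
    by (rule norm_cauchy_cong[OF G _ nc[OF that]]) (auto simp: RZ.star_rho Gc R.A.cpos_star G_def)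
  then have "strict_map A C (\<lambda>a. ampl (\<rho> a), Z)"
    unfolding strict_map_def prod.case using nc F(1) by (intro exI[of _ F]) auto
  then show ?thesis
    using s cpz tensor_cstar_module[OF t s(3) Y] by (simp add: tensor_corr_eq[OF t] strict_pos_corr_def)
qed

lemma tensor_nondeg:
  assumes t: "tensor B X C Y \<sigma>" and Z: "nondeg_corr A B (\<rho>, X)" and Y: "cstar_module C Y"
  shows "nondeg_corr A C (tensor_corr C (\<rho>, X) (\<sigma>, Y))"
proof -
  interpret tensor B X C Y \<sigma> by fact
  note s = nondeg_corrD[OF Z]
  interpret R: cp_rep A B X \<rho> by (rule s)
  have hom: "star_hom A (End C Z) (\<lambda>a. ampl (\<rho> a))"
    using s(6) star_hom_ampl by (auto simp: star_hom_def lin_map_def ampl_basic)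
  let ?P = "{ampl (\<rho> a) z | a z. a \<in> carrier A \<and> z \<in> carrier Z}"
  have P: "?P \<subseteq> carrier Z" by (auto simp: ampl_basic)
  let ?D = "closed_span C Z ?P"
  have D: "Z.closed_subspace ?D" by (rule Z.closed_subspace_closed_span[OF P])
  have "tens x y \<in> ?D" if xy: "x \<in> carrier X" "y \<in> carrier Y" for x y
  proof -
    have "(\<lambda>(a, x). \<rho> a x) ` (carrier A \<times> carrier X) \<subseteq> {x \<in> carrier X. tens x y \<in> ?D}"
    proof clarsimp
      fix a x assume ax: "a \<in> carrier A" "x \<in> carrier X"
      have "ampl (\<rho> a) (tens x y) \<in> ?P" using ax xy by blast
      then show "tens (\<rho> a x) y \<in> ?D" using Z.closed_span_gen[OF P] ax xy by (simp add: ampl_basic)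
    qed
    from X.total_induct[OF nondeg_total[OF Z] closed_subspace_tens_left[OF D xy(2)] this xy(1)]
    show ?thesis by blast
  qed
  then have "tens_set \<subseteq> ?D" by auto
  note Z.total_induct[OF total_tens D this]
  then have "carrier Z \<subseteq> ?D" by (rule subsetI)
  then have "?D = carrier Z" using Z.closed_span_carrier[OF P] by blast
  then show ?thesis
    using s hom tensor_cstar_module[OF t s(3) Y]
    by (simp add: tensor_corr_eq[OF t] nondeg_corr_def correspondence_def)
qed

section \<open>Isomorphisms of correspondences\<close>

text \<open>The body of \<open>corr_iso\<close> for a fixed pair of operators.\<close>

definition intertwines :: "'a cstar \<Rightarrow> ('a \<Rightarrow> 'x \<Rightarrow> 'x) \<Rightarrow> ('b, 'x) hmod \<Rightarrow> ('a \<Rightarrow> 'y \<Rightarrow> 'y) \<Rightarrow> ('b, 'y) hmod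
    \<Rightarrow> ('x \<Rightarrow> 'y) \<Rightarrow> ('y \<Rightarrow> 'x) \<Rightarrow> bool" where
  "intertwines A \<rho> X \<sigma> Y V W \<longleftrightarrow> is_adjoint X Y V W \<and>
     (\<forall>x\<in>carrier X. W (V x) = x) \<and> (\<forall>y\<in>carrier Y. V (W y) = y) \<and>
     (\<forall>a\<in>carrier A. \<forall>y\<in>carrier Y. V (\<rho> a (W y)) = \<sigma> a y)"

lemma corr_iso_intertwines: "corr_iso A (\<rho>, X) (\<sigma>, Y) \<longleftrightarrow> (\<exists>V W. intertwines A \<rho> X \<sigma> Y V W)"
  by (simp add: corr_iso_def intertwines_def)

lemma intertwinesD:
  assumes "intertwines A \<rho> X \<sigma> Y V W"
  shows "is_adjoint X Y V W" "x \<in> carrier X \<Longrightarrow> V x \<in> carrier Y" "y \<in> carrier Y \<Longrightarrow> W y \<in> carrier X"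
    "x \<in> carrier X \<Longrightarrow> W (V x) = x" "y \<in> carrier Y \<Longrightarrow> V (W y) = y"
    "a \<in> carrier A \<Longrightarrow> y \<in> carrier Y \<Longrightarrow> V (\<rho> a (W y)) = \<sigma> a y"
    "x \<in> carrier X \<Longrightarrow> y \<in> carrier Y \<Longrightarrow> inner Y (V x) y = inner X x (W y)"
    "x \<in> carrier X \<Longrightarrow> x' \<in> carrier X \<Longrightarrow> inner Y (V x) (V x') = inner X x x'"
    "a \<in> carrier A \<Longrightarrow> x \<in> carrier X \<Longrightarrow> \<sigma> a (V x) = V (\<rho> a x)"
proof -
  show VW: "is_adjoint X Y V W" "x \<in> carrier X \<Longrightarrow> V x \<in> carrier Y" "y \<in> carrier Y \<Longrightarrow> W y \<in> carrier X"
    "x \<in> carrier X \<Longrightarrow> W (V x) = x" "y \<in> carrier Y \<Longrightarrow> V (W y) = y"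
    "a \<in> carrier A \<Longrightarrow> y \<in> carrier Y \<Longrightarrow> V (\<rho> a (W y)) = \<sigma> a y"
    "x \<in> carrier X \<Longrightarrow> y \<in> carrier Y \<Longrightarrow> inner Y (V x) y = inner X x (W y)" for x y a
    using assms by (auto simp: intertwines_def is_adjoint_def)
  show "inner Y (V x) (V x') = inner X x x'" if "x \<in> carrier X" "x' \<in> carrier X"
    using VW(7)[OF that(1) VW(2)[OF that(2)]] VW(4)[OF that(2)] by simp
  show "\<sigma> a (V x) = V (\<rho> a x)" if "a \<in> carrier A" "x \<in> carrier X"
    using VW(6)[OF that(1) VW(2)[OF that(2)]] VW(4)[OF that(2)] by simp
qed

lemma corr_iso_refl: "corr_iso A Z Z"
  by (cases Z) (auto simp: corr_iso_def is_adjoint_def intro!: exI[of _ "\<lambda>x. x"])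

lemma corr_iso_trans:
  assumes "corr_iso A Z Z'" "corr_iso A Z' Z''" shows "corr_iso A Z Z''"
proof -
  obtain \<rho> X \<sigma> Y \<tau> U where e: "Z = (\<rho>, X)" "Z' = (\<sigma>, Y)" "Z'' = (\<tau>, U)" by (metis surj_pair)
  obtain V W where "intertwines A \<rho> X \<sigma> Y V W" using assms(1) by (auto simp: e corr_iso_intertwines)
  note VW = intertwinesD[OF this]
  obtain V' W' where "intertwines A \<sigma> Y \<tau> U V' W'" using assms(2) by (auto simp: e corr_iso_intertwines)
  note VW' = intertwinesD[OF this]
  have "is_adjoint X U (\<lambda>x. V' (V x)) (\<lambda>u. W (W' u))"
    unfolding is_adjoint_def by (intro conjI ballI funcsetI) (simp_all add: VW(2,3,7) VW'(2,3,7))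
  then have "intertwines A \<rho> X \<tau> U (\<lambda>x. V' (V x)) (\<lambda>u. W (W' u))"
    unfolding intertwines_def
    by (intro conjI ballI) (simp_all add: VW(2,4,5,6) VW'(3-6))
  then show ?thesis unfolding e corr_iso_intertwines by blast
qed

lemma corr_iso_sym:
  assumes "corr_iso A (\<rho>, X) (\<sigma>, Y)" "hilbert_module B X" "hilbert_module B Y"
    "\<And>a x. a \<in> carrier A \<Longrightarrow> x \<in> carrier X \<Longrightarrow> \<rho> a x \<in> carrier X"
  shows "corr_iso A (\<sigma>, Y) (\<rho>, X)"
proof -
  obtain V W where "intertwines A \<rho> X \<sigma> Y V W" using assms(1) by (auto simp: corr_iso_intertwines)
  note VW = intertwinesD[OF this]
  have "is_adjoint Y X W V" by (rule is_adjoint_sym[OF assms(2,3) VW(1)])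
  then have "intertwines A \<sigma> Y \<rho> X W V" unfolding intertwines_def
    by (intro conjI ballI) (simp_all add: VW(2,4,5,9) assms(4))
  then show ?thesis unfolding corr_iso_intertwines by blast
qed

text \<open>Symmetry needs that \<open>\<rho>(a)\<close> preserves the module, so that \<open>WV\<close> cancels in \<open>W\<sigma>(a)V\<close>.\<close>

lemma strict_iso_sym:
  assumes "corr_iso A Z Z'" "strict_pos_corr A B Z" "strict_pos_corr A B Z'"
  shows "corr_iso A Z' Z"
proof -
  obtain \<rho> X \<sigma> Y where e: "Z = (\<rho>, X)" "Z' = (\<sigma>, Y)" by (metis surj_pair)
  interpret cp_rep A B X \<rho> by (rule strict_pos_corrD(8)[OF assms(2)[unfolded e]])
  show ?thesis unfolding e
    by (rule corr_iso_sym[OF assms(1)[unfolded e] hilbert_module_axioms strict_pos_corrD(5)[OF assms(3)[unfolded e]]])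
      simp
qed

lemma tensor_iso:
  assumes t: "tensor B X C Y \<sigma>" and t': "tensor B X' C Y' \<sigma>'"
    and i: "corr_iso A (\<rho>, X) (\<rho>', X')" and j: "corr_iso B (\<sigma>, Y) (\<sigma>', Y')"
    and E: "\<And>a. a \<in> carrier A \<Longrightarrow> \<rho> a \<in> carrier (End B X)" "\<And>a. a \<in> carrier A \<Longrightarrow> \<rho>' a \<in> carrier (End B X')"
  shows "corr_iso A (tensor_corr C (\<rho>, X) (\<sigma>, Y)) (tensor_corr C (\<rho>', X') (\<sigma>', Y'))"
proof -
  interpret L: tensor B X C Y \<sigma> by fact
  interpret R: tensor B X' C Y' \<sigma>' by fact
  obtain V W where "intertwines A \<rho> X \<rho>' X' V W" using i by (auto simp: corr_iso_intertwines)
  note V = intertwinesD[OF this]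
  obtain V' W' where "intertwines B \<sigma> Y \<sigma>' Y' V' W'" using j by (auto simp: corr_iso_intertwines)
  note V' = intertwinesD[OF this]
  have img: "(\<lambda>(x, y). R.tens (V x) (V' y)) ` (carrier X \<times> carrier Y) = R.tens_set"
  proof
    show "R.tens_set \<subseteq> (\<lambda>(x, y). R.tens (V x) (V' y)) ` (carrier X \<times> carrier Y)"
    proof clarsimp
      fix x y assume "x \<in> carrier X'" "y \<in> carrier Y'"
      then show "R.tens x y \<in> (\<lambda>(x, y). R.tens (V x) (V' y)) ` (carrier X \<times> carrier Y)"
        by (intro image_eqI[of _ _ "(W x, W' y)"]) (simp_all add: V(3,5) V'(3,5))
    qed
  qed (use V(2) V'(2) in auto)
  show ?thesis
    unfolding tensor_corr_eq[OF t] tensor_corr_eq[OF t']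
  proof (rule gram_unitary[where f="\<lambda>(x, y). L.tens x y" and g="\<lambda>(x, y). R.tens (V x) (V' y)"
        and I="carrier X \<times> carrier Y"])
    show "L.Z.total (L.tens_set)" by (rule L.total_tens)
    show "R.Z.total ((\<lambda>(x, y). R.tens (V x) (V' y)) ` (carrier X \<times> carrier Y))"
      unfolding img by (rule R.total_tens)
    fix p q assume pq: "p \<in> carrier X \<times> carrier Y" "q \<in> carrier X \<times> carrier Y"
    then show "inner L.Z (case p of (x, y) \<Rightarrow> L.tens x y) (case q of (x, y) \<Rightarrow> L.tens x y)
        = inner R.Z (case p of (x, y) \<Rightarrow> R.tens (V x) (V' y)) (case q of (x, y) \<Rightarrow> R.tens (V x) (V' y))"
      by (auto simp: V(2,8,9) V'(2,8,9) L.inner_tens R.inner_tens)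
    fix a assume a: "a \<in> carrier A"
    have "\<rho> a x \<in> carrier X" if "x \<in> carrier X" for x using E(1)[OF a] that by simp
    then show "inner L.Z (case p of (x, y) \<Rightarrow> L.tens x y) (L.ampl (\<rho> a) (case q of (x, y) \<Rightarrow> L.tens x y))
        = inner R.Z (case p of (x, y) \<Rightarrow> R.tens (V x) (V' y))
           (R.ampl (\<rho>' a) (case q of (x, y) \<Rightarrow> R.tens (V x) (V' y)))"
      using pq a by (auto simp: E V(2,8,9) V'(2,8,9) L.ampl_basic R.ampl_basic L.inner_tens R.inner_tens)
  next
    show "\<exists>S. is_adjoint L.Z L.Z (L.ampl (\<rho> a)) S" "\<exists>S. is_adjoint R.Z R.Z (R.ampl (\<rho>' a)) S"
      if "a \<in> carrier A" for a using L.ampl_basic(1) R.ampl_basic(1) E that by blast+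
  qed (rule L.Z.hilbert_module_axioms R.Z.hilbert_module_axioms)+
qed

lemma (in hilbert_module) total_carrier: "total (carrier X)"
  by (rule totalI) auto

text \<open>The Gram matrices of \<open>(x \<otimes> y) \<otimes> w\<close> and \<open>x \<otimes> (y \<otimes> w)\<close> agree: both have the entries
  \<open>\<langle>w, \<tau>(\<langle>y, \<sigma>(\<langle>x, x'\<rangle>)y'\<rangle>)w'\<rangle>\<close>.\<close>

lemma tensor_assoc:
  assumes t1: "tensor B X C Y \<sigma>" and t2: "tensor C Y D W \<tau>"
    and t3: "tensor C (completion C (alg_tensor X C (\<sigma>, Y))) D W \<tau>"
    and t4: "tensor B X D (completion D (alg_tensor Y D (\<tau>, W))) (\<lambda>b. tensor.ampl Y D W \<tau> (\<sigma> b))"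
    and E: "\<And>a. a \<in> carrier A \<Longrightarrow> \<rho> a \<in> carrier (End B X)"
  shows "corr_iso A (tensor_corr D (tensor_corr C (\<rho>, X) (\<sigma>, Y)) (\<tau>, W))
    (tensor_corr D (\<rho>, X) (tensor_corr D (\<sigma>, Y) (\<tau>, W)))"
proof -
  interpret T1: tensor B X C Y \<sigma> by fact
  interpret T2: tensor C Y D W \<tau> by fact
  interpret T3: tensor C "completion C (alg_tensor X C (\<sigma>, Y))" D W \<tau> by fact
  interpret T4: tensor B X D "completion D (alg_tensor Y D (\<tau>, W))" "\<lambda>b. T2.ampl (\<sigma> b)" by fact
  let ?I = "(carrier X \<times> carrier Y) \<times> carrier W"
  let ?f = "\<lambda>((x, y), w). T3.tens (T1.tens x y) w" and ?g = "\<lambda>((x, y), w). T4.tens x (T2.tens y w)"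
  have "?f ` ?I = (\<lambda>(x, y). T3.tens x y) ` (T1.tens_set \<times> carrier W)" by force
  then have f: "T3.Z.total (?f ` ?I)"
    using T3.total_tens_of_total[OF T1.total_tens T2.Y.total_carrier] by simp
  have "?g ` ?I = (\<lambda>(x, y). T4.tens x y) ` (carrier X \<times> T2.tens_set)" by force
  then have g: "T4.Z.total (?g ` ?I)"
    using T4.total_tens_of_total[OF T1.X.total_carrier T2.total_tens] by simp
  have EY: "\<sigma> b \<in> carrier (End C Y)" if "b \<in> carrier B" for b using that by simp
  show ?thesis
    unfolding tensor_corr_eq[OF t1] tensor_corr_eq[OF t2] tensor_corr_eq[OF t3] tensor_corr_eq[OF t4]
  proof (rule gram_unitary[OF T3.Z.hilbert_module_axioms T4.Z.hilbert_module_axioms f g])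
    fix p q assume "p \<in> ?I" "q \<in> ?I"
    then obtain x y w x' y' w' where pq: "p = ((x, y), w)" "q = ((x', y'), w')" "x \<in> carrier X" "y \<in> carrier Y"
      "w \<in> carrier W" "x' \<in> carrier X" "y' \<in> carrier Y" "w' \<in> carrier W" by auto
    have gr: "inner T3.Z (T3.tens (T1.tens x y) w) (T3.tens (T1.tens u y') w')
        = inner T4.Z (T4.tens x (T2.tens y w)) (T4.tens u (T2.tens y' w'))" if u: "u \<in> carrier X" for u
      using pq u EY[of "inner X x u"]
      by (simp add: T1.inner_tens T2.inner_tens T3.inner_tens T4.inner_tens T2.ampl_basic)
    show "inner T3.Z (?f p) (?f q) = inner T4.Z (?g p) (?g q)" using gr[OF pq(6)] by (simp add: pq)
    fix a assume a: "a \<in> carrier A"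
    have "\<rho> a x' \<in> carrier X" using E[OF a] pq by simp
    from gr[OF this]
    show "inner T3.Z (?f p) (T3.ampl (T1.ampl (\<rho> a)) (?f q)) = inner T4.Z (?g p) (T4.ampl (\<rho> a) (?g q))"
      using pq E[OF a] by (simp add: T1.ampl_basic T3.ampl_basic T4.ampl_basic)
  next
    show "\<exists>S. is_adjoint T3.Z T3.Z (T3.ampl (T1.ampl (\<rho> a))) S" "\<exists>S. is_adjoint T4.Z T4.Z (T4.ampl (\<rho> a)) S"
      if "a \<in> carrier A" for a
      using T3.ampl_basic(1)[OF T1.ampl_basic(2)[OF E[OF that]]] T4.ampl_basic(1)[OF E[OF that]] by blast+
  qed
qed

text \<open>The vectors \<open>a \<otimes> x\<close> and \<open>\<phi>(a)x\<close> have the same inner products because \<open>\<phi>\<close> is a *-homomorphism, and nondegeneracy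
  says that the latter are total.\<close>

lemma ksgns_nondeg_iso:
  assumes "nondeg_corr A B Z" shows "corr_iso A (ksgns A B Z) Z"
proof -
  obtain \<phi> X where Z: "Z = (\<phi>, X)" by (cases Z)
  note n = nondeg_corrD[OF assms[unfolded Z]]
  interpret cp_rep A B X \<phi> by (rule n)
  have t: "tensor A (self_module A) B X \<phi>" by (rule tensor_self[OF cp_rep_axioms])
  interpret T: tensor A "self_module A" B X \<phi> by (rule t)
  have s: "self_corr A = (fst (self_corr A), self_module A)" by simp
  interpret S: cp_rep A A "self_module A" "fst (self_corr A)"
    using nondeg_corrD(8)[of A A "fst (self_corr A)" "self_module A"] nondeg_self[OF n(1)] by simp
  have mult: "\<phi> (a \<otimes>\<^bsub>A\<^esub> b) x = \<phi> a (\<phi> b x)" if "a \<in> carrier A" "b \<in> carrier A" "x \<in> carrier X" for a b x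
    using n(6) that by (simp add: star_hom_def)
  have pi: "fst (self_corr A) a b = a \<otimes>\<^bsub>A\<^esub> b" if "b \<in> carrier A" for a b using that by (simp add: self_corr_def)
  have "corr_iso A (\<lambda>a. T.ampl (fst (self_corr A) a), T.Z) (\<phi>, X)"
  proof (rule gram_unitary[where f="\<lambda>(a, x). T.tens a x" and g="\<lambda>(a, x). \<phi> a x" and I="carrier A \<times> carrier X"])
    show "T.Z.total ((\<lambda>(a, x). T.tens a x) ` (carrier A \<times> carrier X))" using T.total_tens by simp
    show "total ((\<lambda>(a, x). \<phi> a x) ` (carrier A \<times> carrier X))" by (rule nondeg_total[OF assms[unfolded Z]])
    fix p q assume pq: "p \<in> carrier A \<times> carrier X" "q \<in> carrier A \<times> carrier X"
    show "inner T.Z (case p of (a, x) \<Rightarrow> T.tens a x) (case q of (a, x) \<Rightarrow> T.tens a x)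
        = inner X (case p of (a, x) \<Rightarrow> \<phi> a x) (case q of (a, x) \<Rightarrow> \<phi> a x)"
      using pq by (auto simp: T.inner_tens mult rho_adjD(3))
    fix a assume a: "a \<in> carrier A"
    show "inner T.Z (case p of (a, x) \<Rightarrow> T.tens a x) (T.ampl (fst (self_corr A) a) (case q of (a, x) \<Rightarrow> T.tens a x))
        = inner X (case p of (a, x) \<Rightarrow> \<phi> a x) (\<phi> a (case q of (a, x) \<Rightarrow> \<phi> a x))"
      using pq a by (auto simp: T.ampl_basic T.inner_tens mult rho_adjD(3) pi)
  next
    show "\<exists>S. is_adjoint T.Z T.Z (T.ampl (fst (self_corr A) a)) S" "\<exists>S. is_adjoint X X (\<phi> a) S"
      if "a \<in> carrier A" for a using T.ampl_basic(1)[OF S.rho_End[OF that]] rho_adjoint[OF that] by blast+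
  qed (rule T.Z.hilbert_module_axioms hilbert_module_axioms)+
  then show ?thesis unfolding Z ksgns_def by (subst s) (simp only: tensor_corr_eq[OF t])
qed

section \<open>Transport to a large enough type\<close>

text \<open>A vector is determined by its inner products with a countable total set, and these by their approximations from
  a countable dense set, so vectors are encoded as sets of natural numbers.\<close>

lemma cstar_module_lepoll_real:
  assumes "cstar_module B X" shows "carrier X \<lesssim> (UNIV :: real set)"
proof -
  interpret hilbert_module B X using assms by (simp add: cstar_module_def)
  obtain S where S: "countable S" "total S" using cstar_module_total[OF assms] by blast
  obtain d :: "nat \<Rightarrow> 'a" where d: "\<And>n. d n \<in> carrier B" "\<And>a \<epsilon>. a \<in> carrier B \<Longrightarrow> \<epsilon> > 0 \<Longrightarrow> \<exists>n. cdist B (d n) a < \<epsilon>"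
    using separable_denseE assms unfolding cstar_module_def by metis
  have SX: "S \<subseteq> carrier X" using S(2) by (simp add: total_def)
  define code where "code x = {prod_encode (to_nat_on S s, prod_encode (k, m)) | s k m.
    s \<in> S \<and> cdist B (d k) (inner X s x) < inverse (real (Suc m))}" for x
  have code: "prod_encode (to_nat_on S s, prod_encode (k, m)) \<in> code x
      \<longleftrightarrow> cdist B (d k) (inner X s x) < inverse (real (Suc m))" if "s \<in> S" for s k m x
    using that inj_on_to_nat_on[OF S(1)] by (auto simp: code_def inj_on_def)
  have "inj_on code (carrier X)"
  proof (rule inj_onI)
    fix x y assume x: "x \<in> carrier X" and y: "y \<in> carrier X" and eq: "code x = code y"
    show "x = y"
    proof (rule total_eqI[OF S(2) x y])
      fix s assume s: "s \<in> S"
      let ?u = "inner X s x" and ?v = "inner X s y"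
      have uv: "?u \<in> carrier B" "?v \<in> carrier B" using s SX x y by auto
      have "cdist B ?u ?v \<le> 0 + \<epsilon>" if "\<epsilon> > 0" for \<epsilon>
      proof -
        obtain m where m: "inverse (real (Suc m)) < \<epsilon>/2" using reals_Archimedean[of "\<epsilon>/2"] \<open>\<epsilon> > 0\<close> by auto
        obtain k where k: "cdist B (d k) ?u < inverse (real (Suc m))" using d(2)[OF uv(1)] by (meson inverse_positive_iff_positive of_nat_0_less_iff zero_less_Suc)
        then have "cdist B (d k) ?v < inverse (real (Suc m))" using code[OF s, of k m x] code[OF s, of k m y] eq by simp
        then show ?thesis using k m B.cdist_triangle[of ?u "d k" ?v] uv d(1) by (simp add: B.cdist_commute[of ?u])
      qed
      then have "cdist B ?u ?v \<le> 0" by (rule field_le_epsilon)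
      then show "?u = ?v" using B.cdist_zero_iff[OF uv] B.cdist_nonneg[of ?u ?v] by linarith
    qed
  qed
  then have "carrier X \<lesssim> (UNIV :: nat set set)" unfolding lepoll_def by (intro exI[of _ code]) auto
  then show ?thesis using nat_sets_eqpoll_reals eqpoll_imp_lepoll lepoll_trans by blast
qed

lemma hilbert_module_copy:
  fixes X :: "('b, 'z) hmod"
  assumes "hilbert_module B X" "carrier X \<lesssim> (UNIV :: 'x set)"
  obtains Y :: "('b, 'x) hmod" and V W where "hilbert_module B Y" "is_adjoint X Y V W"
    "\<And>x. x \<in> carrier X \<Longrightarrow> W (V x) = x" "\<And>y. y \<in> carrier Y \<Longrightarrow> V (W y) = y"
proof -
  interpret hilbert_module B X by fact
  obtain g :: "'z \<Rightarrow> 'x" where g: "inj_on g (carrier X)" using assms(2) by (auto simp: lepoll_def)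
  define h where "h = inv_into (carrier X) g"
  have hg [simp]: "h (g x) = x" if "x \<in> carrier X" for x using that g by (simp add: h_def)
  define Y :: "('b, 'x) hmod" where "Y = \<lparr>carrier = g ` carrier X, mult = undefined, one = undefined, zero = g \<zero>\<^bsub>X\<^esub>,
    add = (\<lambda>x y. g (h x \<oplus>\<^bsub>X\<^esub> h y)), smult = (\<lambda>z x. g (z \<odot>\<^bsub>X\<^esub> h x)), ract = (\<lambda>x b. g (ract X (h x) b)),
    inner = (\<lambda>x y. inner X (h x) (h y))\<rparr>"
  have Y [simp]: "carrier Y = g ` carrier X" "\<zero>\<^bsub>Y\<^esub> = g \<zero>\<^bsub>X\<^esub>" "x \<oplus>\<^bsub>Y\<^esub> y = g (h x \<oplus>\<^bsub>X\<^esub> h y)"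
    "z \<odot>\<^bsub>Y\<^esub> x = g (z \<odot>\<^bsub>X\<^esub> h x)" "ract Y x b = g (ract X (h x) b)" "inner Y x y = inner X (h x) (h y)" for x y z b
    by (simp_all add: Y_def)
  have dist: "hdist B Y (g x) (g y) = hdist B X x y" if "x \<in> carrier X" "y \<in> carrier X" for x y
    using that by (simp add: hdist_def hnorm_def)
  have ab: "abelian_group Y"
  proof (rule abelian_groupI)
    show "\<exists>y\<in>carrier Y. y \<oplus>\<^bsub>Y\<^esub> x = \<zero>\<^bsub>Y\<^esub>" if x: "x \<in> carrier Y" for x
      using x by (intro bexI[of _ "(-1) \<odot>\<^bsub>Y\<^esub> x"]) (auto simp: cX.csmult_m1 X.l_neg)
  qed (auto simp: X.a_ac)
  have md: "module complex_ring Y"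
    by (rule moduleI[OF cring_class ab])
      (auto simp: plus_class times_class one_class cX.csmult_l_distr cX.csmult_r_distr cX.csmult_assoc)
  have "Metric_space (carrier Y) (hdist B Y)"
  proof
    show "0 \<le> hdist B Y x y" for x y by (auto simp: hdist_def hnorm_def intro!: B.nrm_nonneg)
    show "hdist B Y x y = hdist B Y y x" for x y
    proof (cases "x \<in> carrier Y \<and> y \<in> carrier Y")
      case True
      then show ?thesis using dist hdist_commute by auto
    qed (auto simp: hdist_def)
    show "hdist B Y x y = 0 \<longleftrightarrow> x = y" if "x \<in> carrier Y" "y \<in> carrier Y" for x y
      using that dist by (auto dest: hdist_zeroD)
    show "hdist B Y x z \<le> hdist B Y x y + hdist B Y y z" if "x \<in> carrier Y" "y \<in> carrier Y" "z \<in> carrier Y" for x y z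
      using that dist hdist_triangle by auto
  qed
  note mY = this
  have comp: "Metric_space.mcomplete (carrier Y) (hdist B Y)"
    unfolding Metric_space.mcomplete_def[OF mY]
  proof (intro allI impI)
    fix s assume "Metric_space.MCauchy (carrier Y) (hdist B Y) s"
    then have s: "range s \<subseteq> carrier Y" "\<And>\<epsilon>. \<epsilon> > 0 \<Longrightarrow> \<exists>N. \<forall>m\<ge>N. \<forall>n\<ge>N. hdist B Y (s m) (s n) < \<epsilon>"
      unfolding Metric_space.MCauchy_def[OF mY] by auto
    have "\<forall>n. \<exists>u. u \<in> carrier X \<and> s n = g u" using s(1) by auto
    then obtain u where u: "\<And>n. u n \<in> carrier X" "\<And>n. s n = g (u n)" by metis
    have "u \<in> hcauchy B X" using s(2) u by (auto simp: hcauchy_def dist)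
    then obtain x where x: "x \<in> carrier X" "(\<lambda>n. hdist B X (u n) x) \<longlonglongrightarrow> 0" using hcauchy_limit by blast
    then show "\<exists>x. limitin (Metric_space.mtopology (carrier Y) (hdist B Y)) s x sequentially"
      unfolding Metric_space.limit_metric_sequentially[OF mY]
      using u by (intro exI[of _ "g x"]) (auto simp: dist lim_sequentially)
  qed
  have hY: "hilbert_module B Y"
    by (intro hilbert_module.intro hilbert_module_axioms.intro B.cstar_algebra_axioms md comp)
      (auto simp: inner_simps inner_star inner_pos ract_add_left ract_add_right ract_mult ract_smult_left
        ract_smult_right intro!: arg_cong[of _ _ g] dest: inner_definite)
  have "is_adjoint X Y g h" by (auto simp: is_adjoint_def)
  then show ?thesis by (rule that[OF hY]) auto
qed

text \<open>Conjugation by a unitary.\<close>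

lemma transport_corr:
  assumes hX: "hilbert_module B X" and hY: "hilbert_module B Y" and VW: "is_adjoint X Y V W"
    "\<And>x. x \<in> carrier X \<Longrightarrow> W (V x) = x" "\<And>y. y \<in> carrier Y \<Longrightarrow> V (W y) = y"
    and E: "\<And>a. a \<in> carrier A \<Longrightarrow> \<rho> a \<in> carrier (End B X)"
  defines "\<sigma> \<equiv> \<lambda>a. \<lambda>y\<in>carrier Y. V (\<rho> a (W y))"
  shows "corr_iso A (\<rho>, X) (\<sigma>, Y)" "nondeg_corr A B (\<rho>, X) \<Longrightarrow> nondeg_corr A B (\<sigma>, Y)"
    "strict_pos_corr A B (\<rho>, X) \<Longrightarrow> strict_pos_corr A B (\<sigma>, Y)"
proof -
  interpret X: hilbert_module B X by fact
  interpret Y: hilbert_module B Y by fact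
  have Vc [simp]: "V x \<in> carrier Y" if "x \<in> carrier X" for x using VW(1) that by (auto simp: is_adjoint_def)
  have Wc [simp]: "W y \<in> carrier X" if "y \<in> carrier Y" for y using VW(1) that by (auto simp: is_adjoint_def)
  have iV: "inner Y (V x) y = inner X x (W y)" if "x \<in> carrier X" "y \<in> carrier Y" for x y
    using VW(1) that by (auto simp: is_adjoint_def)
  have iW: "inner X (W y) x = inner Y y (V x)" if "x \<in> carrier X" "y \<in> carrier Y" for x y
    using is_adjoint_sym[OF hX hY VW(1)] that by (auto simp: is_adjoint_def)
  have Vadd: "V (x \<oplus>\<^bsub>X\<^esub> x') = V x \<oplus>\<^bsub>Y\<^esub> V x'" if "x \<in> carrier X" "x' \<in> carrier X" for x x'
    using that by (intro Y.inner_eqI_left) (simp_all add: X.inner_simps Y.inner_simps iV)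
  have Vsmult: "V (z \<odot>\<^bsub>X\<^esub> x) = z \<odot>\<^bsub>Y\<^esub> V x" if "x \<in> carrier X" for x z
    using that by (intro Y.inner_eqI_left) (simp_all add: X.inner_simps Y.inner_simps iV)
  note Vlin = Vadd Vsmult
  have V0: "V \<zero>\<^bsub>X\<^esub> = \<zero>\<^bsub>Y\<^esub>" using Vsmult[of "\<zero>\<^bsub>X\<^esub>" 0] by simp
  have dist: "hdist B Y (V x) (V x') = hdist B X x x'" if "x \<in> carrier X" "x' \<in> carrier X" for x x'
    using that by (simp add: X.hdist_eq Y.hdist_eq hnorm_def iV VW(2) flip: Vlin)
  have sub: "X.closed_subspace {x \<in> carrier X. V x \<in> D}" if D: "Y.closed_subspace D" for D
  proof (rule X.closed_subspaceI)
    fix s x assume s: "\<And>n::nat. s n \<in> {x \<in> carrier X. V x \<in> D}" and x: "x \<in> carrier X" "(\<lambda>n. hdist B X (s n) x) \<longlonglongrightarrow> 0"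
    have "\<exists>y\<in>D. hdist B Y y (V x) < \<epsilon>" if "\<epsilon> > 0" for \<epsilon>
    proof -
      obtain n where "hdist B X (s n) x < \<epsilon>" using LIMSEQ_D[OF x(2) \<open>\<epsilon> > 0\<close>] by fastforce
      then show ?thesis using s[of n] x dist by (intro bexI[of _ "V (s n)"]) auto
    qed
    then show "x \<in> {x \<in> carrier X. V x \<in> D}" using D x by (auto simp: Y.closed_subspace_def)
  qed (use D in \<open>auto simp: Y.closed_subspace_def Vlin V0\<close>)
  have tot: "Y.total (V ` S)" if S: "X.total S" for S
  proof (rule Y.totalI)
    show "V ` S \<subseteq> carrier Y" using S by (auto simp: X.total_def)
    fix D assume D: "Y.closed_subspace D" "V ` S \<subseteq> D"
    have "S \<subseteq> {x \<in> carrier X. V x \<in> D}" using S D by (auto simp: X.total_def)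
    note X.total_induct[OF S sub[OF D(1)] this]
    then show "carrier Y \<subseteq> D" using VW(3) Wc by (metis (no_types, lifting) mem_Collect_eq subsetI)
  qed
  have cm: "cstar_module B Y" if m: "cstar_module B X"
  proof -
    obtain S where "countable S" "X.total S" using cstar_module_total[OF m] by blast
    then show ?thesis using m tot hY by (intro cstar_moduleI[of B Y "V ` S"]) (auto simp: cstar_module_def)
  qed
  define Ad where "Ad R = (\<lambda>y\<in>carrier Y. V (R (W y)))" for R
  have adAd: "is_adjoint Y Y (Ad R) (Ad (star (End B X) R))" if "R \<in> carrier (End B X)" for R
    using that by (auto simp: is_adjoint_def Ad_def iV X.End_inner simp flip: iW)
  have AdE: "Ad R \<in> carrier (End B Y)" if "R \<in> carrier (End B X)" for R
    by (rule Y.EndI[OF _ adAd[OF that]]) (simp add: Ad_def)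
  have hom: "star_hom (End B X) (End B Y) Ad"
    unfolding star_hom_def lin_map_def
  proof (intro conjI ballI allI)
    show "Ad \<in> carrier (End B X) \<rightarrow> carrier (End B Y)" using AdE by auto
    fix R S z assume R: "R \<in> carrier (End B X)"
    show "Ad (z \<odot>\<^bsub>End B X\<^esub> R) = z \<odot>\<^bsub>End B Y\<^esub> Ad R"
      using R by (intro Y.End_eqI AdE) (auto simp: AdE, auto simp: Ad_def Vlin)
    show "Ad (star (End B X) R) = star (End B Y) (Ad R)"
      by (rule Y.End_starI[symmetric, OF adAd[OF R]]) (simp_all add: Ad_def)
    assume S: "S \<in> carrier (End B X)"
    show "Ad (R \<oplus>\<^bsub>End B X\<^esub> S) = Ad R \<oplus>\<^bsub>End B Y\<^esub> Ad S"
      using R S by (intro Y.End_eqI AdE) (auto simp: AdE, auto simp: Ad_def Vlin)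
    show "Ad (R \<otimes>\<^bsub>End B X\<^esub> S) = Ad R \<otimes>\<^bsub>End B Y\<^esub> Ad S"
      using R S by (intro Y.End_eqI AdE) (auto simp: AdE, auto simp: Ad_def VW(2))
  qed
  have sA: "\<sigma> = (\<lambda>a. Ad (\<rho> a))" by (simp add: \<sigma>_def Ad_def)
  show "corr_iso A (\<rho>, X) (\<sigma>, Y)"
    unfolding corr_iso_def prod.case using VW by (intro exI[of _ V] exI[of _ W]) (auto simp: \<sigma>_def)
  show "nondeg_corr A B (\<sigma>, Y)" if n: "nondeg_corr A B (\<rho>, X)"
  proof -
    note s = nondeg_corrD[OF n]
    have h: "star_hom A (End B Y) \<sigma>"
      using s(6) hom E unfolding sA by (auto simp: star_hom_def lin_map_def AdE)
    let ?P = "{\<sigma> a y | a y. a \<in> carrier A \<and> y \<in> carrier Y}"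
    have P: "?P \<subseteq> carrier Y" using E AdE unfolding sA by auto
    have "V ` ((\<lambda>(a, x). \<rho> a x) ` (carrier A \<times> carrier X)) \<subseteq> ?P"
    proof clarsimp
      fix a x assume "a \<in> carrier A" "x \<in> carrier X"
      then show "\<exists>a' y. V (\<rho> a x) = \<sigma> a' y \<and> a' \<in> carrier A \<and> y \<in> carrier Y"
        by (intro exI[of _ a] exI[of _ "V x"]) (simp add: \<sigma>_def VW(2))
    qed
    then have "V ` ((\<lambda>(a, x). \<rho> a x) ` (carrier A \<times> carrier X)) \<subseteq> closed_span B Y ?P"
      using Y.closed_span_gen[OF P] by blast
    note Y.total_induct[OF tot[OF nondeg_total[OF n]] Y.closed_subspace_closed_span[OF P] this]
    then have "carrier Y \<subseteq> closed_span B Y ?P" by (rule subsetI)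
    then have "closed_span B Y ?P = carrier Y" using Y.closed_span_carrier[OF P] by blast
    then show ?thesis using s h cm by (simp add: nondeg_corr_def correspondence_def)
  qed
  show "strict_pos_corr A B (\<sigma>, Y)" if n: "strict_pos_corr A B (\<rho>, X)"
  proof -
    note s = strict_pos_corrD[OF n]
    interpret R: cp_rep A B X \<rho> by (rule s)
    have cpY: "cp_map A (End B Y) \<sigma>"
      unfolding cp_map_def
    proof (intro conjI allI impI)
      show "lin_map A (End B Y) \<sigma>"
        using s(6) hom E unfolding sA by (auto simp: cp_map_def star_hom_def lin_map_def AdE)
      fix n M assume "mat_pos n A M"
      then have "mat_pos n (End B X) (\<lambda>i j. \<rho> (M i j))" using s(6) by (simp add: cp_map_def)
      from star_hom_mat_pos[OF hom X.abelian_group_End Y.abelian_group_End _ _ this]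
      show "mat_pos n (End B Y) (\<lambda>i j. \<sigma> (M i j))" unfolding sA by auto
    qed
    obtain F where F: "approx_unit A F" "\<And>x. x \<in> carrier X \<Longrightarrow> norm_cauchy B X F (\<lambda>e. \<rho> e x)"
      using s(7) by (auto simp: strict_map_def)
    interpret RY: cp_rep A B Y \<sigma>
      using cpY by (intro cp_rep.intro cp_rep_axioms.intro s(2) hY)
    define G where "G = {a. cpos A a \<and> nrm A a \<le> 1}"
    have G: "eventually (\<lambda>e. e \<in> G) F"
      using F(1) by (auto simp: approx_unit_def G_def elim: eventually_mono)
    have Gc: "a \<in> carrier A" if "a \<in> G" for a using that R.A.cpos_carrier by (auto simp: G_def)
    have nc: "norm_cauchy B Y F (\<lambda>e. \<sigma> e y)" if y: "y \<in> carrier Y" for y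
      unfolding norm_cauchy_def
    proof (intro allI impI)
      fix \<epsilon> :: real assume "\<epsilon> > 0"
      then obtain H where H: "eventually (\<lambda>e. e \<in> H) F" "\<forall>d\<in>H. \<forall>e\<in>H. hdist B X (\<rho> d (W y)) (\<rho> e (W y)) < \<epsilon>"
        using F(2)[OF Wc[OF y]] unfolding norm_cauchy_def by blast
      have "eventually (\<lambda>e. e \<in> G \<inter> H) F" using eventually_conj[OF G H(1)] by simp
      moreover have "hdist B Y (\<sigma> d y) (\<sigma> e y) < \<epsilon>" if "d \<in> G \<inter> H" "e \<in> G \<inter> H" for d e
        using that H(2) Gc y by (simp add: \<sigma>_def dist)
      ultimately show "\<exists>G. eventually (\<lambda>e. e \<in> G) F \<and> (\<forall>d\<in>G. \<forall>e\<in>G. hdist B Y (\<sigma> d y) (\<sigma> e y) < \<epsilon>)" by blast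
    qed
    have "norm_cauchy B Y F (\<lambda>e. star (End B Y) (\<sigma> e) y)" if "y \<in> carrier Y" for y
      by (rule norm_cauchy_cong[OF G _ nc[OF that]]) (auto simp: RY.star_rho Gc R.A.cpos_star G_def)
    then have "strict_map A B (\<sigma>, Y)" unfolding strict_map_def prod.case using nc F(1) by (intro exI[of _ F]) auto
    then show ?thesis using s cpY cm by (simp add: strict_pos_corr_def)
  qed
qed

section \<open>The laws of the two semi-categories up to isomorphism\<close>

lemma nondeg_strict: "nondeg_corr A B Z \<Longrightarrow> strict_pos_corr A B Z"
  using nondeg_strict_pos by (cases Z) blast

lemma tensor_corr_strict:
  assumes "strict_pos_corr A B Z" "nondeg_corr B C W" shows "strict_pos_corr A C (tensor_corr C Z W)"
proof -
  obtain \<rho> X \<sigma> Y where e: "Z = (\<rho>, X)" "W = (\<sigma>, Y)" by (metis surj_pair)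
  note z = strict_pos_corrD[OF assms(1)[unfolded e]] and w = nondeg_corrD[OF assms(2)[unfolded e]]
  show ?thesis unfolding e by (rule tensor_strict_pos[OF tensor_hom[OF z(5) w(5,6)] assms(1)[unfolded e] w(3)])
qed

lemma tensor_corr_nondeg:
  assumes "nondeg_corr A B Z" "nondeg_corr B C W" shows "nondeg_corr A C (tensor_corr C Z W)"
proof -
  obtain \<rho> X \<sigma> Y where e: "Z = (\<rho>, X)" "W = (\<sigma>, Y)" by (metis surj_pair)
  note z = nondeg_corrD[OF assms(1)[unfolded e]] and w = nondeg_corrD[OF assms(2)[unfolded e]]
  show ?thesis unfolding e by (rule tensor_nondeg[OF tensor_hom[OF z(5) w(5,6)] assms(1)[unfolded e] w(3)])
qed

lemma tensor_corr_iso: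
  assumes Z: "strict_pos_corr A B Z" "strict_pos_corr A B Z'" "corr_iso A Z Z'"
    and W: "nondeg_corr B C W" "nondeg_corr B C W'" "corr_iso B W W'"
  shows "corr_iso A (tensor_corr C Z W) (tensor_corr C Z' W')"
proof -
  obtain \<rho> X \<sigma> Y where e: "Z = (\<rho>, X)" "W = (\<sigma>, Y)" by (metis surj_pair)
  obtain \<rho>' X' \<sigma>' Y' where e': "Z' = (\<rho>', X')" "W' = (\<sigma>', Y')" by (metis surj_pair)
  note z = strict_pos_corrD[OF Z(1)[unfolded e]] and w = nondeg_corrD[OF W(1)[unfolded e]]
  note z' = strict_pos_corrD[OF Z(2)[unfolded e']] and w' = nondeg_corrD[OF W(2)[unfolded e']]
  show ?thesis unfolding e e'
    by (rule tensor_iso[OF tensor_hom[OF z(5) w(5,6)] tensor_hom[OF z'(5) w'(5,6)] Z(3)[unfolded e e']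
      W(3)[unfolded e e'] cp_rep.rho_End[OF z(8)] cp_rep.rho_End[OF z'(8)]])
qed

lemma self_cp_rep: "separable_cstar A \<Longrightarrow> cp_rep A A (self_module A) (fst (self_corr A))"
  by (rule nondeg_corrD(8)) (simp add: nondeg_self)

lemma ksgns_nondeg:
  assumes "strict_pos_corr A B Z" shows "nondeg_corr A B (ksgns A B Z)"
proof -
  obtain \<rho> X where e: "Z = (\<rho>, X)" by (cases Z)
  note z = strict_pos_corrD[OF assms[unfolded e]]
  have "nondeg_corr A B (tensor_corr B (fst (self_corr A), self_module A) (\<rho>, X))"
    by (rule tensor_nondeg[OF tensor_self[OF z(8)] _ z(3)]) (use nondeg_self[OF z(1)] in simp)
  then show ?thesis by (simp add: ksgns_def e)
qed

lemma ksgns_iso: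
  assumes "strict_pos_corr A B Z" "strict_pos_corr A B Z'" "corr_iso A Z Z'"
  shows "corr_iso A (ksgns A B Z) (ksgns A B Z')"
proof -
  obtain \<rho> X \<rho>' X' where e: "Z = (\<rho>, X)" "Z' = (\<rho>', X')" by (metis surj_pair)
  note z = strict_pos_corrD[OF assms(1)[unfolded e]] and z' = strict_pos_corrD[OF assms(2)[unfolded e]]
  have "corr_iso A (tensor_corr B (fst (self_corr A), self_module A) (\<rho>, X))
      (tensor_corr B (fst (self_corr A), self_module A) (\<rho>', X'))"
    by (rule tensor_iso[OF tensor_self[OF z(8)] tensor_self[OF z'(8)] corr_iso_refl assms(3)[unfolded e]])
      (rule cp_rep.rho_End[OF self_cp_rep[OF z(1)]], assumption)+
  then show ?thesis by (simp add: ksgns_def e)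
qed

lemma tensor_corr_assoc:
  assumes Z: "strict_pos_corr A B Z" and W: "nondeg_corr B C W" and H: "nondeg_corr C D H"
  shows "corr_iso A (tensor_corr D (tensor_corr C Z W) H) (tensor_corr D Z (tensor_corr D W H))"
proof -
  obtain \<rho> X \<sigma> Y \<tau> U where e: "Z = (\<rho>, X)" "W = (\<sigma>, Y)" "H = (\<tau>, U)" by (metis surj_pair)
  note z = strict_pos_corrD[OF Z[unfolded e]] and w = nondeg_corrD[OF W[unfolded e]]
    and h = nondeg_corrD[OF H[unfolded e]]
  note t1 = tensor_hom[OF z(5) w(5,6)] and t2 = tensor_hom[OF w(5) h(5,6)]
  note zw = strict_pos_corrD[OF tensor_corr_strict[OF Z W, unfolded e tensor_corr_eq[OF t1]]]
  note wh = nondeg_corrD[OF tensor_corr_nondeg[OF W H, unfolded e tensor_corr_eq[OF t2]]]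
  show ?thesis unfolding e
    by (rule tensor_assoc[OF t1 t2 tensor_hom[OF zw(5) h(5,6)] tensor_hom[OF z(5) wh(5,6)] cp_rep.rho_End[OF z(8)]])
qed

text \<open>This is the isomorphism behind functoriality: both sides are the triple tensor product of \<open>A\<close>, the
  module of \<open>W\<close> and the module of \<open>H\<close>.\<close>

lemma ksgns_tensor:
  assumes W: "strict_pos_corr A B W" and H: "nondeg_corr B C H"
  shows "corr_iso A (ksgns A C (tensor_corr C W H)) (tensor_corr C (ksgns A B W) H)"
proof -
  obtain \<sigma> Y \<tau> U where e: "W = (\<sigma>, Y)" "H = (\<tau>, U)" by (metis surj_pair)
  note w = strict_pos_corrD[OF W[unfolded e]] and h = nondeg_corrD[OF H[unfolded e]]
  note t1 = tensor_self[OF w(8)] and t2 = tensor_hom[OF w(5) h(5,6)]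
  note K = ksgns_nondeg[OF W] and WH = tensor_corr_strict[OF W H]
  have k: "hilbert_module B (completion B (alg_tensor (self_module A) B (\<sigma>, Y)))"
  proof -
    have "nondeg_corr A B (tensor_corr B (fst (self_corr A), self_module A) (\<sigma>, Y))" using K by (simp add: ksgns_def e)
    then show ?thesis unfolding tensor_corr_eq[OF t1] by (rule nondeg_corrD(5))
  qed
  note wh = strict_pos_corrD[OF WH[unfolded e tensor_corr_eq[OF t2]]]
  have "corr_iso A (tensor_corr C (tensor_corr B (fst (self_corr A), self_module A) (\<sigma>, Y)) (\<tau>, U))
      (tensor_corr C (fst (self_corr A), self_module A) (tensor_corr C (\<sigma>, Y) (\<tau>, U)))"
    by (rule tensor_assoc[OF t1 t2 tensor_hom[OF k h(5,6)] tensor_self[OF wh(8)]])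
      (rule cp_rep.rho_End[OF self_cp_rep[OF w(1)]])
  then have "corr_iso A (tensor_corr C (ksgns A B W) H) (ksgns A C (tensor_corr C W H))"
    by (simp add: ksgns_def e)
  then show ?thesis
    by (rule strict_iso_sym[OF _ nondeg_strict[OF tensor_corr_nondeg[OF K H]] nondeg_strict[OF ksgns_nondeg[OF WH]]])
qed

section \<open>Isomorphism classes and the semi-functors\<close>

lemma ench_class_cong:
  assumes "strict_pos_corr A B Z" "strict_pos_corr A B Z'" "corr_iso A Z Z'"
  shows "ench_class A B Z = ench_class A B Z'"
  using corr_iso_trans[OF assms(3)] corr_iso_trans[OF strict_iso_sym[OF assms(3,1,2)]]
  by (auto simp: ench_class_def)

lemma ques_class_cong:
  assumes "strict_pos_corr A B Z" "strict_pos_corr A B Z'" "corr_iso A Z Z'"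
  shows "ques_class A B Z = ques_class A B Z'"
  using corr_iso_trans[OF assms(3)] corr_iso_trans[OF strict_iso_sym[OF assms(3,1,2)]]
  by (auto simp: ques_class_def)

text \<open>The union over the class is the common value at all of its representatives, see \<open>mor_ksgns\<close>.\<close>

definition ksgns_functor ::
    "('a cstar, ('a, 'a, 'x) corr set, 'a cstar, ('a, 'a, 'x) corr set) sfun" where
  "ksgns_functor = \<lparr>obj = (\<lambda>A. A), mor = (\<lambda>A B f. \<Union>Z\<in>f. ench_class A B (ksgns A B Z))\<rparr>"

lemma ench_class_ksgns:
  assumes "nondeg_corr A B Z"
  shows "ench_class A B (ksgns A B Z) = (ench_class A B Z :: ('a, 'b, 'x) corr set)"
  by (rule ench_class_cong[OF nondeg_strict[OF ksgns_nondeg[OF nondeg_strict[OF assms]]] nondeg_strict[OF assms]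
    ksgns_nondeg_iso[OF assms]])

lemma Hom_EnchiladaE:
  fixes f :: "('a, 'a, 'x) corr set"
  assumes "f \<in> Hom Enchilada A B"
  obtains Z :: "('a, 'a, 'x) corr" where "nondeg_corr A B Z" "f = ench_class A B Z"
  using assms by (auto simp: Enchilada_def)

lemma Hom_QuesadillaE:
  fixes f :: "('a, 'a, 'x) corr set"
  assumes "f \<in> Hom Quesadilla A B"
  obtains Z :: "('a, 'a, 'x) corr" where "strict_pos_corr A B Z" "f = ques_class A B Z"
  using assms by (auto simp: Quesadilla_def)

lemma obj_ksgns_functor: "obj ksgns_functor A = A" and obj_forget: "obj forget A = A"
  by (simp_all add: ksgns_functor_def forget_def)

context
  assumes universe: "(UNIV :: real set) \<lesssim> (UNIV :: 'x set)"
begin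

text \<open>This is where the size of the underlying type enters.\<close>

lemma corr_copy:
  assumes Z: "strict_pos_corr A B Z"
  obtains V :: "('a, 'b, 'x) corr" where "strict_pos_corr A B V" "corr_iso A Z V"
    "nondeg_corr A B Z \<Longrightarrow> nondeg_corr A B V"
proof -
  obtain \<rho> X where e: "Z = (\<rho>, X)" by (cases Z)
  note z = strict_pos_corrD[OF Z[unfolded e]]
  have "carrier X \<lesssim> (UNIV :: 'x set)" by (rule lepoll_trans[OF cstar_module_lepoll_real[OF z(3)] universe])
  then obtain Y :: "('b, 'x) hmod" and V W where Y: "hilbert_module B Y" "is_adjoint X Y V W"
    "\<And>x. x \<in> carrier X \<Longrightarrow> W (V x) = x" "\<And>y. y \<in> carrier Y \<Longrightarrow> V (W y) = y"
    using hilbert_module_copy[OF z(5)] by metis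
  note t = transport_corr[OF z(5) Y cp_rep.rho_End[OF z(8)]]
  show ?thesis
    by (rule that[of "(\<lambda>a. \<lambda>y\<in>carrier Y. V (\<rho> a (W y)), Y)"]) (use t Z in \<open>simp_all add: e\<close>)
qed

lemma ench_class_nonempty:
  assumes "nondeg_corr A B Z" shows "(ench_class A B Z :: ('a, 'b, 'x) corr set) \<noteq> {}"
proof -
  obtain V :: "('a, 'b, 'x) corr" where "corr_iso A Z V" "nondeg_corr A B V"
    using corr_copy[OF nondeg_strict[OF assms]] assms by metis
  then show ?thesis unfolding ench_class_def by blast
qed

lemma ques_class_nonempty:
  assumes "strict_pos_corr A B Z" shows "(ques_class A B Z :: ('a, 'b, 'x) corr set) \<noteq> {}"
proof -
  obtain V :: "('a, 'b, 'x) corr" where "corr_iso A Z V" "strict_pos_corr A B V"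
    using corr_copy[OF assms] by metis
  then show ?thesis unfolding ques_class_def by blast
qed

lemma ench_class_Hom:
  fixes Z :: "('a, 'a, 'z) corr"
  assumes "nondeg_corr A B Z" shows "(ench_class A B Z :: ('a, 'a, 'x) corr set) \<in> Hom Enchilada A B"
proof -
  obtain V :: "('a, 'a, 'x) corr" where V: "corr_iso A Z V" "nondeg_corr A B V"
    using corr_copy[OF nondeg_strict[OF assms]] assms by metis
  have "ench_class A B Z = (ench_class A B V :: ('a, 'a, 'x) corr set)"
    by (rule ench_class_cong[OF nondeg_strict[OF assms] nondeg_strict[OF V(2)] V(1)])
  then show ?thesis using V(2) unfolding Enchilada_def semicat.simps by blast
qed

lemma ques_class_Hom:
  fixes Z :: "('a, 'a, 'z) corr"
  assumes "strict_pos_corr A B Z" shows "(ques_class A B Z :: ('a, 'a, 'x) corr set) \<in> Hom Quesadilla A B"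
proof -
  obtain V :: "('a, 'a, 'x) corr" where V: "strict_pos_corr A B V" "corr_iso A Z V"
    using corr_copy[OF assms] by metis
  have "ques_class A B Z = (ques_class A B V :: ('a, 'a, 'x) corr set)"
    by (rule ques_class_cong[OF assms V])
  then show ?thesis using V(1) unfolding Quesadilla_def semicat.simps by blast
qed

lemma Comp_Enchilada:
  fixes Z :: "('a, 'a, 'z) corr" and W :: "('a, 'a, 'w) corr"
  assumes Z: "nondeg_corr A B Z" and W: "nondeg_corr B C W"
  shows "Comp Enchilada A B C (ench_class A B Z) (ench_class B C W :: ('a, 'a, 'x) corr set)
    = ench_class A C (tensor_corr C Z W)"
proof -
  have "ench_class A C (tensor_corr C Z' W') = (ench_class A C (tensor_corr C Z W) :: ('a, 'a, 'x) corr set)"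
    if Z': "Z' \<in> ench_class A B Z" and W': "W' \<in> ench_class B C W" for Z' W' :: "('a, 'a, 'x) corr"
  proof (rule ench_class_cong[symmetric])
    have i: "nondeg_corr A B Z'" "corr_iso A Z Z'" "nondeg_corr B C W'" "corr_iso B W W'"
      using Z' W' by (auto simp: ench_class_def)
    show "corr_iso A (tensor_corr C Z W) (tensor_corr C Z' W')"
      by (rule tensor_corr_iso[OF nondeg_strict[OF Z] nondeg_strict[OF i(1)] i(2) W i(3,4)])
    show "strict_pos_corr A C (tensor_corr C Z W)" "strict_pos_corr A C (tensor_corr C Z' W')"
      by (rule nondeg_strict[OF tensor_corr_nondeg[OF Z W]] nondeg_strict[OF tensor_corr_nondeg[OF i(1,3)]])+
  qed
  then show ?thesis unfolding Enchilada_def semicat.simps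
    by (intro SUP_eq_const ench_class_nonempty Z W)
qed

lemma Comp_Quesadilla:
  fixes Z :: "('a, 'a, 'z) corr" and W :: "('a, 'a, 'w) corr"
  assumes Z: "strict_pos_corr A B Z" and W: "strict_pos_corr B C W"
  shows "Comp Quesadilla A B C (ques_class A B Z) (ques_class B C W :: ('a, 'a, 'x) corr set)
    = ques_class A C (tensor_corr C Z (ksgns B C W))"
proof -
  have "ques_class A C (tensor_corr C Z' (ksgns B C W'))
      = (ques_class A C (tensor_corr C Z (ksgns B C W)) :: ('a, 'a, 'x) corr set)"
    if Z': "Z' \<in> ques_class A B Z" and W': "W' \<in> ques_class B C W" for Z' W' :: "('a, 'a, 'x) corr"
  proof (rule ques_class_cong[symmetric])
    have i: "strict_pos_corr A B Z'" "corr_iso A Z Z'" "strict_pos_corr B C W'" "corr_iso B W W'"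
      using Z' W' by (auto simp: ques_class_def)
    note k = ksgns_nondeg[OF W] ksgns_nondeg[OF i(3)]
    show "corr_iso A (tensor_corr C Z (ksgns B C W)) (tensor_corr C Z' (ksgns B C W'))"
      by (rule tensor_corr_iso[OF Z i(1,2) k ksgns_iso[OF W i(3,4)]])
    show "strict_pos_corr A C (tensor_corr C Z (ksgns B C W))"
      "strict_pos_corr A C (tensor_corr C Z' (ksgns B C W'))"
      by (rule tensor_corr_strict[OF Z k(1)] tensor_corr_strict[OF i(1) k(2)])+
  qed
  then show ?thesis unfolding Quesadilla_def semicat.simps
    by (intro SUP_eq_const ques_class_nonempty Z W)
qed

lemma mor_forget:
  fixes Z :: "('a, 'a, 'z) corr"
  assumes Z: "nondeg_corr A B Z"
  shows "mor forget A B (ench_class A B Z) = (ques_class A B Z :: ('a, 'a, 'x) corr set)"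
proof -
  have "ques_class A B Z' = (ques_class A B Z :: ('a, 'a, 'x) corr set)"
    if "Z' \<in> ench_class A B Z" for Z' :: "('a, 'a, 'x) corr"
    using that ques_class_cong[OF nondeg_strict[OF Z] nondeg_strict, of Z'] by (auto simp: ench_class_def)
  then show ?thesis unfolding forget_def sfun.simps by (intro SUP_eq_const ench_class_nonempty Z)
qed

lemma mor_ksgns:
  fixes Z :: "('a, 'a, 'z) corr"
  assumes Z: "strict_pos_corr A B Z"
  shows "mor ksgns_functor A B (ques_class A B Z) = (ench_class A B (ksgns A B Z) :: ('a, 'a, 'x) corr set)"
proof -
  have "ench_class A B (ksgns A B Z') = (ench_class A B (ksgns A B Z) :: ('a, 'a, 'x) corr set)"
    if "Z' \<in> ques_class A B Z" for Z' :: "('a, 'a, 'x) corr"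
  proof (rule ench_class_cong[symmetric])
    have i: "strict_pos_corr A B Z'" "corr_iso A Z Z'" using that by (auto simp: ques_class_def)
    show "corr_iso A (ksgns A B Z) (ksgns A B Z')" by (rule ksgns_iso[OF Z i])
    show "strict_pos_corr A B (ksgns A B Z)" "strict_pos_corr A B (ksgns A B Z')"
      by (rule nondeg_strict[OF ksgns_nondeg] Z i)+
  qed
  then show ?thesis unfolding ksgns_functor_def sfun.simps by (intro SUP_eq_const ques_class_nonempty Z)
qed

lemma semicategory_Enchilada: "semicategory (Enchilada :: ('a cstar, ('a, 'a, 'x) corr set) semicat)"
proof
  fix A B C and f g :: "('a, 'a, 'x) corr set"
  assume "f \<in> Hom Enchilada A B" "g \<in> Hom Enchilada B C"
  then obtain Z W :: "('a, 'a, 'x) corr" where e: "nondeg_corr A B Z" "f = ench_class A B Z"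
    "nondeg_corr B C W" "g = ench_class B C W" by (metis Hom_EnchiladaE)
  show "Comp Enchilada A B C f g \<in> Hom Enchilada A C"
    unfolding e(2,4) Comp_Enchilada[OF e(1,3)] by (rule ench_class_Hom[OF tensor_corr_nondeg[OF e(1,3)]])
next
  fix A B C D and f g h :: "('a, 'a, 'x) corr set"
  assume "f \<in> Hom Enchilada A B" "g \<in> Hom Enchilada B C" "h \<in> Hom Enchilada C D"
  then obtain Z W H :: "('a, 'a, 'x) corr" where e: "nondeg_corr A B Z" "f = ench_class A B Z"
    "nondeg_corr B C W" "g = ench_class B C W" "nondeg_corr C D H" "h = ench_class C D H"
    by (metis Hom_EnchiladaE)
  note ZW = tensor_corr_nondeg[OF e(1,3)] and WH = tensor_corr_nondeg[OF e(3,5)]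
  show "Comp Enchilada A C D (Comp Enchilada A B C f g) h = Comp Enchilada A B D f (Comp Enchilada B C D g h)"
    unfolding e(2,4,6) Comp_Enchilada[OF e(1,3)] Comp_Enchilada[OF e(3,5)] Comp_Enchilada[OF ZW e(5)]
      Comp_Enchilada[OF e(1) WH]
    by (rule ench_class_cong[OF nondeg_strict[OF tensor_corr_nondeg[OF ZW e(5)]]
      nondeg_strict[OF tensor_corr_nondeg[OF e(1) WH]] tensor_corr_assoc[OF nondeg_strict[OF e(1)] e(3,5)]])
qed

lemma semicategory_Quesadilla: "semicategory (Quesadilla :: ('a cstar, ('a, 'a, 'x) corr set) semicat)"
proof
  fix A B C and f g :: "('a, 'a, 'x) corr set"
  assume "f \<in> Hom Quesadilla A B" "g \<in> Hom Quesadilla B C"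
  then obtain Z W :: "('a, 'a, 'x) corr" where e: "strict_pos_corr A B Z" "f = ques_class A B Z"
    "strict_pos_corr B C W" "g = ques_class B C W" by (metis Hom_QuesadillaE)
  show "Comp Quesadilla A B C f g \<in> Hom Quesadilla A C"
    unfolding e(2,4) Comp_Quesadilla[OF e(1,3)]
    by (rule ques_class_Hom[OF tensor_corr_strict[OF e(1) ksgns_nondeg[OF e(3)]]])
next
  fix A B C D and f g h :: "('a, 'a, 'x) corr set"
  assume "f \<in> Hom Quesadilla A B" "g \<in> Hom Quesadilla B C" "h \<in> Hom Quesadilla C D"
  then obtain Z W H :: "('a, 'a, 'x) corr" where e: "strict_pos_corr A B Z" "f = ques_class A B Z"
    "strict_pos_corr B C W" "g = ques_class B C W" "strict_pos_corr C D H" "h = ques_class C D H"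
    by (metis Hom_QuesadillaE)
  note KW = ksgns_nondeg[OF e(3)] and KH = ksgns_nondeg[OF e(5)]
  note ZW = tensor_corr_strict[OF e(1) KW] and WH = tensor_corr_strict[OF e(3) KH]
  have "corr_iso A (tensor_corr D (tensor_corr C Z (ksgns B C W)) (ksgns C D H))
      (tensor_corr D Z (tensor_corr D (ksgns B C W) (ksgns C D H)))"
    by (rule tensor_corr_assoc[OF e(1) KW KH])
  moreover have "corr_iso B (tensor_corr D (ksgns B C W) (ksgns C D H)) (ksgns B D (tensor_corr D W (ksgns C D H)))"
    by (rule strict_iso_sym[OF ksgns_tensor[OF e(3) KH] nondeg_strict[OF ksgns_nondeg[OF WH]]
      nondeg_strict[OF tensor_corr_nondeg[OF KW KH]]])
  then have "corr_iso A (tensor_corr D Z (tensor_corr D (ksgns B C W) (ksgns C D H)))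
      (tensor_corr D Z (ksgns B D (tensor_corr D W (ksgns C D H))))"
    by (rule tensor_corr_iso[OF e(1) e(1) corr_iso_refl tensor_corr_nondeg[OF KW KH] ksgns_nondeg[OF WH]])
  ultimately have i: "corr_iso A (tensor_corr D (tensor_corr C Z (ksgns B C W)) (ksgns C D H))
      (tensor_corr D Z (ksgns B D (tensor_corr D W (ksgns C D H))))" by (rule corr_iso_trans)
  show "Comp Quesadilla A C D (Comp Quesadilla A B C f g) h = Comp Quesadilla A B D f (Comp Quesadilla B C D g h)"
    unfolding e(2,4,6) Comp_Quesadilla[OF e(1,3)] Comp_Quesadilla[OF e(3,5)] Comp_Quesadilla[OF ZW e(5)]
      Comp_Quesadilla[OF e(1) WH]
    by (rule ques_class_cong[OF tensor_corr_strict[OF ZW KH] tensor_corr_strict[OF e(1) ksgns_nondeg[OF WH]] i])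
qed

lemma semifunctor_forget:
  "semifunctor Enchilada Quesadilla (forget :: ('a cstar, ('a, 'a, 'x) corr set, 'a cstar, ('a, 'a, 'x) corr set) sfun)"
proof (intro semifunctor.intro semifunctor_axioms.intro semicategory_Enchilada semicategory_Quesadilla)
  have obj: "obj forget A = A" for A :: "'a cstar" by (simp add: forget_def)
  fix A :: "'a cstar" assume "A \<in> Ob (Enchilada :: ('a cstar, ('a, 'a, 'x) corr set) semicat)"
  then show "obj (forget :: ('a cstar, ('a, 'a, 'x) corr set, 'a cstar, ('a, 'a, 'x) corr set) sfun) A
      \<in> Ob (Quesadilla :: ('a cstar, ('a, 'a, 'x) corr set) semicat)"
    by (simp add: forget_def Enchilada_def Quesadilla_def)
next
  fix A B and f :: "('a, 'a, 'x) corr set"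
  assume "f \<in> Hom Enchilada A B"
  then obtain Z :: "('a, 'a, 'x) corr" where e: "nondeg_corr A B Z" "f = ench_class A B Z" by (metis Hom_EnchiladaE)
  show "mor forget A B f \<in> Hom Quesadilla (obj forget A) (obj forget B)"
    unfolding e(2) mor_forget[OF e(1)] using ques_class_Hom[OF nondeg_strict[OF e(1)]] by (simp add: forget_def)
next
  fix A B C and f g :: "('a, 'a, 'x) corr set"
  assume "f \<in> Hom Enchilada A B" "g \<in> Hom Enchilada B C"
  then obtain Z W :: "('a, 'a, 'x) corr" where e: "nondeg_corr A B Z" "f = ench_class A B Z"
    "nondeg_corr B C W" "g = ench_class B C W" by (metis Hom_EnchiladaE)
  note s = nondeg_strict[OF e(1)] nondeg_strict[OF e(3)]
  note K = ksgns_nondeg[OF s(2)]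
  have "corr_iso A (tensor_corr C Z (ksgns B C W)) (tensor_corr C Z W)"
    by (rule tensor_corr_iso[OF s(1) s(1) corr_iso_refl K e(3) ksgns_nondeg_iso[OF e(3)]])
  then have "ques_class A C (tensor_corr C Z (ksgns B C W)) = (ques_class A C (tensor_corr C Z W) :: ('a, 'a, 'x) corr set)"
    by (rule ques_class_cong[OF tensor_corr_strict[OF s(1) K] tensor_corr_strict[OF s(1) e(3)]])
  then show "mor forget A C (Comp Enchilada A B C f g)
      = Comp Quesadilla (obj forget A) (obj forget B) (obj forget C) (mor forget A B f) (mor forget B C g)"
    unfolding e(2,4) Comp_Enchilada[OF e(1,3)] mor_forget[OF e(1)] mor_forget[OF e(3)]
      mor_forget[OF tensor_corr_nondeg[OF e(1,3)]]
    by (simp add: forget_def Comp_Quesadilla[OF s])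
qed

lemma semifunctor_ksgns:
  "semifunctor Quesadilla Enchilada
    (ksgns_functor :: ('a cstar, ('a, 'a, 'x) corr set, 'a cstar, ('a, 'a, 'x) corr set) sfun)"
proof (intro semifunctor.intro semifunctor_axioms.intro semicategory_Enchilada semicategory_Quesadilla)
  fix A :: "'a cstar" assume "A \<in> Ob (Quesadilla :: ('a cstar, ('a, 'a, 'x) corr set) semicat)"
  then show "obj (ksgns_functor :: ('a cstar, ('a, 'a, 'x) corr set, 'a cstar, ('a, 'a, 'x) corr set) sfun) A
      \<in> Ob (Enchilada :: ('a cstar, ('a, 'a, 'x) corr set) semicat)"
    by (simp add: ksgns_functor_def Enchilada_def Quesadilla_def)
next
  fix A B and f :: "('a, 'a, 'x) corr set"
  assume "f \<in> Hom Quesadilla A B"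
  then obtain Z :: "('a, 'a, 'x) corr" where e: "strict_pos_corr A B Z" "f = ques_class A B Z" by (metis Hom_QuesadillaE)
  show "mor ksgns_functor A B f \<in> Hom Enchilada (obj ksgns_functor A) (obj ksgns_functor B)"
    unfolding e(2) mor_ksgns[OF e(1)] using ench_class_Hom[OF ksgns_nondeg[OF e(1)]] by (simp add: ksgns_functor_def)
next
  fix A B C and f g :: "('a, 'a, 'x) corr set"
  assume "f \<in> Hom Quesadilla A B" "g \<in> Hom Quesadilla B C"
  then obtain Z W :: "('a, 'a, 'x) corr" where e: "strict_pos_corr A B Z" "f = ques_class A B Z"
    "strict_pos_corr B C W" "g = ques_class B C W" by (metis Hom_QuesadillaE)
  note K = ksgns_nondeg[OF e(1)] ksgns_nondeg[OF e(3)]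
  note s = tensor_corr_strict[OF e(1) K(2)]
  have "ench_class A C (ksgns A C (tensor_corr C Z (ksgns B C W)))
      = (ench_class A C (tensor_corr C (ksgns A B Z) (ksgns B C W)) :: ('a, 'a, 'x) corr set)"
    by (rule ench_class_cong[OF nondeg_strict[OF ksgns_nondeg[OF s]] nondeg_strict[OF tensor_corr_nondeg[OF K]]
      ksgns_tensor[OF e(1) K(2)]])
  then show "mor ksgns_functor A C (Comp Quesadilla A B C f g)
      = Comp Enchilada (obj ksgns_functor A) (obj ksgns_functor B) (obj ksgns_functor C)
          (mor ksgns_functor A B f) (mor ksgns_functor B C g)"
    unfolding e(2,4) Comp_Quesadilla[OF e(1,3)] mor_ksgns[OF e(1)] mor_ksgns[OF e(3)] mor_ksgns[OF s]
    by (simp add: ksgns_functor_def Comp_Enchilada[OF K])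
qed

lemma ksgns_forget:
  "sf_eq Enchilada
    (sf_comp ksgns_functor (forget :: ('a cstar, ('a, 'a, 'x) corr set, 'a cstar, ('a, 'a, 'x) corr set) sfun)) sf_id"
proof -
  have "mor ksgns_functor A B (mor forget A B f) = f"
    if f: "f \<in> Hom Enchilada A B" for A B and f :: "('a, 'a, 'x) corr set"
  proof -
    obtain Z :: "('a, 'a, 'x) corr" where e: "nondeg_corr A B Z" "f = ench_class A B Z"
      using Hom_EnchiladaE[OF f] by metis
    show ?thesis
      unfolding e(2) mor_forget[OF e(1)] mor_ksgns[OF nondeg_strict[OF e(1)]] by (rule ench_class_ksgns[OF e(1)])
  qed
  then show ?thesis by (simp add: sf_eq_def sf_comp_def sf_id_def obj_ksgns_functor obj_forget)
qed

lemma forget_ksgns_idempotent: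
  "sf_eq Quesadilla (sf_comp (sf_comp forget ksgns_functor) (sf_comp forget ksgns_functor))
    (sf_comp forget (ksgns_functor :: ('a cstar, ('a, 'a, 'x) corr set, 'a cstar, ('a, 'a, 'x) corr set) sfun))"
proof -
  have "mor ksgns_functor A B (mor forget A B (mor ksgns_functor A B f)) = mor ksgns_functor A B f"
    if f: "f \<in> Hom Quesadilla A B" for A B and f :: "('a, 'a, 'x) corr set"
  proof -
    obtain Z :: "('a, 'a, 'x) corr" where e: "strict_pos_corr A B Z" "f = ques_class A B Z"
      using Hom_QuesadillaE[OF f] by metis
    note K = ksgns_nondeg[OF e(1)]
    show ?thesis
      unfolding e(2) mor_ksgns[OF e(1)] mor_forget[OF K] mor_ksgns[OF nondeg_strict[OF K]] by (rule ench_class_ksgns[OF K])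
  qed
  then show ?thesis by (simp add: sf_eq_def sf_comp_def obj_ksgns_functor obj_forget)
qed

end

theorem proposition3p19:
  assumes universe: "(UNIV :: real set) \<lesssim> (UNIV :: 'x set)"
  shows "semifunctor Enchilada Quesadilla
      (forget :: ('a cstar, ('a, 'a, 'x) corr set, 'a cstar, ('a, 'a, 'x) corr set) sfun) \<and>
    (\<exists>KSGNS :: ('a cstar, ('a, 'a, 'x) corr set, 'a cstar, ('a, 'a, 'x) corr set) sfun.
      semifunctor Quesadilla Enchilada KSGNS \<and>
      (\<forall>A. separable_cstar A \<longrightarrow> obj KSGNS A = A) \<and>
      (\<forall>A B (\<rho> :: 'a \<Rightarrow> 'x \<Rightarrow> 'x) X. strict_pos_corr A B (\<rho>, X) \<longrightarrow>
         mor KSGNS A B (ques_class A B (\<rho>, X)) = ench_class A B (ksgns A B (\<rho>, X))) \<and>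
      (\<forall>A B (\<rho> :: 'a \<Rightarrow> 'x \<Rightarrow> 'x) X. nondeg_corr A B (\<rho>, X) \<longrightarrow>
         mor KSGNS A B (ques_class A B (\<rho>, X)) = ench_class A B (\<rho>, X)) \<and>
      sf_eq Enchilada (sf_comp KSGNS forget) sf_id \<and>
      sf_eq Quesadilla
        (sf_comp (sf_comp forget KSGNS) (sf_comp forget KSGNS)) (sf_comp forget KSGNS))"
proof (intro conjI exI[of _ ksgns_functor] allI impI semifunctor_forget[OF universe] semifunctor_ksgns[OF universe]
    mor_ksgns[OF universe] ksgns_forget[OF universe] forget_ksgns_idempotent[OF universe])
  fix A B :: "'a cstar" and \<rho> :: "'a \<Rightarrow> 'x \<Rightarrow> 'x" and X assume n: "nondeg_corr A B (\<rho>, X)"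
  show "mor ksgns_functor A B (ques_class A B (\<rho>, X) :: ('a, 'a, 'x) corr set) = ench_class A B (\<rho>, X)"
    unfolding mor_ksgns[OF universe nondeg_strict[OF n]] by (rule ench_class_ksgns[OF n])
qed (rule obj_ksgns_functor)

end
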